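(* Let $(M,\mathcal D,\mathcal P)$ be a polarised $k$-contact manifold of jet type and order $r$. Assume that the distributions $\mathcal V_r$ and $\mathcal V_{r-1}=\mathcal D^{(r-1)}\cap\mathcal V_r$ appearing in the definition of jet type are globally defined, regular and simple, with smooth leaf spaces $Q:=M/\mathcal V_r$ and $E:=M/\mathcal V_{r-1}$. Then there exists a submersion $\pi:E\to Q$ (induced by the inclusion $\mathcal V_{r-1}\subset\mathcal V_r$). Assume moreover that the local identifications of $(M,\mathcal D,\mathcal P)$ with finite-order jet bundles (described in the context) have transition functions induced by $r$-th jet prolongations of local bundle automorphisms of $\pi:E\to Q$. Then the local identifications glue to a well-defined smooth local diffeomorphism $\Phi:M\to J^r\pi$. If this map is a global diffeomorphism onto $J^r\pi$, then $\Phi$ is a global polarised $k$-contactomorphism from $(M,\mathcal D,\mathcal P)$ to $(J^r\pi,\mathcal C^r_\pi,\ker T\pi_{r,r-1})$.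
   Context: Here $r\ge1$. A $k$-contact form on an open set $U$ is an $\mathbb R^k$-valued one-form $\boldsymbol\eta=\sum_A\eta^A\otimes e_A$ with $\ker\boldsymbol\eta=\bigcap_A\ker\eta^A$ a non-zero distribution of corank $k$ and $\ker\boldsymbol\eta\oplus\ker d\boldsymbol\eta=TU$, $\ker d\boldsymbol\eta=\bigcap_A\ker d\eta^A$. A $k$-contact manifold is a pair $(M,\mathcal D)$ with $\mathcal D$ a regular corank-$k$ distribution locally, around every point, the kernel of a $k$-contact form. Levi tensor: $\mathcal L_{\mathcal D}(X_x,Y_x)=[X,Y]_x\bmod\mathcal D_x$ on $\mathcal D$. A subspace of $\mathcal D_x$ is isotropic if $\mathcal L_{\mathcal D}$ vanishes on it, Legendrian if moreover it has an isotropic complement in $\mathcal D_x$; subbundles likewise pointwise. A polarisation is an integrable Legendrian subbundle $\mathcal P\subset\mathcal D$ of maximal rank among all integrable Legendrian subbundles of $\mathcal D$; then $(M,\mathcal D,\mathcal P)$ is a polarised $k$-contact manifold. A polarised $k$-contactomorphism is a diffeomorphism which, together with its inverse, maps the contact distribution into the contact distribution and the polarisation into the polarisation. Derived flag: $\mathcal D^{(0)}=\mathcal D$, $\mathcal D^{(s)}=\mathcal D^{(s-1)}+[\mathcal D,\mathcal D^{(s-1)}]$. $(M,\mathcal D,\mathcal P)$ is of Spencer type and order $r$ if $\mathcal D^{(r)}=TM$ and near every point there is an integrable isotropic complement $H\subset\mathcal D$ of $\mathcal P$ such that, for $W\simeq\mathcal D^{(r)}/\mathcal D^{(r-1)}$,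 one has vector bundle isomorphisms $\mathcal P\simeq S^rH^*\otimes W$, $\mathcal D^{(s)}/\mathcal D^{(s-1)}\simeq S^{r-s}H^*\otimes W$ ($s=1,\dots,r$), under which the bracket actions $H\otimes\mathcal P\to\mathcal D^{(1)}/\mathcal D$, $X\otimes Y\mapsto-[X,Y]\bmod\mathcal D$, and $H\otimes(\mathcal D^{(s)}/\mathcal D^{(s-1)})\to\mathcal D^{(s+1)}/\mathcal D^{(s)}$, $X\otimes[Y]\mapsto-[X,Y]\bmod\mathcal D^{(s)}$ ($s=1,\dots,r-1$), coincide with the Spencer contractions $X\otimes\omega\otimes w\mapsto\iota_X\omega\otimes w$. It is of jet type and order $r$ if it is of Spencer type of order $r$ and around every $p\in M$ there are an open $U\ni p$, an isotropic integrable complement $H$ of $\mathcal V_0:=\mathcal P|_U$ in $\mathcal D|_U$ and an integrable complement $\mathcal V_r$ of $H$ in $TU$ such that $\mathcal V_s=\mathcal D^{(s)}\cap\mathcal V_r$, $s=0,\dots,r-1$, are regular involutive distributions. A regular involutive distribution is simple if its leaf space is a smooth manifold for which the quotient map is a submersion. $J^r\pi$ is the $r$-th jet bundle ($J^0\pi=E$), $\pi_r:J^r\pi\to Q$, $\pi_{r,s}$ the projections, $\mathcal C^r_\pi$ its Cartan distribution. Local identifications: for every point of $M$ there are an open neighbourhood $U_a$, a fibred manifold $\pi_a:E_a\to Q_a$ and a diffeomorphism $\Phi_a:U_a\to V_a$ onto an open subset $V_a\subset J^r\pi_a$ with $T\Phi_a(\mathcal D|_{U_a})=\mathcal C^r_{\pi_a}|_{V_a}$,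 $T\Phi_a(\mathcal P|_{U_a})=\ker T(\pi_a)_{r,r-1}|_{V_a}$, and also $T\Phi_a(\mathcal V_r)=\ker T(\pi_a)_r|_{V_a}$, $T\Phi_a(\mathcal V_{r-1})=\ker T(\pi_a)_{r,0}|_{V_a}$; through the last two equalities $Q_a$ and $E_a$ are identified with open subsets of $Q$ and $E$. The transition functions are $\Phi_b\circ\Phi_a^{-1}$ on overlaps. "Glue" means that $\Phi$ coincides on each $U_a$ with $\Phi_a$ after identifying $\pi_a$ with the restriction of $\pi$: $\Phi(p)$ is the $r$-jet at the class of $p$ in $Q$, of a local section of $\pi$ taking there as value the class of $p$ in $E$, determined by $\Phi_a(p)$. *)

theory Defs
  imports "HOL-Analysis.Analysis" "HOL-Library.Function_Algebras" "HOL-Library.Multiset"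
begin

text \<open>
  Tangent vectors are derivations, that is, elements of a function space; the pointwise vector
  space structure makes \<open>subspace\<close>, \<open>span\<close> and \<open>dim\<close> available for subspaces of tangent spaces.
\<close>

instantiation "fun" :: (type, real_vector) real_vector
begin

definition scaleR_fun :: "real \<Rightarrow> ('a \<Rightarrow> 'b) \<Rightarrow> 'a \<Rightarrow> 'b"
  where "scaleR_fun c f = (\<lambda>x. c *\<^sub>R f x)"

instance
  by standard (simp_all add: scaleR_fun_def fun_eq_iff scaleR_add_right scaleR_add_left)

end

definition direct_sum :: "'v::real_vector set \<Rightarrow> 'v set \<Rightarrow> 'v set \<Rightarrow> bool"
  where "direct_sum A B C \<longleftrightarrow>
    subspace A \<and> subspace B \<and> A \<inter> B = {0} \<and> C = {a + b |a b. a \<in> A \<and> b \<in> B}"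


section \<open>Smooth functions on coordinate spaces\<close>

text \<open>
  \<open>coord_space I\<close> is \<open>\<real>\<^sup>I\<close> for a finite index set \<open>I\<close>, as functions vanishing outside \<open>I\<close>, with the
  topology induced by the product topology. Index sets (rather than \<open>{..<n}\<close> throughout) are used
  because the coordinates of jet bundles are indexed by multi-indices.
\<close>

definition coord_space :: "'i set \<Rightarrow> ('i \<Rightarrow> real) set"
  where "coord_space I = {x. \<forall>i. i \<notin> I \<longrightarrow> x i = 0}"

definition coord_open :: "'i set \<Rightarrow> ('i \<Rightarrow> real) set \<Rightarrow> bool"
  where "coord_open I S \<longleftrightarrow> openin (top_of_set (coord_space I)) S"

definition pderiv_at :: "'i \<Rightarrow> (('i \<Rightarrow> real) \<Rightarrow> real) \<Rightarrow> ('i \<Rightarrow> real) \<Rightarrow> real"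
  where "pderiv_at i f x = deriv (\<lambda>t. f (x(i := t))) (x i)"

primrec Ck_on :: "nat \<Rightarrow> 'i set \<Rightarrow> ('i \<Rightarrow> real) set \<Rightarrow> (('i \<Rightarrow> real) \<Rightarrow> real) \<Rightarrow> bool"
  where
    "Ck_on 0 I S f \<longleftrightarrow> continuous_on S f"
  | "Ck_on (Suc n) I S f \<longleftrightarrow> continuous_on S f \<and>
      (\<forall>i\<in>I. (\<forall>x\<in>S. (\<lambda>t. f (x(i := t))) differentiable at (x i)) \<and> Ck_on n I S (pderiv_at i f))"

definition Cinf_on :: "'i set \<Rightarrow> ('i \<Rightarrow> real) set \<Rightarrow> (('i \<Rightarrow> real) \<Rightarrow> real) \<Rightarrow> bool"
  where "Cinf_on I S f \<longleftrightarrow> coord_open I S \<and> (\<forall>n. Ck_on n I S f)"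

definition multi_pderiv ::
    "'i::linorder multiset \<Rightarrow> (('i \<Rightarrow> real) \<Rightarrow> real) \<Rightarrow> ('i \<Rightarrow> real) \<Rightarrow> real"
  where "multi_pderiv J f = foldr pderiv_at (sorted_list_of_multiset J) f"


section \<open>Smooth manifolds\<close>

text \<open>A chart is a pair of its domain and its coordinate map (relevant on the domain only).\<close>

record ('a, 'i) mfd =
  index :: "'i set"
  atlas :: "('a set \<times> ('a \<Rightarrow> 'i \<Rightarrow> real)) set"

definition carrier :: "('a, 'i) mfd \<Rightarrow> 'a set"
  where "carrier M = \<Union> (fst ` atlas M)"

definition mdim :: "('a, 'i) mfd \<Rightarrow> nat"
  where "mdim M = card (index M)"

definition mopen :: "('a, 'i) mfd \<Rightarrow> 'a set \<Rightarrow> bool"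
  where "mopen M W \<longleftrightarrow>
    W \<subseteq> carrier M \<and> (\<forall>(U, \<phi>)\<in>atlas M. coord_open (index M) (\<phi> ` (U \<inter> W)))"

definition coord_patch :: "'i set \<Rightarrow> 'a set \<times> ('a \<Rightarrow> 'i \<Rightarrow> real) \<Rightarrow> bool"
  where "coord_patch I c \<longleftrightarrow> (case c of (U, \<phi>) \<Rightarrow> inj_on \<phi> U \<and> coord_open I (\<phi> ` U))"

definition compatible ::
    "'i set \<Rightarrow> 'a set \<times> ('a \<Rightarrow> 'i \<Rightarrow> real) \<Rightarrow> 'a set \<times> ('a \<Rightarrow> 'i \<Rightarrow> real) \<Rightarrow> bool"
  where "compatible I c d \<longleftrightarrow> (case (c, d) of ((U, \<phi>), (V, \<psi>)) \<Rightarrow>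
    (\<forall>i\<in>I. Cinf_on I (\<phi> ` (U \<inter> V)) (\<lambda>x. \<psi> (inv_into U \<phi> x) i)) \<and>
    (\<forall>i\<in>I. Cinf_on I (\<psi> ` (U \<inter> V)) (\<lambda>x. \<phi> (inv_into V \<psi> x) i)) \<and>
    coord_open I (\<phi> ` (U \<inter> V)) \<and> coord_open I (\<psi> ` (U \<inter> V)))"

definition smooth_manifold :: "('a, 'i) mfd \<Rightarrow> bool"
  where "smooth_manifold M \<longleftrightarrow>
    finite (index M) \<and>
    (\<forall>c\<in>atlas M. coord_patch (index M) c) \<and>
    (\<forall>c\<in>atlas M. \<forall>d\<in>atlas M. compatible (index M) c d) \<and>
    Hausdorff_space (topology (mopen M)) \<and> second_countable (topology (mopen M))"

definition charts :: "('a, 'i) mfd \<Rightarrow> ('a set \<times> ('a \<Rightarrow> 'i \<Rightarrow> real)) set"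
  \<comment> \<open>the maximal atlas\<close>
  where "charts M = {c. fst c \<subseteq> carrier M \<and> coord_patch (index M) c \<and>
    (\<forall>d\<in>atlas M. compatible (index M) c d)}"

definition smooth_fun :: "('a, 'i) mfd \<Rightarrow> 'a set \<Rightarrow> ('a \<Rightarrow> real) \<Rightarrow> bool"
  where "smooth_fun M W f \<longleftrightarrow> mopen M W \<and>
    (\<forall>(U, \<phi>)\<in>atlas M. Cinf_on (index M) (\<phi> ` (U \<inter> W)) (\<lambda>x. f (inv_into U \<phi> x)))"

definition smooth_at :: "('a, 'i) mfd \<Rightarrow> 'a \<Rightarrow> ('a \<Rightarrow> real) \<Rightarrow> bool"
  where "smooth_at M p f \<longleftrightarrow> (\<exists>W. p \<in> W \<and> smooth_fun M W f)"

definition smooth_map ::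
    "('a, 'i) mfd \<Rightarrow> 'a set \<Rightarrow> ('b, 'j) mfd \<Rightarrow> ('a \<Rightarrow> 'b) \<Rightarrow> bool"
  where "smooth_map M W N F \<longleftrightarrow> mopen M W \<and> F ` W \<subseteq> carrier N \<and>
    (\<forall>V. mopen N V \<longrightarrow> mopen M (W \<inter> F -` V)) \<and>
    (\<forall>(V, \<psi>)\<in>atlas N. \<forall>j\<in>index N. smooth_fun M (W \<inter> F -` V) (\<lambda>p. \<psi> (F p) j))"

definition diffeo_on ::
    "('a, 'i) mfd \<Rightarrow> 'a set \<Rightarrow> ('b, 'j) mfd \<Rightarrow> 'b set \<Rightarrow> ('a \<Rightarrow> 'b) \<Rightarrow> bool"
  where "diffeo_on M U N V F \<longleftrightarrow>
    mopen M U \<and> mopen N V \<and> bij_betw F U V \<and>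
    smooth_map M U N F \<and> smooth_map N V M (inv_into U F)"

definition diffeo :: "('a, 'i) mfd \<Rightarrow> ('b, 'j) mfd \<Rightarrow> ('a \<Rightarrow> 'b) \<Rightarrow> bool"
  where "diffeo M N F \<longleftrightarrow> diffeo_on M (carrier M) N (carrier N) F"

definition local_diffeo :: "('a, 'i) mfd \<Rightarrow> ('b, 'j) mfd \<Rightarrow> ('a \<Rightarrow> 'b) \<Rightarrow> bool"
  where "local_diffeo M N F \<longleftrightarrow> smooth_map M (carrier M) N F \<and>
    (\<forall>p\<in>carrier M. \<exists>U. p \<in> U \<and> diffeo_on M U N (F ` U) F)"


section \<open>Tangent vectors and vector fields\<close>

type_synonym 'a tvec = "('a \<Rightarrow> real) \<Rightarrow> real"

definition tangent_space :: "('a, 'i) mfd \<Rightarrow> 'a \<Rightarrow> 'a tvec set"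
  \<comment> \<open>derivations on germs of smooth functions at \<open>p\<close>, normalised to \<open>0\<close> on all other functions\<close>
  where "tangent_space M p = {v.
    (\<forall>f. \<not> smooth_at M p f \<longrightarrow> v f = 0) \<and>
    (\<forall>f g W. smooth_at M p f \<and> smooth_at M p g \<and> mopen M W \<and> p \<in> W \<and> (\<forall>q\<in>W. f q = g q)
      \<longrightarrow> v f = v g) \<and>
    (\<forall>f g a b. smooth_at M p f \<and> smooth_at M p g
      \<longrightarrow> v (\<lambda>q. a * f q + b * g q) = a * v f + b * v g) \<and>
    (\<forall>f g. smooth_at M p f \<and> smooth_at M p g
      \<longrightarrow> v (\<lambda>q. f q * g q) = v f * g p + f p * v g)}"

definition tangent_map :: "('b, 'j) mfd \<Rightarrow> ('a \<Rightarrow> 'b) \<Rightarrow> 'a \<Rightarrow> 'a tvec \<Rightarrow> 'b tvec"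
  where "tangent_map N F p v = (\<lambda>g. if smooth_at N (F p) g then v (g \<circ> F) else 0)"

definition ker_tangent_map ::
    "('a, 'i) mfd \<Rightarrow> ('b, 'j) mfd \<Rightarrow> ('a \<Rightarrow> 'b) \<Rightarrow> 'a \<Rightarrow> 'a tvec set"
  where "ker_tangent_map M N F p = {v \<in> tangent_space M p. tangent_map N F p v = 0}"

definition submersion :: "('a, 'i) mfd \<Rightarrow> ('b, 'j) mfd \<Rightarrow> ('a \<Rightarrow> 'b) \<Rightarrow> bool"
  where "submersion M N F \<longleftrightarrow> smooth_map M (carrier M) N F \<and>
    (\<forall>p\<in>carrier M. tangent_map N F p ` tangent_space M p = tangent_space N (F p))"

definition vector_field :: "('a, 'i) mfd \<Rightarrow> 'a set \<Rightarrow> ('a \<Rightarrow> 'a tvec) \<Rightarrow> bool"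
  where "vector_field M U X \<longleftrightarrow> mopen M U \<and> (\<forall>p\<in>U. X p \<in> tangent_space M p) \<and>
    (\<forall>W f. smooth_fun M W f \<longrightarrow> smooth_fun M (U \<inter> W) (\<lambda>p. X p f))"

definition lie_bracket ::
    "('a, 'i) mfd \<Rightarrow> ('a \<Rightarrow> 'a tvec) \<Rightarrow> ('a \<Rightarrow> 'a tvec) \<Rightarrow> 'a \<Rightarrow> 'a tvec"
  where "lie_bracket M X Y p =
    (\<lambda>f. if smooth_at M p f then X p (\<lambda>q. Y q f) - Y p (\<lambda>q. X q f) else 0)"


section \<open>Distributions\<close>

type_synonym 'a dist = "'a \<Rightarrow> 'a tvec set"

definition section_of ::
    "('a, 'i) mfd \<Rightarrow> 'a set \<Rightarrow> 'a dist \<Rightarrow> ('a \<Rightarrow> 'a tvec) \<Rightarrow> bool"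
  where "section_of M U D X \<longleftrightarrow> vector_field M U X \<and> (\<forall>p\<in>U. X p \<in> D p)"

definition regular_dist :: "('a, 'i) mfd \<Rightarrow> 'a set \<Rightarrow> nat \<Rightarrow> 'a dist \<Rightarrow> bool"
  \<comment> \<open>smooth distribution of constant rank \<open>m\<close> on \<open>U\<close>, i.e. one with local frames of \<open>m\<close> fields\<close>
  where "regular_dist M U m D \<longleftrightarrow> mopen M U \<and>
    (\<forall>p\<in>U. \<exists>N X. p \<in> N \<and> N \<subseteq> U \<and> mopen M N \<and> (\<forall>i<m. vector_field M N (X i)) \<and>
      (\<forall>q\<in>N. D q = span ((\<lambda>i. X i q) ` {..<m}) \<and> dim (D q) = m))"

definition involutive :: "('a, 'i) mfd \<Rightarrow> 'a set \<Rightarrow> 'a dist \<Rightarrow> bool"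
  where "involutive M U D \<longleftrightarrow> (\<forall>N X Y. N \<subseteq> U \<and> section_of M N D X \<and> section_of M N D Y
    \<longrightarrow> (\<forall>p\<in>N. lie_bracket M X Y p \<in> D p))"

definition integrable_dist :: "('a, 'i) mfd \<Rightarrow> 'a set \<Rightarrow> 'a dist \<Rightarrow> bool"
  \<comment> \<open>locally tangent to the slices \<open>\<phi>\<^sub>i = const\<close> (\<open>i \<in> A\<close>) of a chart, which are its integral manifolds\<close>
  where "integrable_dist M U D \<longleftrightarrow>
    (\<forall>p\<in>U. \<exists>V \<phi> A. (V, \<phi>) \<in> charts M \<and> p \<in> V \<and> V \<subseteq> U \<and> A \<subseteq> index M \<and>
      (\<forall>q\<in>V. D q = {v \<in> tangent_space M q. \<forall>i\<in>A. v (\<lambda>x. \<phi> x i) = 0}))"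

primrec derived :: "('a, 'i) mfd \<Rightarrow> 'a dist \<Rightarrow> nat \<Rightarrow> 'a dist"
  \<comment> \<open>the derived flag \<open>D\<^sup>(\<^sup>s\<^sup>)\<close>\<close>
  where
    "derived M D 0 = D"
  | "derived M D (Suc s) = (\<lambda>p. span (derived M D s p \<union>
      {lie_bracket M X Y p |X Y. \<exists>N. p \<in> N \<and> section_of M N D X \<and> section_of M N (derived M D s) Y}))"


section \<open>\<open>k\<close>-contact manifolds and polarisations\<close>

definition one_form :: "('a, 'i) mfd \<Rightarrow> 'a set \<Rightarrow> ('a \<Rightarrow> 'a tvec \<Rightarrow> real) \<Rightarrow> bool"
  where "one_form M U \<omega> \<longleftrightarrow> mopen M U \<and>
    (\<forall>p\<in>U. \<forall>u\<in>tangent_space M p. \<forall>v\<in>tangent_space M p. \<forall>a b.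
      \<omega> p (a *\<^sub>R u + b *\<^sub>R v) = a * \<omega> p u + b * \<omega> p v) \<and>
    (\<forall>N X. N \<subseteq> U \<and> vector_field M N X \<longrightarrow> smooth_fun M N (\<lambda>p. \<omega> p (X p)))"

definition ext_deriv ::
    "('a, 'i) mfd \<Rightarrow> ('a \<Rightarrow> 'a tvec \<Rightarrow> real) \<Rightarrow> ('a \<Rightarrow> 'a tvec) \<Rightarrow> ('a \<Rightarrow> 'a tvec) \<Rightarrow> 'a \<Rightarrow> real"
  \<comment> \<open>\<open>d\<omega>(X, Y)\<close>\<close>
  where "ext_deriv M \<omega> X Y p =
    X p (\<lambda>q. \<omega> q (Y q)) - Y p (\<lambda>q. \<omega> q (X q)) - \<omega> p (lie_bracket M X Y p)"

text \<open>An \<open>\<real>\<^sup>k\<close>-valued one-form is given by its components \<open>\<eta> A\<close>, \<open>A < k\<close>.\<close>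

definition ker_form ::
    "('a, 'i) mfd \<Rightarrow> nat \<Rightarrow> (nat \<Rightarrow> 'a \<Rightarrow> 'a tvec \<Rightarrow> real) \<Rightarrow> 'a dist"
  where "ker_form M k \<eta> p = {v \<in> tangent_space M p. \<forall>A<k. \<eta> A p v = 0}"

definition ker_ext_deriv ::
    "('a, 'i) mfd \<Rightarrow> nat \<Rightarrow> (nat \<Rightarrow> 'a \<Rightarrow> 'a tvec \<Rightarrow> real) \<Rightarrow> 'a dist"
  \<comment> \<open>\<open>d\<eta>\<^sup>A\<close> is tensorial, so it is evaluated at \<open>v\<close> by extending \<open>v\<close> to a local vector field\<close>
  where "ker_ext_deriv M k \<eta> p = {v \<in> tangent_space M p. \<forall>A<k. \<forall>N X Y.
    p \<in> N \<and> vector_field M N X \<and> vector_field M N Y \<and> X p = v \<longrightarrow> ext_deriv M (\<eta> A) X Y p = 0}"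

definition k_contact_form ::
    "nat \<Rightarrow> ('a, 'i) mfd \<Rightarrow> 'a set \<Rightarrow> (nat \<Rightarrow> 'a \<Rightarrow> 'a tvec \<Rightarrow> real) \<Rightarrow> bool"
  where "k_contact_form k M U \<eta> \<longleftrightarrow> (\<forall>A<k. one_form M U (\<eta> A)) \<and>
    (\<exists>m>0. m + k = mdim M \<and> regular_dist M U m (ker_form M k \<eta>)) \<and>
    (\<forall>p\<in>U. direct_sum (ker_form M k \<eta> p) (ker_ext_deriv M k \<eta> p) (tangent_space M p))"

definition k_contact_manifold :: "nat \<Rightarrow> ('a, 'i) mfd \<Rightarrow> 'a dist \<Rightarrow> bool"
  where "k_contact_manifold k M D \<longleftrightarrow> smooth_manifold M \<and>
    (\<exists>m. m + k = mdim M \<and> regular_dist M (carrier M) m D) \<and>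
    (\<forall>p\<in>carrier M. \<exists>U \<eta>. p \<in> U \<and> k_contact_form k M U \<eta> \<and> (\<forall>q\<in>U. D q = ker_form M k \<eta> q))"

definition levi_tensor :: "('a, 'i) mfd \<Rightarrow> 'a dist \<Rightarrow> 'a \<Rightarrow> 'a tvec \<Rightarrow> 'a tvec \<Rightarrow> 'a tvec set"
  \<comment> \<open>the class \<open>[X, Y]\<^sub>x + D\<^sub>x\<close>, as a coset, for local sections extending \<open>v, w \<in> D\<^sub>x\<close>\<close>
  where "levi_tensor M D x v w = {u \<in> tangent_space M x. \<exists>N X Y. x \<in> N \<and>
    section_of M N D X \<and> section_of M N D Y \<and> X x = v \<and> Y x = w \<and> u - lie_bracket M X Y x \<in> D x}"

definition isotropic :: "('a, 'i) mfd \<Rightarrow> 'a dist \<Rightarrow> 'a \<Rightarrow> 'a tvec set \<Rightarrow> bool"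
  \<comment> \<open>\<open>D x\<close> is the zero coset\<close>
  where "isotropic M D x S \<longleftrightarrow> subspace S \<and> S \<subseteq> D x \<and> (\<forall>v\<in>S. \<forall>w\<in>S. levi_tensor M D x v w = D x)"

definition legendrian :: "('a, 'i) mfd \<Rightarrow> 'a dist \<Rightarrow> 'a \<Rightarrow> 'a tvec set \<Rightarrow> bool"
  where "legendrian M D x S \<longleftrightarrow>
    isotropic M D x S \<and> (\<exists>C. isotropic M D x C \<and> direct_sum S C (D x))"

definition integrable_legendrian :: "('a, 'i) mfd \<Rightarrow> 'a dist \<Rightarrow> nat \<Rightarrow> 'a dist \<Rightarrow> bool"
  where "integrable_legendrian M D m P \<longleftrightarrow>
    regular_dist M (carrier M) m P \<and> integrable_dist M (carrier M) P \<and>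
    (\<forall>x\<in>carrier M. legendrian M D x (P x))"

definition polarisation :: "('a, 'i) mfd \<Rightarrow> 'a dist \<Rightarrow> 'a dist \<Rightarrow> bool"
  where "polarisation M D P \<longleftrightarrow>
    (\<exists>m. integrable_legendrian M D m P \<and> (\<forall>m' P'. integrable_legendrian M D m' P' \<longrightarrow> m' \<le> m))"

definition polarised_k_contact :: "nat \<Rightarrow> ('a, 'i) mfd \<Rightarrow> 'a dist \<Rightarrow> 'a dist \<Rightarrow> bool"
  where "polarised_k_contact k M D P \<longleftrightarrow> k_contact_manifold k M D \<and> polarisation M D P"

definition polarised_k_contactomorphism ::
    "nat \<Rightarrow> ('a, 'i) mfd \<Rightarrow> 'a dist \<Rightarrow> 'a dist \<Rightarrow> ('b, 'j) mfd \<Rightarrow> 'b dist \<Rightarrow> 'b dist \<Rightarrow> ('a \<Rightarrow> 'b) \<Rightarrow> bool"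
  where "polarised_k_contactomorphism k M D P M' D' P' F \<longleftrightarrow>
    polarised_k_contact k M D P \<and> polarised_k_contact k M' D' P' \<and> diffeo M M' F \<and>
    (\<forall>x\<in>carrier M. tangent_map M' F x ` D x \<subseteq> D' (F x) \<and> tangent_map M' F x ` P x \<subseteq> P' (F x)) \<and>
    (let G = inv_into (carrier M) F in
      \<forall>y\<in>carrier M'. tangent_map M G y ` D' y \<subseteq> D (G y) \<and> tangent_map M G y ` P' y \<subseteq> P (G y))"


section \<open>Spencer type and jet type\<close>

definition sym_forms :: "'v::real_vector set \<Rightarrow> 'v set \<Rightarrow> nat \<Rightarrow> ('v list \<Rightarrow> 'v) set"
  \<comment> \<open>\<open>S\<^sup>nH\<^sup>* \<otimes> W\<close>: symmetric \<open>n\<close>-linear maps \<open>H \<times> \<dots> \<times> H \<rightarrow> W\<close>, normalised to \<open>0\<close> elsewhere\<close>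
  where "sym_forms H W n = {\<omega>.
    (\<forall>xs. length xs = n \<and> set xs \<subseteq> H \<longrightarrow> \<omega> xs \<in> W) \<and>
    (\<forall>xs. \<not> (length xs = n \<and> set xs \<subseteq> H) \<longrightarrow> \<omega> xs = 0) \<and>
    (\<forall>xs i u v a b. length xs = n \<and> set xs \<subseteq> H \<and> i < n \<and> u \<in> H \<and> v \<in> H \<longrightarrow>
      \<omega> (xs[i := a *\<^sub>R u + b *\<^sub>R v]) = a *\<^sub>R \<omega> (xs[i := u]) + b *\<^sub>R \<omega> (xs[i := v])) \<and>
    (\<forall>xs ys. mset xs = mset ys \<longrightarrow> \<omega> xs = \<omega> ys)}"

definition quotient_bundle_iso ::
    "('a, 'i) mfd \<Rightarrow> 'a set \<Rightarrow> 'a dist \<Rightarrow> 'a dist \<Rightarrow> 'a dist \<Rightarrow> 'a dist \<Rightarrow> nat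
      \<Rightarrow> ('a \<Rightarrow> 'a tvec \<Rightarrow> 'a tvec list \<Rightarrow> 'a tvec) \<Rightarrow> bool"
  \<comment> \<open>\<open>\<alpha>\<close> induces a smooth vector bundle isomorphism \<open>B/K \<simeq> S\<^sup>nH\<^sup>* \<otimes> W\<close> over \<open>U\<close>: fibrewise it is
    linear and onto with kernel \<open>K\<close>, and it maps smooth sections to smooth sections\<close>
  where "quotient_bundle_iso M U B K H W n \<alpha> \<longleftrightarrow>
    (\<forall>x\<in>U.
      (\<forall>u\<in>B x. \<forall>v\<in>B x. \<forall>a b. \<alpha> x (a *\<^sub>R u + b *\<^sub>R v) = a *\<^sub>R \<alpha> x u + b *\<^sub>R \<alpha> x v) \<and>
      \<alpha> x ` B x = sym_forms (H x) (W x) n \<and>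
      {u \<in> B x. \<alpha> x u = 0} = K x) \<and>
    (\<forall>N Y Xs. N \<subseteq> U \<and> section_of M N B Y \<and> length Xs = n \<and> (\<forall>X\<in>set Xs. section_of M N H X)
      \<longrightarrow> section_of M N W (\<lambda>x. \<alpha> x (Y x) (map (\<lambda>X. X x) Xs)))"

definition spencer_bracket ::
    "('a, 'i) mfd \<Rightarrow> 'a set \<Rightarrow> 'a dist \<Rightarrow> 'a dist \<Rightarrow> nat
      \<Rightarrow> ('a \<Rightarrow> 'a tvec \<Rightarrow> 'a tvec list \<Rightarrow> 'a tvec)
      \<Rightarrow> ('a \<Rightarrow> 'a tvec \<Rightarrow> 'a tvec list \<Rightarrow> 'a tvec) \<Rightarrow> bool"
  \<comment> \<open>\<open>X \<otimes> [Y] \<mapsto> -[X, Y]\<close>, read through \<open>\<alpha>\<close> and \<open>\<beta>\<close>, is \<open>X \<otimes> \<omega> \<mapsto> \<omega>(X, \<cdot>, \<dots>, \<cdot>)\<close> with values in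
    symmetric \<open>n\<close>-linear maps\<close>
  where "spencer_bracket M U H B n \<alpha> \<beta> \<longleftrightarrow>
    (\<forall>N X Y. N \<subseteq> U \<and> section_of M N H X \<and> section_of M N B Y \<longrightarrow>
      (\<forall>x\<in>N. \<forall>hs. length hs = n \<and> set hs \<subseteq> H x \<longrightarrow>
        \<beta> x (- lie_bracket M X Y x) hs = \<alpha> x (Y x) (X x # hs)))"

definition integrable_isotropic_complement ::
    "('a, 'i) mfd \<Rightarrow> 'a set \<Rightarrow> 'a dist \<Rightarrow> 'a dist \<Rightarrow> 'a dist \<Rightarrow> bool"
  where "integrable_isotropic_complement M U D P H \<longleftrightarrow>
    (\<exists>h. regular_dist M U h H) \<and> integrable_dist M U H \<and>
    (\<forall>x\<in>U. isotropic M D x (H x) \<and> direct_sum (P x) (H x) (D x))"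

definition spencer_type :: "nat \<Rightarrow> ('a, 'i) mfd \<Rightarrow> 'a dist \<Rightarrow> 'a dist \<Rightarrow> bool"
  \<comment> \<open>The bundle \<open>W \<simeq> D\<^sup>(\<^sup>r\<^sup>)/D\<^sup>(\<^sup>r\<^sup>-\<^sup>1\<^sup>)\<close> is realised as a complement of \<open>D\<^sup>(\<^sup>r\<^sup>-\<^sup>1\<^sup>)\<close> in \<open>D\<^sup>(\<^sup>r\<^sup>)\<close>.
    \<open>\<alpha> 0\<close> is the isomorphism for \<open>P\<close>, and \<open>\<alpha> s\<close> for \<open>s \<ge> 1\<close> the one for \<open>D\<^sup>(\<^sup>s\<^sup>)/D\<^sup>(\<^sup>s\<^sup>-\<^sup>1\<^sup>)\<close>.\<close>
  where "spencer_type r M D P \<longleftrightarrow>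
    (\<forall>p\<in>carrier M. derived M D r p = tangent_space M p) \<and>
    (\<forall>p\<in>carrier M. \<exists>U H W \<alpha>. p \<in> U \<and>
      integrable_isotropic_complement M U D P H \<and>
      (\<forall>s\<le>r. \<exists>m. regular_dist M U m (derived M D s)) \<and>
      (\<exists>w. regular_dist M U w W) \<and>
      (\<forall>x\<in>U. direct_sum (W x) (derived M D (r - 1) x) (derived M D r x)) \<and>
      quotient_bundle_iso M U P (\<lambda>x. {0}) H W r (\<alpha> 0) \<and>
      (\<forall>s\<in>{1..r}. quotient_bundle_iso M U (derived M D s) (derived M D (s - 1)) H W (r - s) (\<alpha> s)) \<and>
      spencer_bracket M U H P (r - 1) (\<alpha> 0) (\<alpha> 1) \<and>
      (\<forall>s\<in>{1..<r}. spencer_bracket M U H (derived M D s) (r - s - 1) (\<alpha> s) (\<alpha> (s + 1))))"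

definition jet_splitting ::
    "nat \<Rightarrow> ('a, 'i) mfd \<Rightarrow> 'a dist \<Rightarrow> 'a dist \<Rightarrow> 'a set \<Rightarrow> 'a dist \<Rightarrow> 'a dist \<Rightarrow> bool"
  \<comment> \<open>\<open>H\<close> and \<open>V = V\<^sub>r\<close> are as required in the definition of jet type, on the open set \<open>U\<close>;
    \<open>V\<^sub>s = D\<^sup>(\<^sup>s\<^sup>) \<inter> V\<close>, so that \<open>V\<^sub>0 = D \<inter> V\<close> has to be \<open>P\<close>\<close>
  where "jet_splitting r M D P U H V \<longleftrightarrow>
    integrable_isotropic_complement M U D P H \<and>
    (\<exists>m. regular_dist M U m V) \<and> integrable_dist M U V \<and>
    (\<forall>x\<in>U. direct_sum (H x) (V x) (tangent_space M x)) \<and>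
    (\<forall>x\<in>U. D x \<inter> V x = P x) \<and>
    (\<forall>s<r. (\<exists>m. regular_dist M U m (\<lambda>x. derived M D s x \<inter> V x)) \<and>
      involutive M U (\<lambda>x. derived M D s x \<inter> V x))"

definition jet_type :: "nat \<Rightarrow> ('a, 'i) mfd \<Rightarrow> 'a dist \<Rightarrow> 'a dist \<Rightarrow> bool"
  where "jet_type r M D P \<longleftrightarrow> spencer_type r M D P \<and>
    (\<forall>p\<in>carrier M. \<exists>U H V. p \<in> U \<and> jet_splitting r M D P U H V)"


section \<open>Leaf spaces\<close>

definition real_line :: "(real, unit) mfd"
  where "real_line = \<lparr>index = UNIV, atlas = {(UNIV, \<lambda>t _. t)}\<rparr>"

definition velocity :: "('a, 'i) mfd \<Rightarrow> (real \<Rightarrow> 'a) \<Rightarrow> real \<Rightarrow> 'a tvec"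
  where "velocity M \<gamma> t =
    tangent_map M \<gamma> t (\<lambda>f. if smooth_at real_line t f then deriv f t else 0)"

definition tangent_step :: "('a, 'i) mfd \<Rightarrow> 'a dist \<Rightarrow> ('a \<times> 'a) set"
  where "tangent_step M V = {(\<gamma> a, \<gamma> b) |\<gamma> a b. a \<le> b \<and>
    (\<exists>T. {a..b} \<subseteq> T \<and> smooth_map real_line T M \<gamma>) \<and> (\<forall>t\<in>{a..b}. velocity M \<gamma> t \<in> V (\<gamma> t))}"

definition leaf :: "('a, 'i) mfd \<Rightarrow> 'a dist \<Rightarrow> 'a \<Rightarrow> 'a set"
  \<comment> \<open>the points reached from \<open>p\<close> by piecewise smooth curves tangent to \<open>V\<close>\<close>
  where "leaf M V p = {q. (p, q) \<in> (tangent_step M V)\<^sup>*}"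

definition simple_with ::
    "('a, 'i) mfd \<Rightarrow> 'a dist \<Rightarrow> ('a set, nat) mfd \<Rightarrow> bool"
  \<comment> \<open>the regular involutive distribution \<open>V\<close> is simple, with \<open>Q\<close> as its smooth leaf space \<open>M/V\<close>\<close>
  where "simple_with M V Q \<longleftrightarrow>
    (\<exists>m. regular_dist M (carrier M) m V) \<and> involutive M (carrier M) V \<and>
    smooth_manifold Q \<and> (\<exists>n. index Q = {..<n}) \<and>
    carrier Q = leaf M V ` carrier M \<and> submersion M Q (leaf M V)"


section \<open>Jet bundles\<close>

definition fibred_manifold ::
    "('e, nat) mfd \<Rightarrow> ('q, nat) mfd \<Rightarrow> ('e \<Rightarrow> 'q) \<Rightarrow> bool"
  where "fibred_manifold E Q \<pi> \<longleftrightarrow> smooth_manifold E \<and> smooth_manifold Q \<and>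
    (\<exists>q m. index Q = {..<q} \<and> index E = {..<q + m}) \<and>
    submersion E Q \<pi> \<and> \<pi> ` carrier E = carrier Q"

definition local_section ::
    "('e, nat) mfd \<Rightarrow> ('q, nat) mfd \<Rightarrow> ('e \<Rightarrow> 'q) \<Rightarrow> 'q \<Rightarrow> ('q \<Rightarrow> 'e) \<Rightarrow> bool"
  \<comment> \<open>\<open>\<sigma>\<close> is a smooth section of \<open>\<pi>\<close> near \<open>x\<close>; its values away from \<open>x\<close> are irrelevant\<close>
  where "local_section E Q \<pi> x \<sigma> \<longleftrightarrow>
    (\<exists>N. x \<in> N \<and> smooth_map Q N E \<sigma> \<and> (\<forall>y\<in>N. \<pi> (\<sigma> y) = y))"

definition same_jet ::
    "('e, nat) mfd \<Rightarrow> ('q, nat) mfd \<Rightarrow> nat \<Rightarrow> 'q \<Rightarrow> ('q \<Rightarrow> 'e) \<Rightarrow> ('q \<Rightarrow> 'e) \<Rightarrow> bool"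
  where "same_jet E Q r x \<sigma> \<tau> \<longleftrightarrow> \<sigma> x = \<tau> x \<and>
    (\<forall>(V, \<phi>)\<in>charts Q. \<forall>(U, \<psi>)\<in>charts E. x \<in> V \<and> \<sigma> x \<in> U \<longrightarrow>
      (\<forall>i\<in>index E. \<forall>J. set_mset J \<subseteq> index Q \<and> size J \<le> r \<longrightarrow>
        multi_pderiv J (\<lambda>z. \<psi> (\<sigma> (inv_into V \<phi> z)) i) (\<phi> x) =
        multi_pderiv J (\<lambda>z. \<psi> (\<tau> (inv_into V \<phi> z)) i) (\<phi> x)))"

text \<open>The \<open>r\<close>-jet of \<open>\<sigma>\<close> at \<open>x\<close> is \<open>x\<close> together with the class of local sections with this jet.\<close>

type_synonym ('e, 'q) jet = "'q \<times> ('q \<Rightarrow> 'e) set"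

definition jet ::
    "('e, nat) mfd \<Rightarrow> ('q, nat) mfd \<Rightarrow> ('e \<Rightarrow> 'q) \<Rightarrow> nat \<Rightarrow> 'q \<Rightarrow> ('q \<Rightarrow> 'e) \<Rightarrow> ('e, 'q) jet"
  where "jet E Q \<pi> r x \<sigma> = (x, {\<tau>. local_section E Q \<pi> x \<tau> \<and> same_jet E Q r x \<sigma> \<tau>})"

definition jets ::
    "('e, nat) mfd \<Rightarrow> ('q, nat) mfd \<Rightarrow> ('e \<Rightarrow> 'q) \<Rightarrow> nat \<Rightarrow> ('e, 'q) jet set"
  where "jets E Q \<pi> r = {jet E Q \<pi> r x \<sigma> |x \<sigma>. x \<in> carrier Q \<and> local_section E Q \<pi> x \<sigma>}"

definition jet_rep :: "('e, 'q) jet \<Rightarrow> 'q \<Rightarrow> 'e"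
  where "jet_rep j = (SOME \<sigma>. \<sigma> \<in> snd j)"

definition jet_source :: "('e, 'q) jet \<Rightarrow> 'q"
  \<comment> \<open>\<open>\<pi>\<^sub>r : J\<^sup>r\<pi> \<rightarrow> Q\<close>\<close>
  where "jet_source j = fst j"

definition jet_target :: "('e, 'q) jet \<Rightarrow> 'e"
  \<comment> \<open>\<open>\<pi>\<^sub>r\<^sub>,\<^sub>0 : J\<^sup>r\<pi> \<rightarrow> E\<close>\<close>
  where "jet_target j = jet_rep j (fst j)"

definition jet_proj ::
    "('e, nat) mfd \<Rightarrow> ('q, nat) mfd \<Rightarrow> ('e \<Rightarrow> 'q) \<Rightarrow> nat \<Rightarrow> ('e, 'q) jet \<Rightarrow> ('e, 'q) jet"
  \<comment> \<open>\<open>\<pi>\<^sub>r\<^sub>,\<^sub>s : J\<^sup>r\<pi> \<rightarrow> J\<^sup>s\<pi>\<close>\<close>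
  where "jet_proj E Q \<pi> s j = jet E Q \<pi> s (fst j) (jet_rep j)"

definition adapted_charts ::
    "('e, nat) mfd \<Rightarrow> ('q, nat) mfd \<Rightarrow> ('e \<Rightarrow> 'q)
      \<Rightarrow> (('e set \<times> ('e \<Rightarrow> nat \<Rightarrow> real)) \<times> ('q set \<times> ('q \<Rightarrow> nat \<Rightarrow> real))) set"
  \<comment> \<open>with \<open>dim Q = q\<close>, the first \<open>q\<close> of the coordinates \<open>\<psi>\<close> on \<open>E\<close> are the coordinates \<open>\<phi>\<close> on \<open>Q\<close>\<close>
  where "adapted_charts E Q \<pi> = {((U, \<psi>), (V, \<phi>)) |U \<psi> V \<phi>.
    (U, \<psi>) \<in> charts E \<and> (V, \<phi>) \<in> charts Q \<and> \<pi> ` U \<subseteq> V \<and>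
    (\<forall>e\<in>U. \<forall>i\<in>index Q. \<psi> e i = \<phi> (\<pi> e) i)}"

definition jet_index :: "nat set \<Rightarrow> nat set \<Rightarrow> nat \<Rightarrow> (nat \<times> nat multiset) set"
  where "jet_index I K r = (\<lambda>i. (i, {#})) ` I \<union>
    {(\<alpha>, J). \<alpha> \<in> K - I \<and> set_mset J \<subseteq> I \<and> size J \<le> r}"

definition jet_bundle ::
    "('e, nat) mfd \<Rightarrow> ('q, nat) mfd \<Rightarrow> ('e \<Rightarrow> 'q) \<Rightarrow> nat \<Rightarrow> (('e, 'q) jet, nat \<times> nat multiset) mfd"
  \<comment> \<open>Adapted charts induce the coordinates \<open>x\<^sup>i, u\<^sup>\<alpha>\<^sub>J\<close> on jets; the coordinate indexed by \<open>(\<alpha>, J)\<close> is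
    the \<open>J\<close>-th derivative of the \<open>\<alpha>\<close>-th component of a section, which for \<open>\<alpha> \<in> index Q\<close> and empty \<open>J\<close>
    is the base coordinate \<open>x\<^sup>\<alpha>\<close>.\<close>
  where "jet_bundle E Q \<pi> r = \<lparr>
    index = jet_index (index Q) (index E) r,
    atlas = {({j \<in> jets E Q \<pi> r. jet_target j \<in> U},
              \<lambda>j (\<alpha>, J). if (\<alpha>, J) \<in> jet_index (index Q) (index E) r
                 then multi_pderiv J (\<lambda>z. \<psi> (jet_rep j (inv_into V \<phi> z)) \<alpha>) (\<phi> (jet_source j)) else 0)
             |U \<psi> V \<phi>. ((U, \<psi>), (V, \<phi>)) \<in> adapted_charts E Q \<pi>}\<rparr>"

definition cartan ::
    "('e, nat) mfd \<Rightarrow> ('q, nat) mfd \<Rightarrow> ('e \<Rightarrow> 'q) \<Rightarrow> nat \<Rightarrow> ('e, 'q) jet dist"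
  \<comment> \<open>spanned by the tangent spaces of all prolonged local sections \<open>j\<^sup>r\<sigma>\<close> through \<open>j\<close>\<close>
  where "cartan E Q \<pi> r j = span (\<Union>\<sigma>\<in>snd j.
    tangent_map (jet_bundle E Q \<pi> r) (\<lambda>y. jet E Q \<pi> r y \<sigma>) (fst j) ` tangent_space Q (fst j))"

definition jet_vertical ::
    "('e, nat) mfd \<Rightarrow> ('q, nat) mfd \<Rightarrow> ('e \<Rightarrow> 'q) \<Rightarrow> nat \<Rightarrow> ('e, 'q) jet dist"
  \<comment> \<open>\<open>ker T\<pi>\<^sub>r\<^sub>,\<^sub>r\<^sub>-\<^sub>1\<close>\<close>
  where "jet_vertical E Q \<pi> r =
    ker_tangent_map (jet_bundle E Q \<pi> r) (jet_bundle E Q \<pi> (r - 1)) (jet_proj E Q \<pi> (r - 1))"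

definition prolong ::
    "('e, nat) mfd \<Rightarrow> ('q, nat) mfd \<Rightarrow> ('e \<Rightarrow> 'q) \<Rightarrow> nat
      \<Rightarrow> ('d \<Rightarrow> 'e) \<Rightarrow> 'p set \<Rightarrow> ('p \<Rightarrow> 'q) \<Rightarrow> ('d, 'p) jet \<Rightarrow> ('e, 'q) jet"
  \<comment> \<open>The prolongation \<open>j\<^sup>r\<^sub>x\<sigma> \<mapsto> j\<^sup>r\<^sub>g\<^sub>(\<^sub>x\<^sub>)(f \<circ> \<sigma> \<circ> g\<^sup>-\<^sup>1)\<close> of a bundle map \<open>f\<close> covering a diffeomorphism \<open>g\<close>
    that is defined on \<open>B\<close>; \<open>E\<close>, \<open>Q\<close>, \<open>\<pi>\<close> is the bundle in which \<open>f\<close> takes its values.\<close>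
  where "prolong E Q \<pi> r f B g j = jet E Q \<pi> r (g (fst j)) (f \<circ> jet_rep j \<circ> inv_into B g)"

definition local_bundle_automorphism ::
    "('e, nat) mfd \<Rightarrow> ('q, nat) mfd \<Rightarrow> ('e \<Rightarrow> 'q)
      \<Rightarrow> 'e set \<Rightarrow> ('e \<Rightarrow> 'e) \<Rightarrow> 'q set \<Rightarrow> ('q \<Rightarrow> 'q) \<Rightarrow> bool"
  where "local_bundle_automorphism E Q \<pi> E' f Q' g \<longleftrightarrow>
    diffeo_on E E' E (f ` E') f \<and> diffeo_on Q Q' Q (g ` Q') g \<and>
    \<pi> ` E' = Q' \<and> (\<forall>e\<in>E'. \<pi> (f e) = g (\<pi> e))"


section \<open>Local identifications with jet bundles\<close>

text \<open>
  The index \<open>a\<close> of a family of local identifications ranges over a set \<open>A\<close>. Besides the maps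
  \<open>\<Phi> a : U a \<rightarrow> V a\<close>, a family carries the identifications \<open>\<iota> a\<close> and \<open>\<kappa> a\<close> of \<open>E\<^sub>a\<close> and \<open>Q\<^sub>a\<close> with open
  subsets of \<open>E\<close> and \<open>Q\<close>, under which the point of \<open>E\<^sub>a\<close> (of \<open>Q\<^sub>a\<close>) below \<open>\<Phi> a p\<close> becomes the class
  of \<open>p\<close>.
\<close>

record ('m, 'd, 'p, 'e, 'q) local_ident =
  dom :: "'m set"
  tot :: "('d, nat) mfd"
  base :: "('p, nat) mfd"
  proj :: "'d \<Rightarrow> 'p"
  ran :: "('d, 'p) jet set"
  ident :: "'m \<Rightarrow> ('d, 'p) jet"
  tot_emb :: "'d \<Rightarrow> 'e"
  base_emb :: "'p \<Rightarrow> 'q"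

definition local_identification ::
    "nat \<Rightarrow> ('m, 'i) mfd \<Rightarrow> 'm dist \<Rightarrow> 'm dist \<Rightarrow> 'm dist \<Rightarrow> ('m set, nat) mfd \<Rightarrow> ('m set, nat) mfd
      \<Rightarrow> ('m set \<Rightarrow> 'm set) \<Rightarrow> ('m, 'd, 'p, 'm set, 'm set) local_ident \<Rightarrow> bool"
  where "local_identification r M D P V E Q \<pi> c \<longleftrightarrow>
    (let \<Phi> = ident c; J = jet_bundle (tot c) (base c) (proj c) r;
         V' = (\<lambda>p. derived M D (r - 1) p \<inter> V p) in
      fibred_manifold (tot c) (base c) (proj c) \<and>
      diffeo_on M (dom c) J (ran c) \<Phi> \<and>
      (\<forall>p\<in>dom c.
        tangent_map J \<Phi> p ` D p = cartan (tot c) (base c) (proj c) r (\<Phi> p) \<and>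
        tangent_map J \<Phi> p ` P p = jet_vertical (tot c) (base c) (proj c) r (\<Phi> p) \<and>
        tangent_map J \<Phi> p ` V p = ker_tangent_map J (base c) jet_source (\<Phi> p) \<and>
        tangent_map J \<Phi> p ` V' p = ker_tangent_map J (tot c) jet_target (\<Phi> p)) \<and>
      diffeo_on (tot c) (carrier (tot c)) E (tot_emb c ` carrier (tot c)) (tot_emb c) \<and>
      diffeo_on (base c) (carrier (base c)) Q (base_emb c ` carrier (base c)) (base_emb c) \<and>
      (\<forall>e\<in>carrier (tot c). \<pi> (tot_emb c e) = base_emb c (proj c e)) \<and>
      (\<forall>p\<in>dom c. tot_emb c (jet_target (\<Phi> p)) = leaf M V' p \<and>
        base_emb c (jet_source (\<Phi> p)) = leaf M V p))"

definition jet_emb ::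
    "nat \<Rightarrow> ('e, nat) mfd \<Rightarrow> ('q, nat) mfd \<Rightarrow> ('e \<Rightarrow> 'q)
      \<Rightarrow> ('m, 'd, 'p, 'e, 'q) local_ident \<Rightarrow> ('d, 'p) jet \<Rightarrow> ('e, 'q) jet"
  \<comment> \<open>the map \<open>J\<^sup>r\<pi>\<^sub>a \<rightarrow> J\<^sup>r\<pi>\<close> identifying \<open>\<pi>\<^sub>a\<close> with a restriction of \<open>\<pi>\<close>\<close>
  where "jet_emb r E Q \<pi> c =
    prolong E Q \<pi> r (tot_emb c) (carrier (base c)) (base_emb c)"

definition transition_by_prolongation ::
    "nat \<Rightarrow> ('e, nat) mfd \<Rightarrow> ('q, nat) mfd \<Rightarrow> ('e \<Rightarrow> 'q)
      \<Rightarrow> ('m, 'd, 'p, 'e, 'q) local_ident \<Rightarrow> ('m, 'd, 'p, 'e, 'q) local_ident \<Rightarrow> bool"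
  \<comment> \<open>near each point of its domain, the transition function \<open>\<Phi>\<^sub>b \<circ> \<Phi>\<^sub>a\<^sup>-\<^sup>1\<close> between \<open>c = a\<close> and
    \<open>d = b\<close>, read in \<open>J\<^sup>r\<pi>\<close>, is the prolongation of a local bundle automorphism of \<open>\<pi>\<close>\<close>
  where "transition_by_prolongation r E Q \<pi> c d \<longleftrightarrow>
    (\<forall>j\<^sub>0 \<in> ident c ` (dom c \<inter> dom d). \<exists>N E' f Q' g.
      j\<^sub>0 \<in> N \<and> N \<subseteq> ident c ` (dom c \<inter> dom d) \<and>
      mopen (jet_bundle (tot c) (base c) (proj c) r) N \<and>
      local_bundle_automorphism E Q \<pi> E' f Q' g \<and>
      (\<forall>j\<in>N. jet_target (jet_emb r E Q \<pi> c j) \<in> E' \<and>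
        jet_emb r E Q \<pi> d (ident d (inv_into (dom c) (ident c) j)) =
          prolong E Q \<pi> r f Q' g (jet_emb r E Q \<pi> c j)))"

end

theory Submission
  imports Defs
begin

text \<open>
  Let \<open>V' = D\<^sup>(\<^sup>r\<^sup>-\<^sup>1\<^sup>) \<inter> V\<^sub>r\<close>. Its leaves lie in leaves of \<open>V\<^sub>r\<close>, so mapping the class of \<open>p\<close> in \<open>E\<close> to its
  class in \<open>Q\<close> is well defined. This map \<open>\<pi>\<close> is a submersion because \<open>M \<rightarrow> E\<close> is a surjective
  submersion, which has local sections: locally \<open>\<pi>\<close> is such a section followed by \<open>M \<rightarrow> Q\<close>
  (\<open>submersion_descends\<close>).

  A local identification around \<open>p\<close>, followed by the map of jets that an open embedding of bundles
  induces, assigns to \<open>p\<close> an \<open>r\<close>-jet over the classes of \<open>p\<close> in \<open>E\<close> and \<open>Q\<close>. The essential point is that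
  two identifications give the same jet (\<open>identifications_agree\<close>). By assumption the two jets are
  related, at all points \<open>q\<close> near \<open>p\<close>, by the prolongation \<open>j\<^sup>r\<sigma> \<mapsto> j\<^sup>r(f \<circ> \<sigma> \<circ> g\<^sup>-\<^sup>1)\<close> of a bundle
  automorphism \<open>f\<close> over \<open>g\<close>. Since both lie over the classes of \<open>q\<close>, the automorphism fixes these
  classes. Submersions are open maps (\<open>submersion_image_mopen\<close>), so the classes of points near \<open>p\<close> fill
  neighbourhoods of those of \<open>p\<close>; there \<open>f\<close> and \<open>g\<close> are the identity, \<open>f \<circ> \<sigma> \<circ> g\<^sup>-\<^sup>1\<close> has the germ of
  \<open>\<sigma>\<close>, and the prolongation fixes its jet. Thus \<open>\<Phi>\<close> is well defined.

  An open embedding of bundles induces a map of jet bundles that is the identity in corresponding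
  coordinates (\<open>emb_coord\<close>). It is therefore a diffeomorphism onto an open set, and it preserves the
  Cartan distribution, because it maps prolonged sections to prolonged sections (\<open>cartan_push\<close>), and
  the vertical tangent spaces, because it commutes with the projections (\<open>vertical_push\<close>). With the
  properties of the identifications this makes \<open>\<Phi>\<close> a local diffeomorphism whose tangent maps take
  \<open>D\<close> to the Cartan distribution and \<open>P\<close> to the vertical tangent spaces (\<open>glued_map_local\<close>).

  If \<open>\<Phi>\<close> is a diffeomorphism, it remains to see that its target is a polarised \<open>k\<close>-contact manifold. That
  the charts of \<open>J\<^sup>r\<pi>\<close> make it a manifold is deduced from \<open>\<Phi>\<close> (\<open>diffeo_smooth_manifold\<close>); before, only
  the injectivity of these charts is used. All notions in the definition of a polarised \<open>k\<close>-contact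
  manifold are natural under diffeomorphisms (\<open>polarised_k_contact_push\<close>).

  The differential calculus that this rests on is developed from partial derivatives: the chain
  rule, the symmetry of second derivatives and the lemma of Hadamard give the dimension of tangent
  spaces and the independence of jets of the charts, and straightening a submersion in coordinates
  gives its local sections.
\<close>

section \<open>Calculus on coordinate spaces\<close>

text \<open>
  Cubes are neighbourhoods in the coordinate space in which coordinates can be changed one at a
  time.
\<close>

definition cube :: "'i set \<Rightarrow> ('i \<Rightarrow> real) \<Rightarrow> real \<Rightarrow> ('i \<Rightarrow> real) set"
  where "cube I x e = {y \<in> coord_space I. \<forall>i\<in>I. \<bar>y i - x i\<bar> < e}"

lemma coord_open_subset: "coord_open I S \<Longrightarrow> S \<subseteq> coord_space I"
  by (simp add: coord_open_def openin_imp_subset)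

lemma coord_space_upd: "x \<in> coord_space I \<Longrightarrow> i \<in> I \<Longrightarrow> x(i := t) \<in> coord_space I"
  by (auto simp: coord_space_def)

lemma coord_space_eqI:
  "x \<in> coord_space I \<Longrightarrow> y \<in> coord_space I \<Longrightarrow> (\<And>i. i \<in> I \<Longrightarrow> x i = y i) \<Longrightarrow> x = y"
  by (auto simp: coord_space_def fun_eq_iff) metis

lemma cube_center: "x \<in> coord_space I \<Longrightarrow> 0 < e \<Longrightarrow> x \<in> cube I x e"
  by (simp add: cube_def)

lemma cube_mono: "d \<le> e \<Longrightarrow> cube I x d \<subseteq> cube I x e"
  by (force simp: cube_def)

lemma cube_upd: "y \<in> cube I x e \<Longrightarrow> i \<in> I \<Longrightarrow> \<bar>s - x i\<bar> < e \<Longrightarrow> y(i := s) \<in> cube I x e"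
  by (auto simp: cube_def coord_space_upd)

lemma coord_open_cube:
  assumes "finite I" shows "coord_open I (cube I x e)"
proof -
  have "open (\<Inter>i\<in>I. {y. \<bar>y i - x i\<bar> < e})"
    using assms by (intro open_INT ballI open_Collect_less continuous_intros) auto
  moreover have "cube I x e = coord_space I \<inter> (\<Inter>i\<in>I. {y. \<bar>y i - x i\<bar> < e})"
    by (auto simp: cube_def)
  ultimately show ?thesis unfolding coord_open_def openin_open by blast
qed

lemma open_contains_cube:
  assumes fin: "finite I" and T: "open T" and x: "x \<in> T" "x \<in> coord_space I"
  shows "\<exists>e>0. cube I x e \<subseteq> T"
proof -
  have "openin (product_topology (\<lambda>i. euclidean) UNIV) T"
    using T by (simp add: open_fun_def)
  from product_topology_open_contains_basis[OF this x(1)]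
  obtain X where X: "x \<in> (\<Pi>\<^sub>E i\<in>UNIV. X i)" "\<And>i. open (X i)" "(\<Pi>\<^sub>E i\<in>UNIV. X i) \<subseteq> T"
    by auto
  have "\<forall>i\<in>I. \<exists>e>0. \<forall>y. \<bar>y - x i\<bar> < e \<longrightarrow> y \<in> X i"
    using X(1,2) unfolding open_dist dist_real_def by auto
  then obtain e where e: "\<And>i. i \<in> I \<Longrightarrow> e i > 0" "\<And>i y. i \<in> I \<Longrightarrow> \<bar>y - x i\<bar> < e i \<Longrightarrow> y \<in> X i"
    by metis
  define d where "d = Min (insert 1 (e ` I))"
  have d: "d > 0" "\<And>i. i \<in> I \<Longrightarrow> d \<le> e i" using fin e(1) by (auto simp: d_def)
  have "cube I x d \<subseteq> (\<Pi>\<^sub>E i\<in>UNIV. X i)"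
  proof
    fix y assume y: "y \<in> cube I x d"
    have "y i \<in> X i" for i
    proof (cases "i \<in> I")
      case True
      then have "\<bar>y i - x i\<bar> < e i" using y d(2)[OF True] by (auto simp: cube_def dest: bspec)
      then show ?thesis using e(2)[OF True] by blast
    next
      case False
      then have "y i = x i" using y x(2) by (auto simp: cube_def coord_space_def)
      then show ?thesis using X(1) by auto
    qed
    then show "y \<in> (\<Pi>\<^sub>E i\<in>UNIV. X i)" by auto
  qed
  then show ?thesis using d(1) X(3) by blast
qed

lemma coord_open_iff:
  assumes "finite I"
  shows "coord_open I S \<longleftrightarrow> S \<subseteq> coord_space I \<and> (\<forall>x\<in>S. \<exists>e>0. cube I x e \<subseteq> S)"
proof (intro iffI conjI ballI)
  assume S: "coord_open I S"
  show "S \<subseteq> coord_space I" using S by (rule coord_open_subset)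
  fix x assume x: "x \<in> S"
  obtain T where T: "open T" "S = coord_space I \<inter> T" using S unfolding coord_open_def openin_open by blast
  then obtain e where "e > 0" "cube I x e \<subseteq> T" using open_contains_cube[OF assms T(1)] x by blast
  moreover have "cube I x e \<subseteq> coord_space I" by (auto simp: cube_def)
  ultimately show "\<exists>e>0. cube I x e \<subseteq> S" using T(2) by blast
next
  assume S: "S \<subseteq> coord_space I \<and> (\<forall>x\<in>S. \<exists>e>0. cube I x e \<subseteq> S)"
  show "coord_open I S" unfolding coord_open_def
  proof (subst openin_subopen, intro ballI)
    fix x assume x: "x \<in> S"
    then obtain e where e: "e > 0" "cube I x e \<subseteq> S" using S by blast
    have "x \<in> cube I x e" using S x e(1) by (intro cube_center) auto
    then show "\<exists>T. openin (top_of_set (coord_space I)) T \<and> x \<in> T \<and> T \<subseteq> S"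
      using coord_open_cube[OF assms, of x e] e unfolding coord_open_def by blast
  qed
qed

lemma coord_open_Int: "coord_open I S \<Longrightarrow> coord_open I T \<Longrightarrow> coord_open I (S \<inter> T)"
  by (simp add: coord_open_def openin_Int)

lemma coord_open_Union: "(\<And>S. S \<in> \<S> \<Longrightarrow> coord_open I S) \<Longrightarrow> coord_open I (\<Union>\<S>)"
  by (auto simp: coord_open_def intro: openin_Union)

lemma coord_open_empty: "coord_open I {}"
  by (simp add: coord_open_def)

lemma coord_open_subopen:
  "(\<And>x. x \<in> S \<Longrightarrow> \<exists>T. coord_open I T \<and> x \<in> T \<and> T \<subseteq> S) \<Longrightarrow> coord_open I S"
  unfolding coord_open_def by (subst openin_subopen) blast

lemma continuous_on_cube:
  fixes f :: "('i \<Rightarrow> real) \<Rightarrow> real"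
  assumes fin: "finite I" and S: "S \<subseteq> coord_space I"
  shows "continuous_on S f \<longleftrightarrow> (\<forall>x\<in>S. \<forall>e>0. \<exists>d>0. \<forall>y\<in>S \<inter> cube I x d. \<bar>f y - f x\<bar> < e)"
proof (intro iffI ballI allI impI)
  fix x and e :: real
  assume f: "continuous_on S f" and x: "x \<in> S" and e: "e > 0"
  have "open (ball (f x) e)" "f x \<in> ball (f x) e" using e by auto
  then obtain A where A: "open A" "x \<in> A" "\<forall>y\<in>S. y \<in> A \<longrightarrow> f y \<in> ball (f x) e"
    using f x unfolding continuous_on_topological by meson
  obtain d where "d > 0" "cube I x d \<subseteq> A" using open_contains_cube[OF fin A(1,2)] S x by blast
  then show "\<exists>d>0. \<forall>y\<in>S \<inter> cube I x d. \<bar>f y - f x\<bar> < e"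
    using A(3) by (intro exI[of _ d]) (auto simp: dist_real_def abs_minus_commute)
next
  assume *: "\<forall>x\<in>S. \<forall>e>0. \<exists>d>0. \<forall>y\<in>S \<inter> cube I x d. \<bar>f y - f x\<bar> < e"
  show "continuous_on S f" unfolding continuous_on_topological
  proof (intro ballI allI impI)
    fix x B assume x: "x \<in> S" and B: "open B" "f x \<in> B"
    obtain e where e: "e > 0" "\<And>y. \<bar>y - f x\<bar> < e \<Longrightarrow> y \<in> B"
      using B unfolding open_dist dist_real_def by auto
    obtain d where d: "d > 0" "\<forall>y\<in>S \<inter> cube I x d. \<bar>f y - f x\<bar> < e" using * x e(1) by blast
    obtain T where T: "open T" "cube I x d = coord_space I \<inter> T"
      using coord_open_cube[OF fin, of x d] unfolding coord_open_def openin_open by blast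
    show "\<exists>A. open A \<and> x \<in> A \<and> (\<forall>y\<in>S. y \<in> A \<longrightarrow> f y \<in> B)"
      using T d S x e(2) cube_center[of x I d] by (intro exI[of _ T]) blast
  qed
qed

lemma continuous_on_open_cube:
  fixes f :: "('i \<Rightarrow> real) \<Rightarrow> real"
  assumes fin: "finite I" and S: "coord_open I S" and f: "continuous_on S f" and "x \<in> S" "e > 0"
  shows "\<exists>d>0. \<forall>y\<in>cube I x d. y \<in> S \<and> \<bar>f y - f x\<bar> < e"
proof -
  obtain d1 where d1: "d1 > 0" "\<forall>y\<in>S \<inter> cube I x d1. \<bar>f y - f x\<bar> < e"
    using continuous_on_cube[OF fin coord_open_subset[OF S], of f] assms by blast
  obtain d2 where d2: "d2 > 0" "cube I x d2 \<subseteq> S" using coord_open_iff[OF fin] S assms(4) by blast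
  have "\<forall>y\<in>cube I x (min d1 d2). y \<in> S \<and> \<bar>f y - f x\<bar> < e"
    using d1(2) d2(2) cube_mono[of "min d1 d2" d1 I x] cube_mono[of "min d1 d2" d2 I x] by (auto simp: subset_iff)
  then show ?thesis using d1(1) d2(1) by (intro exI[of _ "min d1 d2"]) auto
qed

subsection \<open>Functions of class \<open>C\<^sup>k\<close>\<close>

lemma upd_eventually:
  assumes fin: "finite I" and S: "coord_open I S" and "i \<in> I" "x \<in> S"
  shows "\<forall>\<^sub>F t in nhds (x i). x(i := t) \<in> S"
proof -
  obtain e where e: "e > 0" "cube I x e \<subseteq> S" using coord_open_iff[OF fin] S assms by blast
  have "x \<in> coord_space I" using coord_open_subset[OF S] assms by blast
  then have "x(i := t) \<in> S" if "dist t (x i) < e" for t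
    using e cube_upd[OF cube_center[OF _ e(1)], of x I i t] that \<open>i \<in> I\<close> by (auto simp: dist_real_def)
  then show ?thesis unfolding eventually_nhds_metric using e(1) by blast
qed

lemma pderiv_at_cong:
  assumes "finite I" "coord_open I S" "i \<in> I" "x \<in> S" "\<And>y. y \<in> S \<Longrightarrow> f y = g y"
  shows "pderiv_at i f x = pderiv_at i g x"
proof -
  have "\<forall>\<^sub>F t in nhds (x i). f (x(i := t)) = g (x(i := t))"
    using upd_eventually[OF assms(1-4)] by (rule eventually_mono) (use assms(5) in auto)
  then show ?thesis unfolding pderiv_at_def by (rule deriv_cong_ev) simp
qed

lemma has_pderiv:
  assumes "Ck_on (Suc n) I S f" "i \<in> I" "x \<in> S"
  shows "((\<lambda>t. f (x(i := t))) has_real_derivative pderiv_at i f x) (at (x i))"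
  using assms by (simp add: pderiv_at_def DERIV_deriv_iff_real_differentiable)

lemma has_pderiv_upd:
  assumes "Ck_on (Suc n) I S f" "i \<in> I" "x(i := s) \<in> S"
  shows "((\<lambda>t. f (x(i := t))) has_real_derivative pderiv_at i f (x(i := s))) (at s)"
  using has_pderiv[OF assms] by simp

lemma Ck_on_continuous: "Ck_on n I S f \<Longrightarrow> continuous_on S f"
  by (cases n) auto

lemma Ck_on_pderiv: "Ck_on (Suc n) I S f \<Longrightarrow> i \<in> I \<Longrightarrow> Ck_on n I S (pderiv_at i f)"
  by simp

lemma Ck_on_decr: "Ck_on (Suc n) I S f \<Longrightarrow> Ck_on n I S f"
  by (induction n arbitrary: f) auto

lemma Ck_on_subset: "Ck_on n I S f \<Longrightarrow> T \<subseteq> S \<Longrightarrow> Ck_on n I T f"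
  by (induction n arbitrary: f) (auto intro: continuous_on_subset)

lemma Ck_on_SucI:
  assumes fin: "finite I" and S: "coord_open I S" and f: "continuous_on S f"
    and deriv: "\<And>i x. i \<in> I \<Longrightarrow> x \<in> S \<Longrightarrow> ((\<lambda>t. f (x(i := t))) has_real_derivative f' i x) (at (x i))"
    and f': "\<And>i. i \<in> I \<Longrightarrow> Ck_on n I S (pderiv_at i f)"
  shows "Ck_on (Suc n) I S f"
  using assms by (auto simp: real_differentiable_def)

lemma Ck_on_cong:
  assumes "finite I" "coord_open I S"
  shows "Ck_on n I S f \<Longrightarrow> (\<And>x. x \<in> S \<Longrightarrow> f x = g x) \<Longrightarrow> Ck_on n I S g"
proof (induction n arbitrary: f g)
  case 0
  then show ?case by (auto cong: continuous_on_cong)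
next
  case (Suc n)
  show ?case
  proof (rule Ck_on_SucI[OF assms])
    show "continuous_on S g" using Suc by (auto cong: continuous_on_cong)
    fix i assume i: "i \<in> I"
    have eq: "pderiv_at i f x = pderiv_at i g x" if "x \<in> S" for x
      using pderiv_at_cong[OF assms i that] Suc(3) by blast
    show "Ck_on n I S (pderiv_at i g)" using Ck_on_pderiv[OF Suc.prems(1) i] eq by (rule Suc.IH)
    fix x assume x: "x \<in> S"
    have ev: "\<forall>\<^sub>F t in nhds (x i). f (x(i := t)) = g (x(i := t))"
      using upd_eventually[OF assms i x] by (rule eventually_mono) (use Suc(3) in auto)
    show "((\<lambda>t. g (x(i := t))) has_real_derivative pderiv_at i f x) (at (x i))"
      using has_pderiv[OF Suc.prems(1) i x] DERIV_cong_ev[OF refl ev refl] by blast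
  qed
qed

text \<open>
  Allows explicit formulas \<open>f'\<close> for the partial derivatives, which agree with
  \<open>pderiv_at\<close> on \<open>S\<close> only.
\<close>

lemma Ck_on_SucI':
  assumes fin: "finite I" and S: "coord_open I S" and f: "continuous_on S f"
    and deriv: "\<And>i x. i \<in> I \<Longrightarrow> x \<in> S \<Longrightarrow> ((\<lambda>t. f (x(i := t))) has_real_derivative f' i x) (at (x i))"
    and f': "\<And>i. i \<in> I \<Longrightarrow> Ck_on n I S (f' i)"
  shows "Ck_on (Suc n) I S f"
proof (rule Ck_on_SucI[OF fin S f deriv])
  fix i assume i: "i \<in> I"
  show "Ck_on n I S (pderiv_at i f)"
    by (rule Ck_on_cong[OF fin S f'[OF i]]) (simp add: pderiv_at_def DERIV_imp_deriv[OF deriv[OF i]])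
qed auto

lemma continuous_on_local:
  fixes f :: "('i \<Rightarrow> real) \<Rightarrow> real"
  assumes fin: "finite I"
    and loc: "\<And>x. x \<in> S \<Longrightarrow> \<exists>T. x \<in> T \<and> T \<subseteq> S \<and> coord_open I T \<and> continuous_on T f"
  shows "continuous_on S f"
proof -
  have S: "S \<subseteq> coord_space I" using loc coord_open_subset by blast
  have "\<exists>d>0. \<forall>y\<in>S \<inter> cube I x d. \<bar>f y - f x\<bar> < e" if "x \<in> S" "e > 0" for x e
  proof -
    obtain T where T: "x \<in> T" "T \<subseteq> S" "coord_open I T" "continuous_on T f" using loc \<open>x \<in> S\<close> by meson
    show ?thesis using continuous_on_open_cube[OF fin T(3,4,1) \<open>e > 0\<close>] by blast
  qed
  then show ?thesis using continuous_on_cube[OF fin S] by blast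
qed

lemma Ck_on_local:
  assumes fin: "finite I"
    and loc: "\<And>x. x \<in> S \<Longrightarrow> \<exists>T. x \<in> T \<and> T \<subseteq> S \<and> coord_open I T \<and> Ck_on n I T f"
  shows "Ck_on n I S f"
  using loc
proof (induction n arbitrary: f)
  case 0
  then show ?case using continuous_on_local[OF fin, of S f] by simp
next
  case (Suc n)
  have "continuous_on S f"
    using Suc.prems Ck_on_continuous[of "Suc n" I _ f] by (intro continuous_on_local[OF fin]) blast
  moreover have "Ck_on n I S (pderiv_at i f)" if "i \<in> I" for i
    using Suc.prems that by (intro Suc.IH) (meson Ck_on_pderiv)
  moreover have "(\<lambda>t. f (x(i := t))) differentiable at (x i)" if "i \<in> I" "x \<in> S" for i x
    using Suc.prems[OF that(2)] that(1) by auto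
  ultimately show ?case by simp
qed

subsection \<open>The chain rule\<close>

lemma mvt_upd:
  assumes f: "Ck_on (Suc n) I S f" and i: "i \<in> I"
    and seg: "\<And>s. s \<in> closed_segment a b \<Longrightarrow> x(i := s) \<in> S"
  shows "\<exists>s\<in>closed_segment a b. f (x(i := b)) - f (x(i := a)) = (b - a) * pderiv_at i f (x(i := s))"
proof -
  have D: "((\<lambda>t. f (x(i := t))) has_real_derivative pderiv_at i f (x(i := s))) (at s)"
    if "s \<in> closed_segment a b" for s
    using has_pderiv_upd[OF f i seg[OF that]] .
  consider "a < b" | "a = b" | "b < a" by linarith
  then show ?thesis
  proof cases
    case 1
    then have "\<exists>z. a < z \<and> z < b \<and> f (x(i := b)) - f (x(i := a)) = (b - a) * pderiv_at i f (x(i := z))"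
      using D MVT2[of a b "\<lambda>t. f (x(i := t))" "\<lambda>s. pderiv_at i f (x(i := s))"] by (simp add: closed_segment_eq_real_ivl)
    then show ?thesis using 1 by (force simp: closed_segment_eq_real_ivl)
  next
    case 2 then show ?thesis by auto
  next
    case 3
    then have "\<exists>z. b < z \<and> z < a \<and> f (x(i := a)) - f (x(i := b)) = (a - b) * pderiv_at i f (x(i := z))"
      using D MVT2[of b a "\<lambda>t. f (x(i := t))" "\<lambda>s. pderiv_at i f (x(i := s))"] by (simp add: closed_segment_eq_real_ivl)
    then obtain z where "b < z" "z < a" "f (x(i := a)) - f (x(i := b)) = (a - b) * pderiv_at i f (x(i := z))" by blast
    then show ?thesis using 3 by (intro bexI[of _ z]) (auto simp: closed_segment_eq_real_ivl algebra_simps)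
  qed
qed

text \<open>
  Change the coordinates of \<open>x\<close> into those of \<open>y\<close> one at a time and
  apply the mean value theorem to each change. As the partial derivatives are continuous, they are
  then within \<open>e\<close> of their values at \<open>x\<close>.
\<close>

lemma total_differentiability:
  assumes fin: "finite I" and S: "coord_open I S" and f: "Ck_on (Suc n) I S f" and x: "x \<in> S" and e: "e > 0"
  shows "\<exists>d>0. \<forall>y\<in>cube I x d. y \<in> S \<and>
    \<bar>f y - f x - (\<Sum>i\<in>I. pderiv_at i f x * (y i - x i))\<bar> \<le> e * (\<Sum>i\<in>I. \<bar>y i - x i\<bar>)"
proof -
  have xc: "x \<in> coord_space I" using coord_open_subset[OF S] x by blast
  have "K \<subseteq> I \<Longrightarrow> \<exists>d>0. \<forall>y\<in>cube I x d. (\<forall>i\<in>I - K. y i = x i) \<longrightarrow> y \<in> S \<and>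
      \<bar>f y - f x - (\<Sum>i\<in>K. pderiv_at i f x * (y i - x i))\<bar> \<le> e * (\<Sum>i\<in>K. \<bar>y i - x i\<bar>)"
    if "finite K" for K
    using that
  proof (induction K)
    case empty
    have "y = x" if "y \<in> cube I x 1" "\<forall>i\<in>I. y i = x i" for y
      using that xc by (intro coord_space_eqI[of y I x]) (auto simp: cube_def)
    then have "\<forall>y\<in>cube I x 1. (\<forall>i\<in>I. y i = x i) \<longrightarrow> y \<in> S \<and> \<bar>f y - f x\<bar> \<le> 0"
      using x by force
    then show ?case by (intro exI[of _ 1]) auto
  next
    case (insert k K)
    then have k: "k \<in> I" "k \<notin> K" by auto
    obtain d1 where d1: "d1 > 0" and IH: "\<forall>y\<in>cube I x d1. (\<forall>i\<in>I - K. y i = x i) \<longrightarrow> y \<in> S \<and>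
      \<bar>f y - f x - (\<Sum>i\<in>K. pderiv_at i f x * (y i - x i))\<bar> \<le> e * (\<Sum>i\<in>K. \<bar>y i - x i\<bar>)"
      using insert by auto
    obtain d2 where d2: "d2 > 0" "\<forall>y\<in>cube I x d2. y \<in> S \<and> \<bar>pderiv_at k f y - pderiv_at k f x\<bar> < e"
      using continuous_on_open_cube[OF fin S Ck_on_continuous[OF Ck_on_pderiv[OF f k(1)]] x e] by blast
    define d where "d = min d1 d2"
    have d: "d > 0" "cube I x d \<subseteq> cube I x d1" "cube I x d \<subseteq> cube I x d2"
      using d1 d2 unfolding d_def by (auto intro!: cube_mono)
    have "y \<in> S \<and> \<bar>f y - f x - (\<Sum>i\<in>insert k K. pderiv_at i f x * (y i - x i))\<bar>
        \<le> e * (\<Sum>i\<in>insert k K. \<bar>y i - x i\<bar>)"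
      if y: "y \<in> cube I x d" and fix': "\<forall>i\<in>I - insert k K. y i = x i" for y
    proof -
      define y' where "y' = y(k := x k)"
      have "y' \<in> cube I x d" unfolding y'_def using y k d(1) by (intro cube_upd) auto
      then have y': "\<bar>f y' - f x - (\<Sum>i\<in>K. pderiv_at i f x * (y' i - x i))\<bar> \<le> e * (\<Sum>i\<in>K. \<bar>y' i - x i\<bar>)"
        using d(2) fix' k by (intro IH[rule_format, THEN conjunct2]) (auto simp: y'_def)
      have sums: "(\<Sum>i\<in>K. pderiv_at i f x * (y' i - x i)) = (\<Sum>i\<in>K. pderiv_at i f x * (y i - x i))"
        "(\<Sum>i\<in>K. \<bar>y' i - x i\<bar>) = (\<Sum>i\<in>K. \<bar>y i - x i\<bar>)"
        using k(2) by (auto simp: y'_def intro!: sum.cong)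
      have seg: "y(k := s) \<in> cube I x d" if "s \<in> closed_segment (x k) (y k)" for s
        using that y k(1) d(1) by (intro cube_upd) (auto simp: cube_def closed_segment_eq_real_ivl split: if_splits dest!: bspec[of I _ k])
      have "\<exists>s\<in>closed_segment (x k) (y k). f (y(k := y k)) - f (y(k := x k)) = (y k - x k) * pderiv_at k f (y(k := s))"
        using seg d(3) d2(2) by (intro mvt_upd[OF f k(1)]) blast
      then obtain s where s: "s \<in> closed_segment (x k) (y k)" "f y - f y' = (y k - x k) * pderiv_at k f (y(k := s))"
        by (auto simp: y'_def)
      have "\<bar>pderiv_at k f (y(k := s)) - pderiv_at k f x\<bar> \<le> e" using seg[OF s(1)] d(3) d2(2) by (auto intro: less_imp_le)
      from mult_right_mono[OF this abs_ge_zero[of "y k - x k"]]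
      have "\<bar>(y k - x k) * (pderiv_at k f (y(k := s)) - pderiv_at k f x)\<bar> \<le> e * \<bar>y k - x k\<bar>"
        by (simp add: abs_mult mult.commute)
      then have "\<bar>f y - f y' - pderiv_at k f x * (y k - x k)\<bar> \<le> e * \<bar>y k - x k\<bar>"
        by (simp add: s(2) algebra_simps)
      then have "\<bar>f y - f x - (\<Sum>i\<in>insert k K. pderiv_at i f x * (y i - x i))\<bar> \<le> e * (\<Sum>i\<in>insert k K. \<bar>y i - x i\<bar>)"
        using y' k(2) insert.hyps(1) by (simp add: sums distrib_left)
      moreover have "y \<in> S" using y d(3) d2(2) by blast
      ultimately show ?thesis by blast
    qed
    then show ?case using d(1) by blast
  qed
  from this[OF fin order_refl] show ?thesis by simp
qed

text \<open>
  The remainder in the total differential is at most an arbitrarily small multiple of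
  \<open>\<Sum>i\<in>I. \<bar>\<gamma> t i - \<gamma> t0 i\<bar>\<close>, which is of order
  \<open>t - t0\<close> because the difference quotients of \<open>\<gamma>\<close> converge.
\<close>

lemma chain_rule_curve:
  assumes fin: "finite I" and S: "coord_open I S" and f: "Ck_on (Suc n) I S f"
    and \<gamma>: "\<forall>\<^sub>F t in nhds t0. \<gamma> t \<in> coord_space I" "\<gamma> t0 \<in> S"
    and \<gamma>': "\<And>i. i \<in> I \<Longrightarrow> ((\<lambda>t. \<gamma> t i) has_real_derivative \<gamma>' i) (at t0)"
  shows "((\<lambda>t. f (\<gamma> t)) has_real_derivative (\<Sum>i\<in>I. pderiv_at i f (\<gamma> t0) * \<gamma>' i)) (at t0)"
proof -
  define x where "x = \<gamma> t0"
  define R where "R t = (f (\<gamma> t) - f x - (\<Sum>i\<in>I. pderiv_at i f x * (\<gamma> t i - x i))) / (t - t0)" for t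
  define B where "B t = (\<Sum>i\<in>I. \<bar>(\<gamma> t i - x i) / (t - t0)\<bar>)" for t
  define B0 where "B0 = (\<Sum>i\<in>I. \<bar>\<gamma>' i\<bar>)"
  have quot: "((\<lambda>t. (\<gamma> t i - x i) / (t - t0)) \<longlongrightarrow> \<gamma>' i) (at t0)" if "i \<in> I" for i
    using \<gamma>'[OF that] unfolding has_field_derivative_iff x_def .
  have B: "(B \<longlongrightarrow> B0) (at t0)" unfolding B_def B0_def using quot by (intro tendsto_intros) auto
  have B0: "B0 \<ge> 0" by (simp add: B0_def sum_nonneg)
  have R: "(R \<longlongrightarrow> 0) (at t0)"
  proof (rule tendstoI)
    fix e :: real assume e: "e > 0"
    define e' where "e' = e / (B0 + 1)"
    have e': "e' > 0" using e B0 by (simp add: e'_def)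
    obtain d where d: "d > 0" "\<forall>y\<in>cube I x d. \<bar>f y - f x - (\<Sum>i\<in>I. pderiv_at i f x * (y i - x i))\<bar> \<le> e' * (\<Sum>i\<in>I. \<bar>y i - x i\<bar>)"
      using total_differentiability[OF fin S f \<gamma>(2) e'] unfolding x_def by blast
    have "\<forall>\<^sub>F t in at t0. \<forall>i\<in>I. \<bar>\<gamma> t i - x i\<bar> < d"
    proof (intro eventually_ball_finite fin ballI)
      fix i assume "i \<in> I"
      then have "isCont (\<lambda>t. \<gamma> t i) t0" using \<gamma>' DERIV_isCont by blast
      then show "\<forall>\<^sub>F t in at t0. \<bar>\<gamma> t i - x i\<bar> < d"
        using tendstoD[OF _ d(1), of "\<lambda>t. \<gamma> t i" "\<gamma> t0 i" "at t0"]
        by (simp add: isCont_def x_def dist_real_def)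
    qed
    moreover have "\<forall>\<^sub>F t in at t0. \<gamma> t \<in> coord_space I"
      using \<gamma>(1) unfolding eventually_nhds_conv_at by blast
    moreover have "\<forall>\<^sub>F t in at t0. B t < B0 + 1"
      using B by (rule order_tendstoD) simp
    moreover have "\<forall>\<^sub>F t in at t0. t \<noteq> t0" by (simp add: eventually_at_filter)
    ultimately show "\<forall>\<^sub>F t in at t0. dist (R t) 0 < e"
    proof eventually_elim
      case (elim t)
      then have "\<gamma> t \<in> cube I x d" by (simp add: cube_def)
      then have "\<bar>R t\<bar> \<le> (e' * (\<Sum>i\<in>I. \<bar>\<gamma> t i - x i\<bar>)) / \<bar>t - t0\<bar>"
        unfolding R_def abs_divide using d(2) by (intro divide_right_mono) auto
      also have "\<dots> = e' * B t" by (simp add: B_def abs_divide flip: sum_divide_distrib)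
      also have "\<dots> < e' * (B0 + 1)" using elim e' by (intro mult_strict_left_mono) auto
      also have "\<dots> = e" using B0 by (simp add: e'_def)
      finally show ?case by simp
    qed
  qed
  have "((\<lambda>t. R t + (\<Sum>i\<in>I. pderiv_at i f x * ((\<gamma> t i - x i) / (t - t0)))) \<longlongrightarrow>
      0 + (\<Sum>i\<in>I. pderiv_at i f x * \<gamma>' i)) (at t0)"
    using quot by (intro tendsto_add R tendsto_sum tendsto_mult tendsto_const) auto
  moreover have "R t + (\<Sum>i\<in>I. pderiv_at i f x * ((\<gamma> t i - x i) / (t - t0))) = (f (\<gamma> t) - f (\<gamma> t0)) / (t - t0)" for t
  proof -
    have "(\<Sum>i\<in>I. pderiv_at i f x * ((\<gamma> t i - x i) / (t - t0))) =
        (\<Sum>i\<in>I. pderiv_at i f x * (\<gamma> t i - x i)) / (t - t0)"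
      by (simp add: sum_divide_distrib)
    then show ?thesis by (simp add: R_def x_def flip: add_divide_distrib)
  qed
  ultimately show ?thesis unfolding has_field_derivative_iff x_def by simp
qed

lemma Ck_on_const:
  assumes "finite I" "coord_open I S" shows "Ck_on n I S (\<lambda>x. c)"
proof (induction n arbitrary: c)
  case (Suc n)
  show ?case by (rule Ck_on_SucI'[OF assms, where f' = "\<lambda>_ _. 0"]) (simp_all add: Suc)
qed simp

lemma continuous_on_coordinate: "continuous_on S (\<lambda>x. x k :: real)"
  by (rule continuous_on_subset[OF continuous_on_product_coordinates]) simp

lemma Ck_on_coordinate:
  assumes "finite I" "coord_open I S" shows "Ck_on n I S (\<lambda>x. x k)"
proof (cases n)
  case 0 then show ?thesis by (simp add: continuous_on_coordinate)
next
  case (Suc m)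
  have "Ck_on (Suc m) I S (\<lambda>x. x k)"
  proof (rule Ck_on_SucI'[OF assms continuous_on_coordinate])
    fix i and x :: "'a \<Rightarrow> real"
    show "((\<lambda>t. (x(i := t)) k) has_real_derivative (if i = k then 1 else 0)) (at (x i))"
      by (auto intro!: derivative_eq_intros)
    show "Ck_on m I S (\<lambda>_. if i = k then 1 else 0)" by (rule Ck_on_const[OF assms])
  qed
  then show ?thesis using Suc by simp
qed

lemma Ck_on_add:
  assumes "finite I" "coord_open I S"
  shows "Ck_on n I S f \<Longrightarrow> Ck_on n I S g \<Longrightarrow> Ck_on n I S (\<lambda>x. f x + g x)"
proof (induction n arbitrary: f g)
  case 0 then show ?case by (auto intro: continuous_intros)
next
  case (Suc n)
  show ?case
  proof (rule Ck_on_SucI'[OF assms])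
    show "continuous_on S (\<lambda>x. f x + g x)" using Suc by (auto intro: continuous_intros)
    fix i assume i: "i \<in> I"
    show "Ck_on n I S (\<lambda>x. pderiv_at i f x + pderiv_at i g x)" using Suc i by (intro Suc.IH) auto
    fix x assume x: "x \<in> S"
    show "((\<lambda>t. f (x(i := t)) + g (x(i := t))) has_real_derivative pderiv_at i f x + pderiv_at i g x) (at (x i))"
      using has_pderiv[OF Suc.prems(1) i x] has_pderiv[OF Suc.prems(2) i x] by (rule DERIV_add)
  qed
qed

lemma Ck_on_mult:
  assumes "finite I" "coord_open I S"
  shows "Ck_on n I S f \<Longrightarrow> Ck_on n I S g \<Longrightarrow> Ck_on n I S (\<lambda>x. f x * g x)"
proof (induction n arbitrary: f g)
  case 0 then show ?case by (auto intro: continuous_intros)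
next
  case (Suc n)
  show ?case
  proof (rule Ck_on_SucI'[OF assms])
    show "continuous_on S (\<lambda>x. f x * g x)" using Suc by (auto intro: continuous_intros)
    fix i assume i: "i \<in> I"
    show "Ck_on n I S (\<lambda>x. pderiv_at i f x * g x + pderiv_at i g x * f x)"
      using Suc.prems i Ck_on_decr[OF Suc.prems(1)] Ck_on_decr[OF Suc.prems(2)]
      by (intro Ck_on_add[OF assms] Suc.IH Ck_on_pderiv)
    fix x assume x: "x \<in> S"
    show "((\<lambda>t. f (x(i := t)) * g (x(i := t))) has_real_derivative pderiv_at i f x * g x + pderiv_at i g x * f x) (at (x i))"
      using DERIV_mult[OF has_pderiv[OF Suc.prems(1) i x] has_pderiv[OF Suc.prems(2) i x]]
      by (simp only: fun_upd_triv)
  qed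
qed

lemma Ck_on_sum:
  assumes "finite I" "coord_open I S" "\<And>k. k \<in> K \<Longrightarrow> Ck_on n I S (f k)"
  shows "Ck_on n I S (\<lambda>x. \<Sum>k\<in>K. f k x)"
  using assms(3)
  by (induction K rule: infinite_finite_induct) (auto intro: Ck_on_add Ck_on_const assms)

lemma Ck_on_inverse:
  assumes "finite I" "coord_open I S" "\<And>x. x \<in> S \<Longrightarrow> f x \<noteq> 0"
  shows "Ck_on n I S f \<Longrightarrow> Ck_on n I S (\<lambda>x. inverse (f x))"
proof (induction n)
  case 0 then show ?case using assms(3) by (auto intro: continuous_intros)
next
  case (Suc n)
  have IH: "Ck_on n I S (\<lambda>x. inverse (f x))" using Suc Ck_on_decr by blast
  show ?case
  proof (rule Ck_on_SucI'[OF assms(1,2)])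
    show "continuous_on S (\<lambda>x. inverse (f x))" using Suc assms(3) by (auto intro: continuous_intros)
    fix i assume i: "i \<in> I"
    show "Ck_on n I S (\<lambda>x. (-1) * (inverse (f x) * pderiv_at i f x * inverse (f x)))"
      using Suc.prems i IH by (intro Ck_on_mult[OF assms(1,2)] Ck_on_const[OF assms(1,2)]) auto
    fix x assume x: "x \<in> S"
    show "((\<lambda>t. inverse (f (x(i := t)))) has_real_derivative (-1) * (inverse (f x) * pderiv_at i f x * inverse (f x))) (at (x i))"
      using DERIV_inverse'[OF has_pderiv[OF Suc.prems(1) i x]] assms(3)[OF x]
      by (simp only: fun_upd_triv mult_minus1 not_False_eq_True)
  qed
qed

lemma continuous_on_compose_coordinates:
  assumes "\<And>j. j \<in> J \<Longrightarrow> continuous_on S (\<lambda>x. F x j)" "F ` S \<subseteq> T" "T \<subseteq> coord_space J" "continuous_on T g"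
  shows "continuous_on S (\<lambda>x. g (F x :: 'j \<Rightarrow> real) :: real)"
proof -
  have "continuous_on S (\<lambda>x. F x j)" for j
  proof (cases "j \<in> J")
    case False
    then have "F x j = 0" if "x \<in> S" for x using assms(2,3) that by (force simp: coord_space_def)
    then show ?thesis by (simp cong: continuous_on_cong)
  qed (use assms(1) in blast)
  then have "continuous_on S F" by (rule continuous_on_coordinatewise_then_product)
  then show ?thesis using continuous_on_compose2[OF assms(4)] assms(2) by blast
qed

lemma pderiv_at_compose:
  assumes I: "finite I" "coord_open I S" and J: "finite J" "coord_open J T"
    and F: "\<And>j. j \<in> J \<Longrightarrow> Ck_on (Suc n) I S (\<lambda>x. F x j)" "F ` S \<subseteq> T"
    and g: "Ck_on (Suc m) J T g" and i: "i \<in> I" and x: "x \<in> S"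
  shows "((\<lambda>t. g (F (x(i := t)))) has_real_derivative
      (\<Sum>j\<in>J. pderiv_at j g (F x) * pderiv_at i (\<lambda>x. F x j) x)) (at (x i))"
proof -
  have "\<forall>\<^sub>F t in nhds (x i). F (x(i := t)) \<in> coord_space J"
    using upd_eventually[OF I i x] by (rule eventually_mono) (use F(2) coord_open_subset[OF J(2)] in blast)
  moreover have "F (x(i := x i)) \<in> T" using x F(2) by auto
  ultimately show ?thesis
    using chain_rule_curve[OF J g, of "\<lambda>t. F (x(i := t))" "x i" "\<lambda>j. pderiv_at i (\<lambda>x. F x j) x"]
      has_pderiv[OF F(1) i x] by simp
qed

lemma Ck_on_compose:
  assumes I: "finite I" "coord_open I S" and J: "finite J" "coord_open J T"
    and F: "F ` S \<subseteq> T"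
  shows "(\<And>j. j \<in> J \<Longrightarrow> Ck_on n I S (\<lambda>x. F x j)) \<Longrightarrow> Ck_on n J T g \<Longrightarrow> Ck_on n I S (\<lambda>x. g (F x))"
proof (induction n arbitrary: g)
  case 0
  then show ?case using continuous_on_compose_coordinates[of J S F T g] F coord_open_subset[OF J(2)] by simp
next
  case (Suc n)
  have F': "Ck_on n I S (\<lambda>x. F x j)" if "j \<in> J" for j using Suc.prems(1) that Ck_on_decr by blast
  show ?case
  proof (rule Ck_on_SucI'[OF I])
    show "continuous_on S (\<lambda>x. g (F x))"
      by (rule continuous_on_compose_coordinates[OF _ F coord_open_subset[OF J(2)]])
        (use Ck_on_continuous[OF Suc.prems(1)] Ck_on_continuous[OF Suc.prems(2)] in auto)
    fix i assume i: "i \<in> I"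
    show "Ck_on n I S (\<lambda>x. \<Sum>j\<in>J. pderiv_at j g (F x) * pderiv_at i (\<lambda>x. F x j) x)"
    proof (intro Ck_on_sum[OF I] Ck_on_mult[OF I])
      fix j assume j: "j \<in> J"
      show "Ck_on n I S (\<lambda>x. pderiv_at j g (F x))"
        using F' Ck_on_pderiv[OF Suc.prems(2) j] by (rule Suc.IH)
      show "Ck_on n I S (pderiv_at i (\<lambda>x. F x j))"
        using Suc.prems(1)[OF j] i by (rule Ck_on_pderiv)
    qed
    fix x assume "x \<in> S"
    then show "((\<lambda>t. g (F (x(i := t)))) has_real_derivative
        (\<Sum>j\<in>J. pderiv_at j g (F x) * pderiv_at i (\<lambda>x. F x j) x)) (at (x i))"
      using pderiv_at_compose[OF I J Suc.prems(1) F Suc.prems(2) i] by blast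
  qed
qed

lemma Cinf_on_open: "Cinf_on I S f \<Longrightarrow> coord_open I S"
  and Cinf_on_Ck: "Cinf_on I S f \<Longrightarrow> Ck_on n I S f"
  by (auto simp: Cinf_on_def)

lemma Cinf_on_continuous: "Cinf_on I S f \<Longrightarrow> continuous_on S f"
  using Cinf_on_Ck Ck_on_continuous by blast

lemma Cinf_on_pderiv: "Cinf_on I S f \<Longrightarrow> i \<in> I \<Longrightarrow> Cinf_on I S (pderiv_at i f)"
  by (simp add: Cinf_on_def Ck_on_pderiv del: Ck_on.simps)

lemma Cinf_on_subset: "Cinf_on I S f \<Longrightarrow> coord_open I T \<Longrightarrow> T \<subseteq> S \<Longrightarrow> Cinf_on I T f"
  by (auto simp: Cinf_on_def intro: Ck_on_subset[of _ I S])

lemma Cinf_on_cong: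
  assumes "finite I" "Cinf_on I S f" "\<And>x. x \<in> S \<Longrightarrow> f x = g x" shows "Cinf_on I S g"
  unfolding Cinf_on_def
proof (intro conjI allI)
  show S: "coord_open I S" using assms(2) by (rule Cinf_on_open)
  show "Ck_on n I S g" for n
    by (rule Ck_on_cong[OF assms(1) S Cinf_on_Ck[OF assms(2)] assms(3)])
qed

lemma Cinf_on_local:
  assumes "finite I" "\<And>x. x \<in> S \<Longrightarrow> \<exists>T. x \<in> T \<and> T \<subseteq> S \<and> Cinf_on I T f"
  shows "Cinf_on I S f"
  unfolding Cinf_on_def
proof (intro conjI allI)
  show "coord_open I S" using assms(2) unfolding Cinf_on_def by (intro coord_open_subopen) blast
  show "Ck_on n I S f" for n
    using assms(2) unfolding Cinf_on_def by (intro Ck_on_local[OF assms(1)]) blast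
qed

lemma Cinf_on_const: "finite I \<Longrightarrow> coord_open I S \<Longrightarrow> Cinf_on I S (\<lambda>x. c)"
  by (simp add: Cinf_on_def Ck_on_const)

lemma Cinf_on_coordinate: "finite I \<Longrightarrow> coord_open I S \<Longrightarrow> Cinf_on I S (\<lambda>x. x k)"
  by (simp add: Cinf_on_def Ck_on_coordinate)

lemma Cinf_on_add: "finite I \<Longrightarrow> Cinf_on I S f \<Longrightarrow> Cinf_on I S g \<Longrightarrow> Cinf_on I S (\<lambda>x. f x + g x)"
  by (simp add: Cinf_on_def Ck_on_add)

lemma Cinf_on_mult: "finite I \<Longrightarrow> Cinf_on I S f \<Longrightarrow> Cinf_on I S g \<Longrightarrow> Cinf_on I S (\<lambda>x. f x * g x)"
  by (simp add: Cinf_on_def Ck_on_mult)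

lemma Cinf_on_compose:
  assumes I: "finite I" "coord_open I S" and J: "finite J" and F: "F ` S \<subseteq> T"
    and "\<And>j. j \<in> J \<Longrightarrow> Cinf_on I S (\<lambda>x. F x j)" and g: "Cinf_on J T g"
  shows "Cinf_on I S (\<lambda>x. g (F x))"
  unfolding Cinf_on_def
proof (intro conjI allI I(2))
  show "Ck_on n I S (\<lambda>x. g (F x))" for n
    by (rule Ck_on_compose[OF I J Cinf_on_open[OF g] F Cinf_on_Ck[OF assms(5)] Cinf_on_Ck[OF g]])
qed

lemma pderiv_at_coordinate: "pderiv_at i (\<lambda>x. x k) x = (if i = k then 1 else 0)"
proof -
  have "((\<lambda>t. (x(i := t)) k) has_real_derivative (if i = k then 1 else 0)) (at (x i))"
    by (auto intro!: derivative_eq_intros)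
  then show ?thesis unfolding pderiv_at_def by (rule DERIV_imp_deriv)
qed

lemma Cinf_has_pderiv:
  assumes "Cinf_on I S f" "i \<in> I" "x \<in> S"
  shows "((\<lambda>t. f (x(i := t))) has_real_derivative pderiv_at i f x) (at (x i))"
  using has_pderiv[OF Cinf_on_Ck[OF assms(1)] assms(2,3)] .

lemma pderiv_at_eqI:
  "((\<lambda>t. f (x(i := t))) has_real_derivative D) (at (x i)) \<Longrightarrow> pderiv_at i f x = D"
  unfolding pderiv_at_def by (rule DERIV_imp_deriv)

lemma pderiv_at_comp:
  assumes I: "finite I" "coord_open I S" and J: "finite J" and F: "F ` S \<subseteq> T"
    and Fj: "\<And>j. j \<in> J \<Longrightarrow> Cinf_on I S (\<lambda>x. F x j)" and g: "Cinf_on J T g" and i: "i \<in> I" and x: "x \<in> S"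
  shows "pderiv_at i (\<lambda>x. g (F x)) x = (\<Sum>j\<in>J. pderiv_at j g (F x) * pderiv_at i (\<lambda>x. F x j) x)"
  by (rule pderiv_at_eqI, rule pderiv_at_compose[OF I J Cinf_on_open[OF g] Cinf_on_Ck[OF Fj] F Cinf_on_Ck[OF g] i x])

lemma pderiv_at_mult:
  assumes "Cinf_on I S f" "Cinf_on I S g" "i \<in> I" "x \<in> S"
  shows "pderiv_at i (\<lambda>x. f x * g x) x = pderiv_at i f x * g x + f x * pderiv_at i g x"
  using DERIV_mult[OF Cinf_has_pderiv[OF assms(1,3,4)] Cinf_has_pderiv[OF assms(2,3,4)]]
  by (intro pderiv_at_eqI) (simp only: fun_upd_triv mult.commute)

lemma pderiv_at_lincomb:
  assumes "Cinf_on I S f" "Cinf_on I S g" "i \<in> I" "x \<in> S"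
  shows "pderiv_at i (\<lambda>x. a * f x + b * g x) x = a * pderiv_at i f x + b * pderiv_at i g x"
  by (intro pderiv_at_eqI DERIV_add DERIV_cmult Cinf_has_pderiv[OF assms(1,3,4)] Cinf_has_pderiv[OF assms(2,3,4)])

lemma coord_open_vimage:
  assumes I: "coord_open I S" and F: "\<And>j. j \<in> J \<Longrightarrow> continuous_on S (\<lambda>x. F x j)"
    "F ` S \<subseteq> coord_space J" and T: "coord_open J T"
  shows "coord_open I {x \<in> S. F x \<in> T}"
proof -
  have "continuous_on S (\<lambda>x. F x j)" for j
  proof (cases "j \<in> J")
    case False
    then have "F x j = 0" if "x \<in> S" for x using F(2) that by (force simp: coord_space_def)
    then show ?thesis by (simp cong: continuous_on_cong)
  qed (use F(1) in blast)
  then have "continuous_on S F" by (rule continuous_on_coordinatewise_then_product)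
  then have "openin (top_of_set S) (S \<inter> F -` T)"
    using continuous_openin_preimage[of S F "coord_space J" T] F(2) T by (auto simp: coord_open_def)
  then have "openin (top_of_set (coord_space I)) (S \<inter> F -` T)"
    using I openin_trans unfolding coord_open_def by blast
  moreover have "S \<inter> F -` T = {x \<in> S. F x \<in> T}" by auto
  ultimately show ?thesis by (simp add: coord_open_def)
qed

lemma coord_open_space: "coord_open I (coord_space I)"
  by (simp add: coord_open_def)

lemma coord_open_Collect_less:
  fixes f g :: "('i \<Rightarrow> real) \<Rightarrow> real"
  assumes I: "coord_open I S" and f: "continuous_on S f" and g: "continuous_on S g"
  shows "coord_open I {x \<in> S. f x < g x}"
proof -
  have "continuous_on S (\<lambda>x. g x - f x)" using f g by (intro continuous_intros)
  then have "openin (top_of_set S) (S \<inter> (\<lambda>x. g x - f x) -` {0<..})"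
    by (intro continuous_openin_preimage_gen) auto
  then have "openin (top_of_set (coord_space I)) (S \<inter> (\<lambda>x. g x - f x) -` {0<..})"
    using I openin_trans unfolding coord_open_def by blast
  moreover have "S \<inter> (\<lambda>x. g x - f x) -` {0<..} = {x \<in> S. f x < g x}" by auto
  ultimately show ?thesis by (simp add: coord_open_def)
qed

subsection \<open>Symmetry of second derivatives\<close>

text \<open>
  The mean value theorem in \<open>x\<^sub>i\<close>, for the difference in
  \<open>x\<^sub>j\<close>, and then in \<open>x\<^sub>j\<close>. The left-hand side is symmetric
  in \<open>i\<close> and \<open>j\<close>.
\<close>

lemma mixed_difference:
  assumes f: "Ck_on (Suc (Suc n)) I S f" and ij: "i \<in> I" "j \<in> I" "i \<noteq> j" and h: "0 < h"
    and sq: "\<And>s t. s \<in> {0..h} \<Longrightarrow> t \<in> {0..h} \<Longrightarrow> x(i := x i + s, j := x j + t) \<in> S"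
  shows "\<exists>s\<in>{0..h}. \<exists>t\<in>{0..h}.
    f (x(i := x i + h, j := x j + h)) - f (x(i := x i + h)) - f (x(j := x j + h)) + f x =
      h * h * pderiv_at j (pderiv_at i f) (x(i := x i + s, j := x j + t))"
proof -
  define g where "g s = f (x(j := x j + h, i := s)) - f (x(i := s))" for s
  have in1: "x(j := x j + h, i := s) \<in> S" and in2: "x(i := s) \<in> S" if "s \<in> {x i..x i + h}" for s
  proof -
    show "x(j := x j + h, i := s) \<in> S"
      using sq[of "s - x i" h] that h ij(3) fun_upd_twist[of i j x] by auto
    show "x(i := s) \<in> S" using sq[of "s - x i" 0] that h ij(3) by (simp add: fun_upd_idem)
  qed
  have "\<exists>z. x i < z \<and> z < x i + h \<and> g (x i + h) - g (x i) =
      (x i + h - x i) * (pderiv_at i f (x(j := x j + h, i := z)) - pderiv_at i f (x(i := z)))"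
    unfolding g_def using h
    by (intro MVT2 DERIV_diff has_pderiv_upd[OF f ij(1)] in1 in2) auto
  then obtain s where s: "x i < s" "s < x i + h" and gs: "g (x i + h) - g (x i) =
      h * (pderiv_at i f (x(j := x j + h, i := s)) - pderiv_at i f (x(i := s)))" by auto
  have "\<exists>t\<in>closed_segment (x j) (x j + h). pderiv_at i f ((x(i := s))(j := x j + h)) - pderiv_at i f ((x(i := s))(j := x j)) =
      (x j + h - x j) * pderiv_at j (pderiv_at i f) ((x(i := s))(j := t))"
  proof (rule mvt_upd[OF Ck_on_pderiv[OF f ij(1)] ij(2)])
    fix t assume "t \<in> closed_segment (x j) (x j + h)"
    then show "x(i := s, j := t) \<in> S"
      using sq[of "s - x i" "t - x j"] s h by (auto simp: closed_segment_eq_real_ivl)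
  qed
  then obtain t where t: "t \<in> {x j..x j + h}" and
    "pderiv_at i f (x(i := s, j := x j + h)) - pderiv_at i f (x(i := s)) = h * pderiv_at j (pderiv_at i f) (x(i := s, j := t))"
    using h ij(3) by (auto simp: closed_segment_eq_real_ivl fun_upd_idem)
  then have "g (x i + h) - g (x i) = h * h * pderiv_at j (pderiv_at i f) (x(i := s, j := t))"
    using gs fun_upd_twist[OF ij(3), of x s "x j + h"] by simp
  then show ?thesis
    using s t ij(3) fun_upd_twist[OF ij(3), of x "x i + h" "x j + h"]
    by (intro bexI[of _ "s - x i"] bexI[of _ "t - x j"]) (auto simp: g_def fun_upd_idem)
qed

text \<open>
  Both mixed derivatives are limits of the same second difference quotient, by
  \<open>mixed_difference\<close> and continuity.
\<close>

lemma pderiv_at_commute: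
  assumes fin: "finite I" and S: "coord_open I S" and f: "Ck_on (Suc (Suc n)) I S f"
    and ij: "i \<in> I" "j \<in> I" and x: "x \<in> S"
  shows "pderiv_at i (pderiv_at j f) x = pderiv_at j (pderiv_at i f) x"
proof (cases "i = j")
  case False
  let ?P = "pderiv_at i (pderiv_at j f)" and ?Q = "pderiv_at j (pderiv_at i f)"
  have xc: "x \<in> coord_space I" using x coord_open_subset[OF S] by blast
  have cont: "continuous_on S ?P" "continuous_on S ?Q"
    using Ck_on_continuous[OF Ck_on_pderiv[OF Ck_on_pderiv[OF f]]] ij by blast+
  have "\<bar>?P x - ?Q x\<bar> \<le> 2 * e" if e: "e > 0" for e
  proof -
    obtain d1 where d1: "d1 > 0" "\<forall>y\<in>cube I x d1. y \<in> S \<and> \<bar>?P y - ?P x\<bar> < e"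
      using continuous_on_open_cube[OF fin S cont(1) x e] by blast
    obtain d2 where d2: "d2 > 0" "\<forall>y\<in>cube I x d2. y \<in> S \<and> \<bar>?Q y - ?Q x\<bar> < e"
      using continuous_on_open_cube[OF fin S cont(2) x e] by blast
    define h where "h = min d1 d2 / 2"
    have h: "h > 0" "h < d1" "h < d2" using d1(1) d2(1) by (auto simp: h_def min_def)
    have sq: "x(i := x i + s, j := x j + t) \<in> cube I x d1 \<inter> cube I x d2" if "s \<in> {0..h}" "t \<in> {0..h}" for s t
      using that h xc ij False by (auto simp: cube_def coord_space_def)
    obtain s t where st: "s \<in> {0..h}" "t \<in> {0..h}" "f (x(i := x i + h, j := x j + h)) - f (x(i := x i + h)) - f (x(j := x j + h)) + f x =
      h * h * ?Q (x(i := x i + s, j := x j + t))"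
      using mixed_difference[OF f ij False h(1)] sq d1(2) by (metis (no_types, lifting) IntE)
    have sq': "x(j := x j + s, i := x i + t) \<in> S" if "s \<in> {0..h}" "t \<in> {0..h}" for s t
      using sq[OF that(2,1)] d1(2) fun_upd_twist[OF False, of x "x i + t" "x j + s"] by auto
    obtain s' t' where st': "s' \<in> {0..h}" "t' \<in> {0..h}" "f (x(j := x j + h, i := x i + h)) - f (x(j := x j + h)) - f (x(i := x i + h)) + f x =
      h * h * ?P (x(j := x j + s', i := x i + t'))"
      using mixed_difference[OF f ij(2,1) False[symmetric] h(1) sq'] by blast
    have "h * h * ?Q (x(i := x i + s, j := x j + t)) = h * h * ?P (x(i := x i + t', j := x j + s'))"
      using st(3) st'(3) unfolding fun_upd_twist[OF False, of x] by linarith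
    then have "?Q (x(i := x i + s, j := x j + t)) = ?P (x(i := x i + t', j := x j + s'))" using h by simp
    moreover have "\<bar>?Q (x(i := x i + s, j := x j + t)) - ?Q x\<bar> < e" using sq[OF st(1,2)] d2(2) by blast
    moreover have "\<bar>?P (x(i := x i + t', j := x j + s')) - ?P x\<bar> < e" using sq[OF st'(2,1)] d1(2) by blast
    ultimately show ?thesis by linarith
  qed
  from this[of "\<bar>?P x - ?Q x\<bar> / 4"] show ?thesis by (cases "?P x = ?Q x") auto
qed simp

subsection \<open>Hadamard's lemma in one coordinate\<close>

text \<open>
  Differentiation under the integral sign. The weight \<open>t ^ m\<close> makes the statement
  inductive: each derivative along \<open>k\<close> contributes a factor \<open>t\<close>.
\<close>

lemma Ck_on_segment_integral:
  fixes h :: "('i \<Rightarrow> real) \<Rightarrow> real"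
  assumes fin: "finite I" and S: "coord_open I S" and k: "k \<in> I"
    and seg: "\<And>x t. x \<in> S \<Longrightarrow> t \<in> {0..1} \<Longrightarrow> x(k := c + t * (x k - c)) \<in> S"
  shows "Ck_on n I S h \<Longrightarrow> Ck_on n I S (\<lambda>x. integral (cbox 0 1) (\<lambda>t. t ^ m * h (x(k := c + t * (x k - c)))))"
proof (induction n arbitrary: h m)
  have jc: "continuous_on (S \<times> cbox 0 1) (\<lambda>(x, t). t ^ m * h (x(k := c + t * (x k - c))))"
    if h: "continuous_on S h" for h :: "('i \<Rightarrow> real) \<Rightarrow> real" and m :: nat
  proof -
    have coord: "continuous_on A (\<lambda>p::('i \<Rightarrow> real) \<times> real. fst p i)" for A i
      by (rule continuous_on_compose2[OF continuous_on_coordinate, of _ fst UNIV]) (auto intro: continuous_intros)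
    have "continuous_on (S \<times> cbox 0 1) (\<lambda>p. (fst p)(k := c + snd p * (fst p k - c)))"
    proof (rule continuous_on_coordinatewise_then_product)
      fix i
      have "continuous_on (S \<times> cbox 0 1) (\<lambda>p. c + snd p * (fst p k - c))"
        by (intro continuous_intros coord)
      then show "continuous_on (S \<times> cbox 0 1) (\<lambda>p. ((fst p)(k := c + snd p * (fst p k - c))) i)"
        using coord by (cases "i = k") simp_all
    qed
    then have "continuous_on (S \<times> cbox 0 1) (\<lambda>p. h ((fst p)(k := c + snd p * (fst p k - c))))"
      by (rule continuous_on_compose2[OF h]) (use seg in auto)
    then show ?thesis by (simp add: case_prod_unfold) (intro continuous_intros; simp)
  qed
  have cont: "continuous_on S (\<lambda>x. integral (cbox 0 1) (\<lambda>t. t ^ m * h (x(k := c + t * (x k - c)))))"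
    if h: "continuous_on S h" for h :: "('i \<Rightarrow> real) \<Rightarrow> real" and m :: nat
    by (rule integral_continuous_on_param[OF jc[OF h]])
  {
    case 0
    then show ?case unfolding Ck_on.simps(1) by (rule cont)
  next
    case (Suc n)
    show ?case
    proof (rule Ck_on_SucI'[OF fin S cont[OF Ck_on_continuous[OF Suc.prems]]])
      fix j assume j: "j \<in> I"
      let ?m = "if j = k then Suc m else m"
      show "Ck_on n I S (\<lambda>x. integral (cbox 0 1) (\<lambda>t. t ^ ?m * pderiv_at j h (x(k := c + t * (x k - c)))))"
        by (rule Suc.IH[OF Ck_on_pderiv[OF Suc.prems j]])
      fix x assume x: "x \<in> S"
      obtain e where e: "e > 0" "cube I x e \<subseteq> S" using coord_open_iff[OF fin] S x by blast
      define U where "U = {x j - e<..<x j + e}"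
      have U: "x(j := s) \<in> S" if "s \<in> U" for s
      proof -
        have "x(j := s) \<in> cube I x e"
          using that e(1) x coord_open_subset[OF S] j by (intro cube_upd cube_center) (auto simp: U_def)
        then show ?thesis using e(2) by blast
      qed
      let ?F = "\<lambda>h m s t. t ^ m * h ((x(j := s))(k := c + t * ((x(j := s)) k - c))) :: real"
      have FC: "continuous_on (U \<times> cbox 0 1) (\<lambda>(s, t). ?F g m s t)" if g: "continuous_on S g" for g m
      proof -
        have "continuous_on (U \<times> cbox 0 1) (\<lambda>p::real \<times> real. x(j := fst p))"
        proof (rule continuous_on_coordinatewise_then_product)
          show "continuous_on (U \<times> cbox 0 1) (\<lambda>p::real \<times> real. (x(j := fst p)) i)" for i
            by (cases "i = j") (simp_all add: continuous_on_fst continuous_on_id)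
        qed
        then have "continuous_on (U \<times> cbox 0 1) (\<lambda>p::real \<times> real. (x(j := fst p), snd p))"
          by (intro continuous_on_Pair continuous_on_snd continuous_on_id)
        then have "continuous_on (U \<times> cbox 0 1) (\<lambda>p. (\<lambda>(x, t). t ^ m * g (x(k := c + t * (x k - c)))) (x(j := fst p), snd p))"
          by (rule continuous_on_compose2[OF jc[OF g]]) (use U in auto)
        then show ?thesis by (simp add: case_prod_unfold)
      qed
      have D: "((\<lambda>s. ?F h m s t) has_real_derivative ?F (pderiv_at j h) ?m s t) (at s within U)"
        if s: "s \<in> U" and t: "t \<in> cbox 0 1" for s t
      proof (cases "j = k")
        case True
        have in_S: "x(k := c + t * (s - c)) \<in> S" using seg[OF U[OF s], of t] t True by simp
        have "((\<lambda>s. c + t * (s - c)) has_real_derivative t) (at s)"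
          by (auto intro!: derivative_eq_intros)
        from DERIV_chain2[OF has_pderiv_upd[OF Suc.prems k in_S] this]
        have "((\<lambda>s. t ^ m * h (x(k := c + t * (s - c)))) has_real_derivative
            t ^ m * (pderiv_at k h (x(k := c + t * (s - c))) * t)) (at s)"
          by (rule DERIV_cmult)
        then show ?thesis using True by (auto intro: has_field_derivative_at_within simp: mult_ac)
      next
        case False
        have tw: "(x(j := s))(k := v) = (x(k := v))(j := s)" for s v using False by (rule fun_upd_twist)
        have in_S: "x(k := c + t * (x k - c), j := s) \<in> S" using seg[OF U[OF s], of t] t False by (simp add: tw)
        have "((\<lambda>s. t ^ m * h (x(k := c + t * (x k - c), j := s))) has_real_derivative
            t ^ m * pderiv_at j h (x(k := c + t * (x k - c), j := s))) (at s)"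
          by (rule DERIV_cmult[OF has_pderiv_upd[OF Suc.prems j in_S]])
        then show ?thesis using False by (auto intro: has_field_derivative_at_within simp: tw)
      qed
      have int: "?F h m s integrable_on cbox 0 1" if "s \<in> U" for s
      proof (rule integrable_continuous)
        have "continuous_on (cbox 0 1) (\<lambda>t. (s, t))" by (intro continuous_intros)
        then have "continuous_on (cbox 0 1) (\<lambda>t. (\<lambda>(s, t). ?F h m s t) (s, t))"
          by (rule continuous_on_compose2[OF FC[OF Ck_on_continuous[OF Suc.prems]]]) (use that in auto)
        then show "continuous_on (cbox 0 1) (?F h m s)" by (simp only: prod.case)
      qed
      have "((\<lambda>s. integral (cbox 0 1) (?F h m s)) has_real_derivative
          integral (cbox 0 1) (?F (pderiv_at j h) ?m (x j))) (at (x j) within U)"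
        by (rule leibniz_rule_field_derivative[OF D int FC[OF Ck_on_continuous[OF Ck_on_pderiv[OF Suc.prems j]]]])
          (use e(1) in \<open>auto simp: U_def\<close>)
      moreover have "at (x j) within U = at (x j)" using e(1) by (intro at_within_open) (auto simp: U_def)
      ultimately show "((\<lambda>s. integral (cbox 0 1) (\<lambda>t. t ^ m * h ((x(j := s))(k := c + t * ((x(j := s)) k - c))))) has_real_derivative
          integral (cbox 0 1) (\<lambda>t. t ^ ?m * pderiv_at j h (x(k := c + t * (x k - c))))) (at (x j))"
        by simp
    qed
  }
qed

text \<open>
  \<open>g x\<close> is the mean value of \<open>pderiv_at k f\<close> on the segment from
  \<open>x(k := c)\<close> to \<open>x\<close>.
\<close>

lemma hadamard_coordinate:
  assumes fin: "finite I" and f: "Cinf_on I S f" and k: "k \<in> I"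
    and seg: "\<And>x t. x \<in> S \<Longrightarrow> t \<in> {0..1} \<Longrightarrow> x(k := c + t * (x k - c)) \<in> S"
  obtains g where "Cinf_on I S g" "\<And>x. x \<in> S \<Longrightarrow> f x = f (x(k := c)) + (x k - c) * g x"
    "\<And>x. x \<in> S \<Longrightarrow> x k = c \<Longrightarrow> g x = pderiv_at k f x"
proof
  have S: "coord_open I S" using f by (rule Cinf_on_open)
  define g where "g x = integral (cbox 0 1) (\<lambda>t. t ^ 0 * pderiv_at k f (x(k := c + t * (x k - c))))" for x
  show "Cinf_on I S g"
    unfolding Cinf_on_def g_def using S Ck_on_segment_integral[OF fin S k seg] Cinf_on_Ck[OF Cinf_on_pderiv[OF f k]]
    by blast
  fix x assume x: "x \<in> S"
  show "g x = pderiv_at k f x" if "x k = c" using that by (simp add: g_def fun_upd_idem)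
  have "((\<lambda>t. f (x(k := c + t * (x k - c)))) has_vector_derivative
      pderiv_at k f (x(k := c + t * (x k - c))) * (x k - c)) (at t within {0..1})" if "t \<in> {0..1}" for t
  proof -
    have "((\<lambda>t. c + t * (x k - c)) has_real_derivative (x k - c)) (at t)"
      by (auto intro!: derivative_eq_intros)
    from DERIV_chain2[OF has_pderiv_upd[OF Cinf_on_Ck[OF f] k seg[OF x that]] this]
    show ?thesis
      by (simp add: has_real_derivative_iff_has_vector_derivative has_vector_derivative_at_within)
  qed
  then have "((\<lambda>t. pderiv_at k f (x(k := c + t * (x k - c))) * (x k - c)) has_integral
      f (x(k := c + 1 * (x k - c))) - f (x(k := c + 0 * (x k - c)))) {0..1}"
    by (rule fundamental_theorem_of_calculus[OF zero_le_one])
  then have "integral {0..1} (\<lambda>t. pderiv_at k f (x(k := c + t * (x k - c))) * (x k - c)) =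
      f (x(k := c + 1 * (x k - c))) - f (x(k := c + 0 * (x k - c)))"
    by (rule integral_unique)
  then have "g x * (x k - c) = f x - f (x(k := c))" by (simp add: g_def)
  then show "f x = f (x(k := c)) + (x k - c) * g x" by (simp add: algebra_simps)
qed

subsection \<open>Straightening a submersion\<close>

text \<open>
  The one-variable implicit function theorem with parameters, solving \<open>G z = y\<close> for the coordinate
  \<open>z\<^sub>i\<close>. Since the \<open>i\<close>-th slot of the argument of \<open>h\<close> is then free, it is used for the value \<open>y\<close>,
  so that \<open>z \<mapsto> z(i := h z)\<close> is a local inverse of \<open>z \<mapsto> z(i := G z)\<close>.
\<close>

lemma local_coordinate_replacement:
  assumes fin: "finite I" and G: "Cinf_on I S G" and z0: "z0 \<in> S" and i: "i \<in> I"
    and nz: "pderiv_at i G z0 \<noteq> 0"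
  obtains T h where "coord_open I T" "z0(i := G z0) \<in> T" "Cinf_on I T h" "h (z0(i := G z0)) = z0 i"
    "\<And>z. z \<in> T \<Longrightarrow> z(i := h z) \<in> S" "\<And>z. z \<in> T \<Longrightarrow> G (z(i := h z)) = z i"
    "pderiv_at i h (z0(i := G z0)) \<noteq> 0"
proof -
  \<comment> \<open>\<open>c * G\<close> is increasing in the \<open>i\<close>-th coordinate near \<open>z0\<close>\<close>
  define c where "c = sgn (pderiv_at i G z0)"
  have S: "coord_open I S" and contG: "continuous_on S G" using G Cinf_on_open Cinf_on_continuous by blast+
  have cc: "c * c = 1" using nz by (simp add: c_def sgn_if)
  have S_sub: "S \<subseteq> coord_space I" by (rule coord_open_subset[OF S])
  obtain d where d: "d > 0" "\<forall>y\<in>cube I z0 d. y \<in> S \<and> \<bar>pderiv_at i G y - pderiv_at i G z0\<bar> < \<bar>pderiv_at i G z0\<bar>"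
    using continuous_on_open_cube[OF fin S Cinf_on_continuous[OF Cinf_on_pderiv[OF G i]] z0, of "\<bar>pderiv_at i G z0\<bar>"] nz by auto
  have pos: "c * pderiv_at i G y > 0" if "y \<in> cube I z0 d" for y
    using d(2) that by (auto simp: c_def sgn_if abs_if split: if_splits dest!: bspec[of _ _ y])
  define a where "a = z0 i"
  define Z where "Z = {z \<in> coord_space I. z(i := a) \<in> cube I z0 d}"
  have Zupd: "z(i := t) \<in> cube I z0 d" if "z \<in> Z" "\<bar>t - a\<bar> < d" for z t
    using cube_upd[of "z(i := a)" I z0 d i t] that i by (simp add: Z_def a_def)
  have mono: "c * G (z(i := s)) < c * G (z(i := t))" if "z \<in> Z" "\<bar>s - a\<bar> < d" "\<bar>t - a\<bar> < d" "s < t" for z s t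
  proof -
    have seg: "z(i := u) \<in> cube I z0 d" if "u \<in> closed_segment s t" for u
      using that \<open>s < t\<close> \<open>\<bar>s - a\<bar> < d\<close> \<open>\<bar>t - a\<bar> < d\<close> by (intro Zupd \<open>z \<in> Z\<close>) (auto simp: closed_segment_eq_real_ivl)
    have "\<exists>u\<in>closed_segment s t. G (z(i := t)) - G (z(i := s)) = (t - s) * pderiv_at i G (z(i := u))"
      by (rule mvt_upd[OF Cinf_on_Ck[OF G] i]) (use seg d(2) in blast)
    then obtain u where u: "u \<in> closed_segment s t" "G (z(i := t)) - G (z(i := s)) = (t - s) * pderiv_at i G (z(i := u))" by blast
    have "c * (G (z(i := t)) - G (z(i := s))) = (t - s) * (c * pderiv_at i G (z(i := u)))"
      by (simp add: u(2))
    also have "\<dots> > 0" using pos[OF seg[OF u(1)]] \<open>s < t\<close> by simp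
    finally show ?thesis by (simp add: algebra_simps)
  qed
  have upd_space: "(\<lambda>z. z(i := s)) ` coord_space I \<subseteq> coord_space I" for s
    using i by (auto simp: coord_space_upd)
  have upd_cont: "continuous_on A (\<lambda>z. (z(i := s)) j)" for A :: "(_ \<Rightarrow> real) set" and s j
    by (cases "i = j") (simp_all add: continuous_on_coordinate)
  have Z_open: "coord_open I Z"
    unfolding Z_def using upd_cont upd_space by (intro coord_open_vimage[OF coord_open_space _ _ coord_open_cube[OF fin]])
  have Gcont: "continuous_on Z (\<lambda>z. c * G (z(i := s)))" if "\<bar>s - a\<bar> < d" for s
    by (intro continuous_on_mult continuous_on_const
      continuous_on_compose_coordinates[of I Z "\<lambda>z. z(i := s)" S G, OF upd_cont _ S_sub contG])
      (use Zupd that d(2) in blast)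
  define \<delta> where "\<delta> = d / 2"
  have \<delta>: "\<delta> > 0" "\<delta> < d" using d(1) by (auto simp: \<delta>_def)
  have ci: "continuous_on A (\<lambda>z. c * z i)" for A by (intro continuous_intros continuous_on_coordinate)
  \<comment> \<open>The \<open>z\<close> for which \<open>G (z(i := t')) = z i\<close> has its solution \<open>t'\<close> between \<open>s\<close> and \<open>t\<close>; that these sets are open gives continuity of \<open>h\<close>.\<close>
  define between where "between s t = {z \<in> Z. c * G (z(i := s)) < c * z i} \<inter> {z \<in> Z. c * z i < c * G (z(i := t))}" for s t
  have between_open: "coord_open I (between s t)" if "\<bar>s - a\<bar> < d" "\<bar>t - a\<bar> < d" for s t
    unfolding between_def using that
    by (intro coord_open_Int coord_open_Collect_less[OF Z_open] Gcont ci)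
  define T where "T = between (a - \<delta>) (a + \<delta>)"
  have T_open: "coord_open I T" unfolding T_def by (rule between_open) (use \<delta> in auto)
  have T_Z: "T \<subseteq> Z" by (auto simp: T_def between_def)
  have T_space: "T \<subseteq> coord_space I" using T_Z by (auto simp: Z_def)
  have ex: "\<exists>t. s1 < t \<and> t < s2 \<and> G (z(i := t)) = z i"
    if z: "z \<in> between s1 s2" and s: "\<bar>s1 - a\<bar> < d" "\<bar>s2 - a\<bar> < d" "s1 < s2" for z s1 s2
  proof -
    have zZ: "z \<in> Z" using z by (simp add: between_def)
    have "continuous_on {s1..s2} (\<lambda>t. c * G (z(i := t)))"
    proof (intro continuous_on_mult continuous_on_const continuous_on_compose2[OF contG])
      show "continuous_on {s1..s2} (\<lambda>t. z(i := t))"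
      proof (rule continuous_on_coordinatewise_then_product)
        show "continuous_on {s1..s2} (\<lambda>t. (z(i := t)) j)" for j
          by (cases "i = j") (simp_all add: continuous_on_id)
      qed
      show "(\<lambda>t. z(i := t)) ` {s1..s2} \<subseteq> S" using Zupd[OF zZ] s d(2) by fastforce
    qed
    moreover have "c * G (z(i := s1)) < c * z i" "c * z i < c * G (z(i := s2))" using z by (auto simp: between_def)
    ultimately obtain t where t: "s1 \<le> t" "t \<le> s2" "c * G (z(i := t)) = c * z i"
      using IVT'[of "\<lambda>t. c * G (z(i := t))" s1 "c * z i" s2] s(3) by force
    have "t \<noteq> s1" "t \<noteq> s2" using t(3) z by (auto simp: between_def)
    moreover have "G (z(i := t)) = z i" using t(3) nz by (simp add: c_def sgn_if split: if_splits)
    ultimately show ?thesis using t(1,2) by (intro exI[of _ t]) auto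
  qed
  have uniq: "s = t" if "z \<in> Z" "\<bar>s - a\<bar> < d" "\<bar>t - a\<bar> < d" "G (z(i := s)) = G (z(i := t))" for z s t
    using mono[OF that(1-3)] mono[OF that(1) that(3,2)] that(4) by (cases s t rule: linorder_cases) auto
  define h where "h z = (THE t. \<bar>t - a\<bar> < d \<and> G (z(i := t)) = z i)" for z
  have hI: "h z = t" if "z \<in> Z" "\<bar>t - a\<bar> < d" "G (z(i := t)) = z i" for z t
    unfolding h_def by (rule the_equality) (use that uniq[OF that(1)] in auto)
  have hT: "\<bar>h z - a\<bar> < \<delta>" "G (z(i := h z)) = z i" if z: "z \<in> T" for z
  proof -
    obtain t where t: "a - \<delta> < t" "t < a + \<delta>" "G (z(i := t)) = z i"
      using ex[of z "a - \<delta>" "a + \<delta>"] z \<delta> by (auto simp: T_def)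
    then have "h z = t" using z T_Z \<delta> by (intro hI) auto
    then show "\<bar>h z - a\<bar> < \<delta>" "G (z(i := h z)) = z i" using t by auto
  qed
  have h_cube: "z(i := h z) \<in> cube I z0 d" if "z \<in> T" for z
    using hT(1)[OF that] \<delta> T_Z that by (intro Zupd) auto
  then have hS: "z(i := h z) \<in> S" if "z \<in> T" for z using d(2) that by blast
  have h_cont_at: "\<exists>e'>0. \<forall>w\<in>T \<inter> cube I z e'. \<bar>h w - h z\<bar> < e" if z: "z \<in> T" and e: "e > 0" for z e
  proof -
    define r where "r = min (e / 2) ((\<delta> - \<bar>h z - a\<bar>) / 2)"
    have r': "r > 0" "2 * r \<le> e" "2 * r \<le> \<delta> - \<bar>h z - a\<bar>"
      using e hT(1)[OF z] by (auto simp: r_def min_def)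
    have r: "r > 0" "r < e" "\<bar>h z - r - a\<bar> < d" "\<bar>h z + r - a\<bar> < d"
      using r' \<delta> by linarith+
    have "z \<in> between (h z - r) (h z + r)"
    proof -
      have "c * G (z(i := h z - r)) < c * G (z(i := h z))" "c * G (z(i := h z)) < c * G (z(i := h z + r))"
        using r hT(1)[OF z] \<delta> z T_Z by (auto intro!: mono)
      then show ?thesis using hT(2)[OF z] z T_Z by (auto simp: between_def)
    qed
    then obtain e' where e': "e' > 0" "cube I z e' \<subseteq> between (h z - r) (h z + r)"
      using between_open[OF r(3,4)] coord_open_iff[OF fin] by blast
    have "\<bar>h w - h z\<bar> < e" if w: "w \<in> T \<inter> cube I z e'" for w
    proof -
      obtain t where t: "h z - r < t" "t < h z + r" "G (w(i := t)) = w i"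
        using ex[of w "h z - r" "h z + r"] w e'(2) r by auto
      have "\<bar>t - a\<bar> < d" using t r(3,4) by (auto simp: abs_if split: if_splits)
      then have "h w = t" using w T_Z t(3) by (intro hI) auto
      then show ?thesis using t r(2) by auto
    qed
    then show ?thesis using e'(1) by blast
  qed
  have h_cont: "continuous_on T h"
    unfolding continuous_on_cube[OF fin T_space] using h_cont_at by blast
  \<comment> \<open>the derivatives of \<open>h\<close> obtained from \<open>G (z(i := h z)) = z i\<close> by implicit differentiation\<close>
  define h' where "h' k z = ((if k = i then 1 else 0) + (if k = i then 0 else -1) * pderiv_at k G (z(i := h z)))
      * inverse (pderiv_at i G (z(i := h z)))" for k z
  have dnz: "pderiv_at i G (z(i := h z)) \<noteq> 0" if "z \<in> T" for z
    using pos[OF h_cube[OF that]] by auto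
  have deriv: "((\<lambda>t. h (z(k := t))) has_real_derivative h' k z) (at (z k))" if k: "k \<in> I" and z: "z \<in> T" for k z
  proof -
    let ?w = "z(i := h z)"
    define s0 where "s0 = z k"
    define \<phi> where "\<phi> s = h (z(k := s))" for s
    \<comment> \<open>By the mean value theorem \<open>u\<close> is the increment of \<open>h\<close> times a value of \<open>pderiv_at i G\<close>, while its own derivative is known.\<close>
    define u where "u s = (z(k := s)) i - G ((z(k := s))(i := h z))" for s
    have phi0: "\<phi> s0 = h z" by (simp add: \<phi>_def s0_def)
    have u0: "u s0 = 0" using hT(2)[OF z] by (simp add: u_def s0_def)
    have "(u has_real_derivative (if k = i then 1 else 0) + (if k = i then 0 else -1) * pderiv_at k G ?w) (at s0)"
    proof (cases "k = i")
      case True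
      have "((\<lambda>s. s - G ?w) has_real_derivative 1) (at s0)" by (auto intro!: derivative_eq_intros)
      then show ?thesis using True by (simp add: u_def[abs_def])
    next
      case False
      have "((\<lambda>s. z i - G (?w(k := s))) has_real_derivative 0 - pderiv_at k G ?w) (at (?w k))"
        by (intro DERIV_diff DERIV_const Cinf_has_pderiv[OF G k hS[OF z]])
      moreover have "u = (\<lambda>s. z i - G (?w(k := s)))"
        using False fun_upd_twist[OF False, of z] by (auto simp: u_def[abs_def])
      ultimately show ?thesis using False by (simp add: s0_def)
    qed
    then have u_lim: "((\<lambda>s. u s / (s - s0)) \<longlongrightarrow> (if k = i then 1 else 0) + (if k = i then 0 else -1) * pderiv_at k G ?w) (at s0)"
      by (simp add: has_field_derivative_iff u0)
    have evT: "\<forall>\<^sub>F s in nhds s0. z(k := s) \<in> T" unfolding s0_def by (rule upd_eventually[OF fin T_open k z])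
    have phi_lim: "(\<phi> \<longlongrightarrow> h z) (at s0)"
    proof (rule tendstoI)
      fix e :: real assume "e > 0"
      then obtain e' where e': "e' > 0" "\<forall>w\<in>T \<inter> cube I z e'. \<bar>h w - h z\<bar> < e" using h_cont_at[OF z] by blast
      have "\<forall>\<^sub>F s in nhds s0. z(k := s) \<in> cube I z e'"
        unfolding s0_def using T_space z e'(1) by (intro upd_eventually[OF fin coord_open_cube[OF fin] k] cube_center) auto
      then show "\<forall>\<^sub>F s in at s0. dist (\<phi> s) (h z) < e"
        using evT e'(2) unfolding eventually_nhds_conv_at by (auto simp: \<phi>_def dist_real_def elim: eventually_elim2)
    qed
    have "\<forall>s. \<exists>\<xi>. z(k := s) \<in> T \<longrightarrow> \<xi> \<in> closed_segment (h z) (\<phi> s) \<and>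
        u s = (\<phi> s - h z) * pderiv_at i G ((z(k := s))(i := \<xi>))"
    proof
      fix s
      show "\<exists>\<xi>. z(k := s) \<in> T \<longrightarrow> \<xi> \<in> closed_segment (h z) (\<phi> s) \<and> u s = (\<phi> s - h z) * pderiv_at i G ((z(k := s))(i := \<xi>))"
      proof (cases "z(k := s) \<in> T")
        case True
        have "\<exists>\<xi>\<in>closed_segment (h z) (\<phi> s). G ((z(k := s))(i := \<phi> s)) - G ((z(k := s))(i := h z)) =
            (\<phi> s - h z) * pderiv_at i G ((z(k := s))(i := \<xi>))"
        proof (rule mvt_upd[OF Cinf_on_Ck[OF G] i])
          fix \<xi> assume "\<xi> \<in> closed_segment (h z) (\<phi> s)"
          then have "\<bar>\<xi> - a\<bar> < d"
            using hT(1)[OF z] hT(1)[OF True] \<delta> by (auto simp: \<phi>_def closed_segment_eq_real_ivl split: if_splits)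
          then show "z(k := s, i := \<xi>) \<in> S" using Zupd[of "z(k := s)" \<xi>] True T_Z d(2) by blast
        qed
        then show ?thesis using hT(2)[OF True] by (auto simp: u_def \<phi>_def)
      qed simp
    qed
    then obtain \<xi> where \<xi>: "\<And>s. z(k := s) \<in> T \<Longrightarrow> \<xi> s \<in> closed_segment (h z) (\<phi> s)"
      "\<And>s. z(k := s) \<in> T \<Longrightarrow> u s = (\<phi> s - h z) * pderiv_at i G ((z(k := s))(i := \<xi> s))" by metis
    have den: "((\<lambda>s. pderiv_at i G ((z(k := s))(i := \<xi> s))) \<longlongrightarrow> pderiv_at i G ?w) (at s0)"
    proof (rule tendstoI)
      fix e :: real assume "e > 0"
      then obtain e' where e': "e' > 0" "\<forall>y\<in>cube I ?w e'. y \<in> S \<and> \<bar>pderiv_at i G y - pderiv_at i G ?w\<bar> < e"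
        using continuous_on_open_cube[OF fin S Cinf_on_continuous[OF Cinf_on_pderiv[OF G i]] hS[OF z]] by blast
      have "\<forall>\<^sub>F s in at s0. \<bar>s - s0\<bar> < e'" using e'(1) by (auto simp: eventually_at dist_real_def)
      moreover have "\<forall>\<^sub>F s in at s0. \<bar>\<phi> s - h z\<bar> < e'" using tendstoD[OF phi_lim e'(1)] by (simp add: dist_real_def)
      moreover have "\<forall>\<^sub>F s in at s0. z(k := s) \<in> T" using evT unfolding eventually_nhds_conv_at by blast
      ultimately show "\<forall>\<^sub>F s in at s0. dist (pderiv_at i G ((z(k := s))(i := \<xi> s))) (pderiv_at i G ?w) < e"
      proof eventually_elim
        case (elim s)
        have "\<bar>\<xi> s - h z\<bar> < e'" using \<xi>(1)[OF elim(3)] elim(2) by (auto simp: closed_segment_eq_real_ivl split: if_splits)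
        then have "z(k := s, i := \<xi> s) \<in> cube I ?w e'"
          using elim e'(1) z T_space i k by (auto simp: cube_def s0_def coord_space_def)
        then show ?case using e'(2) by (auto simp: dist_real_def)
      qed
    qed
    have "((\<lambda>s. (u s / (s - s0)) * inverse (pderiv_at i G ((z(k := s))(i := \<xi> s)))) \<longlongrightarrow> h' k z) (at s0)"
      unfolding h'_def by (intro tendsto_mult u_lim tendsto_inverse den dnz z)
    moreover have "\<forall>\<^sub>F s in at s0. (u s / (s - s0)) * inverse (pderiv_at i G ((z(k := s))(i := \<xi> s))) = (\<phi> s - \<phi> s0) / (s - s0)"
    proof -
      have "\<forall>\<^sub>F s in at s0. z(k := s) \<in> T" using evT unfolding eventually_nhds_conv_at by blast
      moreover have "\<forall>\<^sub>F s in at s0. pderiv_at i G ((z(k := s))(i := \<xi> s)) \<noteq> 0"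
        using tendsto_imp_eventually_ne[OF den dnz[OF z]] .
      ultimately show ?thesis
        by eventually_elim (simp add: \<xi>(2) phi0 divide_simps)
    qed
    ultimately have "((\<lambda>s. (\<phi> s - \<phi> s0) / (s - s0)) \<longlongrightarrow> h' k z) (at s0)"
      by (rule Lim_transform_eventually)
    then show ?thesis unfolding has_field_derivative_iff \<phi>_def s0_def .
  qed
  have h_Ck: "Ck_on n I T h" for n
  proof (induction n)
    case 0 then show ?case using h_cont by simp
  next
    case (Suc n)
    show ?case
    proof (rule Ck_on_SucI'[OF fin T_open h_cont deriv])
      fix k assume k: "k \<in> I"
      have upd: "Ck_on n I T (\<lambda>z. (z(i := h z)) j)" for j
        by (cases "i = j") (simp_all add: Suc Ck_on_coordinate[OF fin T_open])
      have comp: "Ck_on n I T (\<lambda>z. pderiv_at l G (z(i := h z)))" if "l \<in> I" for l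
        by (rule Ck_on_compose[OF fin T_open fin S image_subsetI[OF hS] upd Cinf_on_Ck[OF Cinf_on_pderiv[OF G that]]])
      show "Ck_on n I T (h' k)"
        unfolding h'_def[abs_def]
        by (rule Ck_on_mult[OF fin T_open Ck_on_add[OF fin T_open Ck_on_const[OF fin T_open] Ck_on_mult[OF fin T_open Ck_on_const[OF fin T_open] comp[OF k]]]
            Ck_on_inverse[OF fin T_open dnz comp[OF i]]])
    qed
  qed
  let ?z1 = "z0(i := G z0)"
  have z0Z: "z0 \<in> Z" using z0 S_sub cube_center[OF _ d(1), of z0 I] by (auto simp: Z_def a_def)
  have z1Z: "?z1 \<in> Z" using z0Z i by (simp add: Z_def coord_space_upd)
  have z1T: "?z1 \<in> T"
  proof -
    have "c * G (z0(i := a - \<delta>)) < c * G (z0(i := a))" "c * G (z0(i := a)) < c * G (z0(i := a + \<delta>))"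
      using \<delta> by (auto intro!: mono[OF z0Z])
    then show ?thesis using z1Z by (simp add: T_def between_def a_def)
  qed
  have h1: "h ?z1 = z0 i" using \<delta> d(1) by (intro hI z1Z) (auto simp: a_def)
  have "pderiv_at i h ?z1 = h' i ?z1" by (rule pderiv_at_eqI[OF deriv[OF i z1T]])
  then have "pderiv_at i h ?z1 \<noteq> 0" using dnz[OF z1T] by (simp add: h'_def)
  moreover have "Cinf_on I T h" using T_open h_Ck by (simp add: Cinf_on_def)
  ultimately show ?thesis using that[OF T_open z1T _ h1 hS hT(2)] by blast
qed

text \<open>
  \<open>\<Theta>\<close> is a parametrisation near \<open>x0 = \<Theta> z0\<close> in which the
  functions \<open>F j\<close> with \<open>j \<in> K\<close> are coordinate functions. The last
  condition says that its Jacobian at \<open>z0\<close> is invertible.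
\<close>

definition straightening ::
    "'i set \<Rightarrow> ('i \<Rightarrow> real) set \<Rightarrow> ('j \<Rightarrow> ('i \<Rightarrow> real) \<Rightarrow> real) \<Rightarrow> ('i \<Rightarrow> real) \<Rightarrow> 'j set
      \<Rightarrow> ('j \<Rightarrow> 'i) \<Rightarrow> ('i \<Rightarrow> real) set \<Rightarrow> (('i \<Rightarrow> real) \<Rightarrow> 'i \<Rightarrow> real) \<Rightarrow> ('i \<Rightarrow> real) \<Rightarrow> bool"
  where "straightening I S F x0 K \<beta> T \<Theta> z0 \<longleftrightarrow>
    (inj_on \<beta> K \<and> \<beta> ` K \<subseteq> I) \<and> (coord_open I T \<and> z0 \<in> T) \<and>
    (\<forall>l\<in>I. Cinf_on I T (\<lambda>z. \<Theta> z l)) \<and> \<Theta> ` T \<subseteq> S \<and> \<Theta> z0 = x0 \<and>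
    (\<forall>z\<in>T. \<forall>j\<in>K. F j (\<Theta> z) = z (\<beta> j)) \<and>
    (\<forall>\<omega>. (\<forall>i\<in>I. (\<Sum>l\<in>I. \<omega> l * pderiv_at i (\<lambda>z. \<Theta> z l) z0) = 0) \<longrightarrow> (\<forall>l\<in>I. \<omega> l = 0))"

text \<open>
  The functions \<open>F j\<close> become coordinates one at a time. Independence of the
  differentials gives the next function a non-zero derivative along a coordinate that does not yet
  represent some \<open>F k\<close>, and it is then exchanged for this coordinate.
\<close>

lemma submersion_straightening:
  assumes I: "finite I" and J: "finite J" and S: "coord_open I S"
    and F: "\<And>j. j \<in> J \<Longrightarrow> Cinf_on I S (F j)" and x0: "x0 \<in> S"
    and indep: "\<And>c. (\<And>i. i \<in> I \<Longrightarrow> (\<Sum>j\<in>J. c j * pderiv_at i (F j) x0) = 0) \<Longrightarrow> (\<forall>j\<in>J. c j = 0)"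
    and "finite K" "K \<subseteq> J"
  shows "\<exists>\<beta> T \<Theta> z0. straightening I S F x0 K \<beta> T \<Theta> z0"
  using assms(7,8)
proof (induction K)
  case empty
  have "\<omega> i = 0" if "\<forall>i\<in>I. (\<Sum>l\<in>I. \<omega> l * (if i = l then 1 else 0)) = 0" "i \<in> I" for \<omega> :: "_ \<Rightarrow> real" and i
    using that I by (simp add: mult_if_delta if_distrib cong: if_cong)
  then show ?case
    using S x0 unfolding straightening_def
    by (intro exI[of _ undefined] exI[of _ S] exI[of _ "\<lambda>z. z"] exI[of _ x0])
      (auto simp: pderiv_at_coordinate Cinf_on_coordinate[OF I])
next
  case (insert j K)
  then have j: "j \<in> J" "j \<notin> K" and K: "K \<subseteq> J" "finite K" by auto
  obtain \<beta> T \<Theta> z0 where st: "straightening I S F x0 K \<beta> T \<Theta> z0"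
    using insert.IH[OF K(1)] by (elim exE)
  note st = st[unfolded straightening_def]
  have \<beta>: "inj_on \<beta> K" "\<beta> ` K \<subseteq> I" and T: "coord_open I T" "z0 \<in> T"
    using st by simp_all
  have \<Theta>: "\<Theta> ` T \<subseteq> S" "\<Theta> z0 = x0" using st by simp_all
  have \<Theta>_smooth: "\<forall>l\<in>I. Cinf_on I T (\<lambda>z. \<Theta> z l)" using st by (elim conjE)
  have F\<Theta>: "\<forall>z\<in>T. \<forall>j\<in>K. F j (\<Theta> z) = z (\<beta> j)" using st by (elim conjE)
  have inv\<Theta>: "\<forall>\<omega>. (\<forall>i\<in>I. (\<Sum>l\<in>I. \<omega> l * pderiv_at i (\<lambda>z. \<Theta> z l) z0) = 0) \<longrightarrow> (\<forall>l\<in>I. \<omega> l = 0)"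
    using st by (elim conjE)
  note \<Theta> = \<Theta>_smooth[rule_format] \<Theta> and F\<Theta> = F\<Theta>[rule_format] and inv\<Theta> = inv\<Theta>[rule_format]
  define G where "G z = F j (\<Theta> z)" for z
  have G: "Cinf_on I T G" unfolding G_def[abs_def]
    by (rule Cinf_on_compose[OF I T(1) I \<Theta>(2,1) F[OF j(1)]])
  have dF\<Theta>: "pderiv_at i (\<lambda>z. F k (\<Theta> z)) z0 = (\<Sum>l\<in>I. pderiv_at l (F k) x0 * pderiv_at i (\<lambda>z. \<Theta> z l) z0)"
    if "k \<in> J" "i \<in> I" for k i
    using pderiv_at_comp[OF I T(1) I \<Theta>(2,1) F[OF that(1)] that(2) T(2)] by (simp add: \<Theta>(3))
  \<comment> \<open>Otherwise the differential of \<open>F j\<close> is a combination of those of the \<open>F k\<close> with \<open>k \<in> K\<close>.\<close>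
  have "\<exists>i\<in>I - \<beta> ` K. pderiv_at i G z0 \<noteq> 0"
  proof (rule ccontr)
    assume "\<not> ?thesis"
    then have zero: "pderiv_at i G z0 = 0" if "i \<in> I" "i \<notin> \<beta> ` K" for i using that by blast
    define c where "c k = (if k = j then 1 else if k \<in> K then - pderiv_at (\<beta> k) G z0 else 0)" for k
    have "(\<Sum>l\<in>I. (\<Sum>k\<in>J. c k * pderiv_at l (F k) x0) * pderiv_at i (\<lambda>z. \<Theta> z l) z0) = 0" if i: "i \<in> I" for i
    proof -
      have dK: "pderiv_at i (\<lambda>z. F k (\<Theta> z)) z0 = (if i = \<beta> k then 1 else 0)" if "k \<in> K" for k
        using pderiv_at_cong[OF I T(1) i T(2), of "\<lambda>z. F k (\<Theta> z)" "\<lambda>z. z (\<beta> k)"] F\<Theta> that pderiv_at_coordinate by metis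
      have "(\<Sum>l\<in>I. (\<Sum>k\<in>J. c k * pderiv_at l (F k) x0) * pderiv_at i (\<lambda>z. \<Theta> z l) z0) =
          (\<Sum>k\<in>J. c k * pderiv_at i (\<lambda>z. F k (\<Theta> z)) z0)"
        unfolding sum_distrib_right by (subst sum.swap) (simp add: dF\<Theta> i sum_distrib_left mult.assoc)
      also have "\<dots> = (\<Sum>k\<in>insert j K. c k * pderiv_at i (\<lambda>z. F k (\<Theta> z)) z0)"
        using J insert.prems by (intro sum.mono_neutral_right) (auto simp: c_def)
      also have "\<dots> = pderiv_at i G z0 + (\<Sum>k\<in>K. - pderiv_at (\<beta> k) G z0 * (if i = \<beta> k then 1 else 0))"
      proof -
        have "(\<Sum>k\<in>K. c k * pderiv_at i (\<lambda>z. F k (\<Theta> z)) z0) = (\<Sum>k\<in>K. - pderiv_at (\<beta> k) G z0 * (if i = \<beta> k then 1 else 0))"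
          using j(2) by (intro sum.cong) (auto simp: c_def dK)
        then show ?thesis using j(2) K(2) by (simp add: c_def G_def[abs_def])
      qed
      also have "\<dots> = 0"
      proof (cases "i \<in> \<beta> ` K")
        case True
        then obtain k where k: "k \<in> K" "i = \<beta> k" by blast
        have "(\<Sum>k'\<in>K. - pderiv_at (\<beta> k') G z0 * (if i = \<beta> k' then 1 else 0)) =
            (\<Sum>k'\<in>K. if k' = k then - pderiv_at i G z0 else 0)"
          using k \<beta>(1) by (intro sum.cong) (auto simp: inj_on_eq_iff)
        then show ?thesis using k K(2) by simp
      next
        case False
        then have "(\<Sum>k\<in>K. - pderiv_at (\<beta> k) G z0 * (if i = \<beta> k then 1 else 0)) = 0"
          by (intro sum.neutral) auto
        then show ?thesis using zero[OF i False] by simp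
      qed
      finally show ?thesis .
    qed
    then have "\<forall>l\<in>I. (\<Sum>k\<in>J. c k * pderiv_at l (F k) x0) = 0"
      using inv\<Theta>[of "\<lambda>l. \<Sum>k\<in>J. c k * pderiv_at l (F k) x0"] by blast
    then have "\<forall>k\<in>J. c k = 0" by (intro indep) blast
    then show False using j(1) by (auto simp: c_def)
  qed
  then obtain i where i: "i \<in> I" "i \<notin> \<beta> ` K" "pderiv_at i G z0 \<noteq> 0" by blast
  let ?z1 = "z0(i := G z0)"
  obtain T' h where T': "coord_open I T'" "?z1 \<in> T'" and h: "Cinf_on I T' h" "h ?z1 = z0 i"
    "\<And>z. z \<in> T' \<Longrightarrow> z(i := h z) \<in> T" "\<And>z. z \<in> T' \<Longrightarrow> G (z(i := h z)) = z i" "pderiv_at i h ?z1 \<noteq> 0"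
    using local_coordinate_replacement[OF I G T(2) i(1,3)] by blast
  let ?\<theta> = "\<lambda>z. z(i := h z)"
  have \<theta>: "Cinf_on I T' (\<lambda>z. ?\<theta> z l)" for l
    by (cases "i = l") (simp_all add: h(1) Cinf_on_coordinate[OF I T'(1)])
  have \<theta>T: "?\<theta> ` T' \<subseteq> T" using h(3) by auto
  have \<theta>1: "?\<theta> ?z1 = z0" by (simp add: h(2))
  define \<beta>' where "\<beta>' = \<beta>(j := i)"
  have "inj_on \<beta>' (insert j K)" "\<beta>' ` insert j K \<subseteq> I"
    using \<beta> i(1,2) j(2) unfolding \<beta>'_def by (auto simp: inj_on_def)
  moreover have "Cinf_on I T' (\<lambda>z. \<Theta> (?\<theta> z) l)" if "l \<in> I" for l
    by (rule Cinf_on_compose[OF I T'(1) I \<theta>T \<theta> \<Theta>(1)[OF that]])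
  moreover have "(\<lambda>z. \<Theta> (?\<theta> z)) ` T' \<subseteq> S" using \<Theta>(2) \<theta>T by blast
  moreover have "F k (\<Theta> (?\<theta> z)) = z (\<beta>' k)" if "z \<in> T'" "k \<in> insert j K" for z k
    using that h(3)[OF that(1)] h(4)[OF that(1)] F\<Theta> i(2) j(2) by (auto simp: \<beta>'_def G_def)
  moreover have "\<omega> n = 0"
    if \<omega>: "\<forall>k\<in>I. (\<Sum>m\<in>I. \<omega> m * pderiv_at k (\<lambda>z. \<Theta> (?\<theta> z) m) ?z1) = 0" and n: "n \<in> I" for \<omega> n
  proof -
    \<comment> \<open>The Jacobian of \<open>z \<mapsto> z(i := h z)\<close> is the identity except in row \<open>i\<close>, where its diagonal entry is not zero.\<close>
    define \<nu> where "\<nu> l = (\<Sum>m\<in>I. \<omega> m * pderiv_at l (\<lambda>z. \<Theta> z m) z0)" for l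
    have "(\<Sum>l\<in>I. \<nu> l * pderiv_at k (\<lambda>z. ?\<theta> z l) ?z1) = 0" if k: "k \<in> I" for k
    proof -
      have "pderiv_at k (\<lambda>z. \<Theta> (?\<theta> z) m) ?z1 =
          (\<Sum>l\<in>I. pderiv_at l (\<lambda>z. \<Theta> z m) z0 * pderiv_at k (\<lambda>z. ?\<theta> z l) ?z1)" if "m \<in> I" for m
        using pderiv_at_comp[OF I T'(1) I \<theta>T \<theta> \<Theta>(1)[OF that] k T'(2)] unfolding \<theta>1 .
      then have "(\<Sum>m\<in>I. \<omega> m * (\<Sum>l\<in>I. pderiv_at l (\<lambda>z. \<Theta> z m) z0 * pderiv_at k (\<lambda>z. ?\<theta> z l) ?z1)) =
          (\<Sum>m\<in>I. \<omega> m * pderiv_at k (\<lambda>z. \<Theta> (?\<theta> z) m) ?z1)"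
        by (intro sum.cong refl) (simp only:)
      also have "\<dots> = 0" using \<omega> k by blast
      finally have "(\<Sum>m\<in>I. \<omega> m * (\<Sum>l\<in>I. pderiv_at l (\<lambda>z. \<Theta> z m) z0 * pderiv_at k (\<lambda>z. ?\<theta> z l) ?z1)) = 0" .
      moreover have "(\<Sum>m\<in>I. \<omega> m * (\<Sum>l\<in>I. pderiv_at l (\<lambda>z. \<Theta> z m) z0 * pderiv_at k (\<lambda>z. ?\<theta> z l) ?z1)) =
          (\<Sum>l\<in>I. \<nu> l * pderiv_at k (\<lambda>z. ?\<theta> z l) ?z1)"
        unfolding \<nu>_def sum_distrib_left sum_distrib_right by (subst sum.swap) (simp only: mult.assoc)
      ultimately show ?thesis by simp
    qed
    note nu = this
    have d\<theta>: "pderiv_at k (\<lambda>z. ?\<theta> z l) ?z1 = (if l = i then pderiv_at k h ?z1 else if k = l then 1 else 0)" for k l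
      by (cases "l = i") (simp_all add: pderiv_at_coordinate)
    have split: "(\<Sum>l\<in>I. \<nu> l * pderiv_at k (\<lambda>z. ?\<theta> z l) ?z1) =
        \<nu> i * pderiv_at k h ?z1 + (if k = i then 0 else \<nu> k)" if k: "k \<in> I" for k
    proof -
      have "(\<Sum>l\<in>I. \<nu> l * pderiv_at k (\<lambda>z. ?\<theta> z l) ?z1) =
          \<nu> i * pderiv_at k h ?z1 + (\<Sum>l\<in>I - {i}. \<nu> l * pderiv_at k (\<lambda>z. ?\<theta> z l) ?z1)"
        using sum.remove[OF I i(1), of "\<lambda>l. \<nu> l * pderiv_at k (\<lambda>z. ?\<theta> z l) ?z1"] by (simp only: d\<theta>) simp
      also have "(\<Sum>l\<in>I - {i}. \<nu> l * pderiv_at k (\<lambda>z. ?\<theta> z l) ?z1) = (\<Sum>l\<in>I - {i}. if l = k then \<nu> k else 0)"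
        unfolding d\<theta> by (intro sum.cong) auto
      also have "\<dots> = (if k = i then 0 else \<nu> k)" using I k by auto
      finally show ?thesis .
    qed
    have "\<nu> i = 0" using nu[OF i(1)] split[OF i(1)] h(5) by simp
    then have "\<nu> l = 0" if "l \<in> I" for l using nu[OF that] split[OF that] by (cases "l = i") simp_all
    then show ?thesis unfolding \<nu>_def using inv\<Theta>[of \<omega>] n by blast
  qed
  moreover have "\<Theta> (?\<theta> ?z1) = x0" by (simp only: \<theta>1 \<Theta>(3))
  ultimately show ?case using T' unfolding straightening_def
    by (intro exI[of _ \<beta>'] exI[of _ T'] exI[of _ "\<lambda>z. \<Theta> (?\<theta> z)"] exI[of _ ?z1] conjI ballI allI impI)
qed

text \<open>
  In straightened coordinates \<open>F\<close> is a projection, which is inverted by the inclusion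
  of a slice.
\<close>

lemma local_right_inverse:
  assumes I: "finite I" and J: "finite J" and S: "coord_open I S"
    and F: "\<And>j. j \<in> J \<Longrightarrow> Cinf_on I S (\<lambda>x. F x j)" "F ` S \<subseteq> coord_space J" and x0: "x0 \<in> S"
    and indep: "\<And>c. (\<And>i. i \<in> I \<Longrightarrow> (\<Sum>j\<in>J. c j * pderiv_at i (\<lambda>x. F x j) x0) = 0) \<Longrightarrow> (\<forall>j\<in>J. c j = 0)"
  obtains T s where "coord_open J T" "F x0 \<in> T" "s ` T \<subseteq> S" "\<And>i. i \<in> I \<Longrightarrow> Cinf_on J T (\<lambda>y. s y i)"
    "s (F x0) = x0" "\<And>y. y \<in> T \<Longrightarrow> F (s y) = y"
proof -
  have "\<exists>\<beta> T \<Theta> z0. straightening I S (\<lambda>j x. F x j) x0 J \<beta> T \<Theta> z0"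
  proof (rule submersion_straightening[OF I J S _ x0 _ J order_refl])
    show "Cinf_on I S (\<lambda>x. F x j)" if "j \<in> J" for j using F(1)[OF that] .
    show "\<forall>j\<in>J. c j = 0" if "\<And>i. i \<in> I \<Longrightarrow> (\<Sum>j\<in>J. c j * pderiv_at i (\<lambda>x. F x j) x0) = 0" for c
      using indep[OF that] .
  qed
  then obtain \<beta> T \<Theta> z0 where st: "straightening I S (\<lambda>j x. F x j) x0 J \<beta> T \<Theta> z0"
    by (elim exE)
  note st = st[unfolded straightening_def]
  have \<beta>: "inj_on \<beta> J" "\<beta> ` J \<subseteq> I" and T: "coord_open I T" "z0 \<in> T"
    using st by simp_all
  have \<Theta>: "\<Theta> ` T \<subseteq> S" "\<Theta> z0 = x0" using st by simp_all
  have \<Theta>_smooth: "\<forall>l\<in>I. Cinf_on I T (\<lambda>z. \<Theta> z l)" using st by (elim conjE)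
  have F\<Theta>: "\<forall>z\<in>T. \<forall>j\<in>J. F (\<Theta> z) j = z (\<beta> j)" using st by (elim conjE)
  note \<Theta> = \<Theta>_smooth[rule_format] \<Theta> and F\<Theta> = F\<Theta>[rule_format]
  \<comment> \<open>the slice through \<open>z0\<close> along the coordinates that represent \<open>F\<close>\<close>
  define e where "e y = (\<lambda>i. if i \<in> \<beta> ` J then y (inv_into J \<beta> i) else z0 i)" for y :: "'b \<Rightarrow> real"
  have T_sub: "T \<subseteq> coord_space I" by (rule coord_open_subset[OF T(1)])
  have e_space: "e ` coord_space J \<subseteq> coord_space I"
  proof -
    have "i \<notin> \<beta> ` J" "z0 i = 0" if "i \<notin> I" for i
      using \<beta>(2) T(2) T_sub that by (auto simp: coord_space_def)
    then show ?thesis by (auto simp: e_def coord_space_def)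
  qed
  have e_C: "Cinf_on J U (\<lambda>y. e y i)" if "coord_open J U" for i U
    using that by (cases "i \<in> \<beta> ` J") (simp_all add: e_def Cinf_on_coordinate[OF J] Cinf_on_const[OF J])
  have e\<beta>: "e y (\<beta> j) = y j" if "j \<in> J" for y j using that \<beta>(1) by (simp add: e_def)
  define U where "U = {y \<in> coord_space J. e y \<in> T}"
  have U: "coord_open J U" unfolding U_def
    by (rule coord_open_vimage[OF coord_open_space Cinf_on_continuous[OF e_C[OF coord_open_space]] e_space T(1)])
  have eU: "e ` U \<subseteq> T" by (auto simp: U_def)
  have Fx0: "F x0 \<in> coord_space J" using F(2) x0 by blast
  have "e (F x0) = z0"
  proof
    fix i
    show "e (F x0) i = z0 i"
    proof (cases "i \<in> \<beta> ` J")
      case True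
      then obtain j where "j \<in> J" "i = \<beta> j" by blast
      then show ?thesis using e\<beta> F\<Theta>[OF T(2)] \<Theta>(3) by metis
    qed (simp add: e_def)
  qed
  then have "F x0 \<in> U" "\<Theta> (e (F x0)) = x0" using Fx0 T(2) \<Theta>(3) by (auto simp: U_def)
  moreover have "Cinf_on J U (\<lambda>y. \<Theta> (e y) i)" if "i \<in> I" for i
    by (rule Cinf_on_compose[OF J U I eU e_C[OF U] \<Theta>(1)[OF that]])
  moreover have "F (\<Theta> (e y)) = y" if "y \<in> U" for y
  proof (rule coord_space_eqI)
    show "F (\<Theta> (e y)) \<in> coord_space J" using F(2) \<Theta>(2) eU that by blast
    show "y \<in> coord_space J" using that by (simp add: U_def)
    show "F (\<Theta> (e y)) j = y j" if "j \<in> J" for j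
    proof -
      have "e y \<in> T" using \<open>y \<in> U\<close> by (simp add: U_def)
      then have "F (\<Theta> (e y)) j = e y (\<beta> j)" using that by (rule F\<Theta>)
      then show ?thesis using e\<beta>[OF that] by (simp only:)
    qed
  qed
  moreover have "(\<lambda>y. \<Theta> (e y)) ` U \<subseteq> S"
    by (rule image_subsetI, rule subsetD[OF \<Theta>(2)], rule imageI, rule subsetD[OF eU], rule imageI)
  ultimately show ?thesis using U by (intro that[of U "\<lambda>y. \<Theta> (e y)"])
qed

section \<open>Smooth functions and maps on manifolds\<close>

text \<open>
  Jet bundles carry an atlas whose charts are only known to be injective at first, so the lemmas
  below ask for no more than this of the manifold on which the functions live.
\<close>

definition inj_atlas :: "('a, 'i) mfd \<Rightarrow> bool"
  where "inj_atlas A \<longleftrightarrow> finite (index A) \<and> (\<forall>(U, \<phi>)\<in>atlas A. inj_on \<phi> U)"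

lemma inj_atlas_finite: "inj_atlas A \<Longrightarrow> finite (index A)"
  and inj_atlas_inj: "inj_atlas A \<Longrightarrow> (U, \<phi>) \<in> atlas A \<Longrightarrow> inj_on \<phi> U"
  by (auto simp: inj_atlas_def)

lemma atlas_carrier: "(U, \<phi>) \<in> atlas A \<Longrightarrow> U \<subseteq> carrier A"
  by (force simp: carrier_def)

lemma carrierE:
  assumes "p \<in> carrier A" obtains U \<phi> where "(U, \<phi>) \<in> atlas A" "p \<in> U"
  using assms by (auto simp: carrier_def)

lemma mopen_subset: "mopen A W \<Longrightarrow> W \<subseteq> carrier A"
  by (simp add: mopen_def)

lemma mopenD: "mopen A W \<Longrightarrow> (U, \<phi>) \<in> atlas A \<Longrightarrow> coord_open (index A) (\<phi> ` (U \<inter> W))"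
  by (auto simp: mopen_def)

lemma mopenI:
  "W \<subseteq> carrier A \<Longrightarrow> (\<And>U \<phi>. (U, \<phi>) \<in> atlas A \<Longrightarrow> coord_open (index A) (\<phi> ` (U \<inter> W))) \<Longrightarrow> mopen A W"
  by (auto simp: mopen_def)

lemma mopen_Int:
  assumes "inj_atlas A" "mopen A V" "mopen A W" shows "mopen A (V \<inter> W)"
proof (rule mopenI)
  show "V \<inter> W \<subseteq> carrier A" using mopen_subset[OF assms(2)] by blast
  fix U \<phi> assume c: "(U, \<phi>) \<in> atlas A"
  have "\<phi> ` (U \<inter> (V \<inter> W)) = \<phi> ` (U \<inter> V) \<inter> \<phi> ` (U \<inter> W)"
    using inj_on_image_Int[OF inj_atlas_inj[OF assms(1) c], of "U \<inter> V" "U \<inter> W"] by (simp add: Int_ac Int_left_absorb)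
  then show "coord_open (index A) (\<phi> ` (U \<inter> (V \<inter> W)))"
    using coord_open_Int[OF mopenD[OF assms(2) c] mopenD[OF assms(3) c]] by simp
qed

lemma mopen_Union:
  assumes "\<And>W. W \<in> \<W> \<Longrightarrow> mopen A W" shows "mopen A (\<Union>\<W>)"
proof (rule mopenI)
  show "\<Union>\<W> \<subseteq> carrier A" using assms mopen_subset by blast
  fix U \<phi> assume c: "(U, \<phi>) \<in> atlas A"
  have "\<phi> ` (U \<inter> \<Union>\<W>) = \<Union>((\<lambda>W. \<phi> ` (U \<inter> W)) ` \<W>)" by blast
  moreover have "coord_open (index A) (\<Union>((\<lambda>W. \<phi> ` (U \<inter> W)) ` \<W>))"
    using mopenD[OF assms c] by (intro coord_open_Union) auto
  ultimately show "coord_open (index A) (\<phi> ` (U \<inter> \<Union>\<W>))" by simp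
qed

lemma mopen_subopen:
  assumes "\<And>p. p \<in> W \<Longrightarrow> \<exists>V. p \<in> V \<and> V \<subseteq> W \<and> mopen A V" shows "mopen A W"
proof -
  have "W = \<Union>{V. V \<subseteq> W \<and> mopen A V}" using assms by blast
  then show ?thesis using mopen_Union[of "{V. V \<subseteq> W \<and> mopen A V}" A] by simp
qed

lemma mopen_empty: "mopen A {}"
  by (auto simp: mopen_def coord_open_empty)

lemma istopology_mopen: "inj_atlas A \<Longrightarrow> istopology (mopen A)"
  unfolding istopology_def using mopen_Int mopen_Union by blast

lemma openin_mopen: "inj_atlas A \<Longrightarrow> openin (topology (mopen A)) = mopen A"
  by (rule topology_inverse'[OF istopology_mopen])

lemma smooth_fun_mopen: "smooth_fun A W f \<Longrightarrow> mopen A W"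
  by (simp add: smooth_fun_def)

lemma smooth_funD:
  "smooth_fun A W f \<Longrightarrow> (U, \<phi>) \<in> atlas A \<Longrightarrow> Cinf_on (index A) (\<phi> ` (U \<inter> W)) (\<lambda>x. f (inv_into U \<phi> x))"
  by (auto simp: smooth_fun_def)

lemma smooth_funI:
  "mopen A W \<Longrightarrow> (\<And>U \<phi>. (U, \<phi>) \<in> atlas A \<Longrightarrow> Cinf_on (index A) (\<phi> ` (U \<inter> W)) (\<lambda>x. f (inv_into U \<phi> x)))
    \<Longrightarrow> smooth_fun A W f"
  by (auto simp: smooth_fun_def)

lemma smooth_fun_subset:
  assumes "smooth_fun A W f" "mopen A W'" "W' \<subseteq> W" shows "smooth_fun A W' f"
proof (rule smooth_funI[OF assms(2)])
  fix U \<phi> assume c: "(U, \<phi>) \<in> atlas A"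
  show "Cinf_on (index A) (\<phi> ` (U \<inter> W')) (\<lambda>x. f (inv_into U \<phi> x))"
    using Cinf_on_subset[OF smooth_funD[OF assms(1) c] mopenD[OF assms(2) c]] assms(3) by blast
qed

lemma smooth_fun_cong:
  assumes A: "inj_atlas A" and f: "smooth_fun A W f" and eq: "\<And>p. p \<in> W \<Longrightarrow> f p = g p"
  shows "smooth_fun A W g"
proof (rule smooth_funI[OF smooth_fun_mopen[OF f]])
  fix U \<phi> assume c: "(U, \<phi>) \<in> atlas A"
  show "Cinf_on (index A) (\<phi> ` (U \<inter> W)) (\<lambda>x. g (inv_into U \<phi> x))"
    by (rule Cinf_on_cong[OF inj_atlas_finite[OF A] smooth_funD[OF f c]])
      (use eq inj_atlas_inj[OF A c] in auto)
qed

lemma smooth_fun_local: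
  assumes A: "inj_atlas A" and loc: "\<And>p. p \<in> W \<Longrightarrow> \<exists>V. p \<in> V \<and> V \<subseteq> W \<and> smooth_fun A V f"
  shows "smooth_fun A W f"
proof (rule smooth_funI)
  show "mopen A W"
  proof (rule mopen_subopen)
    fix p assume "p \<in> W"
    then obtain V where "p \<in> V" "V \<subseteq> W" "smooth_fun A V f" using loc by blast
    then show "\<exists>V. p \<in> V \<and> V \<subseteq> W \<and> mopen A V" using smooth_fun_mopen[of A V f] by blast
  qed
  fix U \<phi> assume c: "(U, \<phi>) \<in> atlas A"
  show "Cinf_on (index A) (\<phi> ` (U \<inter> W)) (\<lambda>x. f (inv_into U \<phi> x))"
  proof (rule Cinf_on_local[OF inj_atlas_finite[OF A]])
    fix x assume "x \<in> \<phi> ` (U \<inter> W)"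
    then obtain p where p: "p \<in> U" "p \<in> W" "x = \<phi> p" by blast
    obtain V where V: "p \<in> V" "V \<subseteq> W" "smooth_fun A V f" using loc[OF p(2)] by blast
    show "\<exists>T. x \<in> T \<and> T \<subseteq> \<phi> ` (U \<inter> W) \<and> Cinf_on (index A) T (\<lambda>x. f (inv_into U \<phi> x))"
      using smooth_funD[OF V(3) c] p V by (intro exI[of _ "\<phi> ` (U \<inter> V)"]) auto
  qed
qed

lemma smooth_fun_const: "inj_atlas A \<Longrightarrow> mopen A W \<Longrightarrow> smooth_fun A W (\<lambda>p. c)"
  by (rule smooth_funI, assumption, rule Cinf_on_const[OF inj_atlas_finite mopenD])

lemma smooth_fun_add:
  assumes "inj_atlas A" "smooth_fun A W f" "smooth_fun A W g" shows "smooth_fun A W (\<lambda>p. f p + g p)"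
  by (rule smooth_funI, rule smooth_fun_mopen[OF assms(2)], rule Cinf_on_add[OF inj_atlas_finite[OF assms(1)]])
    (rule smooth_funD[OF assms(2)] smooth_funD[OF assms(3)], assumption)+

lemma smooth_fun_mult:
  assumes "inj_atlas A" "smooth_fun A W f" "smooth_fun A W g" shows "smooth_fun A W (\<lambda>p. f p * g p)"
  by (rule smooth_funI, rule smooth_fun_mopen[OF assms(2)], rule Cinf_on_mult[OF inj_atlas_finite[OF assms(1)]])
    (rule smooth_funD[OF assms(2)] smooth_funD[OF assms(3)], assumption)+

lemma smooth_fun_lincomb:
  assumes "inj_atlas A" "smooth_fun A W f" "smooth_fun A W g" shows "smooth_fun A W (\<lambda>p. a * f p + b * g p)"
  by (rule smooth_fun_add[OF assms(1) smooth_fun_mult[OF assms(1) smooth_fun_const[OF assms(1) smooth_fun_mopen[OF assms(2)]] assms(2)]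
        smooth_fun_mult[OF assms(1) smooth_fun_const[OF assms(1) smooth_fun_mopen[OF assms(2)]] assms(3)]])

lemma smooth_fun_Cinf_compose:
  assumes A: "inj_atlas A" and J: "finite J" and W: "mopen A W"
    and u: "\<And>j. j \<in> J \<Longrightarrow> smooth_fun A W (\<lambda>p. u p j)" "u ` W \<subseteq> S" and g: "Cinf_on J S g"
  shows "smooth_fun A W (\<lambda>p. g (u p))"
proof (rule smooth_funI[OF W])
  fix U \<phi> assume c: "(U, \<phi>) \<in> atlas A"
  show "Cinf_on (index A) (\<phi> ` (U \<inter> W)) (\<lambda>x. g (u (inv_into U \<phi> x)))"
  proof (rule Cinf_on_compose[OF inj_atlas_finite[OF A] mopenD[OF W c] J _ smooth_funD[OF u(1) c] g])
    show "(\<lambda>x. u (inv_into U \<phi> x)) ` \<phi> ` (U \<inter> W) \<subseteq> S"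
      using u(2) inj_atlas_inj[OF A c] by auto
  qed
qed

lemma smooth_at_cong:
  assumes A: "inj_atlas A" and W: "mopen A W" "p \<in> W" "\<And>q. q \<in> W \<Longrightarrow> f q = g q" and f: "smooth_at A p f"
  shows "smooth_at A p g"
proof -
  obtain V where V: "p \<in> V" "smooth_fun A V f" using f by (auto simp: smooth_at_def)
  have "smooth_fun A (V \<inter> W) f"
    by (rule smooth_fun_subset[OF V(2) mopen_Int[OF A smooth_fun_mopen[OF V(2)] W(1)]]) simp
  then have "smooth_fun A (V \<inter> W) g" by (rule smooth_fun_cong[OF A]) (use W(3) in simp)
  then show ?thesis using V(1) W(2) by (auto simp: smooth_at_def)
qed

lemma smooth_fun_smooth_at: "smooth_fun A W f \<Longrightarrow> p \<in> W \<Longrightarrow> smooth_at A p f"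
  by (auto simp: smooth_at_def)

lemma smooth_manifold_inj_atlas: "smooth_manifold M \<Longrightarrow> inj_atlas M"
  by (fastforce simp: smooth_manifold_def inj_atlas_def coord_patch_def)

lemma smooth_manifold_finite: "smooth_manifold M \<Longrightarrow> finite (index M)"
  by (simp add: smooth_manifold_def)

lemma chartsD:
  assumes "(U, \<phi>) \<in> charts M"
  shows "U \<subseteq> carrier M" "inj_on \<phi> U" "coord_open (index M) (\<phi> ` U)"
    and "(V, \<psi>) \<in> atlas M \<Longrightarrow> i \<in> index M \<Longrightarrow> Cinf_on (index M) (\<phi> ` (U \<inter> V)) (\<lambda>x. \<psi> (inv_into U \<phi> x) i)"
    and "(V, \<psi>) \<in> atlas M \<Longrightarrow> i \<in> index M \<Longrightarrow> Cinf_on (index M) (\<psi> ` (U \<inter> V)) (\<lambda>x. \<phi> (inv_into V \<psi> x) i)"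
    and "(V, \<psi>) \<in> atlas M \<Longrightarrow> coord_open (index M) (\<phi> ` (U \<inter> V))"
    and "(V, \<psi>) \<in> atlas M \<Longrightarrow> coord_open (index M) (\<psi> ` (U \<inter> V))"
  using assms by (fastforce simp: charts_def coord_patch_def compatible_def)+

lemma atlas_charts: "smooth_manifold M \<Longrightarrow> (U, \<phi>) \<in> atlas M \<Longrightarrow> (U, \<phi>) \<in> charts M"
  using atlas_carrier[of U \<phi> M] by (auto simp: smooth_manifold_def charts_def)

lemma charts_space: "(U, \<phi>) \<in> charts M \<Longrightarrow> p \<in> U \<Longrightarrow> \<phi> p \<in> coord_space (index M)"
  using chartsD(3) coord_open_subset by blast

lemma charts_mopen: "(U, \<phi>) \<in> charts M \<Longrightarrow> mopen M U"
  using chartsD(1,7)[of U \<phi> M] by (intro mopenI) (simp_all add: Int_commute)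

lemma mopen_carrier: "smooth_manifold M \<Longrightarrow> mopen M (carrier M)"
  by (rule mopen_subopen) (metis atlas_charts carrierE chartsD(1) charts_mopen)

text \<open>
  A chart of the maximal atlas is compared near each point with a chart of the atlas, to which the
  transition is smooth; likewise in \<open>smooth_fun_chart\<close>.
\<close>

lemma charts_open_image:
  assumes M: "smooth_manifold M" and c: "(U, \<phi>) \<in> charts M" and W: "mopen M W"
  shows "coord_open (index M) (\<phi> ` (U \<inter> W))"
proof (rule coord_open_subopen)
  fix x assume "x \<in> \<phi> ` (U \<inter> W)"
  then obtain p where p: "p \<in> U" "p \<in> W" "x = \<phi> p" by blast
  obtain V \<psi> where d: "(V, \<psi>) \<in> atlas M" "p \<in> V"
    by (rule carrierE[OF subsetD[OF mopen_subset[OF W] p(2)]])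
  have inj: "inj_on \<phi> U" "inj_on \<psi> V"
    using chartsD(2)[OF c] inj_atlas_inj[OF smooth_manifold_inj_atlas[OF M] d(1)] by auto
  have "coord_open (index M) {x \<in> \<phi> ` (U \<inter> V). \<psi> (inv_into U \<phi> x) \<in> \<psi> ` (V \<inter> W)}"
  proof (rule coord_open_vimage[OF chartsD(6)[OF c d(1)] _ _ mopenD[OF W d(1)]])
    show "continuous_on (\<phi> ` (U \<inter> V)) (\<lambda>x. \<psi> (inv_into U \<phi> x) j)" if "j \<in> index M" for j
      by (rule Cinf_on_continuous[OF chartsD(4)[OF c d(1) that]])
    show "(\<lambda>x. \<psi> (inv_into U \<phi> x)) ` \<phi> ` (U \<inter> V) \<subseteq> coord_space (index M)"
      using inj charts_space[OF atlas_charts[OF M d(1)]] by auto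
  qed
  moreover have "{x \<in> \<phi> ` (U \<inter> V). \<psi> (inv_into U \<phi> x) \<in> \<psi> ` (V \<inter> W)} = \<phi> ` (U \<inter> V \<inter> W)"
    using inj by (auto simp: inj_on_eq_iff)
  ultimately have "coord_open (index M) (\<phi> ` (U \<inter> V \<inter> W))" by simp
  then show "\<exists>T. coord_open (index M) T \<and> x \<in> T \<and> T \<subseteq> \<phi> ` (U \<inter> W)"
    using p d(2) by (intro exI[of _ "\<phi> ` (U \<inter> V \<inter> W)"]) auto
qed

lemma charts_restrict:
  assumes M: "smooth_manifold M" and c: "(U, \<phi>) \<in> charts M" and W: "mopen M W"
  shows "(U \<inter> W, \<phi>) \<in> charts M"
proof -
  have inj: "inj_on \<phi> U" "inj_on \<phi> (U \<inter> W)" using chartsD(2)[OF c] by (auto intro: inj_on_subset)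
  have eq: "inv_into (U \<inter> W) \<phi> x = inv_into U \<phi> x" if "x \<in> \<phi> ` (U \<inter> W \<inter> V)" for x V
    using that inj by auto
  have "compatible (index M) (U \<inter> W, \<phi>) (V, \<psi>)" if d: "(V, \<psi>) \<in> atlas M" for V \<psi>
  proof -
    have fin: "finite (index M)" by (rule smooth_manifold_finite[OF M])
    have UW: "mopen M (U \<inter> W)" by (rule mopen_Int[OF smooth_manifold_inj_atlas[OF M] charts_mopen[OF c] W])
    have o1: "coord_open (index M) (\<phi> ` (U \<inter> W \<inter> V))"
      using charts_open_image[OF M c mopen_Int[OF smooth_manifold_inj_atlas[OF M] W charts_mopen[OF atlas_charts[OF M d]]]]
      by (simp add: Int_assoc)
    have o2: "coord_open (index M) (\<psi> ` (U \<inter> W \<inter> V))"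
      using mopenD[OF UW d] by (simp add: Int_commute)
    have "Cinf_on (index M) (\<phi> ` (U \<inter> W \<inter> V)) (\<lambda>x. \<psi> (inv_into (U \<inter> W) \<phi> x) i)" if "i \<in> index M" for i
    proof (rule Cinf_on_cong[OF fin])
      show "Cinf_on (index M) (\<phi> ` (U \<inter> W \<inter> V)) (\<lambda>x. \<psi> (inv_into U \<phi> x) i)"
        by (rule Cinf_on_subset[OF chartsD(4)[OF c d that] o1]) blast
    qed (simp add: eq)
    moreover have "Cinf_on (index M) (\<psi> ` (U \<inter> W \<inter> V)) (\<lambda>x. \<phi> (inv_into V \<psi> x) i)" if "i \<in> index M" for i
      by (rule Cinf_on_subset[OF chartsD(5)[OF c d that] o2]) blast
    ultimately show ?thesis using o1 o2 by (simp add: compatible_def)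
  qed
  then show ?thesis
    using chartsD(1)[OF c] inj charts_open_image[OF M c W] by (auto simp: charts_def coord_patch_def)
qed

lemma charts_smooth_coordinate:
  assumes M: "smooth_manifold M" and c: "(U, \<phi>) \<in> charts M"
  shows "smooth_fun M U (\<lambda>p. \<phi> p i)"
proof (cases "i \<in> index M")
  case True
  then show ?thesis
    using chartsD(5)[OF c] by (intro smooth_funI charts_mopen[OF c]) (simp add: Int_commute)
next
  case False
  have "smooth_fun M U (\<lambda>p. 0)"
    by (rule smooth_fun_const[OF smooth_manifold_inj_atlas[OF M] charts_mopen[OF c]])
  then show ?thesis
    by (rule smooth_fun_cong[OF smooth_manifold_inj_atlas[OF M]])
      (use charts_space[OF c] False in \<open>auto simp: coord_space_def\<close>)
qed

lemma smooth_fun_chart: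
  assumes M: "smooth_manifold M" and f: "smooth_fun M W f" and c: "(U, \<phi>) \<in> charts M"
  shows "Cinf_on (index M) (\<phi> ` (U \<inter> W)) (\<lambda>x. f (inv_into U \<phi> x))"
proof (rule Cinf_on_local[OF smooth_manifold_finite[OF M]])
  have W: "mopen M W" by (rule smooth_fun_mopen[OF f])
  fix x assume "x \<in> \<phi> ` (U \<inter> W)"
  then obtain p where p: "p \<in> U" "p \<in> W" "x = \<phi> p" by blast
  obtain V \<psi> where d: "(V, \<psi>) \<in> atlas M" "p \<in> V"
    by (rule carrierE[OF subsetD[OF mopen_subset[OF W] p(2)]])
  have inj: "inj_on \<phi> U" "inj_on \<psi> V"
    using chartsD(2)[OF c] inj_atlas_inj[OF smooth_manifold_inj_atlas[OF M] d(1)] by auto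
  have T: "coord_open (index M) (\<phi> ` (U \<inter> (V \<inter> W)))"
    by (rule charts_open_image[OF M c mopen_Int[OF smooth_manifold_inj_atlas[OF M] charts_mopen[OF atlas_charts[OF M d(1)]] W]])
  have "Cinf_on (index M) (\<phi> ` (U \<inter> (V \<inter> W))) (\<lambda>x. f (inv_into V \<psi> (\<psi> (inv_into U \<phi> x))))"
  proof (rule Cinf_on_compose[OF smooth_manifold_finite[OF M] T smooth_manifold_finite[OF M] _ _ smooth_funD[OF f d(1)]])
    show "(\<lambda>x. \<psi> (inv_into U \<phi> x)) ` \<phi> ` (U \<inter> (V \<inter> W)) \<subseteq> \<psi> ` (V \<inter> W)" using inj by auto
    show "Cinf_on (index M) (\<phi> ` (U \<inter> (V \<inter> W))) (\<lambda>x. \<psi> (inv_into U \<phi> x) j)" if "j \<in> index M" for j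
      by (rule Cinf_on_subset[OF chartsD(4)[OF c d(1) that] T]) blast
  qed
  then have "Cinf_on (index M) (\<phi> ` (U \<inter> (V \<inter> W))) (\<lambda>x. f (inv_into U \<phi> x))"
    by (rule Cinf_on_cong[OF smooth_manifold_finite[OF M]]) (use inj in auto)
  then show "\<exists>T. x \<in> T \<and> T \<subseteq> \<phi> ` (U \<inter> W) \<and> Cinf_on (index M) T (\<lambda>x. f (inv_into U \<phi> x))"
    using p d(2) by (intro exI[of _ "\<phi> ` (U \<inter> (V \<inter> W))"]) auto
qed

lemma smooth_map_mopen: "smooth_map A W N F \<Longrightarrow> mopen A W"
  and smooth_map_image: "smooth_map A W N F \<Longrightarrow> p \<in> W \<Longrightarrow> F p \<in> carrier N"
  and smooth_map_vimage: "smooth_map A W N F \<Longrightarrow> mopen N V \<Longrightarrow> mopen A (W \<inter> F -` V)"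
  and smooth_map_coordinate: "smooth_map A W N F \<Longrightarrow> (V, \<psi>) \<in> atlas N \<Longrightarrow> j \<in> index N
    \<Longrightarrow> smooth_fun A (W \<inter> F -` V) (\<lambda>p. \<psi> (F p) j)"
  by (auto simp: smooth_map_def)

lemma smooth_mapI:
  "mopen A W \<Longrightarrow> (\<And>p. p \<in> W \<Longrightarrow> F p \<in> carrier N) \<Longrightarrow> (\<And>V. mopen N V \<Longrightarrow> mopen A (W \<inter> F -` V)) \<Longrightarrow>
    (\<And>V \<psi> j. (V, \<psi>) \<in> atlas N \<Longrightarrow> j \<in> index N \<Longrightarrow> smooth_fun A (W \<inter> F -` V) (\<lambda>p. \<psi> (F p) j))
    \<Longrightarrow> smooth_map A W N F"
  by (auto simp: smooth_map_def)

text \<open>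
  Near \<open>F p\<close> the function \<open>h\<close> is a smooth function of chart coordinates,
  whose pullbacks are smooth by definition of a smooth map.
\<close>

lemma smooth_fun_pullback:
  assumes A: "inj_atlas A" and N: "smooth_manifold N" and F: "smooth_map A W N F" and h: "smooth_fun N V h"
  shows "smooth_fun A (W \<inter> F -` V) (\<lambda>p. h (F p))"
proof (rule smooth_fun_local[OF A])
  note N' = smooth_manifold_inj_atlas[OF N]
  fix p assume p: "p \<in> W \<inter> F -` V"
  obtain V' \<psi> where d: "(V', \<psi>) \<in> atlas N" "F p \<in> V'"
    using p by (elim IntE) (rule carrierE[OF smooth_map_image[OF F]])
  have VV': "mopen N (V' \<inter> V)"
    by (rule mopen_Int[OF N' charts_mopen[OF atlas_charts[OF N d(1)]] smooth_fun_mopen[OF h]])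
  let ?X = "W \<inter> F -` (V' \<inter> V)"
  have X: "mopen A ?X" by (rule smooth_map_vimage[OF F VV'])
  have "smooth_fun A ?X (\<lambda>p. h (inv_into V' \<psi> (\<psi> (F p))))"
  proof (rule smooth_fun_Cinf_compose[OF A inj_atlas_finite[OF N'] X _ _ smooth_funD[OF h d(1)]])
    show "smooth_fun A ?X (\<lambda>p. \<psi> (F p) j)" if "j \<in> index N" for j
      by (rule smooth_fun_subset[OF smooth_map_coordinate[OF F d(1) that] X]) blast
    show "(\<lambda>p. \<psi> (F p)) ` ?X \<subseteq> \<psi> ` (V' \<inter> V)" by blast
  qed
  then have "smooth_fun A ?X (\<lambda>p. h (F p))"
    by (rule smooth_fun_cong[OF A]) (use inj_atlas_inj[OF N' d(1)] in auto)
  then show "\<exists>X. p \<in> X \<and> X \<subseteq> W \<inter> F -` V \<and> smooth_fun A X (\<lambda>p. h (F p))"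
    using p d(2) by (intro exI[of _ ?X]) auto
qed

lemma smooth_at_pullback:
  assumes "inj_atlas A" "smooth_manifold N" "smooth_map A W N F" "p \<in> W" "smooth_at N (F p) h"
  shows "smooth_at A p (\<lambda>p. h (F p))"
proof -
  obtain V where V: "F p \<in> V" "smooth_fun N V h" using assms(5) by (auto simp: smooth_at_def)
  show ?thesis
    by (rule smooth_fun_smooth_at[OF smooth_fun_pullback[OF assms(1-3) V(2)]]) (use V(1) assms(4) in auto)
qed

lemma smooth_map_chart:
  assumes "inj_atlas A" "smooth_manifold N" "smooth_map A W N F" "(V, \<psi>) \<in> charts N"
  shows "smooth_fun A (W \<inter> F -` V) (\<lambda>p. \<psi> (F p) j)"
  by (rule smooth_fun_pullback[OF assms(1-3) charts_smooth_coordinate[OF assms(2,4)]])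

lemma smooth_map_compose:
  assumes A: "inj_atlas A" and N: "smooth_manifold N"
    and F: "smooth_map A W N F" and G: "smooth_map N V P G"
  shows "smooth_map A (W \<inter> F -` V) P (\<lambda>p. G (F p))"
proof (rule smooth_mapI)
  show "mopen A (W \<inter> F -` V)" by (rule smooth_map_vimage[OF F smooth_map_mopen[OF G]])
  show "G (F p) \<in> carrier P" if "p \<in> W \<inter> F -` V" for p using smooth_map_image[OF G] that by blast
  have eq: "W \<inter> F -` V \<inter> (\<lambda>p. G (F p)) -` X = W \<inter> F -` (V \<inter> G -` X)" for X by blast
  show "mopen A (W \<inter> F -` V \<inter> (\<lambda>p. G (F p)) -` X)" if "mopen P X" for X
    unfolding eq by (rule smooth_map_vimage[OF F smooth_map_vimage[OF G that]])
  show "smooth_fun A (W \<inter> F -` V \<inter> (\<lambda>p. G (F p)) -` X) (\<lambda>p. \<psi> (G (F p)) j)"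
    if "(X, \<psi>) \<in> atlas P" "j \<in> index P" for X \<psi> j
    unfolding eq by (rule smooth_fun_pullback[OF A N F smooth_map_coordinate[OF G that]])
qed

lemma smooth_map_subset:
  assumes A: "inj_atlas A" and F: "smooth_map A W N F" and W': "mopen A W'" "W' \<subseteq> W"
  shows "smooth_map A W' N F"
proof (rule smooth_mapI[OF W'(1)])
  have eq: "W' \<inter> F -` V = W' \<inter> (W \<inter> F -` V)" for V using W'(2) by blast
  show op: "mopen A (W' \<inter> F -` V)" if "mopen N V" for V
    unfolding eq by (rule mopen_Int[OF A W'(1) smooth_map_vimage[OF F that]])
  show "F p \<in> carrier N" if "p \<in> W'" for p using smooth_map_image[OF F] W'(2) that by blast
  show "smooth_fun A (W' \<inter> F -` V) (\<lambda>p. \<psi> (F p) j)" if "(V, \<psi>) \<in> atlas N" "j \<in> index N" for V \<psi> j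
  proof (rule smooth_fun_subset[OF smooth_map_coordinate[OF F that]])
    show "mopen A (W' \<inter> F -` V)"
      unfolding eq by (rule mopen_Int[OF A W'(1) smooth_fun_mopen[OF smooth_map_coordinate[OF F that]]])
  qed (use W'(2) in blast)
qed

lemma smooth_map_cong:
  assumes A: "inj_atlas A" and F: "smooth_map A W N F" and eq: "\<And>p. p \<in> W \<Longrightarrow> F p = G p"
  shows "smooth_map A W N G"
proof -
  have v: "W \<inter> G -` V = W \<inter> F -` V" for V using eq by auto
  show ?thesis
  proof (rule smooth_mapI[OF smooth_map_mopen[OF F]])
    show "G p \<in> carrier N" if "p \<in> W" for p using smooth_map_image[OF F that] eq[OF that] by simp
    show "mopen A (W \<inter> G -` V)" if "mopen N V" for V unfolding v by (rule smooth_map_vimage[OF F that])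
    show "smooth_fun A (W \<inter> G -` V) (\<lambda>p. \<psi> (G p) j)" if "(V, \<psi>) \<in> atlas N" "j \<in> index N" for V \<psi> j
      unfolding v by (rule smooth_fun_cong[OF A smooth_map_coordinate[OF F that]]) (use eq in auto)
  qed
qed

lemma smooth_map_local:
  assumes A: "inj_atlas A" and loc: "\<And>p. p \<in> W \<Longrightarrow> \<exists>V. p \<in> V \<and> V \<subseteq> W \<and> smooth_map A V N F"
  shows "smooth_map A W N F"
proof (rule smooth_mapI)
  show "mopen A W"
  proof (rule mopen_subopen)
    fix p assume "p \<in> W"
    then obtain V where "p \<in> V" "V \<subseteq> W" "smooth_map A V N F" using loc by blast
    then show "\<exists>V. p \<in> V \<and> V \<subseteq> W \<and> mopen A V" using smooth_map_mopen[of A V N F] by blast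
  qed
  show "F p \<in> carrier N" if "p \<in> W" for p using loc[OF that] smooth_map_image[of A _ N F p] by blast
  show "mopen A (W \<inter> F -` X)" if "mopen N X" for X
  proof (rule mopen_subopen)
    fix p assume p: "p \<in> W \<inter> F -` X"
    obtain V where V: "p \<in> V" "V \<subseteq> W" "smooth_map A V N F" using loc p by blast
    show "\<exists>Y. p \<in> Y \<and> Y \<subseteq> W \<inter> F -` X \<and> mopen A Y"
      using smooth_map_vimage[OF V(3) that] p V by (intro exI[of _ "V \<inter> F -` X"]) auto
  qed
  show "smooth_fun A (W \<inter> F -` X) (\<lambda>p. \<psi> (F p) j)" if "(X, \<psi>) \<in> atlas N" "j \<in> index N" for X \<psi> j
  proof (rule smooth_fun_local[OF A])
    fix p assume p: "p \<in> W \<inter> F -` X"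
    obtain V where V: "p \<in> V" "V \<subseteq> W" "smooth_map A V N F" using loc p by blast
    show "\<exists>Y. p \<in> Y \<and> Y \<subseteq> W \<inter> F -` X \<and> smooth_fun A Y (\<lambda>p. \<psi> (F p) j)"
      using smooth_map_coordinate[OF V(3) that] p V by (intro exI[of _ "V \<inter> F -` X"]) auto
  qed
qed

lemma diffeo_onD:
  assumes "diffeo_on M U N V F"
  shows "mopen M U" "mopen N V" "bij_betw F U V" "inj_on F U" "F ` U = V" "smooth_map M U N F"
    "smooth_map N V M (inv_into U F)"
  using assms by (auto simp: diffeo_on_def bij_betw_def)

lemma diffeo_on_inverse:
  assumes N: "inj_atlas M" and F: "diffeo_on M U N V F"
  shows "diffeo_on N V M U (inv_into U F)"
proof -
  note F = diffeo_onD[OF F]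
  have "smooth_map M U N (inv_into V (inv_into U F))"
    by (rule smooth_map_cong[OF N F(6)])
      (use F(3) in \<open>metis bij_betwE bij_betw_inv_into bij_betw_inv_into_left inv_into_f_f bij_betw_def\<close>)
  then show ?thesis using F bij_betw_inv_into[OF F(3)] by (simp add: diffeo_on_def)
qed

lemma diffeo_on_image_mopen:
  assumes F: "diffeo_on M U N V F" and W: "mopen M W" "W \<subseteq> U"
  shows "mopen N (F ` W)"
proof -
  note F = diffeo_onD[OF F]
  have "F ` W = V \<inter> inv_into U F -` W"
  proof (intro equalityI subsetI)
    fix y assume y: "y \<in> V \<inter> inv_into U F -` W"
    then have "F (inv_into U F y) = y" using F(5) by (auto intro: f_inv_into_f)
    then show "y \<in> F ` W" using y by (metis IntD2 imageI vimageD)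
  qed (use F(4,5) W(2) in auto)
  then show ?thesis using smooth_map_vimage[OF F(7) W(1)] by simp
qed

lemma smooth_vimage_mopen:
  assumes A: "inj_atlas A" and u: "\<And>j. j \<in> J \<Longrightarrow> smooth_fun A W (\<lambda>p. u p j)" "u ` W \<subseteq> coord_space J"
    and W: "mopen A W" and T: "coord_open J T"
  shows "mopen A {p \<in> W. u p \<in> T}"
proof (rule mopenI)
  show "{p \<in> W. u p \<in> T} \<subseteq> carrier A" using mopen_subset[OF W] by blast
  fix U \<phi> assume c: "(U, \<phi>) \<in> atlas A"
  have "coord_open (index A) {x \<in> \<phi> ` (U \<inter> W). u (inv_into U \<phi> x) \<in> T}"
  proof (rule coord_open_vimage[OF mopenD[OF W c] _ _ T])
    show "continuous_on (\<phi> ` (U \<inter> W)) (\<lambda>x. u (inv_into U \<phi> x) j)" if "j \<in> J" for j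
      by (rule Cinf_on_continuous[OF smooth_funD[OF u(1)[OF that] c]])
    show "(\<lambda>x. u (inv_into U \<phi> x)) ` \<phi> ` (U \<inter> W) \<subseteq> coord_space J"
      using u(2) inj_atlas_inj[OF A c] by auto
  qed
  moreover have "{x \<in> \<phi> ` (U \<inter> W). u (inv_into U \<phi> x) \<in> T} = \<phi> ` (U \<inter> {p \<in> W. u p \<in> T})"
    using inj_atlas_inj[OF A c] by auto
  ultimately show "coord_open (index A) (\<phi> ` (U \<inter> {p \<in> W. u p \<in> T}))" by simp
qed

lemma chart_vimage_mopen:
  assumes M: "smooth_manifold M" and c: "(U, \<phi>) \<in> charts M" and T: "coord_open (index M) T"
  shows "mopen M {p \<in> U. \<phi> p \<in> T}"
  by (rule smooth_vimage_mopen[OF smooth_manifold_inj_atlas[OF M] charts_smooth_coordinate[OF M c] _ charts_mopen[OF c] T])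
    (use charts_space[OF c] in blast)

lemma smooth_map_into_chart:
  assumes A: "inj_atlas A" and M: "smooth_manifold M" and c: "(U, \<phi>) \<in> charts M" and W: "mopen A W"
    and F: "F ` W \<subseteq> U" "\<And>i. i \<in> index M \<Longrightarrow> smooth_fun A W (\<lambda>y. \<phi> (F y) i)"
  shows "smooth_map A W M F"
proof (rule smooth_mapI[OF W])
  have inj: "inj_on \<phi> U" by (rule chartsD(2)[OF c])
  have sp: "(\<lambda>y. \<phi> (F y)) ` W \<subseteq> coord_space (index M)" using charts_space[OF c] F(1) by blast
  show "F y \<in> carrier M" if "y \<in> W" for y using F(1) chartsD(1)[OF c] that by blast
  show op: "mopen A (W \<inter> F -` V)" if V: "mopen M V" for V
  proof -
    have "mopen A {y \<in> W. \<phi> (F y) \<in> \<phi> ` (U \<inter> V)}"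
      by (rule smooth_vimage_mopen[OF A F(2) sp W charts_open_image[OF M c V]])
    moreover have "{y \<in> W. \<phi> (F y) \<in> \<phi> ` (U \<inter> V)} = W \<inter> F -` V"
      using F(1) inj by (auto simp: inj_on_eq_iff image_subset_iff)
    ultimately show ?thesis by simp
  qed
  show "smooth_fun A (W \<inter> F -` V) (\<lambda>y. \<psi> (F y) j)" if d: "(V, \<psi>) \<in> atlas M" "j \<in> index M" for V \<psi> j
  proof -
    note op = op[OF charts_mopen[OF atlas_charts[OF M d(1)]]]
    have "smooth_fun A (W \<inter> F -` V) (\<lambda>y. \<psi> (inv_into U \<phi> (\<phi> (F y))) j)"
    proof (rule smooth_fun_Cinf_compose[OF A smooth_manifold_finite[OF M] op _ _ chartsD(4)[OF c d]])
      show "smooth_fun A (W \<inter> F -` V) (\<lambda>y. \<phi> (F y) i)" if "i \<in> index M" for i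
        by (rule smooth_fun_subset[OF F(2)[OF that] op]) blast
      show "(\<lambda>y. \<phi> (F y)) ` (W \<inter> F -` V) \<subseteq> \<phi> ` (U \<inter> V)" using F(1) by blast
    qed
    then show ?thesis
      by (rule smooth_fun_cong[OF A]) (use F(1) inj in \<open>auto simp: image_subset_iff\<close>)
  qed
qed

section \<open>Tangent vectors\<close>

lemma tangent_spaceD:
  assumes "v \<in> tangent_space M p"
  shows "\<not> smooth_at M p f \<Longrightarrow> v f = 0"
    and "smooth_at M p f \<Longrightarrow> smooth_at M p g \<Longrightarrow> v (\<lambda>q. a * f q + b * g q) = a * v f + b * v g"
    and "smooth_at M p f \<Longrightarrow> smooth_at M p g \<Longrightarrow> v (\<lambda>q. f q * g q) = v f * g p + f p * v g"
    and "smooth_at M p f \<Longrightarrow> smooth_at M p g \<Longrightarrow> mopen M W \<Longrightarrow> p \<in> W \<Longrightarrow> (\<And>q. q \<in> W \<Longrightarrow> f q = g q) \<Longrightarrow> v f = v g"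
proof -
  note v = assms[unfolded tangent_space_def mem_Collect_eq]
  show "\<not> smooth_at M p f \<Longrightarrow> v f = 0" using v by (elim conjE) simp
  show "smooth_at M p f \<Longrightarrow> smooth_at M p g \<Longrightarrow> v (\<lambda>q. a * f q + b * g q) = a * v f + b * v g"
    using v by (elim conjE) simp
  show "smooth_at M p f \<Longrightarrow> smooth_at M p g \<Longrightarrow> v (\<lambda>q. f q * g q) = v f * g p + f p * v g"
    using v by (elim conjE) simp
  have "\<forall>f g W. smooth_at M p f \<and> smooth_at M p g \<and> mopen M W \<and> p \<in> W \<and> (\<forall>q\<in>W. f q = g q) \<longrightarrow> v f = v g"
    using v by (elim conjE)
  then show "smooth_at M p f \<Longrightarrow> smooth_at M p g \<Longrightarrow> mopen M W \<Longrightarrow> p \<in> W \<Longrightarrow> (\<And>q. q \<in> W \<Longrightarrow> f q = g q) \<Longrightarrow> v f = v g"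
    by (elim allE[of _ f] allE[of _ g] allE[of _ W] impE) auto
qed

lemma tangent_spaceI:
  assumes "\<And>f. \<not> smooth_at M p f \<Longrightarrow> v f = 0"
    and "\<And>f g W. smooth_at M p f \<Longrightarrow> smooth_at M p g \<Longrightarrow> mopen M W \<Longrightarrow> p \<in> W \<Longrightarrow> (\<And>q. q \<in> W \<Longrightarrow> f q = g q) \<Longrightarrow> v f = v g"
    and "\<And>f g a b. smooth_at M p f \<Longrightarrow> smooth_at M p g \<Longrightarrow> v (\<lambda>q. a * f q + b * g q) = a * v f + b * v g"
    and "\<And>f g. smooth_at M p f \<Longrightarrow> smooth_at M p g \<Longrightarrow> v (\<lambda>q. f q * g q) = v f * g p + f p * v g"
  shows "v \<in> tangent_space M p"
  unfolding tangent_space_def mem_Collect_eq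
proof (intro conjI allI impI)
  show "v f = 0" if "\<not> smooth_at M p f" for f using that by (rule assms(1))
  show "v f = v g" if "smooth_at M p f \<and> smooth_at M p g \<and> mopen M W \<and> p \<in> W \<and> (\<forall>q\<in>W. f q = g q)" for f g W
    by (rule assms(2)[of f g W]) (use that in auto)
  show "v (\<lambda>q. a * f q + b * g q) = a * v f + b * v g" if "smooth_at M p f \<and> smooth_at M p g" for f g a b
    using that by (elim conjE) (rule assms(3))
  show "v (\<lambda>q. f q * g q) = v f * g p + f p * v g" if "smooth_at M p f \<and> smooth_at M p g" for f g
    using that by (elim conjE) (rule assms(4))
qed

lemma tangent_germ:
  assumes M: "inj_atlas M" and v: "v \<in> tangent_space M p"
    and W: "mopen M W" "p \<in> W" "\<And>q. q \<in> W \<Longrightarrow> f q = g q"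
  shows "v f = v g"
proof (cases "smooth_at M p f")
  case True
  have "smooth_at M p g" by (rule smooth_at_cong[OF M W(1,2) _ True]) (rule W(3))
  with True show ?thesis using W by (rule tangent_spaceD(4)[OF v])
next
  case False
  have "\<not> smooth_at M p g"
  proof
    assume "smooth_at M p g"
    then have "smooth_at M p f" by (rule smooth_at_cong[OF M W(1,2), rotated]) (simp add: W(3))
    with False show False ..
  qed
  with False show ?thesis using tangent_spaceD(1)[OF v] by simp
qed

lemma smooth_at_lincomb:
  assumes M: "inj_atlas M" and "smooth_at M p f" "smooth_at M p g"
  shows "smooth_at M p (\<lambda>q. a * f q + b * g q)" "smooth_at M p (\<lambda>q. f q * g q)"
proof -
  obtain V where V: "p \<in> V" "smooth_fun M V f" using assms(2) by (auto simp: smooth_at_def)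
  obtain W where W: "p \<in> W" "smooth_fun M W g" using assms(3) by (auto simp: smooth_at_def)
  have VW: "mopen M (V \<inter> W)" by (rule mopen_Int[OF M smooth_fun_mopen[OF V(2)] smooth_fun_mopen[OF W(2)]])
  have "smooth_fun M (V \<inter> W) f" "smooth_fun M (V \<inter> W) g"
    by (rule smooth_fun_subset[OF V(2) VW], blast) (rule smooth_fun_subset[OF W(2) VW], blast)
  note sm = smooth_fun_lincomb[OF M this, of a b] smooth_fun_mult[OF M this]
  show "smooth_at M p (\<lambda>q. a * f q + b * g q)" "smooth_at M p (\<lambda>q. f q * g q)"
    using sm V(1) W(1) by (auto simp: smooth_at_def)
qed

lemma tangent_space_subspace: "subspace (tangent_space M p)"
proof (rule subspaceI)
  show "0 \<in> tangent_space M p" by (rule tangent_spaceI) (simp_all add: zero_fun_def)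
  fix u v :: "'a tvec" and c :: real assume u: "u \<in> tangent_space M p"
  note Du = tangent_spaceD[OF u]
  show "c *\<^sub>R u \<in> tangent_space M p"
  proof (rule tangent_spaceI)
    show "(c *\<^sub>R u) f = (c *\<^sub>R u) g" if "smooth_at M p f" "smooth_at M p g" "mopen M W" "p \<in> W" "\<And>q. q \<in> W \<Longrightarrow> f q = g q" for f g W
      using Du(4)[OF that] by (simp add: scaleR_fun_def)
  qed (simp_all add: scaleR_fun_def Du(1,2,3) algebra_simps)
  assume v: "v \<in> tangent_space M p"
  note Dv = tangent_spaceD[OF v]
  show "u + v \<in> tangent_space M p"
  proof (rule tangent_spaceI)
    show "(u + v) f = (u + v) g" if "smooth_at M p f" "smooth_at M p g" "mopen M W" "p \<in> W" "\<And>q. q \<in> W \<Longrightarrow> f q = g q" for f g W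
      using Du(4)[OF that] Dv(4)[OF that] by (simp add: plus_fun_def)
  qed (simp_all add: plus_fun_def Du(1,2,3) Dv(1,2,3) algebra_simps)
qed

lemma smooth_at_const: "smooth_manifold M \<Longrightarrow> p \<in> carrier M \<Longrightarrow> smooth_at M p (\<lambda>q. c)"
  using smooth_fun_const[OF smooth_manifold_inj_atlas mopen_carrier, of M c] by (auto simp: smooth_at_def)

lemma tangent_const:
  assumes "smooth_manifold M" "p \<in> carrier M" "v \<in> tangent_space M p"
  shows "v (\<lambda>q. c) = 0"
proof -
  note s = smooth_at_const[OF assms(1,2), of 1]
  have "v (\<lambda>q. 1 * 1) = v (\<lambda>q. 1) * 1 + 1 * v (\<lambda>q. 1)"
    using tangent_spaceD(3)[OF assms(3) s s] .
  then have "v (\<lambda>q. 1) = 0" by simp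
  then show ?thesis using tangent_spaceD(2)[OF assms(3) s s, of c 0] by simp
qed

lemma tangent_sum_fun: "(\<Sum>k\<in>K. f k) x = (\<Sum>k\<in>K. f k x :: real)"
  by (induction K rule: infinite_finite_induct) (auto simp: zero_fun_def plus_fun_def)

text \<open>
  The value \<open>0\<close> on functions that are not smooth at \<open>p\<close> is the
  normalisation of tangent vectors.
\<close>

definition coordinate_vector :: "('a, 'i) mfd \<Rightarrow> 'a set \<Rightarrow> ('a \<Rightarrow> 'i \<Rightarrow> real) \<Rightarrow> 'a \<Rightarrow> 'i \<Rightarrow> 'a tvec"
  where "coordinate_vector M U \<phi> p i =
    (\<lambda>f. if smooth_at M p f then pderiv_at i (\<lambda>x. f (inv_into U \<phi> x)) (\<phi> p) else 0)"

lemma coordinate_vector_tangent: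
  assumes M: "smooth_manifold M" and c: "(U, \<phi>) \<in> charts M" and p: "p \<in> U" and i: "i \<in> index M"
  shows "coordinate_vector M U \<phi> p i \<in> tangent_space M p"
proof -
  note A = smooth_manifold_inj_atlas[OF M] and fin = smooth_manifold_finite[OF M]
  have inj: "inj_on \<phi> U" by (rule chartsD(2)[OF c])
  let ?h = "\<lambda>f x. f (inv_into U \<phi> x) :: real"
  have common: "\<exists>S. \<phi> p \<in> S \<and> Cinf_on (index M) S (?h f) \<and> Cinf_on (index M) S (?h g)"
    if fg: "smooth_at M p f" "smooth_at M p g" for f g
  proof -
    obtain V where V: "p \<in> V" "smooth_fun M V f" using fg by (auto simp: smooth_at_def)
    obtain W where W: "p \<in> W" "smooth_fun M W g" using fg by (auto simp: smooth_at_def)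
    have VW: "mopen M (V \<inter> W)" by (rule mopen_Int[OF A smooth_fun_mopen[OF V(2)] smooth_fun_mopen[OF W(2)]])
    have "Cinf_on (index M) (\<phi> ` (U \<inter> (V \<inter> W))) (?h f)" "Cinf_on (index M) (\<phi> ` (U \<inter> (V \<inter> W))) (?h g)"
      by (rule smooth_fun_chart[OF M smooth_fun_subset[OF V(2) VW] c], blast)
        (rule smooth_fun_chart[OF M smooth_fun_subset[OF W(2) VW] c], blast)
    then show ?thesis using p V(1) W(1) by (intro exI[of _ "\<phi> ` (U \<inter> (V \<inter> W))"]) simp
  qed
  have germ: "pderiv_at i (?h f) (\<phi> p) = pderiv_at i (?h g) (\<phi> p)"
    if "mopen M W" "p \<in> W" "\<forall>q\<in>W. f q = g q" for f g W
    by (rule pderiv_at_cong[OF fin charts_open_image[OF M c that(1)] i])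
      (use p that inj in auto)
  have lin: "pderiv_at i (?h (\<lambda>q. a * f q + b * g q)) (\<phi> p) = a * pderiv_at i (?h f) (\<phi> p) + b * pderiv_at i (?h g) (\<phi> p)"
    and mul: "pderiv_at i (?h (\<lambda>q. f q * g q)) (\<phi> p) = pderiv_at i (?h f) (\<phi> p) * g p + f p * pderiv_at i (?h g) (\<phi> p)"
    if fg: "smooth_at M p f" "smooth_at M p g" for f g a b
  proof -
    obtain S where S: "\<phi> p \<in> S" "Cinf_on (index M) S (?h f)" "Cinf_on (index M) S (?h g)" using common[OF fg] by blast
    show "pderiv_at i (?h (\<lambda>q. a * f q + b * g q)) (\<phi> p) = a * pderiv_at i (?h f) (\<phi> p) + b * pderiv_at i (?h g) (\<phi> p)"
      by (rule pderiv_at_lincomb[OF S(2,3) i S(1)])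
    show "pderiv_at i (?h (\<lambda>q. f q * g q)) (\<phi> p) = pderiv_at i (?h f) (\<phi> p) * g p + f p * pderiv_at i (?h g) (\<phi> p)"
      using pderiv_at_mult[OF S(2,3) i S(1)] inv_into_f_f[OF inj p] by simp
  qed
  show ?thesis
  proof (rule tangent_spaceI)
    show "coordinate_vector M U \<phi> p i f = coordinate_vector M U \<phi> p i g"
      if "smooth_at M p f" "smooth_at M p g" "mopen M W" "p \<in> W" "\<And>q. q \<in> W \<Longrightarrow> f q = g q" for f g W
      using germ[of W f g] that by (simp add: coordinate_vector_def)
  qed (simp_all add: coordinate_vector_def lin mul smooth_at_lincomb[OF A])
qed

lemma coordinate_vector_coordinate:
  assumes M: "smooth_manifold M" and c: "(U, \<phi>) \<in> charts M" and p: "p \<in> U" and i: "i \<in> index M"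
  shows "coordinate_vector M U \<phi> p i (\<lambda>q. \<phi> q k) = (if i = k then 1 else 0)"
proof -
  have "smooth_at M p (\<lambda>q. \<phi> q k)" by (rule smooth_fun_smooth_at[OF charts_smooth_coordinate[OF M c] p])
  moreover have "pderiv_at i (\<lambda>x. \<phi> (inv_into U \<phi> x) k) (\<phi> p) = pderiv_at i (\<lambda>x. x k) (\<phi> p)"
    by (rule pderiv_at_cong[OF smooth_manifold_finite[OF M] chartsD(3)[OF c] i])
      (use p in \<open>auto simp: chartsD(2)[OF c]\<close>)
  ultimately show ?thesis by (simp add: coordinate_vector_def pderiv_at_coordinate)
qed

text \<open>
  The one-coordinate Hadamard lemma freezes the coordinates of \<open>f\<close> at
  \<open>p\<close> one after another. By the product rule each step contributes one summand, and
  in the end \<open>v\<close> is applied to a constant.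
\<close>

lemma tangent_vector_coordinates:
  assumes M: "smooth_manifold M" and c: "(U, \<phi>) \<in> charts M" and p: "p \<in> U"
    and v: "v \<in> tangent_space M p" and f: "smooth_at M p f"
  shows "v f = (\<Sum>i\<in>index M. v (\<lambda>q. \<phi> q i) * pderiv_at i (\<lambda>x. f (inv_into U \<phi> x)) (\<phi> p))"
proof -
  note A = smooth_manifold_inj_atlas[OF M] and fin = smooth_manifold_finite[OF M]
  have inj: "inj_on \<phi> U" by (rule chartsD(2)[OF c])
  have pc: "p \<in> carrier M" using p chartsD(1)[OF c] by blast
  define I where "I = index M"
  define a where "a = \<phi> p"
  have fin: "finite I" using fin by (simp add: I_def)
  obtain W where W: "p \<in> W" "smooth_fun M W f" using f by (auto simp: smooth_at_def)
  have f_C: "Cinf_on I (\<phi> ` (U \<inter> W)) (\<lambda>x. f (inv_into U \<phi> x))"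
    unfolding I_def by (rule smooth_fun_chart[OF M W(2) c])
  have aW: "a \<in> \<phi> ` (U \<inter> W)" using p W(1) by (auto simp: a_def)
  obtain e where e: "e > 0" "cube I a e \<subseteq> \<phi> ` (U \<inter> W)"
    using Cinf_on_open[OF f_C] coord_open_iff[OF fin] aW by blast
  define B where "B = cube I a e"
  have B: "coord_open I B" unfolding B_def by (rule coord_open_cube[OF fin])
  have a_sp: "a \<in> coord_space I" using charts_space[OF c p] by (simp add: a_def I_def)
  have aB: "a \<in> B" unfolding B_def by (rule cube_center[OF a_sp e(1)])
  define X where "X = {q \<in> U. \<phi> q \<in> B}"
  have X: "mopen M X" unfolding X_def by (rule chart_vimage_mopen[OF M c B[unfolded I_def]])
  have pX: "p \<in> X" using p aB by (simp add: X_def a_def)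
  have coord: "smooth_fun M X (\<lambda>q. \<phi> q i)" for i
    by (rule smooth_fun_subset[OF charts_smooth_coordinate[OF M c] X]) (auto simp: X_def)
  have comp: "smooth_at M p (\<lambda>q. h (\<phi> q))" if "Cinf_on I B h" for h
    by (rule smooth_fun_smooth_at[OF smooth_fun_Cinf_compose[OF A fin X coord _ that] pX]) (auto simp: X_def)
  \<comment> \<open>\<open>pr K\<close> freezes the coordinates in \<open>K\<close> at their values at \<open>p\<close>.\<close>
  define pr where "pr K x = (\<lambda>i. if i \<in> K then a i else x i)" for K and x :: "_ \<Rightarrow> real"
  have prB: "pr K x \<in> B" if "x \<in> B" "K \<subseteq> I" for K x
    using that a_sp e(1) by (auto simp: B_def cube_def pr_def coord_space_def)
  have pr_C: "Cinf_on I B (\<lambda>x. pr K x i)" for K i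
    by (cases "i \<in> K") (simp_all add: pr_def Cinf_on_const[OF fin B] Cinf_on_coordinate[OF fin B])
  have key: "K \<subseteq> I \<Longrightarrow> v (\<lambda>q. h (\<phi> q)) = v (\<lambda>q. h (pr K (\<phi> q))) + (\<Sum>k\<in>K. v (\<lambda>q. \<phi> q k) * pderiv_at k h a)"
    if "finite K" and h: "Cinf_on I B h" for K h
    using that(1)
  proof (induction K)
    case empty
    then show ?case by (simp add: pr_def)
  next
    case (insert k K)
    then have k: "k \<in> I" and K: "K \<subseteq> I" by auto
    define h' where "h' x = h (pr K x)" for x
    have h': "Cinf_on I B h'" unfolding h'_def[abs_def]
      by (rule Cinf_on_compose[OF fin B fin _ pr_C h]) (use prB K in blast)
    have seg: "x(k := a k + t * (x k - a k)) \<in> B" if "x \<in> B" "t \<in> {0..1}" for x t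
    proof -
      have "\<bar>t * (x k - a k)\<bar> \<le> 1 * \<bar>x k - a k\<bar>"
        unfolding abs_mult using that(2) by (intro mult_right_mono) auto
      also have "\<dots> < e" using that(1) k by (auto simp: B_def cube_def)
      finally show ?thesis using that(1) k unfolding B_def by (intro cube_upd) auto
    qed
    obtain g where g: "Cinf_on I B g" "\<And>x. x \<in> B \<Longrightarrow> h' x = h' (x(k := a k)) + (x k - a k) * g x"
      "\<And>x. x \<in> B \<Longrightarrow> x k = a k \<Longrightarrow> g x = pderiv_at k h' x"
      using hadamard_coordinate[OF fin h' k seg] by blast
    have upd: "h' (x(k := a k)) = h (pr (insert k K) x)" for x
      unfolding h'_def pr_def by (rule arg_cong[of _ _ h]) (use insert.hyps in auto)
    have ga: "g a = pderiv_at k h a"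
    proof -
      have pa: "pr K (a(k := t)) = a(k := t)" for t using insert.hyps by (auto simp: pr_def)
      have "pderiv_at k h' a = pderiv_at k h a" unfolding pderiv_at_def h'_def pa ..
      then show ?thesis using g(3)[OF aB] by simp
    qed
    have s1: "smooth_at M p (\<lambda>q. h (pr (insert k K) (\<phi> q)))"
      by (rule comp[OF Cinf_on_compose[OF fin B fin _ pr_C h]]) (use prB insert.prems in blast)
    have s2: "smooth_at M p (\<lambda>q. g (\<phi> q))" by (rule comp[OF g(1)])
    have s3: "smooth_at M p (\<lambda>q. \<phi> q k)" by (rule smooth_fun_smooth_at[OF coord pX])
    \<comment> \<open>\<open>\<phi> q k - a k\<close>, in the form to which linearity of derivations applies\<close>
    have s4: "smooth_at M p (\<lambda>q. 1 * \<phi> q k + (- a k) * 1)"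
      by (rule smooth_at_lincomb(1)[OF A s3 smooth_at_const[OF M pc]])
    have s5: "smooth_at M p (\<lambda>q. (1 * \<phi> q k + (- a k) * 1) * g (\<phi> q))" by (rule smooth_at_lincomb(2)[OF A s4 s2])
    have "v (\<lambda>q. h' (\<phi> q)) = v (\<lambda>q. 1 * h (pr (insert k K) (\<phi> q)) + 1 * ((1 * \<phi> q k + (- a k) * 1) * g (\<phi> q)))"
    proof (rule tangent_germ[OF A v X pX])
      fix q assume "q \<in> X"
      then have "\<phi> q \<in> B" by (simp add: X_def)
      from g(2)[OF this] show "h' (\<phi> q) = 1 * h (pr (insert k K) (\<phi> q)) + 1 * ((1 * \<phi> q k + (- a k) * 1) * g (\<phi> q))"
        unfolding upd by simp
    qed
    also have "\<dots> = v (\<lambda>q. h (pr (insert k K) (\<phi> q))) + v (\<lambda>q. (1 * \<phi> q k + (- a k) * 1) * g (\<phi> q))"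
      using tangent_spaceD(2)[OF v s1 s5, of 1 1] by simp
    also have "v (\<lambda>q. (1 * \<phi> q k + (- a k) * 1) * g (\<phi> q)) = v (\<lambda>q. 1 * \<phi> q k + (- a k) * 1) * g (\<phi> p) + 0"
      using tangent_spaceD(3)[OF v s4 s2] by (simp add: a_def)
    also have "v (\<lambda>q. 1 * \<phi> q k + (- a k) * 1) = v (\<lambda>q. \<phi> q k)"
      using tangent_spaceD(2)[OF v s3 smooth_at_const[OF M pc, of 1], of 1 "- a k"] tangent_const[OF M pc v] by simp
    finally have "v (\<lambda>q. h' (\<phi> q)) = v (\<lambda>q. h (pr (insert k K) (\<phi> q))) + v (\<lambda>q. \<phi> q k) * pderiv_at k h a"
      using ga by (simp add: a_def)
    then show ?case using insert.IH[OF K] insert.hyps by (simp add: h'_def)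
  qed
  let ?h = "\<lambda>x. f (inv_into U \<phi> x)"
  have h_C: "Cinf_on I B ?h" by (rule Cinf_on_subset[OF f_C B]) (use e(2) in \<open>simp add: B_def\<close>)
  have "v f = v (\<lambda>q. ?h (\<phi> q))" by (rule tangent_germ[OF A v X pX]) (use inj in \<open>auto simp: X_def\<close>)
  also have "\<dots> = v (\<lambda>q. ?h (pr I (\<phi> q))) + (\<Sum>k\<in>I. v (\<lambda>q. \<phi> q k) * pderiv_at k ?h a)"
    by (rule key[OF fin h_C order_refl])
  also have "v (\<lambda>q. ?h (pr I (\<phi> q))) = v (\<lambda>q. ?h a)"
  proof (rule tangent_germ[OF A v X pX])
    fix q assume "q \<in> X"
    then have "\<phi> q \<in> coord_space I" by (auto simp: X_def B_def cube_def)
    then have "pr I (\<phi> q) = a" using a_sp by (auto simp: pr_def coord_space_def)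
    then show "?h (pr I (\<phi> q)) = ?h a" by simp
  qed
  also have "\<dots> = 0" by (rule tangent_const[OF M pc v])
  finally show ?thesis by (simp add: I_def a_def)
qed

text \<open>
  The coordinate vectors of a chart are a basis, by their values on the coordinates and by
  \<open>tangent_vector_coordinates\<close>.
\<close>

lemma tangent_space_dim:
  assumes M: "smooth_manifold M" and p: "p \<in> carrier M"
  shows "dim (tangent_space M p) = card (index M)"
proof -
  obtain U \<phi> where c: "(U, \<phi>) \<in> charts M" "p \<in> U"
    using carrierE[OF p] atlas_charts[OF M] by metis
  let ?e = "coordinate_vector M U \<phi> p"
  note fin = smooth_manifold_finite[OF M]
  have e: "?e i (\<lambda>q. \<phi> q k) = (if i = k then 1 else 0)" if "i \<in> index M" for i k
    by (rule coordinate_vector_coordinate[OF M c that])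
  have inj: "inj_on ?e (index M)"
  proof (rule inj_onI)
    fix i j assume ij: "i \<in> index M" "j \<in> index M" "?e i = ?e j"
    then have "?e i (\<lambda>q. \<phi> q j) = ?e j (\<lambda>q. \<phi> q j)" by simp
    then show "i = j" using e ij(1,2) by (simp split: if_splits)
  qed
  have indep: "independent (?e ` index M)"
  proof
    assume "dependent (?e ` index M)"
    then obtain w x where w: "(\<Sum>x\<in>?e ` index M. w x *\<^sub>R x) = 0" and x: "x \<in> ?e ` index M" "w x \<noteq> 0"
      using dependent_finite[of "?e ` index M"] fin by auto
    then obtain k where k: "k \<in> index M" "x = ?e k" by blast
    have "0 = (\<Sum>i\<in>index M. w (?e i) *\<^sub>R ?e i) (\<lambda>q. \<phi> q k)"
      using w by (simp add: sum.reindex[OF inj] zero_fun_def)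
    also have "\<dots> = (\<Sum>i\<in>index M. w (?e i) * (if i = k then 1 else 0))"
      unfolding tangent_sum_fun by (intro sum.cong) (simp_all add: scaleR_fun_def e)
    also have "\<dots> = (\<Sum>i\<in>index M. if i = k then w (?e k) else 0)" by (intro sum.cong) auto
    also have "\<dots> = w x" using fin k by simp
    finally show False using x(2) by simp
  qed
  have "v \<in> span (?e ` index M)" if v: "v \<in> tangent_space M p" for v
  proof -
    have "v = (\<Sum>i\<in>index M. v (\<lambda>q. \<phi> q i) *\<^sub>R ?e i)"
    proof
      fix f
      show "v f = (\<Sum>i\<in>index M. v (\<lambda>q. \<phi> q i) *\<^sub>R ?e i) f"
        using tangent_vector_coordinates[OF M c v] tangent_spaceD(1)[OF v]
        by (cases "smooth_at M p f") (simp_all add: tangent_sum_fun scaleR_fun_def coordinate_vector_def)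
    qed
    also have "\<dots> \<in> span (?e ` index M)" by (intro span_sum span_scale span_base) blast
    finally show ?thesis .
  qed
  then show ?thesis
    using coordinate_vector_tangent[OF M c] card_image[OF inj] by (intro dim_unique[OF _ _ indep]) auto
qed

lemma dim_injective_image:
  fixes T :: "'v::real_vector \<Rightarrow> 'w::real_vector"
  assumes T: "linear T" and V: "subspace V" and inj: "inj_on T V"
  shows "dim (T ` V) = dim V"
proof -
  obtain B where B: "B \<subseteq> V" "independent B" "V \<subseteq> span B" "card B = dim V" by (rule basis_exists)
  have spB: "span B = V" using B(1,3) V by (simp add: span_minimal subset_antisym)
  have "independent (T ` B)"
    using linear_independent_injective_image[OF T B(2)] inj spB by simp
  moreover have "card (T ` B) = dim V"
    using card_image[OF inj_on_subset[OF inj B(1)]] B(4) by simp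
  moreover have "T ` V \<subseteq> span (T ` B)" using linear_span_image[OF T, of B] spB by simp
  ultimately show ?thesis using B(1) by (intro dim_unique[of "T ` B"]) auto
qed

lemma tangent_map_linear: "linear (tangent_map N F p)"
  by (intro linearI) (auto simp: tangent_map_def plus_fun_def scaleR_fun_def fun_eq_iff)

lemma tangent_map_in:
  assumes M: "smooth_manifold M" and N: "smooth_manifold N" and F: "smooth_map M W N F" and p: "p \<in> W"
    and v: "v \<in> tangent_space M p"
  shows "tangent_map N F p v \<in> tangent_space N (F p)"
proof -
  note A = smooth_manifold_inj_atlas[OF M] and B = smooth_manifold_inj_atlas[OF N]
  note pb = smooth_at_pullback[OF A N F p]
  have germ: "v (\<lambda>q. f (F q)) = v (\<lambda>q. g (F q))" if "mopen N V" "F p \<in> V" "\<forall>q\<in>V. f q = g q" for f g V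
    by (rule tangent_germ[OF A v smooth_map_vimage[OF F that(1)]]) (use p that in auto)
  show ?thesis
  proof (rule tangent_spaceI)
    show "tangent_map N F p v f = tangent_map N F p v g"
      if "smooth_at N (F p) f" "smooth_at N (F p) g" "mopen N V" "F p \<in> V" "\<And>q. q \<in> V \<Longrightarrow> f q = g q" for f g V
      using germ[of V f g] that by (simp add: tangent_map_def comp_def)
  qed (simp_all add: tangent_map_def comp_def tangent_spaceD(2,3)[OF v pb pb] smooth_at_lincomb[OF B])
qed

lemma tangent_map_compose:
  assumes N: "inj_atlas N" and P: "smooth_manifold P" and G: "smooth_map N V P G" and p: "F p \<in> V"
  shows "tangent_map P G (F p) (tangent_map N F p v) = tangent_map P (\<lambda>q. G (F q)) p v"
  using smooth_at_pullback[OF N P G p] by (auto simp: tangent_map_def fun_eq_iff comp_def)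

lemma tangent_map_cong:
  assumes M: "inj_atlas M" and v: "v \<in> tangent_space M p" and W: "mopen M W" "p \<in> W" "\<And>q. q \<in> W \<Longrightarrow> F q = G q"
  shows "tangent_map N F p v = tangent_map N G p v"
proof
  fix g
  have "v (\<lambda>q. g (F q)) = v (\<lambda>q. g (G q))" by (rule tangent_germ[OF M v W(1,2)]) (simp add: W(3))
  then show "tangent_map N F p v g = tangent_map N G p v g"
    by (simp add: tangent_map_def comp_def W(3)[OF W(2)])
qed

lemma tangent_map_ident:
  assumes M: "inj_atlas M" and v: "v \<in> tangent_space M p" and W: "mopen M W" "p \<in> W" "\<And>q. q \<in> W \<Longrightarrow> F q = q"
  shows "tangent_map M F p v = v"
proof -
  have "tangent_map M F p v = tangent_map M (\<lambda>q. q) p v" by (rule tangent_map_cong[OF M v W(1,2)]) (rule W(3))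
  also have "\<dots> = v" using tangent_spaceD(1)[OF v] by (auto simp: tangent_map_def fun_eq_iff comp_def)
  finally show ?thesis .
qed

lemma tangent_map_local_inverse:
  assumes M: "inj_atlas M" "smooth_manifold M" and N: "inj_atlas N" "smooth_manifold N"
    and F: "diffeo_on M U N V F" and p: "p \<in> U" and v: "v \<in> tangent_space M p"
  shows "tangent_map M (inv_into U F) (F p) (tangent_map N F p v) = v"
proof -
  note F = diffeo_onD[OF F]
  have "F p \<in> V" using F(5) p by blast
  then have "tangent_map M (inv_into U F) (F p) (tangent_map N F p v) = tangent_map M (\<lambda>q. inv_into U F (F q)) p v"
    by (rule tangent_map_compose[OF N(1) M(2) F(7)])
  also have "\<dots> = v" by (rule tangent_map_ident[OF M(1) v F(1) p]) (use F(4) in simp)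
  finally show ?thesis .
qed

lemma diffeo_on_tangent_bij:
  assumes M: "smooth_manifold M" and N: "smooth_manifold N"
    and F: "diffeo_on M U N V F" and p: "p \<in> U"
  shows "bij_betw (tangent_map N F p) (tangent_space M p) (tangent_space N (F p))"
proof -
  note A = smooth_manifold_inj_atlas[OF M] and B = smooth_manifold_inj_atlas[OF N]
  note F' = diffeo_onD[OF F]
  have Fp: "F p \<in> V" "inv_into U F (F p) = p" using F'(4,5) p by auto
  show ?thesis
  proof (rule bij_betw_byWitness[where f' = "tangent_map M (inv_into U F) (F p)"])
    show "\<forall>v\<in>tangent_space M p. tangent_map M (inv_into U F) (F p) (tangent_map N F p v) = v"
      using tangent_map_local_inverse[OF A M B N F p] by blast
    show "tangent_map N F p ` tangent_space M p \<subseteq> tangent_space N (F p)"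
      using tangent_map_in[OF M N F'(6) p] by blast
    show "tangent_map M (inv_into U F) (F p) ` tangent_space N (F p) \<subseteq> tangent_space M p"
      using tangent_map_in[OF N M F'(7) Fp(1)] unfolding Fp(2) by blast
    show "\<forall>w\<in>tangent_space N (F p). tangent_map N F p (tangent_map M (inv_into U F) (F p) w) = w"
    proof
      fix w assume w: "w \<in> tangent_space N (F p)"
      have "tangent_map N F (inv_into U F (F p)) (tangent_map M (inv_into U F) (F p) w) =
          tangent_map N (\<lambda>q. F (inv_into U F q)) (F p) w"
        by (rule tangent_map_compose[OF A N F'(6)]) (simp add: Fp p)
      also have "\<dots> = w" by (rule tangent_map_ident[OF B w F'(2) Fp(1)]) (use F'(5) in \<open>auto intro: f_inv_into_f\<close>)
      finally show "tangent_map N F p (tangent_map M (inv_into U F) (F p) w) = w" unfolding Fp(2) .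
    qed
  qed
qed

text \<open>
  Both index sets have the size of the dimension of the tangent spaces, which the tangent map
  identifies.
\<close>

lemma diffeo_on_card_index:
  assumes M: "smooth_manifold M" and N: "smooth_manifold N" and F: "diffeo_on M U N V F" and p: "p \<in> U"
  shows "card (index M) = card (index N)"
proof -
  have b: "bij_betw (tangent_map N F p) (tangent_space M p) (tangent_space N (F p))"
    by (rule diffeo_on_tangent_bij[OF assms])
  have "p \<in> carrier M" "F p \<in> carrier N"
    using p mopen_subset[OF diffeo_onD(1)[OF F]] smooth_map_image[OF diffeo_onD(6)[OF F] p] by auto
  then show ?thesis
    using dim_injective_image[OF tangent_map_linear tangent_space_subspace bij_betw_imp_inj_on[OF b]]
      bij_betw_imp_surj_on[OF b] tangent_space_dim[OF M] tangent_space_dim[OF N] by metis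
qed

section \<open>Submersions\<close>

text \<open>
  Surjectivity of the tangent map, evaluated on coordinate vectors of the target, makes the
  differentials of the coordinate functions of \<open>F\<close> independent, so that the straightening applies.
\<close>

lemma submersion_local_section:
  assumes M: "smooth_manifold M" and N: "smooth_manifold N" and F: "submersion M N F" and p: "p \<in> carrier M"
  obtains V s where "F p \<in> V" "smooth_map N V M s" "s (F p) = p" "\<And>y. y \<in> V \<Longrightarrow> F (s y) = y"
proof -
  note A = smooth_manifold_inj_atlas[OF M] and B = smooth_manifold_inj_atlas[OF N]
  have Fs: "smooth_map M (carrier M) N F" and surj: "tangent_map N F p ` tangent_space M p = tangent_space N (F p)"
    using F p by (auto simp: submersion_def)
  have Fp: "F p \<in> carrier N" by (rule smooth_map_image[OF Fs p])
  obtain U0 \<phi> where c0: "(U0, \<phi>) \<in> charts M" "p \<in> U0" using carrierE[OF p] atlas_charts[OF M] by metis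
  obtain V \<psi> where d: "(V, \<psi>) \<in> charts N" "F p \<in> V" using carrierE[OF Fp] atlas_charts[OF N] by metis
  define U where "U = U0 \<inter> (carrier M \<inter> F -` V)"
  have c: "(U, \<phi>) \<in> charts M" "p \<in> U"
    using charts_restrict[OF M c0(1) smooth_map_vimage[OF Fs charts_mopen[OF d(1)]]] c0(2) d(2) p by (auto simp: U_def)
  have inj: "inj_on \<phi> U" "inj_on \<psi> V" by (rule chartsD(2)[OF c(1)], rule chartsD(2)[OF d(1)])
  have FU: "F q \<in> V" if "q \<in> U" for q using that by (simp add: U_def)
  define f where "f x = \<psi> (F (inv_into U \<phi> x))" for x
  have fj: "smooth_fun M U (\<lambda>q. \<psi> (F q) j)" for j
    by (rule smooth_fun_subset[OF smooth_map_chart[OF A N Fs d(1)] charts_mopen[OF c(1)]]) (auto simp: U_def)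
  have f_C: "Cinf_on (index M) (\<phi> ` U) (\<lambda>x. f x j)" for j
    using smooth_fun_chart[OF M fj c(1), of j] unfolding f_def by simp
  have f_sp: "f ` \<phi> ` U \<subseteq> coord_space (index N)"
    using inj(1) FU charts_space[OF d(1)] by (auto simp: f_def)
  have indep: "\<forall>j\<in>index N. b j = 0"
    if b: "\<And>i. i \<in> index M \<Longrightarrow> (\<Sum>j\<in>index N. b j * pderiv_at i (\<lambda>x. f x j) (\<phi> p)) = 0" for b
  proof
    fix k assume k: "k \<in> index N"
    let ?w = "coordinate_vector N V \<psi> (F p) k"
    obtain v where v: "v \<in> tangent_space M p" "?w = tangent_map N F p v"
      using surj coordinate_vector_tangent[OF N d k] by blast
    have sj: "smooth_at N (F p) (\<lambda>y. \<psi> y j)" for j by (rule smooth_fun_smooth_at[OF charts_smooth_coordinate[OF N d(1)] d(2)])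
    have "b k = (\<Sum>j\<in>index N. if j = k then b k else 0)" using k smooth_manifold_finite[OF N] by simp
    also have "\<dots> = (\<Sum>j\<in>index N. b j * ?w (\<lambda>y. \<psi> y j))"
      by (intro sum.cong) (auto simp: coordinate_vector_coordinate[OF N d k])
    also have "\<dots> = (\<Sum>j\<in>index N. b j * v (\<lambda>q. \<psi> (F q) j))"
      using sj by (simp add: v(2) tangent_map_def comp_def)
    also have "\<dots> = (\<Sum>j\<in>index N. b j * (\<Sum>i\<in>index M. v (\<lambda>q. \<phi> q i) * pderiv_at i (\<lambda>x. f x j) (\<phi> p)))"
      unfolding f_def by (intro sum.cong refl arg_cong2[of _ _ _ _ "(*)"]
        tangent_vector_coordinates[OF M c v(1) smooth_fun_smooth_at[OF fj c(2)]])
    also have "\<dots> = (\<Sum>i\<in>index M. v (\<lambda>q. \<phi> q i) * (\<Sum>j\<in>index N. b j * pderiv_at i (\<lambda>x. f x j) (\<phi> p)))"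
      unfolding sum_distrib_left by (subst sum.swap) (simp only: mult.left_commute)
    also have "\<dots> = 0" using b by simp
    finally show "b k = 0" .
  qed
  have fp: "f (\<phi> p) = \<psi> (F p)" using inj(1) c(2) by (simp add: f_def)
  obtain T s where T: "coord_open (index N) T" "f (\<phi> p) \<in> T" and s: "s ` T \<subseteq> \<phi> ` U"
    "\<And>i. i \<in> index M \<Longrightarrow> Cinf_on (index N) T (\<lambda>y. s y i)" "s (f (\<phi> p)) = \<phi> p" "\<And>y. y \<in> T \<Longrightarrow> f (s y) = y"
    by (rule local_right_inverse[OF smooth_manifold_finite[OF M] smooth_manifold_finite[OF N] chartsD(3)[OF c(1)] f_C f_sp
      imageI[OF c(2)] indep], blast) (rule that)
  define V' where "V' = {y \<in> V. \<psi> y \<in> T}"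
  have V': "mopen N V'" unfolding V'_def by (rule chart_vimage_mopen[OF N d(1) T(1)])
  define \<sigma> where "\<sigma> y = inv_into U \<phi> (s (\<psi> y))" for y
  have \<sigma>U: "\<sigma> y \<in> U" and \<phi>\<sigma>: "\<phi> (\<sigma> y) = s (\<psi> y)" if "y \<in> V'" for y
  proof -
    have "s (\<psi> y) \<in> \<phi> ` U" using that s(1) by (auto simp: V'_def)
    then show "\<sigma> y \<in> U" "\<phi> (\<sigma> y) = s (\<psi> y)" unfolding \<sigma>_def by (rule inv_into_into, rule f_inv_into_f)
  qed
  show ?thesis
  proof (rule that[of V' \<sigma>])
    show "F p \<in> V'" using d(2) T(2) by (simp add: V'_def fp)
    show "\<sigma> (F p) = p" using s(3) inj(1) c(2) by (simp add: \<sigma>_def fp)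
    show "F (\<sigma> y) = y" if y: "y \<in> V'" for y
    proof -
      have "f (\<phi> (\<sigma> y)) = \<psi> y" using y s(4) by (simp add: \<phi>\<sigma>[OF y] V'_def)
      then have "\<psi> (F (\<sigma> y)) = \<psi> y" using \<sigma>U[OF y] inj(1) by (simp add: f_def)
      then show ?thesis using inj_onD[OF inj(2)] FU[OF \<sigma>U[OF y]] y by (simp add: V'_def)
    qed
    show "smooth_map N V' M \<sigma>"
    proof (rule smooth_map_into_chart[OF B M c(1) V'])
      show "\<sigma> ` V' \<subseteq> U" using \<sigma>U by blast
      fix i assume i: "i \<in> index M"
      have "smooth_fun N V' (\<lambda>y. s (\<psi> y) i)"
        by (rule smooth_fun_Cinf_compose[OF B smooth_manifold_finite[OF N] V' _ _ s(2)[OF i]])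
          (rule smooth_fun_subset[OF charts_smooth_coordinate[OF N d(1)] V'], auto simp: V'_def)
      then show "smooth_fun N V' (\<lambda>y. \<phi> (\<sigma> y) i)"
        by (rule smooth_fun_cong[OF B]) (simp add: \<phi>\<sigma>)
    qed
  qed
qed

text \<open>
  A local section through \<open>p\<close> pulls \<open>W\<close> back to a neighbourhood of
  \<open>F p\<close> in the image.
\<close>

lemma submersion_image_mopen:
  assumes M: "smooth_manifold M" and N: "smooth_manifold N" and F: "submersion M N F" and W: "mopen M W"
  shows "mopen N (F ` W)"
proof (rule mopen_subopen)
  fix y assume "y \<in> F ` W"
  then obtain p where p: "p \<in> W" "y = F p" by blast
  obtain V s where V: "F p \<in> V" "smooth_map N V M s" "s (F p) = p" "\<And>y. y \<in> V \<Longrightarrow> F (s y) = y"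
    using submersion_local_section[OF M N F] mopen_subset[OF W] p(1) by (metis subsetD)
  have "V \<inter> s -` W \<subseteq> F ` W"
  proof
    fix z assume "z \<in> V \<inter> s -` W"
    then show "z \<in> F ` W" using V(4)[of z] by (intro image_eqI[of z F "s z"]) auto
  qed
  then show "\<exists>X. y \<in> X \<and> X \<subseteq> F ` W \<and> mopen N X"
    using smooth_map_vimage[OF V(2) W] V(1,3) p by (intro exI[of _ "V \<inter> s -` W"]) auto
qed

text \<open>
  Near every point \<open>\<pi>\<close> is \<open>\<tau>\<close> composed with a local section of
  \<open>\<rho>\<close>, hence smooth; its tangent maps are onto because those of
  \<open>\<tau>\<close> are and factor through them.
\<close>

lemma submersion_descends:
  assumes M: "smooth_manifold M" and E: "smooth_manifold E" and Q: "smooth_manifold Q"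
    and \<rho>: "submersion M E \<rho>" "\<rho> ` carrier M = carrier E" and \<tau>: "submersion M Q \<tau>"
    and \<pi>: "\<And>p. p \<in> carrier M \<Longrightarrow> \<pi> (\<rho> p) = \<tau> p"
  shows "submersion E Q \<pi>"
proof -
  note A = smooth_manifold_inj_atlas[OF M] and B = smooth_manifold_inj_atlas[OF E]
  have \<tau>s: "smooth_map M (carrier M) Q \<tau>" and \<rho>s: "smooth_map M (carrier M) E \<rho>" using \<tau> \<rho> by (auto simp: submersion_def)
  have sm: "smooth_map E (carrier E) Q \<pi>"
  proof (rule smooth_map_local[OF B])
    fix e assume "e \<in> carrier E"
    then obtain p where p: "p \<in> carrier M" "e = \<rho> p" using \<rho>(2) by blast
    obtain V s where V: "\<rho> p \<in> V" "smooth_map E V M s" "s (\<rho> p) = p" "\<And>y. y \<in> V \<Longrightarrow> \<rho> (s y) = y"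
      by (rule submersion_local_section[OF M E \<rho>(1) p(1)]) (rule that)
    have sV: "s y \<in> carrier M" if "y \<in> V" for y by (rule smooth_map_image[OF V(2) that])
    have eq: "V \<inter> s -` carrier M = V" using sV by blast
    have "smooth_map E V Q (\<lambda>y. \<tau> (s y))" using smooth_map_compose[OF B M V(2) \<tau>s] unfolding eq .
    then have "smooth_map E V Q \<pi>"
      by (rule smooth_map_cong[OF B]) (use \<pi>[OF sV] V(4) in simp)
    then show "\<exists>V. e \<in> V \<and> V \<subseteq> carrier E \<and> smooth_map E V Q \<pi>"
      using V(1) p(2) mopen_subset[OF smooth_map_mopen[OF V(2)]] by blast
  qed
  have "tangent_map Q \<pi> e ` tangent_space E e = tangent_space Q (\<pi> e)" if e: "e \<in> carrier E" for e
  proof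
    show "tangent_map Q \<pi> e ` tangent_space E e \<subseteq> tangent_space Q (\<pi> e)"
      using tangent_map_in[OF E Q sm e] by blast
    obtain p where p: "p \<in> carrier M" "e = \<rho> p" using \<rho>(2) e by blast
    show "tangent_space Q (\<pi> e) \<subseteq> tangent_map Q \<pi> e ` tangent_space E e"
    proof
      fix w assume "w \<in> tangent_space Q (\<pi> e)"
      then have "w \<in> tangent_space Q (\<tau> p)" using \<pi>[OF p(1)] p(2) by simp
      then obtain v where v: "v \<in> tangent_space M p" "w = tangent_map Q \<tau> p v"
        using \<tau> p(1) by (auto simp: submersion_def)
      have "tangent_map Q \<pi> (\<rho> p) (tangent_map E \<rho> p v) = tangent_map Q (\<lambda>q. \<pi> (\<rho> q)) p v"
        by (rule tangent_map_compose[OF B Q sm]) (use e p(2) in simp)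
      also have "\<dots> = w" unfolding v(2)
        by (rule tangent_map_cong[OF A v(1) mopen_carrier[OF M] p(1)]) (rule \<pi>)
      finally show "w \<in> tangent_map Q \<pi> e ` tangent_space E e"
        using tangent_map_in[OF M E \<rho>s p(1) v(1)] p(2) by blast
    qed
  qed
  then show ?thesis using sm by (simp add: submersion_def)
qed

section \<open>Transport along diffeomorphisms\<close>

text \<open>
  Every notion in the definition of a polarised \<open>k\<close>-contact manifold is natural. The locale is
  symmetric in \<open>(M, F)\<close> and \<open>(N, G)\<close>; each notion is pushed forward along \<open>F\<close>, and quantifiers over
  objects on \<open>N\<close> are handled by pushing these forward along \<open>G\<close>.
\<close>

locale diffeomorphism =
  fixes M :: "('a, 'i) mfd" and N :: "('b, 'j) mfd" and F :: "'a \<Rightarrow> 'b" and G :: "'b \<Rightarrow> 'a"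
  assumes M: "smooth_manifold M" and N: "smooth_manifold N"
    and F: "smooth_map M (carrier M) N F" and G: "smooth_map N (carrier N) M G"
    and GF: "p \<in> carrier M \<Longrightarrow> G (F p) = p" and FG: "q \<in> carrier N \<Longrightarrow> F (G q) = q"
begin

lemma inverse: "diffeomorphism N M G F"
  by (rule diffeomorphism.intro[OF N M G F FG GF])

lemma A: "inj_atlas M" and B: "inj_atlas N"
  using M N smooth_manifold_inj_atlas by auto

lemma F_carrier: "p \<in> carrier M \<Longrightarrow> F p \<in> carrier N" and G_carrier: "q \<in> carrier N \<Longrightarrow> G q \<in> carrier M"
  using smooth_map_image[OF F] smooth_map_image[OF G] by auto

lemma F_image_eq: "W \<subseteq> carrier M \<Longrightarrow> F ` W = carrier N \<inter> G -` W"
proof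
  assume W: "W \<subseteq> carrier M"
  show "F ` W \<subseteq> carrier N \<inter> G -` W" using W F_carrier GF by auto
  show "carrier N \<inter> G -` W \<subseteq> F ` W"
  proof
    fix y assume "y \<in> carrier N \<inter> G -` W"
    then show "y \<in> F ` W" using FG[of y] by (intro image_eqI[of y F "G y"]) auto
  qed
qed

lemma F_image_mopen: "mopen M W \<Longrightarrow> mopen N (F ` W)"
  using F_image_eq[OF mopen_subset] smooth_map_vimage[OF G] by simp

lemma F_image_mem: "W \<subseteq> carrier M \<Longrightarrow> y \<in> F ` W \<Longrightarrow> y \<in> carrier N \<and> G y \<in> W \<and> F (G y) = y"
  using F_image_eq[of W] FG by auto

lemma G_image_F_image: "W \<subseteq> carrier M \<Longrightarrow> G ` F ` W = W"
  using GF by (force simp: image_image)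

lemma smooth_at_iff:
  assumes p: "p \<in> carrier M"
  shows "smooth_at N (F p) g \<longleftrightarrow> smooth_at M p (\<lambda>q. g (F q))"
proof
  assume "smooth_at N (F p) g"
  then show "smooth_at M p (\<lambda>q. g (F q))" by (rule smooth_at_pullback[OF A N F p])
next
  assume "smooth_at M p (\<lambda>q. g (F q))"
  then have "smooth_at N (F p) (\<lambda>y. g (F (G y)))"
    using smooth_at_pullback[OF B M G F_carrier[OF p], of "\<lambda>q. g (F q)"] GF[OF p] by simp
  then show "smooth_at N (F p) g"
    by (rule smooth_at_cong[OF B mopen_carrier[OF N] F_carrier[OF p], rotated]) (simp add: FG)
qed

lemma smooth_fun_push: "smooth_fun M W f \<Longrightarrow> smooth_fun N (F ` W) (\<lambda>y. f (G y))"
  using smooth_fun_pullback[OF B M G] F_image_eq[OF mopen_subset[OF smooth_fun_mopen]] by metis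

lemma smooth_fun_pull: "smooth_fun N W g \<Longrightarrow> smooth_fun M (carrier M \<inter> F -` W) (\<lambda>p. g (F p))"
  by (rule smooth_fun_pullback[OF A N F])

abbreviation dF :: "'a \<Rightarrow> 'a tvec \<Rightarrow> 'b tvec" where "dF \<equiv> tangent_map N F"
abbreviation dG :: "'b \<Rightarrow> 'b tvec \<Rightarrow> 'a tvec" where "dG \<equiv> tangent_map M G"

lemma dF_in: "p \<in> carrier M \<Longrightarrow> v \<in> tangent_space M p \<Longrightarrow> dF p v \<in> tangent_space N (F p)"
  by (rule tangent_map_in[OF M N F])

lemma dF_apply:
  assumes "p \<in> carrier M" "v \<in> tangent_space M p"
  shows "dF p v g = v (\<lambda>q. g (F q))"
  using smooth_at_iff[OF assms(1), of g] tangent_spaceD(1)[OF assms(2), of "\<lambda>q. g (F q)"]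
  by (auto simp: tangent_map_def comp_def)

lemma dG_dF:
  assumes p: "p \<in> carrier M" and v: "v \<in> tangent_space M p"
  shows "dG (F p) (dF p v) = v"
proof -
  have "dG (F p) (dF p v) = tangent_map M (\<lambda>q. G (F q)) p v"
    by (rule tangent_map_compose[OF B M G]) (rule F_carrier[OF p])
  also have "\<dots> = v" by (rule tangent_map_ident[OF A v mopen_carrier[OF M] p GF])
  finally show ?thesis .
qed

lemma dF_inj: "p \<in> carrier M \<Longrightarrow> inj_on (dF p) (tangent_space M p)"
  by (rule inj_on_inverseI) (rule dG_dF)

lemma dG_in: "p \<in> carrier M \<Longrightarrow> w \<in> tangent_space N (F p) \<Longrightarrow> dG (F p) w \<in> tangent_space M p"
  using tangent_map_in[OF N M G F_carrier] GF by metis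

lemma dF_dG:
  assumes p: "p \<in> carrier M" and w: "w \<in> tangent_space N (F p)"
  shows "dF p (dG (F p) w) = w"
  using diffeomorphism.dG_dF[OF inverse F_carrier[OF p] w] GF[OF p] by simp

lemma dF_image_tangent: "p \<in> carrier M \<Longrightarrow> dF p ` tangent_space M p = tangent_space N (F p)"
proof
  assume p: "p \<in> carrier M"
  show "dF p ` tangent_space M p \<subseteq> tangent_space N (F p)" using dF_in[OF p] by blast
  show "tangent_space N (F p) \<subseteq> dF p ` tangent_space M p"
  proof
    fix w assume w: "w \<in> tangent_space N (F p)"
    then show "w \<in> dF p ` tangent_space M p" using dF_dG[OF p w] dG_in[OF p w] by (metis imageI)
  qed
qed

definition push :: "('a \<Rightarrow> 'a tvec) \<Rightarrow> 'b \<Rightarrow> 'b tvec"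
  where "push X y = dF (G y) (X (G y))"

lemma push_F: "p \<in> carrier M \<Longrightarrow> push X (F p) = dF p (X p)"
  by (simp add: push_def GF)

lemma vector_fieldD:
  assumes "vector_field M U X"
  shows "mopen M U" "p \<in> U \<Longrightarrow> p \<in> carrier M" "p \<in> U \<Longrightarrow> X p \<in> tangent_space M p"
    "smooth_fun M W f \<Longrightarrow> smooth_fun M (U \<inter> W) (\<lambda>p. X p f)"
  using assms mopen_subset[of M U] by (auto simp: vector_field_def)

lemma push_vector_field:
  assumes X: "vector_field M U X" shows "vector_field N (F ` U) (push X)"
  unfolding vector_field_def
proof (intro conjI ballI allI impI)
  note X = vector_fieldD[OF X]
  have U: "U \<subseteq> carrier M" by (rule mopen_subset[OF X(1)])
  show "mopen N (F ` U)" by (rule F_image_mopen[OF X(1)])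
  show "push X y \<in> tangent_space N y" if "y \<in> F ` U" for y
    using that dF_in[OF X(2) X(3)] push_F X(2) by fastforce
  fix W f assume f: "smooth_fun N W f"
  let ?V = "U \<inter> (carrier M \<inter> F -` W)"
  have "smooth_fun N (F ` ?V) (\<lambda>y. X (G y) (\<lambda>q. f (F q)))"
    by (rule smooth_fun_push[OF X(4)[OF smooth_fun_pull[OF f]]])
  moreover have eq: "F ` ?V = F ` U \<inter> W" using U by auto
  moreover have "X (G y) (\<lambda>q. f (F q)) = push X y f" if "y \<in> F ` U \<inter> W" for y
  proof -
    have "G y \<in> U" using F_image_mem[OF U] that by blast
    then show ?thesis unfolding push_def using dF_apply[OF X(2) X(3)] by simp
  qed
  ultimately show "smooth_fun N (F ` U \<inter> W) (\<lambda>y. push X y f)"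
    using smooth_fun_cong[OF B, of "F ` U \<inter> W" "\<lambda>y. X (G y) (\<lambda>q. f (F q))" "\<lambda>y. push X y f"] by simp
qed

text \<open>
  The field \<open>push X\<close> acts on \<open>f\<close> as \<open>X\<close> acts on \<open>f
  \<circ> F\<close>, up to composition with \<open>F\<close>.
\<close>

lemma push_bracket:
  assumes X: "vector_field M U X" and Y: "vector_field M U Y" and p: "p \<in> U"
  shows "lie_bracket N (push X) (push Y) (F p) = dF p (lie_bracket M X Y p)"
proof
  fix f
  note X' = vector_fieldD[OF X] and Y' = vector_fieldD[OF Y]
  have one: "push X (F p) (\<lambda>q. push Y q f) = X p (\<lambda>q. Y q (\<lambda>z. f (F z)))"
    if X: "vector_field M U X" and Y: "vector_field M U Y" for X Y
  proof -
    note X = vector_fieldD[OF X] and Y = vector_fieldD[OF Y]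
    have "push X (F p) (\<lambda>q. push Y q f) = X p (\<lambda>q. push Y (F q) f)"
      unfolding push_F[OF X(2)[OF p]] by (rule dF_apply[OF X(2)[OF p] X(3)[OF p]])
    also have "\<dots> = X p (\<lambda>q. Y q (\<lambda>z. f (F z)))"
      by (rule tangent_germ[OF A X(3)[OF p] X(1) p])
        (simp add: push_F[OF Y(2)] dF_apply[OF Y(2) Y(3)])
    finally show ?thesis .
  qed
  show "lie_bracket N (push X) (push Y) (F p) f = dF p (lie_bracket M X Y p) f"
    unfolding lie_bracket_def one[OF X Y] one[OF Y X] tangent_map_def
    using smooth_at_iff[OF X'(2)[OF p], of f] by (simp add: comp_def)
qed

text \<open>
  In \<open>X (Y (f * g))\<close> the terms that obstruct the product rule are symmetric in
  \<open>X\<close> and \<open>Y\<close>, so they cancel in the bracket.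
\<close>

lemma bracket_tangent:
  assumes X: "vector_field M U X" and Y: "vector_field M U Y" and p: "p \<in> U"
  shows "lie_bracket M X Y p \<in> tangent_space M p"
proof -
  note X' = vector_fieldD[OF X] and Y' = vector_fieldD[OF Y]
  have sm: "smooth_at M p (\<lambda>q. X q f)" if f: "smooth_at M p f" and X: "vector_field M U X" for X f
  proof -
    obtain W where W: "p \<in> W" "smooth_fun M W f" using f by (auto simp: smooth_at_def)
    show ?thesis by (rule smooth_fun_smooth_at[OF vector_fieldD(4)[OF X W(2)]]) (simp add: p W(1))
  qed
  have nbhd: "\<exists>W. mopen M W \<and> p \<in> W \<and> W \<subseteq> U \<and> (\<forall>q\<in>W. smooth_at M q f \<and> smooth_at M q g)"
    if fg: "smooth_at M p f" "smooth_at M p g" for f g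
  proof -
    obtain V where V: "p \<in> V" "smooth_fun M V f" using fg(1) by (auto simp: smooth_at_def)
    obtain W where W: "p \<in> W" "smooth_fun M W g" using fg(2) by (auto simp: smooth_at_def)
    have "mopen M (U \<inter> (V \<inter> W))"
      by (rule mopen_Int[OF A X'(1) mopen_Int[OF A smooth_fun_mopen[OF V(2)] smooth_fun_mopen[OF W(2)]]])
    then show ?thesis
      using p V(1) W(1) smooth_fun_smooth_at[OF V(2)] smooth_fun_smooth_at[OF W(2)]
      by (intro exI[of _ "U \<inter> (V \<inter> W)"]) auto
  qed
  have lin: "X p (\<lambda>q. Y q (\<lambda>z. a * f z + b * g z)) = a * X p (\<lambda>q. Y q f) + b * X p (\<lambda>q. Y q g)"
    and mul: "X p (\<lambda>q. Y q (\<lambda>z. f z * g z)) =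
      X p (\<lambda>q. Y q f) * g p + Y p f * X p g + (X p f * Y p g + f p * X p (\<lambda>q. Y q g))"
    if fg: "smooth_at M p f" "smooth_at M p g" and X: "vector_field M U X" and Y: "vector_field M U Y" for f g a b X Y
  proof -
    note Xp = vector_fieldD(3)[OF X p] and Yq = vector_fieldD(3)[OF Y]
    obtain W where W: "mopen M W" "p \<in> W" "W \<subseteq> U" "\<forall>q\<in>W. smooth_at M q f \<and> smooth_at M q g"
      using nbhd[OF fg] by blast
    note Yf = sm[OF fg(1) Y] and Yg = sm[OF fg(2) Y]
    have "X p (\<lambda>q. Y q (\<lambda>z. a * f z + b * g z)) = X p (\<lambda>q. a * Y q f + b * Y q g)"
      by (rule tangent_germ[OF A Xp W(1,2)], rule tangent_spaceD(2)[OF Yq]) (use W(3,4) in auto)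
    then show "X p (\<lambda>q. Y q (\<lambda>z. a * f z + b * g z)) = a * X p (\<lambda>q. Y q f) + b * X p (\<lambda>q. Y q g)"
      using tangent_spaceD(2)[OF Xp Yf Yg] by simp
    have "X p (\<lambda>q. Y q (\<lambda>z. f z * g z)) = X p (\<lambda>q. 1 * (Y q f * g q) + 1 * (f q * Y q g))"
    proof (rule tangent_germ[OF A Xp W(1,2)])
      fix q assume q: "q \<in> W"
      then have "Y q (\<lambda>z. f z * g z) = Y q f * g q + f q * Y q g"
        using W(3,4) by (intro tangent_spaceD(3)[OF Yq]) auto
      then show "Y q (\<lambda>z. f z * g z) = 1 * (Y q f * g q) + 1 * (f q * Y q g)" by simp
    qed
    also have "\<dots> = X p (\<lambda>q. Y q f * g q) + X p (\<lambda>q. f q * Y q g)"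
      using tangent_spaceD(2)[OF Xp smooth_at_lincomb(2)[OF A Yf fg(2)] smooth_at_lincomb(2)[OF A fg(1) Yg], of 1 1] by simp
    finally show "X p (\<lambda>q. Y q (\<lambda>z. f z * g z)) =
      X p (\<lambda>q. Y q f) * g p + Y p f * X p g + (X p f * Y p g + f p * X p (\<lambda>q. Y q g))"
      using tangent_spaceD(3)[OF Xp Yf fg(2)] tangent_spaceD(3)[OF Xp fg(1) Yg] by simp
  qed
  have germ: "X p (\<lambda>q. Y q f) = X p (\<lambda>q. Y q g)"
    if W: "mopen M W" "p \<in> W" "\<And>q. q \<in> W \<Longrightarrow> f q = g q" and X: "vector_field M U X" and Y: "vector_field M U Y" for f g W X Y
  proof (rule tangent_germ[OF A vector_fieldD(3)[OF X p] mopen_Int[OF A X'(1) W(1)]])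
    show "p \<in> U \<inter> W" using p W(2) by simp
    fix q assume "q \<in> U \<inter> W"
    then show "Y q f = Y q g" using W(3) by (intro tangent_germ[OF A vector_fieldD(3)[OF Y] W(1)]) auto
  qed
  show ?thesis
  proof (rule tangent_spaceI)
    show "lie_bracket M X Y p f = lie_bracket M X Y p g"
      if "smooth_at M p f" "smooth_at M p g" "mopen M W" "p \<in> W" "\<And>q. q \<in> W \<Longrightarrow> f q = g q" for f g W
      using germ[OF that(3,4,5) X Y] germ[OF that(3,4,5) Y X] that(1,2) by (simp add: lie_bracket_def)
    show "lie_bracket M X Y p (\<lambda>q. a * f q + b * g q) = a * lie_bracket M X Y p f + b * lie_bracket M X Y p g"
      if "smooth_at M p f" "smooth_at M p g" for f g a b
      using lin[OF that X Y] lin[OF that Y X] that smooth_at_lincomb(1)[OF A that]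
      by (simp add: lie_bracket_def algebra_simps)
    show "lie_bracket M X Y p (\<lambda>q. f q * g q) = lie_bracket M X Y p f * g p + f p * lie_bracket M X Y p g"
      if "smooth_at M p f" "smooth_at M p g" for f g
      using mul[OF that X Y] mul[OF that Y X] that smooth_at_lincomb(2)[OF A that]
      by (simp add: lie_bracket_def algebra_simps)
  qed (simp add: lie_bracket_def)
qed

text \<open>
  The inclusion in the tangent spaces makes the relation symmetric under exchange of
  \<open>F\<close> and \<open>G\<close>.
\<close>

definition related :: "'a dist \<Rightarrow> 'b dist \<Rightarrow> bool"
  where "related D D' \<longleftrightarrow> (\<forall>p\<in>carrier M. D p \<subseteq> tangent_space M p \<and> D' (F p) = dF p ` D p)"

lemma relatedD:
  assumes "related D D'" "p \<in> carrier M"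
  shows "D p \<subseteq> tangent_space M p" "D' (F p) = dF p ` D p"
  using assms by (auto simp: related_def)

lemma related_inverse:
  assumes D: "related D D'" shows "diffeomorphism.related N M G D' D"
  unfolding diffeomorphism.related_def[OF inverse]
proof (intro ballI conjI)
  fix q assume q: "q \<in> carrier N"
  note D = relatedD[OF D G_carrier[OF q]]
  have "D' (F (G q)) \<subseteq> tangent_space N (F (G q))" unfolding D(2) using D(1) dF_in[OF G_carrier[OF q]] by blast
  then show "D' q \<subseteq> tangent_space N q" unfolding FG[OF q] .
  have "dG q ` D' q = (\<lambda>v. dG (F (G q)) (dF (G q) v)) ` D (G q)"
    using D(2) FG[OF q] by (simp add: image_image)
  also have "\<dots> = D (G q)" using dG_dF[OF G_carrier[OF q]] D(1) by (force simp: image_iff)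
  finally show "D (G q) = dG q ` D' q" by simp
qed

lemma related_pullback:
  assumes "\<And>q. q \<in> carrier N \<Longrightarrow> D' q \<subseteq> tangent_space N q"
  shows "related (\<lambda>p. dG (F p) ` D' (F p)) D'"
  unfolding related_def
proof (intro ballI conjI)
  fix p assume p: "p \<in> carrier M"
  note D' = assms[OF F_carrier[OF p]]
  show "dG (F p) ` D' (F p) \<subseteq> tangent_space M p" using dG_in[OF p] D' by blast
  show "D' (F p) = dF p ` dG (F p) ` D' (F p)"
    using dF_dG[OF p] D' by (force simp: image_iff)
qed

lemma section_push:
  assumes D: "related D D'" and X: "section_of M U D X" shows "section_of N (F ` U) D' (push X)"
  unfolding section_of_def
proof (intro conjI ballI)
  have X': "vector_field M U X" "\<forall>p\<in>U. X p \<in> D p" using X by (auto simp: section_of_def)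
  show "vector_field N (F ` U) (push X)" by (rule push_vector_field[OF X'(1)])
  fix y assume "y \<in> F ` U"
  then obtain p where p: "p \<in> U" "y = F p" by blast
  then show "push X y \<in> D' y"
    using X'(2) relatedD(2)[OF D vector_fieldD(2)[OF X'(1) p(1)]] push_F[OF vector_fieldD(2)[OF X'(1) p(1)]] by simp
qed

lemma regular_push:
  assumes D: "related D D'" and reg: "regular_dist M U m D" shows "regular_dist N (F ` U) m D'"
  unfolding regular_dist_def
proof (intro conjI ballI)
  show "mopen N (F ` U)" using reg by (auto simp: regular_dist_def intro: F_image_mopen)
  fix y assume "y \<in> F ` U"
  then obtain p where p: "p \<in> U" "y = F p" by blast
  obtain W X where W: "p \<in> W" "W \<subseteq> U" "mopen M W" and X: "\<forall>i<m. vector_field M W (X i)"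
    "\<forall>q\<in>W. D q = span ((\<lambda>i. X i q) ` {..<m}) \<and> dim (D q) = m"
    using reg p(1) unfolding regular_dist_def by (elim conjE ballE[of _ _ p]) blast+
  have "D' z = span ((\<lambda>i. push (X i) z) ` {..<m}) \<and> dim (D' z) = m" if z: "z \<in> F ` W" for z
  proof -
    obtain q where q: "q \<in> W" "z = F q" using z by blast
    have qc: "q \<in> carrier M" using q(1) mopen_subset[OF W(3)] by blast
    note D = relatedD[OF D qc]
    have span: "D q = span ((\<lambda>i. X i q) ` {..<m})" and dm: "dim (D q) = m" using X(2) q(1) by blast+
    have "D' z = span (dF q ` (\<lambda>i. X i q) ` {..<m})"
      unfolding q(2) D(2) unfolding span by (rule linear_span_image[OF tangent_map_linear, symmetric])
    moreover have "dF q ` (\<lambda>i. X i q) ` {..<m} = (\<lambda>i. push (X i) z) ` {..<m}"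
      using push_F[OF qc] by (simp add: q(2) image_image)
    moreover have "dim (dF q ` D q) = dim (D q)"
      by (rule dim_injective_image[OF tangent_map_linear _ inj_on_subset[OF dF_inj[OF qc] D(1)]]) (simp add: span)
    ultimately show ?thesis using D(2) q(2) dm by simp
  qed
  moreover have "\<forall>i<m. vector_field N (F ` W) (push (X i))"
  proof (intro allI impI)
    show "vector_field N (F ` W) (push (X i))" if "i < m" for i by (rule push_vector_field) (use X(1) that in blast)
  qed
  moreover have "y \<in> F ` W" "F ` W \<subseteq> F ` U" "mopen N (F ` W)" using p W F_image_mopen[OF W(3)] by auto
  ultimately show "\<exists>W X. y \<in> W \<and> W \<subseteq> F ` U \<and> mopen N W \<and> (\<forall>i<m. vector_field N W (X i)) \<and>
      (\<forall>q\<in>W. D' q = span ((\<lambda>i. X i q) ` {..<m}) \<and> dim (D' q) = m)"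
    by (intro exI[of _ "F ` W"] exI[of _ "\<lambda>i. push (X i)"] conjI ballI) blast+
qed

text \<open>The index sets of \<open>M\<close> and \<open>N\<close> may differ, so a chart is pushed forward up to a bijection of these.\<close>

lemma chart_push:
  assumes \<beta>: "bij_betw \<beta> (index N) (index M)" and c: "(V, \<phi>) \<in> charts M"
  shows "(F ` V, \<lambda>y j. if j \<in> index N then \<phi> (G y) (\<beta> j) else 0) \<in> charts N" (is "(_, ?\<psi>) \<in> _")
proof -
  have finM: "finite (index M)" and finN: "finite (index N)"
    using smooth_manifold_finite M N by auto
  have V: "mopen M V" "V \<subseteq> carrier M" and inj: "inj_on \<phi> V"
    by (rule charts_mopen[OF c], rule chartsD(1)[OF c], rule chartsD(2)[OF c])
  \<comment> \<open>the inverse relabelling of the coordinates\<close>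
  define \<rho> where "\<rho> x = (\<lambda>i. if i \<in> index M then x (inv_into (index N) \<beta> i) else 0)" for x :: "'j \<Rightarrow> real"
  have \<psi>_sp: "?\<psi> y \<in> coord_space (index N)" for y by (simp add: coord_space_def)
  have \<rho>\<psi>: "\<rho> (?\<psi> y) = \<phi> (G y)" if "y \<in> F ` V" for y
  proof (rule coord_space_eqI)
    show "\<rho> (?\<psi> y) \<in> coord_space (index M)" by (simp add: \<rho>_def coord_space_def)
    show "\<phi> (G y) \<in> coord_space (index M)" using charts_space[OF c] F_image_mem[OF V(2) that] by blast
    fix i assume i: "i \<in> index M"
    have "inv_into (index N) \<beta> i \<in> index N" "\<beta> (inv_into (index N) \<beta> i) = i"
      using i \<beta> by (auto simp: bij_betw_def intro: inv_into_into f_inv_into_f)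
    then show "\<rho> (?\<psi> y) i = \<phi> (G y) i" using i by (simp add: \<rho>_def)
  qed
  have \<rho>_eq: "?\<psi> y = x" if x: "x \<in> coord_space (index N)" and eq: "\<rho> x = \<phi> (G y)" for x y
  proof (rule coord_space_eqI[OF \<psi>_sp x])
    fix j assume j: "j \<in> index N"
    then have "\<beta> j \<in> index M" "inv_into (index N) \<beta> (\<beta> j) = j" using \<beta> by (auto simp: bij_betw_def)
    then have "\<rho> x (\<beta> j) = x j" by (simp add: \<rho>_def)
    then show "?\<psi> y j = x j" using j eq by simp
  qed
  have \<psi>_inj: "inj_on ?\<psi> (F ` V)"
  proof (rule inj_onI)
    fix y z assume y: "y \<in> F ` V" and z: "z \<in> F ` V" and "?\<psi> y = ?\<psi> z"
    then have "\<phi> (G y) = \<phi> (G z)" using \<rho>\<psi>[OF y] \<rho>\<psi>[OF z] by simp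
    then have "G y = G z" using inj_onD[OF inj] F_image_mem[OF V(2) y] F_image_mem[OF V(2) z] by blast
    then show "y = z" using F_image_mem[OF V(2) y] F_image_mem[OF V(2) z] by metis
  qed
  have \<rho>_C: "Cinf_on (index N) S (\<lambda>x. \<rho> x i)" if "coord_open (index N) S" for S i
    by (cases "i \<in> index M") (simp_all add: \<rho>_def Cinf_on_coordinate[OF finN that] Cinf_on_const[OF finN that])
  have img: "?\<psi> ` (F ` V \<inter> W) = {x \<in> coord_space (index N). \<rho> x \<in> \<phi> ` (V \<inter> (carrier M \<inter> F -` W))}" for W
  proof (intro equalityI subsetI)
    fix x assume "x \<in> ?\<psi> ` (F ` V \<inter> W)"
    then obtain y where y: "y \<in> F ` V" "y \<in> W" "x = ?\<psi> y" by blast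
    then have "\<rho> x = \<phi> (G y)" "G y \<in> V \<inter> (carrier M \<inter> F -` W)"
      using \<rho>\<psi>[OF y(1)] F_image_mem[OF V(2) y(1)] V(2) by auto
    then show "x \<in> {x \<in> coord_space (index N). \<rho> x \<in> \<phi> ` (V \<inter> (carrier M \<inter> F -` W))}" using y(3) \<psi>_sp by blast
  next
    fix x assume "x \<in> {x \<in> coord_space (index N). \<rho> x \<in> \<phi> ` (V \<inter> (carrier M \<inter> F -` W))}"
    then obtain p where p: "p \<in> V" "F p \<in> W" "\<rho> x = \<phi> p" "x \<in> coord_space (index N)" by blast
    then have "?\<psi> (F p) = x" using \<rho>_eq[of x "F p"] GF V(2) by auto
    then show "x \<in> ?\<psi> ` (F ` V \<inter> W)" using p(1,2) by blast
  qed
  have img_open: "coord_open (index N) (?\<psi> ` (F ` V \<inter> W))" if "mopen N W" for W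
    unfolding img
  proof (rule coord_open_vimage[OF coord_open_space _ _ charts_open_image[OF M c smooth_map_vimage[OF F that]]])
    show "continuous_on (coord_space (index N)) (\<lambda>x. \<rho> x i)" for i
      by (rule Cinf_on_continuous[OF \<rho>_C[OF coord_open_space]])
    show "\<rho> ` coord_space (index N) \<subseteq> coord_space (index M)" by (auto simp: \<rho>_def coord_space_def)
  qed
  have FV: "mopen N (F ` V)" by (rule F_image_mopen[OF V(1)])
  have comp: "compatible (index N) (F ` V, ?\<psi>) (W, \<xi>)" if d: "(W, \<xi>) \<in> atlas N" for W \<xi>
  proof -
    have W: "mopen N W" by (rule charts_mopen[OF atlas_charts[OF N d]])
    have "Cinf_on (index N) (?\<psi> ` (F ` V \<inter> W)) (\<lambda>x. \<xi> (inv_into (F ` V) ?\<psi> x) j)" if j: "j \<in> index N" for j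
    proof (rule Cinf_on_cong[OF finN])
      have g: "Cinf_on (index M) (\<phi> ` (V \<inter> (carrier M \<inter> F -` W))) (\<lambda>x. \<xi> (F (inv_into V \<phi> x)) j)"
        by (rule smooth_fun_chart[OF M smooth_map_coordinate[OF F d j] c])
      show "Cinf_on (index N) (?\<psi> ` (F ` V \<inter> W)) (\<lambda>x. \<xi> (F (inv_into V \<phi> (\<rho> x))) j)"
        by (rule Cinf_on_compose[OF finN img_open[OF W] finM _ \<rho>_C[OF img_open[OF W]] g]) (use img in blast)
      fix x assume "x \<in> ?\<psi> ` (F ` V \<inter> W)"
      then obtain y where y: "y \<in> F ` V" "x = ?\<psi> y" by blast
      have "inv_into V \<phi> (\<rho> x) = G y" unfolding y(2) \<rho>\<psi>[OF y(1)]
        by (rule inv_into_f_f[OF inj]) (use F_image_mem[OF V(2) y(1)] in blast)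
      then have "F (inv_into V \<phi> (\<rho> x)) = y" using F_image_mem[OF V(2) y(1)] by simp
      moreover have "inv_into (F ` V) ?\<psi> x = y" unfolding y(2) by (rule inv_into_f_f[OF \<psi>_inj y(1)])
      ultimately show "\<xi> (F (inv_into V \<phi> (\<rho> x))) j = \<xi> (inv_into (F ` V) ?\<psi> x) j" by simp
    qed
    moreover have "Cinf_on (index N) (\<xi> ` (F ` V \<inter> W)) (\<lambda>x. ?\<psi> (inv_into W \<xi> x) j)" if j: "j \<in> index N" for j
      using smooth_funD[OF smooth_fun_push[OF charts_smooth_coordinate[OF M c, of "\<beta> j"]] d] j by (simp add: Int_commute)
    moreover have "coord_open (index N) (\<xi> ` (F ` V \<inter> W))" using mopenD[OF FV d] by (simp add: Int_commute)
    ultimately show ?thesis using img_open[OF W] unfolding compatible_def by simp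
  qed
  have "coord_open (index N) (?\<psi> ` F ` V)"
    using img_open[OF FV] by (simp only: Int_absorb)
  then show ?thesis using \<psi>_inj comp mopen_subset[OF FV] unfolding charts_def coord_patch_def by auto
qed

lemma integrable_push:
  assumes card: "card (index M) = card (index N)"
    and U: "U \<subseteq> carrier M" and D: "related D D'" and int: "integrable_dist M U D"
  shows "integrable_dist N (F ` U) D'"
  unfolding integrable_dist_def
proof
  obtain \<beta> where \<beta>: "bij_betw \<beta> (index N) (index M)"
    using finite_same_card_bij[OF smooth_manifold_finite[OF N] smooth_manifold_finite[OF M]] card by metis
  fix y assume "y \<in> F ` U"
  then obtain p where p: "p \<in> U" "y = F p" by blast
  obtain V \<phi> K where V: "(V, \<phi>) \<in> charts M" "p \<in> V" "V \<subseteq> U" "K \<subseteq> index M"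
    and DV: "\<forall>q\<in>V. D q = {v \<in> tangent_space M q. \<forall>i\<in>K. v (\<lambda>x. \<phi> x i) = 0}"
    using int p(1) unfolding integrable_dist_def by meson
  let ?\<psi> = "\<lambda>y j. if j \<in> index N then \<phi> (G y) (\<beta> j) else 0"
  let ?K = "{j \<in> index N. \<beta> j \<in> K}"
  have Vc: "V \<subseteq> carrier M" by (rule chartsD(1)[OF V(1)])
  have "D' (F q) = {w \<in> tangent_space N (F q). \<forall>j\<in>?K. w (\<lambda>x. ?\<psi> x j) = 0}" if q: "q \<in> V" for q
  proof -
    have qc: "q \<in> carrier M" using q Vc by blast
    have val: "dF q v (\<lambda>x. ?\<psi> x j) = v (\<lambda>x. \<phi> x (\<beta> j))" if v: "v \<in> tangent_space M q" and j: "j \<in> index N" for v j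
      unfolding dF_apply[OF qc v]
      by (rule tangent_germ[OF A v charts_mopen[OF V(1)] q]) (use j GF Vc in auto)
    have K: "(\<forall>j\<in>?K. v (\<lambda>x. \<phi> x (\<beta> j)) = 0) \<longleftrightarrow> (\<forall>i\<in>K. v (\<lambda>x. \<phi> x i) = 0)" for v :: "'a tvec"
    proof
      assume *: "\<forall>j\<in>?K. v (\<lambda>x. \<phi> x (\<beta> j)) = 0"
      show "\<forall>i\<in>K. v (\<lambda>x. \<phi> x i) = 0"
      proof
        fix i assume i: "i \<in> K"
        then obtain j where "j \<in> index N" "i = \<beta> j" using V(4) \<beta> by (auto simp: bij_betw_def)
        then show "v (\<lambda>x. \<phi> x i) = 0" using * i by simp
      qed
    qed simp
    have iff: "(\<forall>j\<in>?K. dF q v (\<lambda>x. ?\<psi> x j) = 0) \<longleftrightarrow> v \<in> D q" if v: "v \<in> tangent_space M q" for v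
    proof -
      have "(\<forall>j\<in>?K. dF q v (\<lambda>x. ?\<psi> x j) = 0) \<longleftrightarrow> (\<forall>j\<in>?K. v (\<lambda>x. \<phi> x (\<beta> j)) = 0)"
      proof (rule ball_cong[OF refl])
        fix j assume "j \<in> ?K"
        then have "j \<in> index N" by simp
        from val[OF v this] show "(dF q v (\<lambda>x. ?\<psi> x j) = 0) \<longleftrightarrow> (v (\<lambda>x. \<phi> x (\<beta> j)) = 0)" by (simp only:)
      qed
      then show ?thesis using K DV q v by simp
    qed
    show ?thesis
      unfolding relatedD(2)[OF D qc] dF_image_tangent[OF qc, symmetric]
      using iff relatedD(1)[OF D qc] by blast
  qed
  then have "\<forall>z\<in>F ` V. D' z = {w \<in> tangent_space N z. \<forall>j\<in>?K. w (\<lambda>x. ?\<psi> x j) = 0}" by blast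
  then show "\<exists>V' \<psi> K'. (V', \<psi>) \<in> charts N \<and> y \<in> V' \<and> V' \<subseteq> F ` U \<and> K' \<subseteq> index N \<and>
      (\<forall>q\<in>V'. D' q = {v \<in> tangent_space N q. \<forall>i\<in>K'. v (\<lambda>x. \<psi> x i) = 0})"
    using chart_push[OF \<beta> V(1)] V(2,3) p(2)
    by (intro exI[of _ "F ` V"] exI[of _ ?\<psi>] exI[of _ ?K] conjI) auto
qed

lemma direct_sum_push:
  assumes p: "p \<in> carrier M" and C: "C \<subseteq> tangent_space M p" and ds: "direct_sum S T C"
  shows "direct_sum (dF p ` S) (dF p ` T) (dF p ` C)"
proof -
  have S: "subspace S" and T: "subspace T" and ST: "S \<inter> T = {0}" and eq: "C = {a + b |a b. a \<in> S \<and> b \<in> T}"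
    using ds by (auto simp: direct_sum_def)
  note lin = tangent_map_linear[of N F p]
  have sub: "a \<in> C" if "a \<in> S \<or> a \<in> T" for a
  proof -
    have "a + 0 \<in> C \<or> 0 + a \<in> C" unfolding eq using that subspace_0[OF S] subspace_0[OF T] by blast
    then show ?thesis by simp
  qed
  have "dF p ` S \<inter> dF p ` T = dF p ` (S \<inter> T)"
    by (rule inj_on_image_Int[OF dF_inj[OF p], symmetric]) (use sub C in auto)
  then have "dF p ` S \<inter> dF p ` T = {0}" using ST linear_0[OF lin] by simp
  moreover have "dF p ` C = {a + b |a b. a \<in> dF p ` S \<and> b \<in> dF p ` T}"
  proof (intro equalityI subsetI)
    fix x assume "x \<in> dF p ` C"
    then obtain a b where ab: "a \<in> S" "b \<in> T" "x = dF p (a + b)" unfolding eq by blast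
    then have "x = dF p a + dF p b" by (simp add: linear_add[OF lin])
    then show "x \<in> {a + b |a b. a \<in> dF p ` S \<and> b \<in> dF p ` T}" using ab(1,2) by blast
  next
    fix x assume "x \<in> {a + b |a b. a \<in> dF p ` S \<and> b \<in> dF p ` T}"
    then obtain a b where ab: "a \<in> S" "b \<in> T" "x = dF p (a + b)" by (auto simp: linear_add[OF lin])
    have "a + b \<in> C" unfolding eq using ab(1,2) by blast
    then show "x \<in> dF p ` C" using ab(3) by blast
  qed
  ultimately show ?thesis
    using linear_subspace_image[OF lin S] linear_subspace_image[OF lin T] by (simp add: direct_sum_def)
qed

subsection \<open>Forms\<close>

definition form_related :: "('a \<Rightarrow> 'a tvec \<Rightarrow> real) \<Rightarrow> ('b \<Rightarrow> 'b tvec \<Rightarrow> real) \<Rightarrow> bool"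
  where "form_related \<omega> \<omega>' \<longleftrightarrow> (\<forall>p\<in>carrier M. \<forall>v\<in>tangent_space M p. \<omega>' (F p) (dF p v) = \<omega> p v)"

lemma form_related_inverse:
  assumes "form_related \<omega> \<omega>'" shows "diffeomorphism.form_related N M G \<omega>' \<omega>"
  unfolding diffeomorphism.form_related_def[OF inverse]
proof (intro ballI)
  fix q w assume q: "q \<in> carrier N" and w: "w \<in> tangent_space N q"
  have w': "w \<in> tangent_space N (F (G q))" using FG[OF q] w by simp
  have "\<omega>' (F (G q)) (dF (G q) (dG (F (G q)) w)) = \<omega> (G q) (dG (F (G q)) w)"
    using assms dG_in[OF G_carrier[OF q] w'] G_carrier[OF q] by (simp add: form_related_def)
  then show "\<omega> (G q) (dG q w) = \<omega>' q w"
    unfolding dF_dG[OF G_carrier[OF q] w'] using FG[OF q] by simp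
qed

lemma ext_deriv_push:
  assumes \<omega>: "form_related \<omega> \<omega>'" and X: "vector_field M U X" and Y: "vector_field M U Y" and p: "p \<in> U"
  shows "ext_deriv N \<omega>' (push X) (push Y) (F p) = ext_deriv M \<omega> X Y p"
proof -
  have pc: "p \<in> carrier M" by (rule vector_fieldD(2)[OF X p])
  have one: "push X (F p) (\<lambda>q. \<omega>' q (push Y q)) = X p (\<lambda>q. \<omega> q (Y q))"
    if X: "vector_field M U X" and Y: "vector_field M U Y" for X Y
  proof -
    have "push X (F p) (\<lambda>q. \<omega>' q (push Y q)) = X p (\<lambda>q. \<omega>' (F q) (push Y (F q)))"
      unfolding push_F[OF pc] by (rule dF_apply[OF pc vector_fieldD(3)[OF X p]])
    also have "\<dots> = X p (\<lambda>q. \<omega> q (Y q))"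
      by (rule tangent_germ[OF A vector_fieldD(3)[OF X p] vector_fieldD(1)[OF X] p])
        (use \<omega> vector_fieldD(2,3)[OF Y] in \<open>simp add: push_F form_related_def\<close>)
    finally show ?thesis .
  qed
  have "\<omega>' (F p) (lie_bracket N (push X) (push Y) (F p)) = \<omega> p (lie_bracket M X Y p)"
    using \<omega> pc bracket_tangent[OF X Y p] unfolding push_bracket[OF X Y p] form_related_def by blast
  then show ?thesis unfolding ext_deriv_def one[OF X Y] one[OF Y X] by simp
qed

lemma ker_form_push:
  assumes \<eta>: "\<forall>A<k. form_related (\<eta> A) (\<eta>' A)" and p: "p \<in> carrier M"
  shows "ker_form N k \<eta>' (F p) = dF p ` ker_form M k \<eta> p"
proof -
  have "dF p v \<in> ker_form N k \<eta>' (F p) \<longleftrightarrow> v \<in> ker_form M k \<eta> p" if "v \<in> tangent_space M p" for v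
    using \<eta> p that dF_in[OF p that] by (auto simp: ker_form_def form_related_def)
  moreover have "ker_form N k \<eta>' (F p) \<subseteq> dF p ` tangent_space M p"
    unfolding dF_image_tangent[OF p] by (auto simp: ker_form_def)
  moreover have "ker_form M k \<eta> p \<subseteq> tangent_space M p" by (auto simp: ker_form_def)
  ultimately show ?thesis by blast
qed

text \<open>
  Fields on \<open>N\<close> that extend \<open>dF p v\<close> are pulled back along
  \<open>F\<close> to fields on \<open>M\<close> that extend \<open>v\<close>.
\<close>

lemma ker_ext_deriv_push_subset:
  assumes \<eta>: "\<forall>A<k. form_related (\<eta> A) (\<eta>' A)" and p: "p \<in> carrier M"
  shows "dF p ` ker_ext_deriv M k \<eta> p \<subseteq> ker_ext_deriv N k \<eta>' (F p)"
proof
  interpret inv: diffeomorphism N M G F by (rule inverse)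
  fix w assume "w \<in> dF p ` ker_ext_deriv M k \<eta> p"
  then obtain v where v: "w = dF p v" "v \<in> tangent_space M p"
    and ker: "\<And>A N X Y. A < k \<Longrightarrow> p \<in> N \<Longrightarrow> vector_field M N X \<Longrightarrow> vector_field M N Y \<Longrightarrow> X p = v
      \<Longrightarrow> ext_deriv M (\<eta> A) X Y p = 0"
    by (auto simp: ker_ext_deriv_def)
  have "ext_deriv N (\<eta>' A) X Y (F p) = 0"
    if A: "A < k" and U: "F p \<in> U" and X: "vector_field N U X" and Y: "vector_field N U Y" and Xp: "X (F p) = w" for A U X Y
  proof -
    have "ext_deriv M (\<eta> A) (inv.push X) (inv.push Y) (G (F p)) = ext_deriv N (\<eta>' A) X Y (F p)"
      by (rule inv.ext_deriv_push[OF form_related_inverse X Y U]) (use \<eta> A in blast)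
    moreover have "ext_deriv M (\<eta> A) (inv.push X) (inv.push Y) p = 0"
    proof (rule ker[OF A _ inv.push_vector_field[OF X] inv.push_vector_field[OF Y]])
      show "p \<in> G ` U" using U GF[OF p] by (metis imageI)
      show "inv.push X p = v" using dG_dF[OF p v(2)] by (simp add: inv.push_def Xp v(1))
    qed
    ultimately show ?thesis by (simp add: GF[OF p])
  qed
  then show "w \<in> ker_ext_deriv N k \<eta>' (F p)"
    unfolding ker_ext_deriv_def mem_Collect_eq using dF_in[OF p v(2)] v(1) by blast
qed

lemma ker_ext_deriv_push:
  assumes \<eta>: "\<forall>A<k. form_related (\<eta> A) (\<eta>' A)" and p: "p \<in> carrier M"
  shows "ker_ext_deriv N k \<eta>' (F p) = dF p ` ker_ext_deriv M k \<eta> p"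
proof
  interpret inv: diffeomorphism N M G F by (rule inverse)
  show "dF p ` ker_ext_deriv M k \<eta> p \<subseteq> ker_ext_deriv N k \<eta>' (F p)" by (rule ker_ext_deriv_push_subset[OF assms])
  have sub: "dG (F p) ` ker_ext_deriv N k \<eta>' (F p) \<subseteq> ker_ext_deriv M k \<eta> p"
    using inv.ker_ext_deriv_push_subset[of k \<eta>' \<eta> "F p"] \<eta> form_related_inverse F_carrier[OF p] GF[OF p] by simp
  show "ker_ext_deriv N k \<eta>' (F p) \<subseteq> dF p ` ker_ext_deriv M k \<eta> p"
  proof
    fix w assume w: "w \<in> ker_ext_deriv N k \<eta>' (F p)"
    then have "w \<in> tangent_space N (F p)" by (simp add: ker_ext_deriv_def)
    then have "w = dF p (dG (F p) w)" using dF_dG[OF p] by simp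
    then show "w \<in> dF p ` ker_ext_deriv M k \<eta> p" using sub w by blast
  qed
qed

lemma one_form_push:
  assumes \<omega>: "one_form M U \<omega>" shows "one_form N (F ` U) (\<lambda>q w. \<omega> (G q) (dG q w))"
proof -
  interpret inv: diffeomorphism N M G F by (rule inverse)
  have U: "mopen M U" "U \<subseteq> carrier M" using \<omega> mopen_subset by (auto simp: one_form_def)
  have lin: "\<omega> (G q) (dG q (a *\<^sub>R u + b *\<^sub>R v)) = a * \<omega> (G q) (dG q u) + b * \<omega> (G q) (dG q v)"
    if q: "q \<in> F ` U" and uv: "u \<in> tangent_space N q" "v \<in> tangent_space N q" for q u v a b
  proof -
    have qc: "q \<in> carrier N" "G q \<in> U" using F_image_mem[OF U(2) q] by auto
    have "dG q (a *\<^sub>R u + b *\<^sub>R v) = a *\<^sub>R dG q u + b *\<^sub>R dG q v"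
      by (simp add: linear_add[OF tangent_map_linear] linear_cmul[OF tangent_map_linear])
    moreover have "dG q u \<in> tangent_space M (G q)" "dG q v \<in> tangent_space M (G q)"
      using inv.dF_in[OF qc(1)] uv by auto
    ultimately show ?thesis using \<omega> qc(2) by (simp add: one_form_def)
  qed
  have sm: "smooth_fun N W (\<lambda>q. \<omega> (G q) (dG q (X q)))" if W: "W \<subseteq> F ` U" and X: "vector_field N W X" for W X
  proof -
    have Wc: "W \<subseteq> carrier N" using W F_image_mem[OF U(2)] by blast
    have "G ` W \<subseteq> U" using W F_image_mem[OF U(2)] by blast
    then have "smooth_fun M (G ` W) (\<lambda>p. \<omega> p (inv.push X p))"
      using \<omega> inv.push_vector_field[OF X] by (simp add: one_form_def)
    then have "smooth_fun N (F ` G ` W) (\<lambda>q. \<omega> (G q) (inv.push X (G q)))" by (rule smooth_fun_push)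
    then have "smooth_fun N W (\<lambda>q. \<omega> (G q) (inv.push X (G q)))" unfolding inv.G_image_F_image[OF Wc] .
    then show ?thesis by (rule smooth_fun_cong[OF B]) (use Wc in \<open>auto simp: inv.push_F\<close>)
  qed
  show ?thesis unfolding one_form_def using lin sm F_image_mopen[OF U(1)] by blast
qed

lemma k_contact_form_push:
  assumes card: "card (index M) = card (index N)" and \<eta>: "k_contact_form k M U \<eta>"
  shows "k_contact_form k N (F ` U) (\<lambda>A q w. \<eta> A (G q) (dG q w))" (is "k_contact_form k N _ ?\<eta>'")
proof -
  have rel: "\<forall>A<k. form_related (\<eta> A) (?\<eta>' A)" by (simp add: form_related_def dG_dF GF)
  obtain m where m: "m > 0" "m + k = mdim M" "regular_dist M U m (ker_form M k \<eta>)"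
    using \<eta> by (auto simp: k_contact_form_def)
  have U: "U \<subseteq> carrier M" using m(3) mopen_subset by (auto simp: regular_dist_def)
  have "related (ker_form M k \<eta>) (ker_form N k ?\<eta>')"
    unfolding related_def using ker_form_push[OF rel] by (auto simp: ker_form_def)
  then have "regular_dist N (F ` U) m (ker_form N k ?\<eta>')" using m(3) by (rule regular_push)
  moreover have "direct_sum (ker_form N k ?\<eta>' q) (ker_ext_deriv N k ?\<eta>' q) (tangent_space N q)" if q: "q \<in> F ` U" for q
  proof -
    obtain p where p: "p \<in> U" "q = F p" using q by blast
    have pc: "p \<in> carrier M" using p U by blast
    have "direct_sum (ker_form M k \<eta> p) (ker_ext_deriv M k \<eta> p) (tangent_space M p)"
      using \<eta> p(1) by (simp add: k_contact_form_def)
    then show ?thesis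
      using direct_sum_push[OF pc order_refl] ker_form_push[OF rel pc] ker_ext_deriv_push[OF rel pc]
        dF_image_tangent[OF pc] p(2) by simp
  qed
  moreover have "one_form N (F ` U) (?\<eta>' A)" if "A < k" for A
    by (rule one_form_push) (use \<eta> that in \<open>simp add: k_contact_form_def\<close>)
  ultimately show ?thesis using m(1,2) card by (auto simp: k_contact_form_def mdim_def)
qed

lemma F_image_carrier: "F ` carrier M = carrier N"
  using F_image_eq[of "carrier M"] G_carrier by auto

lemma k_contact_manifold_push:
  assumes card: "card (index M) = card (index N)" and D: "related D D'" and kc: "k_contact_manifold k M D"
  shows "k_contact_manifold k N D'"
  unfolding k_contact_manifold_def
proof (intro conjI ballI)
  show "smooth_manifold N" by (rule N)
  show "\<exists>m. m + k = mdim N \<and> regular_dist N (carrier N) m D'"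
    using kc regular_push[OF D, of "carrier M"] card by (auto simp: k_contact_manifold_def mdim_def F_image_carrier)
  fix q assume q: "q \<in> carrier N"
  obtain U \<eta> where U: "G q \<in> U" "k_contact_form k M U \<eta>" "\<forall>p\<in>U. D p = ker_form M k \<eta> p"
    using kc G_carrier[OF q] unfolding k_contact_manifold_def by meson
  let ?\<eta>' = "\<lambda>A q w. \<eta> A (G q) (dG q w)"
  have rel: "\<forall>A<k. form_related (\<eta> A) (?\<eta>' A)" by (simp add: form_related_def dG_dF GF)
  have Uc: "U \<subseteq> carrier M" using U(2) mopen_subset by (auto simp: k_contact_form_def regular_dist_def)
  have "D' (F p) = ker_form N k ?\<eta>' (F p)" if "p \<in> U" for p
    using relatedD(2)[OF D] ker_form_push[OF rel] U(3) that Uc by auto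
  moreover have "q \<in> F ` U" using U(1) FG[OF q] by (metis imageI)
  ultimately show "\<exists>U \<eta>. q \<in> U \<and> k_contact_form k N U \<eta> \<and> (\<forall>y\<in>U. D' y = ker_form N k \<eta> y)"
    using k_contact_form_push[OF card U(2)] by (intro exI[of _ "F ` U"] exI[of _ ?\<eta>'] conjI) auto
qed

subsection \<open>Legendrian subbundles\<close>

lemma levi_push_subset:
  assumes D: "related D D'" and p: "p \<in> carrier M"
  shows "dF p ` levi_tensor M D p v w \<subseteq> levi_tensor N D' (F p) (dF p v) (dF p w)"
proof
  fix u' assume "u' \<in> dF p ` levi_tensor M D p v w"
  then obtain u W X Y where u: "u' = dF p u" "u \<in> tangent_space M p" and W: "p \<in> W" "section_of M W D X" "section_of M W D Y"
    "X p = v" "Y p = w" "u - lie_bracket M X Y p \<in> D p"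
    by (auto simp: levi_tensor_def)
  have XY: "vector_field M W X" "vector_field M W Y" using W by (auto simp: section_of_def)
  have "u' - lie_bracket N (push X) (push Y) (F p) = dF p (u - lie_bracket M X Y p)"
    unfolding push_bracket[OF XY W(1)] u(1) by (rule linear_diff[OF tangent_map_linear, symmetric])
  also have "\<dots> \<in> D' (F p)" using W(6) relatedD(2)[OF D p] by simp
  finally have br: "u' - lie_bracket N (push X) (push Y) (F p) \<in> D' (F p)" .
  show "u' \<in> levi_tensor N D' (F p) (dF p v) (dF p w)"
    unfolding levi_tensor_def mem_Collect_eq
    using dF_in[OF p u(2)] u(1) W(1,4,5) section_push[OF D W(2)] section_push[OF D W(3)] br push_F[OF p]
    by (intro conjI exI[of _ "F ` W"] exI[of _ "push X"] exI[of _ "push Y"]) auto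
qed

lemma levi_push:
  assumes D: "related D D'" and p: "p \<in> carrier M" and vw: "v \<in> tangent_space M p" "w \<in> tangent_space M p"
  shows "levi_tensor N D' (F p) (dF p v) (dF p w) = dF p ` levi_tensor M D p v w"
proof
  interpret inv: diffeomorphism N M G F by (rule inverse)
  show "dF p ` levi_tensor M D p v w \<subseteq> levi_tensor N D' (F p) (dF p v) (dF p w)" by (rule levi_push_subset[OF D p])
  have sub: "dG (F p) ` levi_tensor N D' (F p) (dF p v) (dF p w) \<subseteq> levi_tensor M D p v w"
    using inv.levi_push_subset[OF related_inverse[OF D] F_carrier[OF p], of "dF p v" "dF p w"]
    by (simp add: GF[OF p] dG_dF[OF p] vw)
  show "levi_tensor N D' (F p) (dF p v) (dF p w) \<subseteq> dF p ` levi_tensor M D p v w"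
  proof
    fix u assume u: "u \<in> levi_tensor N D' (F p) (dF p v) (dF p w)"
    then have "u \<in> tangent_space N (F p)" by (simp add: levi_tensor_def)
    then have "u = dF p (dG (F p) u)" using dF_dG[OF p] by simp
    then show "u \<in> dF p ` levi_tensor M D p v w" using sub u by blast
  qed
qed

lemma isotropic_push:
  assumes D: "related D D'" and p: "p \<in> carrier M" and S: "isotropic M D p S"
  shows "isotropic N D' (F p) (dF p ` S)"
proof -
  have S': "subspace S" "S \<subseteq> D p" "\<And>v w. v \<in> S \<Longrightarrow> w \<in> S \<Longrightarrow> levi_tensor M D p v w = D p"
    using S by (auto simp: isotropic_def)
  have "levi_tensor N D' (F p) (dF p v) (dF p w) = D' (F p)" if "v \<in> S" "w \<in> S" for v w
  proof -
    have "v \<in> tangent_space M p" "w \<in> tangent_space M p" using that S'(2) relatedD(1)[OF D p] by auto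
    from levi_push[OF D p this] show ?thesis unfolding S'(3)[OF that] relatedD(2)[OF D p] .
  qed
  then show ?thesis
    using linear_subspace_image[OF tangent_map_linear S'(1)] S'(2) relatedD(2)[OF D p] by (auto simp: isotropic_def)
qed

lemma legendrian_push:
  assumes D: "related D D'" and p: "p \<in> carrier M" and S: "legendrian M D p S"
  shows "legendrian N D' (F p) (dF p ` S)"
proof -
  obtain C where C: "isotropic M D p S" "isotropic M D p C" "direct_sum S C (D p)" using S by (auto simp: legendrian_def)
  show ?thesis
    unfolding legendrian_def
    using isotropic_push[OF D p C(1)] isotropic_push[OF D p C(2)] direct_sum_push[OF p relatedD(1)[OF D p] C(3)]
      relatedD(2)[OF D p] by auto
qed

lemma integrable_legendrian_push:
  assumes card: "card (index M) = card (index N)" and D: "related D D'" and P: "related P P'"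
    and leg: "integrable_legendrian M D m P"
  shows "integrable_legendrian N D' m P'"
  unfolding integrable_legendrian_def
proof (intro conjI ballI)
  show "regular_dist N (carrier N) m P'"
    using regular_push[OF P, of "carrier M"] leg by (simp add: integrable_legendrian_def F_image_carrier)
  show "integrable_dist N (carrier N) P'"
    using integrable_push[OF card order_refl P] leg by (simp add: integrable_legendrian_def F_image_carrier)
  fix q assume q: "q \<in> carrier N"
  have "legendrian N D' (F (G q)) (dF (G q) ` P (G q))"
    by (rule legendrian_push[OF D G_carrier[OF q]]) (use leg G_carrier[OF q] in \<open>simp add: integrable_legendrian_def\<close>)
  then show "legendrian N D' q (P' q)" using relatedD(2)[OF P G_carrier[OF q]] FG[OF q] by simp
qed

text \<open>
  Maximality of the rank is preserved because an integrable Legendrian subbundle on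
  \<open>N\<close> is pulled back to one on \<open>M\<close> of the same rank.
\<close>

lemma polarised_k_contact_push:
  assumes card: "card (index M) = card (index N)" and D: "related D D'" and P: "related P P'"
    and pol: "polarised_k_contact k M D P"
  shows "polarised_k_contact k N D' P'"
proof -
  interpret inv: diffeomorphism N M G F by (rule inverse)
  obtain m where m: "integrable_legendrian M D m P" "\<And>m' P''. integrable_legendrian M D m' P'' \<Longrightarrow> m' \<le> m"
    using pol by (auto simp: polarised_k_contact_def polarisation_def)
  have "m' \<le> m" if leg: "integrable_legendrian N D' m' P''" for m' P''
  proof (rule m(2))
    have "P'' q \<subseteq> tangent_space N q" if q: "q \<in> carrier N" for q
    proof -
      have "P'' q \<subseteq> D' q" using leg q by (auto simp: integrable_legendrian_def legendrian_def isotropic_def)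
      also have "\<dots> \<subseteq> tangent_space N q" using inv.relatedD(1)[OF related_inverse[OF D] q] .
      finally show ?thesis .
    qed
    then have "related (\<lambda>p. dG (F p) ` P'' (F p)) P''" by (rule related_pullback)
    then show "integrable_legendrian M D m' (\<lambda>p. dG (F p) ` P'' (F p))"
      using inv.integrable_legendrian_push[OF card[symmetric] related_inverse[OF D] related_inverse leg] by blast
  qed
  then have "polarisation N D' P'"
    using integrable_legendrian_push[OF card D P m(1)] unfolding polarisation_def by blast
  moreover have "k_contact_manifold k N D'"
    by (rule k_contact_manifold_push[OF card D]) (use pol in \<open>simp add: polarised_k_contact_def\<close>)
  ultimately show ?thesis by (simp add: polarised_k_contact_def)
qed

end

text \<open>
  On the empty manifold every rank is the rank of an integrable Legendrian subbundle, so there is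
  no polarisation.
\<close>

lemma polarisation_carrier_nonempty:
  assumes "polarisation M D P" shows "carrier M \<noteq> {}"
proof
  assume e: "carrier M = {}"
  have "integrable_legendrian M D m P" for m
    using e mopen_empty[of M] by (simp add: integrable_legendrian_def regular_dist_def integrable_dist_def)
  then show False using assms unfolding polarisation_def by (meson Suc_n_not_le_n)
qed

section \<open>Jets of smooth functions\<close>

abbreviation pderivs :: "'i list \<Rightarrow> (('i \<Rightarrow> real) \<Rightarrow> real) \<Rightarrow> ('i \<Rightarrow> real) \<Rightarrow> real"
  where "pderivs l f \<equiv> foldr pderiv_at l f"

text \<open>
  For inductions on the order, derivatives along arbitrary lists of indices are more convenient than
  the sorted ones of \<open>multi_pderiv\<close>, because the innermost derivative can be split off.
\<close>

definition jet_eq :: "nat \<Rightarrow> 'i set \<Rightarrow> ('i \<Rightarrow> real) \<Rightarrow> (('i \<Rightarrow> real) \<Rightarrow> real) \<Rightarrow> (('i \<Rightarrow> real) \<Rightarrow> real) \<Rightarrow> bool"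
  where "jet_eq r I x f g \<longleftrightarrow> (\<forall>l. set l \<subseteq> I \<and> length l \<le> r \<longrightarrow> pderivs l f x = pderivs l g x)"

lemma Cinf_on_pderivs: "Cinf_on I S f \<Longrightarrow> set l \<subseteq> I \<Longrightarrow> Cinf_on I S (pderivs l f)"
  by (induction l) (auto intro: Cinf_on_pderiv)

lemma pderivs_cong:
  assumes "finite I" "coord_open I S" "\<And>y. y \<in> S \<Longrightarrow> f y = g y"
  shows "set l \<subseteq> I \<Longrightarrow> x \<in> S \<Longrightarrow> pderivs l f x = pderivs l g x"
proof (induction l arbitrary: x)
  case (Cons i l)
  then show ?case
    using pderiv_at_cong[OF assms(1,2), of i x "pderivs l f" "pderivs l g"] by simp
qed (simp add: assms)

lemma multi_pderiv_cong:
  assumes "finite I" "coord_open I S" "\<And>y. y \<in> S \<Longrightarrow> f y = g y" "set_mset J \<subseteq> I" "x \<in> S"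
  shows "multi_pderiv J f x = multi_pderiv J g x"
  unfolding multi_pderiv_def by (rule pderivs_cong[OF assms(1-3)]) (use assms(4,5) in auto)

lemma pderivs_move:
  assumes fin: "finite I" and f: "Cinf_on I S f"
  shows "set l \<subseteq> I \<Longrightarrow> a \<in> set l \<Longrightarrow> x \<in> S \<Longrightarrow> pderivs l f x = pderivs (a # remove1 a l) f x"
proof (induction l arbitrary: x)
  case (Cons b l)
  show ?case
  proof (cases "a = b")
    case False
    then have a: "a \<in> set l" "a \<in> I" and b: "b \<in> I" using Cons.prems by auto
    have IH: "pderivs l f y = pderiv_at a (pderivs (remove1 a l) f) y" if "y \<in> S" for y
      using Cons.IH[OF _ a(1) that] Cons.prems(1) by simp
    have "pderivs (b # l) f x = pderiv_at b (pderiv_at a (pderivs (remove1 a l) f)) x"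
      using pderiv_at_cong[OF fin Cinf_on_open[OF f] b Cons.prems(3) IH] by simp
    also have "\<dots> = pderiv_at a (pderiv_at b (pderivs (remove1 a l) f)) x"
    proof (rule pderiv_at_commute[OF fin Cinf_on_open[OF f] Cinf_on_Ck b a(2) Cons.prems(3)])
      have "set (remove1 a l) \<subseteq> I" using Cons.prems(1) set_remove1_subset[of a l] by auto
      then show "Cinf_on I S (pderivs (remove1 a l) f)" by (rule Cinf_on_pderivs[OF f])
    qed
    finally show ?thesis using False by simp
  qed simp
qed simp

text \<open>Partial derivatives commute, so only the multiset of the indices matters.\<close>

lemma pderivs_mset:
  assumes fin: "finite I" and f: "Cinf_on I S f"
  shows "mset l = mset l' \<Longrightarrow> set l \<subseteq> I \<Longrightarrow> x \<in> S \<Longrightarrow> pderivs l f x = pderivs l' f x"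
proof (induction l arbitrary: l' x)
  case (Cons a l)
  have a: "a \<in> set l'" "a \<in> I" and l': "set l' \<subseteq> I"
    using Cons.prems(1,2) mset_eq_setD[OF Cons.prems(1)] by auto
  have m: "mset l = mset (remove1 a l')" using Cons.prems(1) by (metis add_mset_remove_trivial mset.simps(2) mset_remove1)
  have "pderivs l f y = pderivs (remove1 a l') f y" if "y \<in> S" for y
    by (rule Cons.IH[OF m _ that]) (use Cons.prems(2) in auto)
  then have "pderiv_at a (pderivs l f) x = pderiv_at a (pderivs (remove1 a l') f) x"
    by (rule pderiv_at_cong[OF fin Cinf_on_open[OF f] a(2) Cons.prems(3)])
  then show ?case using pderivs_move[OF fin f l' a(1) Cons.prems(3)] by (simp only: foldr_Cons comp_apply)
qed simp

lemma jet_eq_multi_pderiv: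
  assumes fin: "finite I" and f: "Cinf_on I S f" and g: "Cinf_on I S g" and x: "x \<in> S"
  shows "jet_eq r I x f g \<longleftrightarrow>
    (\<forall>J. set_mset J \<subseteq> I \<and> size J \<le> r \<longrightarrow> multi_pderiv J f x = multi_pderiv J g x)"
proof (intro iffI allI impI)
  fix J assume *: "jet_eq r I x f g" and J: "set_mset J \<subseteq> I \<and> size J \<le> r"
  have "length (sorted_list_of_multiset J) = size J" by (metis mset_sorted_list_of_multiset size_mset)
  then show "multi_pderiv J f x = multi_pderiv J g x" using * J by (simp add: jet_eq_def multi_pderiv_def)
next
  assume *: "\<forall>J. set_mset J \<subseteq> I \<and> size J \<le> r \<longrightarrow> multi_pderiv J f x = multi_pderiv J g x"
  show "jet_eq r I x f g" unfolding jet_eq_def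
  proof (intro allI impI)
    fix l assume l: "set l \<subseteq> I \<and> length l \<le> r"
    have srt: "pderivs l h x = multi_pderiv (mset l) h x" if "Cinf_on I S h" for h
      unfolding multi_pderiv_def by (rule pderivs_mset[OF fin that _ _ x]) (use l in auto)
    show "pderivs l f x = pderivs l g x" unfolding srt[OF f] srt[OF g] using * l by simp
  qed
qed

lemma jet_eq_refl: "jet_eq r I x f f"
  by (simp add: jet_eq_def)

lemma jet_eq_value: "jet_eq r I x f g \<Longrightarrow> f x = g x"
  unfolding jet_eq_def by (elim allE[of _ "[]"]) simp

lemma jet_eq_0: "jet_eq 0 I x f g \<longleftrightarrow> f x = g x"
  by (simp add: jet_eq_def)

lemma jet_eq_Suc:
  "jet_eq (Suc r) I x f g \<longleftrightarrow> f x = g x \<and> (\<forall>i\<in>I. jet_eq r I x (pderiv_at i f) (pderiv_at i g))"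
proof (intro iffI conjI ballI)
  assume *: "jet_eq (Suc r) I x f g"
  show "f x = g x" by (rule jet_eq_value[OF *])
  fix i assume i: "i \<in> I"
  show "jet_eq r I x (pderiv_at i f) (pderiv_at i g)" unfolding jet_eq_def
  proof (intro allI impI)
    fix l assume "set l \<subseteq> I \<and> length l \<le> r"
    then have "pderivs (l @ [i]) f x = pderivs (l @ [i]) g x" using * i by (simp add: jet_eq_def del: foldr_append)
    then show "pderivs l (pderiv_at i f) x = pderivs l (pderiv_at i g) x" by simp
  qed
next
  assume *: "f x = g x \<and> (\<forall>i\<in>I. jet_eq r I x (pderiv_at i f) (pderiv_at i g))"
  show "jet_eq (Suc r) I x f g" unfolding jet_eq_def
  proof (intro allI impI)
    fix l assume l: "set l \<subseteq> I \<and> length l \<le> Suc r"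
    show "pderivs l f x = pderivs l g x"
    proof (cases l rule: rev_cases)
      case (snoc l' i)
      then show ?thesis using * l by (simp add: jet_eq_def)
    qed (use * in simp)
  qed
qed

lemma jet_eq_Suc_D: "jet_eq (Suc r) I x f g \<Longrightarrow> jet_eq r I x f g"
  by (simp add: jet_eq_def)

lemma jet_eq_cong:
  assumes "finite I" "coord_open I S" "x \<in> S" "\<And>y. y \<in> S \<Longrightarrow> f y = f' y" "\<And>y. y \<in> S \<Longrightarrow> g y = g' y"
    and "jet_eq r I x f g"
  shows "jet_eq r I x f' g'"
  unfolding jet_eq_def
proof (intro allI impI)
  fix l assume l: "set l \<subseteq> I \<and> length l \<le> r"
  have "pderivs l f x = pderivs l f' x" "pderivs l g x = pderivs l g' x"
    using pderivs_cong[OF assms(1,2,4)] pderivs_cong[OF assms(1,2,5)] l assms(3) by auto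
  then show "pderivs l f' x = pderivs l g' x" using assms(6) l by (simp add: jet_eq_def)
qed

lemma pderiv_at_add:
  assumes "Cinf_on I S f" "Cinf_on I S g" "i \<in> I" "x \<in> S"
  shows "pderiv_at i (\<lambda>x. f x + g x) x = pderiv_at i f x + pderiv_at i g x"
  using pderiv_at_lincomb[OF assms, of 1 1] by simp

lemma jet_eq_add:
  assumes fin: "finite I" and x: "x \<in> S"
  shows "Cinf_on I S f \<Longrightarrow> Cinf_on I S g \<Longrightarrow> Cinf_on I S f' \<Longrightarrow> Cinf_on I S g' \<Longrightarrow>
    jet_eq r I x f g \<Longrightarrow> jet_eq r I x f' g' \<Longrightarrow> jet_eq r I x (\<lambda>x. f x + f' x) (\<lambda>x. g x + g' x)"
proof (induction r arbitrary: f g f' g')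
  case (Suc r)
  note S = Cinf_on_open[OF Suc.prems(1)]
  show ?case unfolding jet_eq_Suc
  proof (intro conjI ballI)
    show "f x + f' x = g x + g' x" using Suc.prems(5,6) by (simp add: jet_eq_Suc)
    fix i assume i: "i \<in> I"
    have "jet_eq r I x (\<lambda>x. pderiv_at i f x + pderiv_at i f' x) (\<lambda>x. pderiv_at i g x + pderiv_at i g' x)"
      by (rule Suc.IH[OF Cinf_on_pderiv[OF Suc.prems(1) i] Cinf_on_pderiv[OF Suc.prems(2) i]
            Cinf_on_pderiv[OF Suc.prems(3) i] Cinf_on_pderiv[OF Suc.prems(4) i]])
        (use Suc.prems(5,6) i in \<open>simp_all add: jet_eq_Suc\<close>)
    then show "jet_eq r I x (pderiv_at i (\<lambda>x. f x + f' x)) (pderiv_at i (\<lambda>x. g x + g' x))"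
      by (rule jet_eq_cong[OF fin S x, rotated 2])
        (simp_all add: pderiv_at_add[OF Suc.prems(1,3) i] pderiv_at_add[OF Suc.prems(2,4) i])
  qed
qed (simp add: jet_eq_0)

text \<open>
  By induction on the order, with the product rule; the factors themselves also have equal jets of
  lower order.
\<close>

lemma jet_eq_mult:
  assumes fin: "finite I" and x: "x \<in> S"
  shows "Cinf_on I S f \<Longrightarrow> Cinf_on I S g \<Longrightarrow> Cinf_on I S f' \<Longrightarrow> Cinf_on I S g' \<Longrightarrow>
    jet_eq r I x f g \<Longrightarrow> jet_eq r I x f' g' \<Longrightarrow> jet_eq r I x (\<lambda>x. f x * f' x) (\<lambda>x. g x * g' x)"
proof (induction r arbitrary: f g f' g')
  case (Suc r)
  note S = Cinf_on_open[OF Suc.prems(1)]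
  note low = jet_eq_Suc_D[OF Suc.prems(5)] jet_eq_Suc_D[OF Suc.prems(6)]
  show ?case unfolding jet_eq_Suc
  proof (intro conjI ballI)
    show "f x * f' x = g x * g' x" using Suc.prems(5,6) by (simp add: jet_eq_Suc)
    fix i assume i: "i \<in> I"
    note D = Cinf_on_pderiv[OF Suc.prems(1) i] Cinf_on_pderiv[OF Suc.prems(2) i]
            Cinf_on_pderiv[OF Suc.prems(3) i] Cinf_on_pderiv[OF Suc.prems(4) i]
    have jd: "jet_eq r I x (pderiv_at i f) (pderiv_at i g)" "jet_eq r I x (pderiv_at i f') (pderiv_at i g')"
      using Suc.prems(5,6) i by (simp_all add: jet_eq_Suc)
    have "jet_eq r I x (\<lambda>x. pderiv_at i f x * f' x + f x * pderiv_at i f' x)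
        (\<lambda>x. pderiv_at i g x * g' x + g x * pderiv_at i g' x)"
      by (rule jet_eq_add[OF fin x Cinf_on_mult[OF fin D(1) Suc.prems(3)] Cinf_on_mult[OF fin D(2) Suc.prems(4)]
            Cinf_on_mult[OF fin Suc.prems(1) D(3)] Cinf_on_mult[OF fin Suc.prems(2) D(4)]
            Suc.IH[OF D(1,2) Suc.prems(3,4) jd(1) low(2)] Suc.IH[OF Suc.prems(1,2) D(3,4) low(1) jd(2)]])
    then show "jet_eq r I x (pderiv_at i (\<lambda>x. f x * f' x)) (pderiv_at i (\<lambda>x. g x * g' x))"
      by (rule jet_eq_cong[OF fin S x, rotated 2])
        (simp_all add: pderiv_at_mult[OF Suc.prems(1,3) i] pderiv_at_mult[OF Suc.prems(2,4) i])
  qed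
qed (simp add: jet_eq_0)

lemma Cinf_on_sum:
  assumes "finite I" "coord_open I S" "\<And>k. k \<in> K \<Longrightarrow> Cinf_on I S (f k)"
  shows "Cinf_on I S (\<lambda>x. \<Sum>k\<in>K. f k x)"
  using Ck_on_sum[OF assms(1,2), of K _ f] assms(2,3) by (simp add: Cinf_on_def)

lemma jet_eq_sum:
  assumes fin: "finite I" and S: "coord_open I S" and x: "x \<in> S"
    and f: "\<And>k. k \<in> K \<Longrightarrow> Cinf_on I S (f k)" "\<And>k. k \<in> K \<Longrightarrow> Cinf_on I S (g k)"
      "\<And>k. k \<in> K \<Longrightarrow> jet_eq r I x (f k) (g k)"
  shows "jet_eq r I x (\<lambda>x. \<Sum>k\<in>K. f k x) (\<lambda>x. \<Sum>k\<in>K. g k x)"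
  using f
proof (induction K rule: infinite_finite_induct)
  case (insert k K)
  have "jet_eq r I x (\<lambda>x. f k x + (\<Sum>k\<in>K. f k x)) (\<lambda>x. g k x + (\<Sum>k\<in>K. g k x))"
    using insert.prems insert.IH by (intro jet_eq_add[OF fin x] Cinf_on_sum[OF fin S]) auto
  then show ?case using insert.hyps by simp
qed (simp_all add: jet_eq_refl)

text \<open>
  By the chain rule the first derivatives of a composite are sums of products whose factors have
  equal jets of one order less, so that induction on the order applies.
\<close>

lemma jet_eq_compose:
  assumes I: "finite I" "coord_open I S" and x: "x \<in> S" and J: "finite J"
    and F: "F ` S \<subseteq> T" "\<And>j. j \<in> J \<Longrightarrow> Cinf_on I S (\<lambda>x. F x j)"
    and H: "H ` S \<subseteq> T" "\<And>j. j \<in> J \<Longrightarrow> Cinf_on I S (\<lambda>x. H x j)"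
    and eq: "F x = H x"
  shows "(\<And>j. j \<in> J \<Longrightarrow> jet_eq r I x (\<lambda>x. F x j) (\<lambda>x. H x j)) \<Longrightarrow> Cinf_on J T g \<Longrightarrow>
    jet_eq r I x (\<lambda>x. g (F x)) (\<lambda>x. g (H x))"
proof (induction r arbitrary: g)
  case (Suc r)
  note g = Suc.prems(2)
  have low: "jet_eq r I x (\<lambda>x. F x j) (\<lambda>x. H x j)" if "j \<in> J" for j
    by (rule jet_eq_Suc_D[OF Suc.prems(1)[OF that]])
  show ?case unfolding jet_eq_Suc
  proof (intro conjI ballI)
    show "g (F x) = g (H x)" by (simp add: eq)
    fix i assume i: "i \<in> I"
    have "jet_eq r I x (\<lambda>x. \<Sum>j\<in>J. pderiv_at j g (F x) * pderiv_at i (\<lambda>x. F x j) x)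
        (\<lambda>x. \<Sum>j\<in>J. pderiv_at j g (H x) * pderiv_at i (\<lambda>x. H x j) x)"
    proof (rule jet_eq_sum[OF I x])
      fix j assume j: "j \<in> J"
      note g' = Cinf_on_pderiv[OF g j]
      have c: "Cinf_on I S (\<lambda>x. pderiv_at j g (F x))" "Cinf_on I S (\<lambda>x. pderiv_at j g (H x))"
        by (rule Cinf_on_compose[OF I J F g'], assumption) (rule Cinf_on_compose[OF I J H g'], assumption)
      note d = Cinf_on_pderiv[OF F(2)[OF j] i] Cinf_on_pderiv[OF H(2)[OF j] i]
      show "Cinf_on I S (\<lambda>x. pderiv_at j g (F x) * pderiv_at i (\<lambda>x. F x j) x)"
        "Cinf_on I S (\<lambda>x. pderiv_at j g (H x) * pderiv_at i (\<lambda>x. H x j) x)"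
        by (rule Cinf_on_mult[OF I(1) c(1) d(1)], rule Cinf_on_mult[OF I(1) c(2) d(2)])
      have "jet_eq r I x (\<lambda>x. pderiv_at j g (F x)) (\<lambda>x. pderiv_at j g (H x))"
        using low g' by (rule Suc.IH)
      moreover have "jet_eq r I x (pderiv_at i (\<lambda>x. F x j)) (pderiv_at i (\<lambda>x. H x j))"
        using Suc.prems(1)[OF j] i by (simp add: jet_eq_Suc)
      ultimately show "jet_eq r I x (\<lambda>x. pderiv_at j g (F x) * pderiv_at i (\<lambda>x. F x j) x)
          (\<lambda>x. pderiv_at j g (H x) * pderiv_at i (\<lambda>x. H x j) x)"
        by (rule jet_eq_mult[OF I(1) x c d])
    qed
    then show "jet_eq r I x (pderiv_at i (\<lambda>x. g (F x))) (pderiv_at i (\<lambda>x. g (H x)))"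
      by (rule jet_eq_cong[OF I x, rotated 2])
        (use pderiv_at_comp[OF I J F g i] pderiv_at_comp[OF I J H g i] in simp_all)
  qed
qed (simp add: jet_eq_0 eq)

text \<open>
  By induction on the order, as in \<open>jet_eq_compose\<close>; the derivatives of
  \<open>h\<close> are the same on both sides.
\<close>

lemma jet_eq_reparametrise:
  assumes I: "finite I" "coord_open I S" and x: "x \<in> S" and J: "finite J"
    and h: "h ` S \<subseteq> T" "\<And>j. j \<in> J \<Longrightarrow> Cinf_on I S (\<lambda>x. h x j)"
  shows "Cinf_on J T f \<Longrightarrow> Cinf_on J T g \<Longrightarrow> jet_eq r J (h x) f g \<Longrightarrow> jet_eq r I x (\<lambda>x. f (h x)) (\<lambda>x. g (h x))"
proof (induction r arbitrary: f g)
  case (Suc r)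
  note f = Suc.prems(1) and g = Suc.prems(2)
  show ?case unfolding jet_eq_Suc
  proof (intro conjI ballI)
    show "f (h x) = g (h x)" using Suc.prems(3) by (simp add: jet_eq_Suc)
    fix i assume i: "i \<in> I"
    have "jet_eq r I x (\<lambda>x. \<Sum>j\<in>J. pderiv_at j f (h x) * pderiv_at i (\<lambda>x. h x j) x)
        (\<lambda>x. \<Sum>j\<in>J. pderiv_at j g (h x) * pderiv_at i (\<lambda>x. h x j) x)"
    proof (rule jet_eq_sum[OF I x])
      fix j assume j: "j \<in> J"
      note f' = Cinf_on_pderiv[OF f j] and g' = Cinf_on_pderiv[OF g j]
      have c: "Cinf_on I S (\<lambda>x. pderiv_at j f (h x))" "Cinf_on I S (\<lambda>x. pderiv_at j g (h x))"
        by (rule Cinf_on_compose[OF I J h f'], assumption) (rule Cinf_on_compose[OF I J h g'], assumption)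
      note d = Cinf_on_pderiv[OF h(2)[OF j] i]
      show "Cinf_on I S (\<lambda>x. pderiv_at j f (h x) * pderiv_at i (\<lambda>x. h x j) x)"
        "Cinf_on I S (\<lambda>x. pderiv_at j g (h x) * pderiv_at i (\<lambda>x. h x j) x)"
        by (rule Cinf_on_mult[OF I(1) c(1) d], rule Cinf_on_mult[OF I(1) c(2) d])
      have "jet_eq r I x (\<lambda>x. pderiv_at j f (h x)) (\<lambda>x. pderiv_at j g (h x))"
        by (rule Suc.IH[OF f' g']) (use Suc.prems(3) j in \<open>simp add: jet_eq_Suc\<close>)
      then show "jet_eq r I x (\<lambda>x. pderiv_at j f (h x) * pderiv_at i (\<lambda>x. h x j) x)
          (\<lambda>x. pderiv_at j g (h x) * pderiv_at i (\<lambda>x. h x j) x)"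
        by (rule jet_eq_mult[OF I(1) x c d d _ jet_eq_refl])
    qed
    then show "jet_eq r I x (pderiv_at i (\<lambda>x. f (h x))) (pderiv_at i (\<lambda>x. g (h x)))"
      by (rule jet_eq_cong[OF I x, rotated 2])
        (use pderiv_at_comp[OF I J h f i] pderiv_at_comp[OF I J h g i] in simp_all)
  qed
qed (simp add: jet_eq_0)

text \<open>
  A change of charts of \<open>E\<close> composes both maps with the same function, and a change
  of charts of \<open>Q\<close> reparametrises both; neither affects equality of jets.
\<close>

lemma jet_eq_change_charts:
  assumes Q: "smooth_manifold Q" and E: "smooth_manifold E"
    and \<sigma>: "smooth_map Q N E \<sigma>" and \<tau>: "smooth_map Q N' E \<tau>" and x: "x \<in> N" "x \<in> N'" and eq: "\<sigma> x = \<tau> x"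
    and V: "(V, \<phi>) \<in> charts Q" "x \<in> V" and V': "(V', \<phi>') \<in> charts Q" "x \<in> V'"
    and U: "(U, \<psi>) \<in> charts E" "\<sigma> x \<in> U" and U': "(U', \<psi>') \<in> charts E" "\<sigma> x \<in> U'"
    and jet: "\<And>i. i \<in> index E \<Longrightarrow> jet_eq r (index Q) (\<phi> x)
      (\<lambda>z. \<psi> (\<sigma> (inv_into V \<phi> z)) i) (\<lambda>z. \<psi> (\<tau> (inv_into V \<phi> z)) i)"
  shows "jet_eq r (index Q) (\<phi>' x) (\<lambda>z. \<psi>' (\<sigma> (inv_into V' \<phi>' z)) i) (\<lambda>z. \<psi>' (\<tau> (inv_into V' \<phi>' z)) i)"
proof -
  note A = smooth_manifold_inj_atlas[OF Q]
  have finQ: "finite (index Q)" and finE: "finite (index E)" using Q E smooth_manifold_finite by auto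
  have UU': "mopen E (U \<inter> U')" by (rule mopen_Int[OF smooth_manifold_inj_atlas[OF E] charts_mopen[OF U(1)] charts_mopen[OF U'(1)]])
  define W where "W = (N \<inter> \<sigma> -` (U \<inter> U')) \<inter> (N' \<inter> \<tau> -` (U \<inter> U')) \<inter> (V \<inter> V')"
  have W: "mopen Q W" unfolding W_def
    by (rule mopen_Int[OF A mopen_Int[OF A smooth_map_vimage[OF \<sigma> UU'] smooth_map_vimage[OF \<tau> UU']]
          mopen_Int[OF A charts_mopen[OF V(1)] charts_mopen[OF V'(1)]]])
  have xW: "x \<in> W" using x eq V(2) V'(2) U(2) U'(2) by (simp add: W_def)
  have WV: "W \<subseteq> V" "W \<subseteq> V'" by (auto simp: W_def)
  have inj: "inj_on \<phi> V" "inj_on \<phi>' V'" "inj_on \<psi> U"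
    using chartsD(2)[OF V(1)] chartsD(2)[OF V'(1)] chartsD(2)[OF U(1)] by auto
  have invV: "inv_into V \<phi> (\<phi> y) = y" and invV': "inv_into V' \<phi>' (\<phi>' y) = y" if "y \<in> W" for y
    using inj WV that by auto
  define S where "S = \<phi> ` W"
  define S' where "S' = \<phi>' ` W"
  have S: "coord_open (index Q) S"
    using charts_open_image[OF Q V(1) W] WV(1) by (simp add: S_def Int_absorb1)
  have S': "coord_open (index Q) S'"
    using charts_open_image[OF Q V'(1) W] WV(2) by (simp add: S'_def Int_absorb1)
  have loc: "Cinf_on (index Q) S (\<lambda>z. \<psi> (\<sigma> (inv_into V \<phi> z)) j)" "(\<lambda>z. \<psi> (\<sigma> (inv_into V \<phi> z))) ` S \<subseteq> \<psi> ` (U \<inter> U')"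
    if \<sigma>: "smooth_map Q N E \<sigma>" "W \<subseteq> N \<inter> \<sigma> -` (U \<inter> U')" for N \<sigma> j
  proof -
    have "smooth_fun Q W (\<lambda>y. \<psi> (\<sigma> y) j)"
      by (rule smooth_fun_subset[OF smooth_map_chart[OF A E \<sigma>(1) U(1)] W]) (use \<sigma>(2) in blast)
    from smooth_fun_chart[OF Q this V(1)] show "Cinf_on (index Q) S (\<lambda>z. \<psi> (\<sigma> (inv_into V \<phi> z)) j)"
      using WV(1) by (simp add: S_def Int_absorb1)
    show "(\<lambda>z. \<psi> (\<sigma> (inv_into V \<phi> z))) ` S \<subseteq> \<psi> ` (U \<inter> U')"
    proof (rule image_subsetI)
      fix z assume "z \<in> S"
      then obtain y where y: "y \<in> W" "z = \<phi> y" by (auto simp: S_def)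
      then have "\<sigma> y \<in> U \<inter> U'" using \<sigma>(2) by blast
      then show "\<psi> (\<sigma> (inv_into V \<phi> z)) \<in> \<psi> ` (U \<inter> U')" unfolding y(2) invV[OF y(1)] by (rule imageI)
    qed
  qed
  have W\<sigma>: "W \<subseteq> N \<inter> \<sigma> -` (U \<inter> U')" and W\<tau>: "W \<subseteq> N' \<inter> \<tau> -` (U \<inter> U')" by (auto simp: W_def)
  let ?g = "\<lambda>y. \<psi>' (inv_into U \<psi> y) i"
  have g: "Cinf_on (index E) (\<psi> ` (U \<inter> U')) ?g"
    by (rule smooth_fun_chart[OF E charts_smooth_coordinate[OF E U'(1)] U(1)])
  have xS: "\<phi> x \<in> S" and xS': "\<phi>' x \<in> S'" using xW by (auto simp: S_def S'_def)
  have val: "\<psi> (\<sigma> (inv_into V \<phi> (\<phi> x))) = \<psi> (\<tau> (inv_into V \<phi> (\<phi> x)))" by (simp add: invV[OF xW] eq)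
  have j1: "jet_eq r (index Q) (\<phi> x) (\<lambda>z. ?g (\<psi> (\<sigma> (inv_into V \<phi> z)))) (\<lambda>z. ?g (\<psi> (\<tau> (inv_into V \<phi> z))))"
    by (rule jet_eq_compose[OF finQ S xS finE loc(2)[OF \<sigma> W\<sigma>] loc(1)[OF \<sigma> W\<sigma>] loc(2)[OF \<tau> W\<tau>] loc(1)[OF \<tau> W\<tau>] val jet g])
  let ?h = "\<lambda>z. \<phi> (inv_into V' \<phi>' z)"
  have hS: "?h ` S' \<subseteq> S" by (auto simp: S_def S'_def invV')
  have h_C: "Cinf_on (index Q) S' (\<lambda>z. ?h z j)" for j
  proof -
    have "smooth_fun Q W (\<lambda>y. \<phi> y j)" by (rule smooth_fun_subset[OF charts_smooth_coordinate[OF Q V(1)] W WV(1)])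
    from smooth_fun_chart[OF Q this V'(1)] show ?thesis using WV(2) by (simp add: S'_def Int_absorb1)
  qed
  have hx: "?h (\<phi>' x) = \<phi> x" by (simp add: invV'[OF xW])
  have "jet_eq r (index Q) (\<phi>' x) (\<lambda>z. ?g (\<psi> (\<sigma> (inv_into V \<phi> (?h z))))) (\<lambda>z. ?g (\<psi> (\<tau> (inv_into V \<phi> (?h z)))))"
  proof (rule jet_eq_reparametrise[OF finQ S' xS' finQ hS h_C])
    show "Cinf_on (index Q) S (\<lambda>z. ?g (\<psi> (\<sigma> (inv_into V \<phi> z))))"
      by (rule Cinf_on_compose[OF finQ S finE loc(2)[OF \<sigma> W\<sigma>] loc(1)[OF \<sigma> W\<sigma>] g])
    show "Cinf_on (index Q) S (\<lambda>z. ?g (\<psi> (\<tau> (inv_into V \<phi> z))))"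
      by (rule Cinf_on_compose[OF finQ S finE loc(2)[OF \<tau> W\<tau>] loc(1)[OF \<tau> W\<tau>] g])
    show "jet_eq r (index Q) (?h (\<phi>' x)) (\<lambda>z. ?g (\<psi> (\<sigma> (inv_into V \<phi> z)))) (\<lambda>z. ?g (\<psi> (\<tau> (inv_into V \<phi> z))))"
      unfolding hx by (rule j1)
  qed
  then show ?thesis
  proof (rule jet_eq_cong[OF finQ S' xS', rotated 2])
    have transition: "?g (\<psi> (\<sigma> (inv_into V \<phi> (?h z)))) = \<psi>' (\<sigma> (inv_into V' \<phi>' z)) i"
      if z: "z \<in> S'" and sub: "W \<subseteq> N \<inter> \<sigma> -` (U \<inter> U')" for z N \<sigma>
    proof -
      obtain y where y: "y \<in> W" "z = \<phi>' y" using z by (auto simp: S'_def)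
      then have "\<sigma> y \<in> U" using sub by blast
      then show ?thesis using y inj(3) by (simp add: invV invV')
    qed
    show "?g (\<psi> (\<sigma> (inv_into V \<phi> (?h z)))) = \<psi>' (\<sigma> (inv_into V' \<phi>' z)) i" if "z \<in> S'" for z
      by (rule transition[OF that W\<sigma>])
    show "?g (\<psi> (\<tau> (inv_into V \<phi> (?h z)))) = \<psi>' (\<tau> (inv_into V' \<phi>' z)) i" if "z \<in> S'" for z
      by (rule transition[OF that W\<tau>])
  qed
qed

section \<open>Jet bundles\<close>

lemma same_jetI:
  assumes "\<sigma> x = \<tau> x"
    and "\<And>V \<phi> U \<psi> i J. (V, \<phi>) \<in> charts Q \<Longrightarrow> (U, \<psi>) \<in> charts E \<Longrightarrow> x \<in> V \<Longrightarrow> \<sigma> x \<in> U \<Longrightarrow> i \<in> index E \<Longrightarrow>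
      set_mset J \<subseteq> index Q \<Longrightarrow> size J \<le> r \<Longrightarrow>
        multi_pderiv J (\<lambda>z. \<psi> (\<sigma> (inv_into V \<phi> z)) i) (\<phi> x) = multi_pderiv J (\<lambda>z. \<psi> (\<tau> (inv_into V \<phi> z)) i) (\<phi> x)"
  shows "same_jet E Q r x \<sigma> \<tau>"
  using assms unfolding same_jet_def by (clarsimp split: prod.splits)

lemma same_jetD:
  assumes "same_jet E Q r x \<sigma> \<tau>"
  shows "\<sigma> x = \<tau> x"
    and "(V, \<phi>) \<in> charts Q \<Longrightarrow> (U, \<psi>) \<in> charts E \<Longrightarrow> x \<in> V \<Longrightarrow> \<sigma> x \<in> U \<Longrightarrow> i \<in> index E \<Longrightarrow>
      set_mset J \<subseteq> index Q \<Longrightarrow> size J \<le> r \<Longrightarrow>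
        multi_pderiv J (\<lambda>z. \<psi> (\<sigma> (inv_into V \<phi> z)) i) (\<phi> x) = multi_pderiv J (\<lambda>z. \<psi> (\<tau> (inv_into V \<phi> z)) i) (\<phi> x)"
  using assms unfolding same_jet_def by (blast, fastforce)

lemma same_jet_refl: "same_jet E Q r x \<sigma> \<sigma>"
  by (rule same_jetI) simp_all

lemma same_jet_sym: "same_jet E Q r x \<sigma> \<tau> \<Longrightarrow> same_jet E Q r x \<tau> \<sigma>"
proof (rule same_jetI)
  assume *: "same_jet E Q r x \<sigma> \<tau>"
  show "\<tau> x = \<sigma> x" using same_jetD(1)[OF *] by simp
  show "multi_pderiv J (\<lambda>z. \<psi> (\<tau> (inv_into V \<phi> z)) i) (\<phi> x) = multi_pderiv J (\<lambda>z. \<psi> (\<sigma> (inv_into V \<phi> z)) i) (\<phi> x)"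
    if "(V, \<phi>) \<in> charts Q" "(U, \<psi>) \<in> charts E" "x \<in> V" "\<tau> x \<in> U" "i \<in> index E" "set_mset J \<subseteq> index Q" "size J \<le> r"
    for V \<phi> U \<psi> i J
    by (rule same_jetD(2)[OF *, symmetric]) (use that same_jetD(1)[OF *] in auto)
qed

lemma same_jet_trans:
  assumes st: "same_jet E Q r x \<sigma> \<tau>" and tr: "same_jet E Q r x \<tau> \<rho>" shows "same_jet E Q r x \<sigma> \<rho>"
proof (rule same_jetI)
  show "\<sigma> x = \<rho> x" using same_jetD(1)[OF st] same_jetD(1)[OF tr] by simp
  show "multi_pderiv J (\<lambda>z. \<psi> (\<sigma> (inv_into V \<phi> z)) i) (\<phi> x) = multi_pderiv J (\<lambda>z. \<psi> (\<rho> (inv_into V \<phi> z)) i) (\<phi> x)"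
    if c: "(V, \<phi>) \<in> charts Q" "(U, \<psi>) \<in> charts E" "x \<in> V" "\<sigma> x \<in> U" "i \<in> index E" "set_mset J \<subseteq> index Q" "size J \<le> r"
    for V \<phi> U \<psi> i J
  proof -
    have "\<tau> x \<in> U" using c(4) same_jetD(1)[OF st] by simp
    then show ?thesis
      using same_jetD(2)[OF st c] same_jetD(2)[OF tr c(1-3) _ c(5-7)] by simp
  qed
qed

lemma same_jet_lower: "same_jet E Q r x \<sigma> \<tau> \<Longrightarrow> s \<le> r \<Longrightarrow> same_jet E Q s x \<sigma> \<tau>"
  by (rule same_jetI) (auto intro: same_jetD)

lemma same_jet_germ:
  assumes Q: "smooth_manifold Q" and W: "mopen Q W" "x \<in> W" "\<And>y. y \<in> W \<Longrightarrow> \<sigma> y = \<tau> y"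
  shows "same_jet E Q r x \<sigma> \<tau>"
proof (rule same_jetI)
  show "\<sigma> x = \<tau> x" using W(2,3) by simp
  fix V \<phi> U \<psi> i J assume V: "(V, \<phi>) \<in> charts Q" "x \<in> V" and J: "set_mset J \<subseteq> index Q"
  show "multi_pderiv J (\<lambda>z. \<psi> (\<sigma> (inv_into V \<phi> z)) i) (\<phi> x) = multi_pderiv J (\<lambda>z. \<psi> (\<tau> (inv_into V \<phi> z)) i) (\<phi> x)"
    by (rule multi_pderiv_cong[OF smooth_manifold_finite[OF Q] charts_open_image[OF Q V(1) W(1)] _ J])
      (use V W(2,3) chartsD(2)[OF V(1)] in auto)
qed

lemma local_sectionE:
  assumes "local_section E Q \<pi> x \<sigma>"
  obtains N where "x \<in> N" "mopen Q N" "smooth_map Q N E \<sigma>" "\<And>y. y \<in> N \<Longrightarrow> \<pi> (\<sigma> y) = y"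
    "\<And>y. y \<in> N \<Longrightarrow> local_section E Q \<pi> y \<sigma>" "\<And>y. y \<in> N \<Longrightarrow> \<sigma> y \<in> carrier E"
proof -
  obtain N where N: "x \<in> N" "smooth_map Q N E \<sigma>" "\<forall>y\<in>N. \<pi> (\<sigma> y) = y" using assms by (auto simp: local_section_def)
  have "local_section E Q \<pi> y \<sigma>" if "y \<in> N" for y using N that unfolding local_section_def by blast
  then show ?thesis using that N smooth_map_mopen[OF N(2)] smooth_map_image[OF N(2)] by blast
qed

lemma local_section_base: "local_section E Q \<pi> x \<sigma> \<Longrightarrow> x \<in> carrier Q \<and> \<sigma> x \<in> carrier E \<and> \<pi> (\<sigma> x) = x"
  by (elim local_sectionE) (use mopen_subset in blast)

lemma jet_eqI: "same_jet E Q r x \<sigma> \<tau> \<Longrightarrow> jet E Q \<pi> r x \<sigma> = jet E Q \<pi> r x \<tau>"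
  unfolding jet_def by (auto intro: same_jet_trans same_jet_sym)

lemma jet_eqD:
  assumes "jet E Q \<pi> r x \<sigma> = jet E Q \<pi> r y \<tau>" "local_section E Q \<pi> y \<tau>"
  shows "x = y \<and> same_jet E Q r x \<sigma> \<tau>"
proof -
  have "\<tau> \<in> snd (jet E Q \<pi> r y \<tau>)" using assms(2) by (simp add: jet_def same_jet_refl)
  then have "\<tau> \<in> snd (jet E Q \<pi> r x \<sigma>)" using assms(1) by simp
  moreover have "x = y" using assms(1) by (simp add: jet_def)
  ultimately show ?thesis by (simp add: jet_def)
qed

lemma jet_source_jet: "fst (jet E Q \<pi> r x \<sigma>) = x" "jet_source (jet E Q \<pi> r x \<sigma>) = x"
  by (simp_all add: jet_def jet_source_def)

lemma jet_rep_jet: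
  assumes "local_section E Q \<pi> x \<sigma>"
  shows "local_section E Q \<pi> x (jet_rep (jet E Q \<pi> r x \<sigma>))" "same_jet E Q r x \<sigma> (jet_rep (jet E Q \<pi> r x \<sigma>))"
proof -
  have "\<sigma> \<in> snd (jet E Q \<pi> r x \<sigma>)" using assms by (simp add: jet_def same_jet_refl)
  then have "jet_rep (jet E Q \<pi> r x \<sigma>) \<in> snd (jet E Q \<pi> r x \<sigma>)" 
    unfolding jet_rep_def by (rule someI[of "\<lambda>\<tau>. \<tau> \<in> snd (jet E Q \<pi> r x \<sigma>)"])
  then show "local_section E Q \<pi> x (jet_rep (jet E Q \<pi> r x \<sigma>))" "same_jet E Q r x \<sigma> (jet_rep (jet E Q \<pi> r x \<sigma>))"
    by (simp_all add: jet_def)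
qed

lemma jet_target_jet:
  assumes "local_section E Q \<pi> x \<sigma>" shows "jet_target (jet E Q \<pi> r x \<sigma>) = \<sigma> x"
  using same_jetD(1)[OF jet_rep_jet(2)[OF assms], symmetric] by (simp add: jet_target_def jet_source_jet)

lemma jetsI: "local_section E Q \<pi> x \<sigma> \<Longrightarrow> jet E Q \<pi> r x \<sigma> \<in> jets E Q \<pi> r"
  using local_section_base[of E Q \<pi> x \<sigma>] unfolding jets_def by blast

lemma jetsE:
  assumes "j \<in> jets E Q \<pi> r"
  obtains "local_section E Q \<pi> (fst j) (jet_rep j)" "jet E Q \<pi> r (fst j) (jet_rep j) = j"
proof -
  obtain x \<sigma> where j: "j = jet E Q \<pi> r x \<sigma>" "local_section E Q \<pi> x \<sigma>" using assms by (auto simp: jets_def)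
  show ?thesis
    using that jet_rep_jet[OF j(2), of r] jet_eqI[OF jet_rep_jet(2)[OF j(2)], where \<pi> = \<pi>] unfolding j(1) jet_source_jet by simp
qed

text \<open>These are the coordinate maps of the atlas in \<open>jet_bundle\<close>.\<close>

definition jet_coord :: "('e, nat) mfd \<Rightarrow> ('q, nat) mfd \<Rightarrow> nat \<Rightarrow> ('e \<Rightarrow> nat \<Rightarrow> real) \<Rightarrow> 'q set \<Rightarrow> ('q \<Rightarrow> nat \<Rightarrow> real)
    \<Rightarrow> ('e, 'q) jet \<Rightarrow> nat \<times> nat multiset \<Rightarrow> real"
  where "jet_coord E Q r \<psi> V \<phi> = (\<lambda>j (\<alpha>, J). if (\<alpha>, J) \<in> jet_index (index Q) (index E) r
    then multi_pderiv J (\<lambda>z. \<psi> (jet_rep j (inv_into V \<phi> z)) \<alpha>) (\<phi> (jet_source j)) else 0)"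

lemma jet_bundle_index: "index (jet_bundle E Q \<pi> r) = jet_index (index Q) (index E) r"
  by (simp add: jet_bundle_def)

lemma jet_bundle_atlasI:
  "((U, \<psi>), (V, \<phi>)) \<in> adapted_charts E Q \<pi> \<Longrightarrow>
    ({j \<in> jets E Q \<pi> r. jet_target j \<in> U}, jet_coord E Q r \<psi> V \<phi>) \<in> atlas (jet_bundle E Q \<pi> r)"
  unfolding jet_bundle_def jet_coord_def by auto

lemma jet_bundle_atlasE:
  assumes "(X, \<xi>) \<in> atlas (jet_bundle E Q \<pi> r)"
  obtains U \<psi> V \<phi> where "((U, \<psi>), (V, \<phi>)) \<in> adapted_charts E Q \<pi>" "X = {j \<in> jets E Q \<pi> r. jet_target j \<in> U}"
    "\<xi> = jet_coord E Q r \<psi> V \<phi>"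
  using assms that unfolding jet_bundle_def jet_coord_def by auto

lemma jet_bundle_carrier_subset: "carrier (jet_bundle E Q \<pi> r) \<subseteq> jets E Q \<pi> r"
  by (auto simp: carrier_def jet_bundle_def)

lemma finite_jet_index:
  assumes "finite I" "finite K" shows "finite (jet_index I K r)"
proof -
  have "finite (mset ` {l. set l \<subseteq> I \<and> length l \<le> r})" using finite_lists_length_le[OF assms(1)] by simp
  moreover have "{J. set_mset J \<subseteq> I \<and> size J \<le> r} \<subseteq> mset ` {l. set l \<subseteq> I \<and> length l \<le> r}"
  proof
    fix J assume "J \<in> {J. set_mset J \<subseteq> I \<and> size J \<le> r}"
    moreover obtain l where "J = mset l" using ex_mset by metis
    ultimately show "J \<in> mset ` {l. set l \<subseteq> I \<and> length l \<le> r}" by auto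
  qed
  ultimately have "finite {J. set_mset J \<subseteq> I \<and> size J \<le> r}" using finite_subset by blast
  then have "finite (K \<times> {J. set_mset J \<subseteq> I \<and> size J \<le> r})" using assms(2) by simp
  moreover have "{(\<alpha>, J). \<alpha> \<in> K - I \<and> set_mset J \<subseteq> I \<and> size J \<le> r} \<subseteq> K \<times> {J. set_mset J \<subseteq> I \<and> size J \<le> r}" by auto
  ultimately show ?thesis unfolding jet_index_def using assms(1) finite_subset by blast
qed

lemma adapted_chartsD:
  assumes "((U, \<psi>), (V, \<phi>)) \<in> adapted_charts E Q \<pi>"
  shows "(U, \<psi>) \<in> charts E" "(V, \<phi>) \<in> charts Q" "e \<in> U \<Longrightarrow> \<pi> e \<in> V" "e \<in> U \<Longrightarrow> i \<in> index Q \<Longrightarrow> \<psi> e i = \<phi> (\<pi> e) i"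
  using assms by (auto simp: adapted_charts_def)

lemma jet_coord_same_jet:
  assumes QE: "index Q \<subseteq> index E" and c: "((U, \<psi>), (V, \<phi>)) \<in> adapted_charts E Q \<pi>"
    and \<sigma>: "local_section E Q \<pi> x \<sigma>" "\<sigma> x \<in> U" and J: "(\<alpha>, J) \<in> jet_index (index Q) (index E) r"
  shows "jet_coord E Q r \<psi> V \<phi> (jet E Q \<pi> r x \<sigma>) (\<alpha>, J) = multi_pderiv J (\<lambda>z. \<psi> (\<sigma> (inv_into V \<phi> z)) \<alpha>) (\<phi> x)"
proof -
  note c = adapted_chartsD[OF c]
  have "x \<in> V" using c(3)[OF \<sigma>(2)] local_section_base[OF \<sigma>(1)] by simp
  then show ?thesis
    using same_jetD(2)[OF jet_rep_jet(2)[OF \<sigma>(1), of r] c(2,1) _ \<sigma>(2), of \<alpha> J] J QE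
    by (auto simp: jet_coord_def jet_source_jet jet_index_def)
qed

text \<open>
  The coordinates along the base determine the source of a jet. They also are the components of
  every section in these directions, so that all derivatives of these components are known; the
  derivatives of the other components are coordinates of the jet. By independence of the charts
  this determines the jet.
\<close>

lemma jet_coord_inj:
  assumes E: "smooth_manifold E" and Q: "smooth_manifold Q" and QE: "index Q \<subseteq> index E"
    and c: "((U, \<psi>), (V, \<phi>)) \<in> adapted_charts E Q \<pi>"
  shows "inj_on (jet_coord E Q r \<psi> V \<phi>) {j \<in> jets E Q \<pi> r. jet_target j \<in> U}"
proof (rule inj_onI)
  fix j k assume j: "j \<in> {j \<in> jets E Q \<pi> r. jet_target j \<in> U}" and k: "k \<in> {j \<in> jets E Q \<pi> r. jet_target j \<in> U}"
    and eq: "jet_coord E Q r \<psi> V \<phi> j = jet_coord E Q r \<psi> V \<phi> k"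
  note c' = adapted_chartsD[OF c]
  define x \<sigma> y \<tau> where "x = fst j" and "\<sigma> = jet_rep j" and "y = fst k" and "\<tau> = jet_rep k"
  have \<sigma>: "local_section E Q \<pi> x \<sigma>" "jet E Q \<pi> r x \<sigma> = j"
    unfolding x_def \<sigma>_def using j by (auto elim: jetsE)
  have \<tau>: "local_section E Q \<pi> y \<tau>" "jet E Q \<pi> r y \<tau> = k"
    unfolding y_def \<tau>_def using k by (auto elim: jetsE)
  have xU: "\<sigma> x \<in> U" and yU: "\<tau> y \<in> U"
    using j k jet_target_jet[OF \<sigma>(1), of r] jet_target_jet[OF \<tau>(1), of r] \<sigma>(2) \<tau>(2) by auto
  have xV: "x \<in> V" and yV: "y \<in> V"
    using c'(3)[OF xU] c'(3)[OF yU] local_section_base[OF \<sigma>(1)] local_section_base[OF \<tau>(1)] by auto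
  have co: "multi_pderiv J (\<lambda>z. \<psi> (\<sigma> (inv_into V \<phi> z)) \<alpha>) (\<phi> x) = multi_pderiv J (\<lambda>z. \<psi> (\<tau> (inv_into V \<phi> z)) \<alpha>) (\<phi> y)"
    if "(\<alpha>, J) \<in> jet_index (index Q) (index E) r" for \<alpha> J
    using jet_coord_same_jet[OF QE c \<sigma>(1) xU that] jet_coord_same_jet[OF QE c \<tau>(1) yU that] eq \<sigma>(2) \<tau>(2) by simp
  have injV: "inj_on \<phi> V" and injU: "inj_on \<psi> U" by (rule chartsD(2)[OF c'(2)], rule chartsD(2)[OF c'(1)])
  have "\<phi> x = \<phi> y"
  proof (rule coord_space_eqI[OF charts_space[OF c'(2) xV] charts_space[OF c'(2) yV]])
    fix i assume i: "i \<in> index Q"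
    have "\<psi> (\<sigma> x) i = \<psi> (\<tau> y) i"
      using co[of i "{#}"] i injV xV yV by (simp add: jet_index_def multi_pderiv_def)
    then show "\<phi> x i = \<phi> y i"
      using c'(4)[OF xU i] c'(4)[OF yU i] local_section_base[OF \<sigma>(1)] local_section_base[OF \<tau>(1)] by simp
  qed
  then have xy: "x = y" using inj_onD[OF injV] xV yV by blast
  obtain N where N: "x \<in> N" "mopen Q N" "smooth_map Q N E \<sigma>" "\<And>y. y \<in> N \<Longrightarrow> \<pi> (\<sigma> y) = y"
    using \<sigma>(1) by (elim local_sectionE) (rule that)
  obtain N' where N': "y \<in> N'" "mopen Q N'" "smooth_map Q N' E \<tau>" "\<And>y. y \<in> N' \<Longrightarrow> \<pi> (\<tau> y) = y"
    using \<tau>(1) by (elim local_sectionE) (rule that)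
  note A = smooth_manifold_inj_atlas[OF Q]
  define W where "W = (N \<inter> \<sigma> -` U) \<inter> (N' \<inter> \<tau> -` U) \<inter> V"
  have W: "mopen Q W" unfolding W_def
    by (rule mopen_Int[OF A mopen_Int[OF A smooth_map_vimage[OF N(3) charts_mopen[OF c'(1)]]
          smooth_map_vimage[OF N'(3) charts_mopen[OF c'(1)]]] charts_mopen[OF c'(2)]])
  have xW: "x \<in> W" using N(1) N'(1) xU yU xV xy by (simp add: W_def)
  have S: "coord_open (index Q) (\<phi> ` W)"
    using charts_open_image[OF Q c'(2) W] by (simp add: W_def Int_absorb1 inf.absorb2)
  have inv: "inv_into V \<phi> (\<phi> z) = z" if "z \<in> W" for z using injV that by (simp add: W_def)
  have base: "multi_pderiv J (\<lambda>z. \<psi> (\<sigma> (inv_into V \<phi> z)) \<alpha>) (\<phi> x) = multi_pderiv J (\<lambda>z. \<psi> (\<tau> (inv_into V \<phi> z)) \<alpha>) (\<phi> x)"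
    if \<alpha>: "\<alpha> \<in> index Q" and J: "set_mset J \<subseteq> index Q" for \<alpha> J
  proof (rule multi_pderiv_cong[OF smooth_manifold_finite[OF Q] S _ J])
    show "\<phi> x \<in> \<phi> ` W" using xW by blast
    fix z assume "z \<in> \<phi> ` W"
    then obtain w where w: "w \<in> W" "z = \<phi> w" by blast
    have "\<sigma> w \<in> U" "\<tau> w \<in> U" "\<pi> (\<sigma> w) = w" "\<pi> (\<tau> w) = w" using w(1) N(4) N'(4) by (auto simp: W_def)
    then show "\<psi> (\<sigma> (inv_into V \<phi> z)) \<alpha> = \<psi> (\<tau> (inv_into V \<phi> z)) \<alpha>"
      unfolding w(2) inv[OF w(1)] using c'(4)[of "\<sigma> w" \<alpha>] c'(4)[of "\<tau> w" \<alpha>] \<alpha> by simp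
  qed
  have all: "multi_pderiv J (\<lambda>z. \<psi> (\<sigma> (inv_into V \<phi> z)) \<alpha>) (\<phi> x) = multi_pderiv J (\<lambda>z. \<psi> (\<tau> (inv_into V \<phi> z)) \<alpha>) (\<phi> x)"
    if \<alpha>: "\<alpha> \<in> index E" and J: "set_mset J \<subseteq> index Q" "size J \<le> r" for \<alpha> J
  proof (cases "\<alpha> \<in> index Q")
    case False
    then show ?thesis using co[of \<alpha> J] \<alpha> J xy by (simp add: jet_index_def)
  qed (rule base[OF _ J(1)])
  have Cs: "Cinf_on (index Q) (\<phi> ` W) (\<lambda>z. \<psi> (\<sigma> (inv_into V \<phi> z)) \<alpha>)" if "smooth_map Q N E \<sigma>" "W \<subseteq> N \<inter> \<sigma> -` U" for \<alpha> N \<sigma>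
  proof -
    have "smooth_fun Q W (\<lambda>y. \<psi> (\<sigma> y) \<alpha>)"
      by (rule smooth_fun_subset[OF smooth_map_chart[OF A E that(1) c'(1)] W]) (use that(2) in blast)
    from smooth_fun_chart[OF Q this c'(2)] show ?thesis by (simp add: W_def Int_absorb1 inf.absorb2)
  qed
  have Cs: "Cinf_on (index Q) (\<phi> ` W) (\<lambda>z. \<psi> (\<sigma> (inv_into V \<phi> z)) \<alpha>)"
    "Cinf_on (index Q) (\<phi> ` W) (\<lambda>z. \<psi> (\<tau> (inv_into V \<phi> z)) \<alpha>)" for \<alpha>
    by (rule Cs[OF N(3)], force simp: W_def) (rule Cs[OF N'(3)], force simp: W_def)
  have st: "\<sigma> x = \<tau> x"
  proof (rule inj_onD[OF injU _ xU])
    show "\<tau> x \<in> U" using yU xy by simp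
    show "\<psi> (\<sigma> x) = \<psi> (\<tau> x)"
    proof (rule coord_space_eqI[OF charts_space[OF c'(1) xU]])
      show "\<psi> (\<tau> x) \<in> coord_space (index E)" using charts_space[OF c'(1) yU] xy by simp
      show "\<psi> (\<sigma> x) i = \<psi> (\<tau> x) i" if "i \<in> index E" for i
        using all[OF that, of "{#}"] inv[OF xW] by (simp add: multi_pderiv_def)
    qed
  qed
  have je: "jet_eq r (index Q) (\<phi> x) (\<lambda>z. \<psi> (\<sigma> (inv_into V \<phi> z)) \<alpha>) (\<lambda>z. \<psi> (\<tau> (inv_into V \<phi> z)) \<alpha>)" if "\<alpha> \<in> index E" for \<alpha>
    using jet_eq_multi_pderiv[OF smooth_manifold_finite[OF Q] Cs imageI[OF xW]] all[OF that] by blast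
  have "same_jet E Q r x \<sigma> \<tau>"
  proof (rule same_jetI)
    show "\<sigma> x = \<tau> x" by (rule st)
    fix V' \<phi>' U' \<psi>' i J
    assume V': "(V', \<phi>') \<in> charts Q" and U': "(U', \<psi>') \<in> charts E" and x': "x \<in> V'" "\<sigma> x \<in> U'" and i: "i \<in> index E"
      and J: "set_mset J \<subseteq> index Q" "size J \<le> r"
    have yN: "x \<in> N'" using N'(1) xy by simp
    have je': "jet_eq r (index Q) (\<phi>' x) (\<lambda>z. \<psi>' (\<sigma> (inv_into V' \<phi>' z)) i) (\<lambda>z. \<psi>' (\<tau> (inv_into V' \<phi>' z)) i)"
      by (rule jet_eq_change_charts[OF Q E N(3) N'(3) N(1) yN st c'(2) xV V' x'(1) c'(1) xU U' x'(2) je])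
    have len: "length (sorted_list_of_multiset J) = size J" by (metis mset_sorted_list_of_multiset size_mset)
    show "multi_pderiv J (\<lambda>z. \<psi>' (\<sigma> (inv_into V' \<phi>' z)) i) (\<phi>' x) = multi_pderiv J (\<lambda>z. \<psi>' (\<tau> (inv_into V' \<phi>' z)) i) (\<phi>' x)"
      using je' J len by (simp add: multi_pderiv_def jet_eq_def)
  qed
  then have "jet E Q \<pi> r x \<sigma> = jet E Q \<pi> r x \<tau>" by (rule jet_eqI)
  then show "j = k" using \<sigma>(2) \<tau>(2) xy by simp
qed

lemma jet_bundle_inj_atlas:
  assumes E: "smooth_manifold E" and Q: "smooth_manifold Q" and QE: "index Q \<subseteq> index E"
  shows "inj_atlas (jet_bundle E Q \<pi> r)"
proof -
  have "inj_on \<xi> X" if "(X, \<xi>) \<in> atlas (jet_bundle E Q \<pi> r)" for X \<xi>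
    using that jet_coord_inj[OF E Q QE] by (elim jet_bundle_atlasE) simp
  then show ?thesis
    unfolding inj_atlas_def jet_bundle_index
    using finite_jet_index[OF smooth_manifold_finite[OF Q] smooth_manifold_finite[OF E]] by blast
qed

section \<open>Embeddings of bundles\<close>

text \<open>
  The transition functions to charts of \<open>M\<close> are coordinate expressions of
  \<open>F\<close> and its inverse.
\<close>

lemma charts_transport:
  assumes M: "smooth_manifold M" and N: "smooth_manifold N" and idx: "index M = index N"
    and F: "diffeo_on M U N V F" and c: "(V0, \<psi>) \<in> charts N" "V0 \<subseteq> V"
  shows "(U \<inter> F -` V0, \<lambda>p. \<psi> (F p)) \<in> charts M"
proof -
  note A = smooth_manifold_inj_atlas[OF M] and B = smooth_manifold_inj_atlas[OF N]
  note F' = diffeo_onD[OF F]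
  define X where "X = U \<inter> F -` V0"
  define G where "G = inv_into U F"
  let ?\<psi> = "\<lambda>p. \<psi> (F p)"
  have GF: "G (F p) = p" if "p \<in> U" for p using F'(4) that by (simp add: G_def)
  have X: "mopen M X" unfolding X_def by (rule smooth_map_vimage[OF F'(6) charts_mopen[OF c(1)]])
  have inj\<psi>: "inj_on \<psi> V0" by (rule chartsD(2)[OF c(1)])
  have inj: "inj_on ?\<psi> X"
  proof (rule inj_onI)
    fix p q assume p: "p \<in> X" and q: "q \<in> X" and "\<psi> (F p) = \<psi> (F q)"
    then have "F p = F q" using inj_onD[OF inj\<psi>, of "F p" "F q"] by (auto simp: X_def)
    then show "p = q" using inj_onD[OF F'(4)] p q by (auto simp: X_def)
  qed
  have img: "?\<psi> ` (X \<inter> W) = \<psi> ` (V0 \<inter> (V \<inter> G -` W))" for W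
  proof (intro equalityI subsetI)
    fix x assume "x \<in> ?\<psi> ` (X \<inter> W)"
    then obtain p where p: "p \<in> X" "p \<in> W" "x = \<psi> (F p)" by blast
    then have "F p \<in> V0 \<inter> (V \<inter> G -` W)" using c(2) GF by (auto simp: X_def)
    then show "x \<in> \<psi> ` (V0 \<inter> (V \<inter> G -` W))" using p(3) by blast
  next
    fix x assume "x \<in> \<psi> ` (V0 \<inter> (V \<inter> G -` W))"
    then obtain y where y: "y \<in> V0" "y \<in> V" "G y \<in> W" "x = \<psi> y" by blast
    have "F (G y) = y" "G y \<in> U" using y(2) F'(5) by (auto simp: G_def intro: f_inv_into_f inv_into_into)
    then show "x \<in> ?\<psi> ` (X \<inter> W)" using y by (intro image_eqI[of x ?\<psi> "G y"]) (auto simp: X_def)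
  qed
  have G: "smooth_map N V M G" using F'(7) by (simp add: G_def)
  have comp: "compatible (index M) (X, ?\<psi>) (W, \<xi>)" if d: "(W, \<xi>) \<in> atlas M" for W \<xi>
  proof -
    have W: "mopen M W" by (rule charts_mopen[OF atlas_charts[OF M d]])
    have o: "coord_open (index M) (?\<psi> ` (X \<inter> W))"
      unfolding img idx by (rule charts_open_image[OF N c(1) smooth_map_vimage[OF G W]])
    have "Cinf_on (index M) (?\<psi> ` (X \<inter> W)) (\<lambda>x. \<xi> (inv_into X ?\<psi> x) i)" if i: "i \<in> index M" for i
    proof (rule Cinf_on_cong[OF smooth_manifold_finite[OF M]])
      show "Cinf_on (index M) (?\<psi> ` (X \<inter> W)) (\<lambda>x. \<xi> (G (inv_into V0 \<psi> x)) i)"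
        unfolding img idx by (rule smooth_fun_chart[OF N smooth_map_coordinate[OF G d i] c(1)])
      fix x assume "x \<in> ?\<psi> ` (X \<inter> W)"
      then obtain p where p: "p \<in> X" "x = \<psi> (F p)" by blast
      have "inv_into X ?\<psi> x = p" unfolding p(2) by (rule inv_into_f_f[OF inj p(1)])
      moreover have "G (inv_into V0 \<psi> x) = p" using p inj\<psi> GF by (auto simp: X_def)
      ultimately show "\<xi> (G (inv_into V0 \<psi> x)) i = \<xi> (inv_into X ?\<psi> x) i" by simp
    qed
    moreover have "Cinf_on (index M) (\<xi> ` (X \<inter> W)) (\<lambda>x. ?\<psi> (inv_into W \<xi> x) i)" for i
      using smooth_funD[OF smooth_map_chart[OF A N F'(6) c(1)] d, of i] by (simp add: X_def Int_commute)
    moreover have "coord_open (index M) (\<xi> ` (X \<inter> W))" using mopenD[OF X d] by (simp add: Int_commute)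
    ultimately show ?thesis using o unfolding compatible_def by simp
  qed
  have "coord_open (index M) (?\<psi> ` (X \<inter> X))"
    unfolding img idx by (rule charts_open_image[OF N c(1) smooth_map_vimage[OF G X]])
  then have "coord_patch (index M) (X, ?\<psi>)" using inj by (simp add: coord_patch_def)
  moreover have "\<forall>d\<in>atlas M. compatible (index M) (X, ?\<psi>) d"
  proof
    show "compatible (index M) (X, ?\<psi>) d" if "d \<in> atlas M" for d
      using comp[of "fst d" "snd d"] that by simp
  qed
  ultimately show ?thesis using mopen_subset[OF X] unfolding charts_def X_def[symmetric] by simp
qed

text \<open>
  The map \<open>e\<close> takes charts of \<open>A\<close> to charts of \<open>B\<close> and
  pulls charts of \<open>B\<close> back to charts of \<open>A\<close>, without changing
  coordinates. Hence it transfers open sets, smooth functions and tangent vectors without any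
  computation of derivatives.
\<close>

locale atlas_embedding =
  fixes A :: "('a, 'i) mfd" and B :: "('b, 'i) mfd" and e :: "'a \<Rightarrow> 'b"
  assumes A: "inj_atlas A" and B: "inj_atlas B" and idx: "index A = index B" and inj: "inj_on e (carrier A)"
    and chart_image_ex: "\<And>U \<phi>. (U, \<phi>) \<in> atlas A \<Longrightarrow> \<exists>\<psi>. (e ` U, \<psi>) \<in> atlas B \<and> (\<forall>p\<in>U. \<psi> (e p) = \<phi> p)"
    and chart_vimage_ex: "\<And>V \<psi>. (V, \<psi>) \<in> atlas B \<Longrightarrow>
      \<exists>\<phi>. (carrier A \<inter> e -` V, \<phi>) \<in> atlas A \<and> (\<forall>p\<in>carrier A \<inter> e -` V. \<psi> (e p) = \<phi> p)"
begin

lemma chart_image: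
  assumes "(U, \<phi>) \<in> atlas A" obtains \<psi> where "(e ` U, \<psi>) \<in> atlas B" "\<And>p. p \<in> U \<Longrightarrow> \<psi> (e p) = \<phi> p"
  using chart_image_ex[OF assms] by blast

lemma chart_vimage:
  assumes "(V, \<psi>) \<in> atlas B"
  obtains \<phi> where "(carrier A \<inter> e -` V, \<phi>) \<in> atlas A" "\<And>p. p \<in> carrier A \<Longrightarrow> e p \<in> V \<Longrightarrow> \<psi> (e p) = \<phi> p"
  using chart_vimage_ex[OF assms] by blast

lemma e_carrier: "p \<in> carrier A \<Longrightarrow> e p \<in> carrier B"
proof -
  assume "p \<in> carrier A"
  then obtain U \<phi> where U: "(U, \<phi>) \<in> atlas A" "p \<in> U" by (rule carrierE) (rule that)
  obtain \<psi> where "(e ` U, \<psi>) \<in> atlas B" by (rule chart_image[OF U(1)]) (rule that)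
  from atlas_carrier[OF this] show "e p \<in> carrier B" using U(2) by blast
qed

lemma vimage_mopen: assumes V: "mopen B V" shows "mopen A (carrier A \<inter> e -` V)"
proof (rule mopenI)
  fix U \<phi> assume c: "(U, \<phi>) \<in> atlas A"
  obtain \<psi> where d: "(e ` U, \<psi>) \<in> atlas B" "\<And>p. p \<in> U \<Longrightarrow> \<psi> (e p) = \<phi> p" by (rule chart_image[OF c]) (rule that)
  have "\<phi> ` (U \<inter> (carrier A \<inter> e -` V)) = \<psi> ` (e ` U \<inter> V)"
  proof (intro equalityI subsetI)
    fix x assume "x \<in> \<phi> ` (U \<inter> (carrier A \<inter> e -` V))"
    then obtain p where p: "p \<in> U" "e p \<in> V" "x = \<phi> p" by blast
    then show "x \<in> \<psi> ` (e ` U \<inter> V)" using d(2)[OF p(1)] by (intro image_eqI[of x \<psi> "e p"]) auto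
  next
    fix x assume "x \<in> \<psi> ` (e ` U \<inter> V)"
    then obtain p where p: "p \<in> U" "e p \<in> V" "x = \<psi> (e p)" by blast
    then show "x \<in> \<phi> ` (U \<inter> (carrier A \<inter> e -` V))"
      using d(2)[OF p(1)] atlas_carrier[OF c] by (intro image_eqI[of x \<phi> p]) auto
  qed
  then show "coord_open (index A) (\<phi> ` (U \<inter> (carrier A \<inter> e -` V)))" using mopenD[OF V d(1)] idx by simp
qed simp

lemma image_eq:
  assumes W: "W \<subseteq> carrier A" and d: "\<And>p. p \<in> carrier A \<Longrightarrow> e p \<in> V \<Longrightarrow> \<psi> (e p) = \<phi> p"
  shows "\<psi> ` (V \<inter> e ` W) = \<phi> ` ((carrier A \<inter> e -` V) \<inter> W)"
proof (intro equalityI subsetI)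
  fix x assume "x \<in> \<psi> ` (V \<inter> e ` W)"
  then obtain p where p: "p \<in> W" "e p \<in> V" "x = \<psi> (e p)" by blast
  then show "x \<in> \<phi> ` ((carrier A \<inter> e -` V) \<inter> W)" using d[of p] W by (intro image_eqI[of x \<phi> p]) auto
next
  fix x assume "x \<in> \<phi> ` ((carrier A \<inter> e -` V) \<inter> W)"
  then obtain p where p: "p \<in> W" "e p \<in> V" "p \<in> carrier A" "x = \<phi> p" by blast
  then show "x \<in> \<psi> ` (V \<inter> e ` W)" using d[of p] by (intro image_eqI[of x \<psi> "e p"]) auto
qed

lemma image_mopen: assumes W: "mopen A W" shows "mopen B (e ` W)"
proof (rule mopenI)
  show "e ` W \<subseteq> carrier B" using mopen_subset[OF W] e_carrier by blast
  fix V \<psi> assume c: "(V, \<psi>) \<in> atlas B"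
  obtain \<phi> where d: "(carrier A \<inter> e -` V, \<phi>) \<in> atlas A" "\<And>p. p \<in> carrier A \<Longrightarrow> e p \<in> V \<Longrightarrow> \<psi> (e p) = \<phi> p"
    by (rule chart_vimage[OF c]) (rule that)
  show "coord_open (index B) (\<psi> ` (V \<inter> e ` W))"
    using mopenD[OF W d(1)] idx image_eq[of W V \<psi> \<phi>, OF mopen_subset[OF W] d(2)] by simp
qed

lemma smooth_fun_pull: assumes h: "smooth_fun B V h" shows "smooth_fun A (carrier A \<inter> e -` V) (\<lambda>p. h (e p))"
proof (rule smooth_funI[OF vimage_mopen[OF smooth_fun_mopen[OF h]]])
  fix U \<phi> assume c: "(U, \<phi>) \<in> atlas A"
  obtain \<psi> where d: "(e ` U, \<psi>) \<in> atlas B" "\<And>p. p \<in> U \<Longrightarrow> \<psi> (e p) = \<phi> p" by (rule chart_image[OF c]) (rule that)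
  have eq: "\<phi> ` (U \<inter> (carrier A \<inter> e -` V)) = \<psi> ` (e ` U \<inter> V)"
  proof (intro equalityI subsetI)
    fix x assume "x \<in> \<phi> ` (U \<inter> (carrier A \<inter> e -` V))"
    then obtain p where p: "p \<in> U" "e p \<in> V" "x = \<phi> p" by blast
    then show "x \<in> \<psi> ` (e ` U \<inter> V)" using d(2)[OF p(1)] by (intro image_eqI[of x \<psi> "e p"]) auto
  next
    fix x assume "x \<in> \<psi> ` (e ` U \<inter> V)"
    then obtain p where p: "p \<in> U" "e p \<in> V" "x = \<psi> (e p)" by blast
    then show "x \<in> \<phi> ` (U \<inter> (carrier A \<inter> e -` V))"
      using d(2)[OF p(1)] atlas_carrier[OF c] by (intro image_eqI[of x \<phi> p]) auto
  qed
  show "Cinf_on (index A) (\<phi> ` (U \<inter> (carrier A \<inter> e -` V))) (\<lambda>x. h (e (inv_into U \<phi> x)))"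
    unfolding eq
  proof (rule Cinf_on_cong[OF inj_atlas_finite[OF A]])
    show "Cinf_on (index A) (\<psi> ` (e ` U \<inter> V)) (\<lambda>x. h (inv_into (e ` U) \<psi> x))"
      using smooth_funD[OF h d(1)] idx by simp
    fix x assume "x \<in> \<psi> ` (e ` U \<inter> V)"
    then obtain p where p: "p \<in> U" "x = \<psi> (e p)" by blast
    have "inv_into (e ` U) \<psi> x = e p" unfolding p(2) by (rule inv_into_f_f[OF inj_atlas_inj[OF B d(1)]]) (use p(1) in blast)
    moreover have "inv_into U \<phi> x = p" unfolding p(2) d(2)[OF p(1)] by (rule inv_into_f_f[OF inj_atlas_inj[OF A c] p(1)])
    ultimately show "h (inv_into (e ` U) \<psi> x) = h (e (inv_into U \<phi> x))" by simp
  qed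
qed

lemma smooth_fun_push:
  assumes k: "smooth_fun A W k" and h: "\<And>p. p \<in> W \<Longrightarrow> h (e p) = k p" shows "smooth_fun B (e ` W) h"
proof (rule smooth_funI[OF image_mopen[OF smooth_fun_mopen[OF k]]])
  fix V \<psi> assume c: "(V, \<psi>) \<in> atlas B"
  obtain \<phi> where d: "(carrier A \<inter> e -` V, \<phi>) \<in> atlas A" "\<And>p. p \<in> carrier A \<Longrightarrow> e p \<in> V \<Longrightarrow> \<psi> (e p) = \<phi> p"
    by (rule chart_vimage[OF c]) (rule that)
  let ?U = "carrier A \<inter> e -` V"
  have eq: "\<psi> ` (V \<inter> e ` W) = \<phi> ` (?U \<inter> W)" 
    by (rule image_eq[of W V \<psi> \<phi>, OF mopen_subset[OF smooth_fun_mopen[OF k]] d(2)])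
  show "Cinf_on (index B) (\<psi> ` (V \<inter> e ` W)) (\<lambda>x. h (inv_into V \<psi> x))"
    unfolding eq
  proof (rule Cinf_on_cong[OF inj_atlas_finite[OF B]])
    show "Cinf_on (index B) (\<phi> ` (?U \<inter> W)) (\<lambda>x. k (inv_into ?U \<phi> x))"
      using smooth_funD[OF k d(1)] idx by simp
    fix x assume "x \<in> \<phi> ` (?U \<inter> W)"
    then obtain p where p: "p \<in> ?U" "p \<in> W" "x = \<phi> p" by blast
    have "inv_into ?U \<phi> x = p" unfolding p(3) by (rule inv_into_f_f[OF inj_atlas_inj[OF A d(1)] p(1)])
    moreover have "inv_into V \<psi> x = e p"
    proof -
      have "x = \<psi> (e p)" using p d(2) by auto
      then show ?thesis using p(1) inv_into_f_f[OF inj_atlas_inj[OF B c], of "e p"] by auto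
    qed
    ultimately show "k (inv_into ?U \<phi> x) = h (inv_into V \<psi> x)" using h[OF p(2)] by simp
  qed
qed

lemma smooth_at_iff:
  assumes p: "p \<in> carrier A" shows "smooth_at B (e p) h \<longleftrightarrow> smooth_at A p (\<lambda>q. h (e q))"
proof
  assume "smooth_at B (e p) h"
  then obtain V where V: "e p \<in> V" "smooth_fun B V h" by (auto simp: smooth_at_def)
  show "smooth_at A p (\<lambda>q. h (e q))" by (rule smooth_fun_smooth_at[OF smooth_fun_pull[OF V(2)]]) (use V(1) p in auto)
next
  assume "smooth_at A p (\<lambda>q. h (e q))"
  then obtain W where W: "p \<in> W" "smooth_fun A W (\<lambda>q. h (e q))" by (auto simp: smooth_at_def)
  show "smooth_at B (e p) h" by (rule smooth_fun_smooth_at[OF smooth_fun_push[OF W(2)]]) (use W(1) in auto)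
qed

lemma tangent_map_comp:
  assumes "F p \<in> carrier A"
  shows "tangent_map B (\<lambda>q. e (F q)) p v = tangent_map B e (F p) (tangent_map A F p v)"
  using smooth_at_iff[OF assms] by (auto simp: tangent_map_def fun_eq_iff comp_def)

lemma tangent_map_apply:
  assumes p: "p \<in> carrier A" and w: "w \<in> tangent_space A p"
  shows "tangent_map B e p w h = w (\<lambda>q. h (e q))"
  using smooth_at_iff[OF p, of h] tangent_spaceD(1)[OF w, of "\<lambda>q. h (e q)"] by (auto simp: tangent_map_def comp_def)

lemma tangent_map_in:
  assumes p: "p \<in> carrier A" and w: "w \<in> tangent_space A p"
  shows "tangent_map B e p w \<in> tangent_space B (e p)"
proof (rule tangent_spaceI)
  note ap = tangent_map_apply[OF p w] and iff = smooth_at_iff[OF p]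
  show "tangent_map B e p w f = 0" if "\<not> smooth_at B (e p) f" for f using that by (simp add: tangent_map_def)
  show "tangent_map B e p w f = tangent_map B e p w g"
    if "smooth_at B (e p) f" "smooth_at B (e p) g" "mopen B V" "e p \<in> V" "\<And>q. q \<in> V \<Longrightarrow> f q = g q" for f g V
    unfolding ap by (rule tangent_germ[OF A w vimage_mopen[OF that(3)]]) (use p that in auto)
  show "tangent_map B e p w (\<lambda>q. a * f q + b * g q) = a * tangent_map B e p w f + b * tangent_map B e p w g"
    if "smooth_at B (e p) f" "smooth_at B (e p) g" for f g a b
    unfolding ap by (rule tangent_spaceD(2)[OF w]) (use that iff in auto)
  show "tangent_map B e p w (\<lambda>q. f q * g q) = tangent_map B e p w f * g (e p) + f (e p) * tangent_map B e p w g"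
    if "smooth_at B (e p) f" "smooth_at B (e p) g" for f g
    unfolding ap by (rule tangent_spaceD(3)[OF w]) (use that iff in auto)
qed

lemma tangent_map_onto:
  assumes p: "p \<in> carrier A" and u: "u \<in> tangent_space B (e p)"
  obtains w where "w \<in> tangent_space A p" "tangent_map B e p w = u"
proof
  let ?e' = "inv_into (carrier A) e"
  define w where "w k = (if smooth_at A p k then u (\<lambda>b. k (?e' b)) else 0)" for k :: "'a \<Rightarrow> real"
  have e': "?e' (e q) = q" if "q \<in> W" "mopen A W" for q W using inj that mopen_subset[OF that(2)] by auto
  have sm: "smooth_at B (e p) (\<lambda>b. k (?e' b))" if k: "smooth_at A p k" for k
  proof -
    obtain W where W: "p \<in> W" "smooth_fun A W k" using k by (auto simp: smooth_at_def)
    show ?thesis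
      by (rule smooth_fun_smooth_at[OF smooth_fun_push[OF W(2)]])
        (use W(1) e'[OF _ smooth_fun_mopen[OF W(2)]] in auto)
  qed
  show w: "w \<in> tangent_space A p"
  proof (rule tangent_spaceI)
    show "w f = 0" if "\<not> smooth_at A p f" for f using that by (simp add: w_def)
    show "w f = w g" if "smooth_at A p f" "smooth_at A p g" "mopen A W" "p \<in> W" "\<And>q. q \<in> W \<Longrightarrow> f q = g q" for f g W
    proof -
      have "u (\<lambda>b. f (?e' b)) = u (\<lambda>b. g (?e' b))"
        by (rule tangent_germ[OF B u image_mopen[OF that(3)]]) (use that e'[OF _ that(3)] in auto)
      then show ?thesis using that(1,2) by (simp add: w_def)
    qed
    show "w (\<lambda>q. a * f q + b * g q) = a * w f + b * w g" if "smooth_at A p f" "smooth_at A p g" for f g a b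
      using tangent_spaceD(2)[OF u sm[OF that(1)] sm[OF that(2)], of a b] that smooth_at_lincomb(1)[OF A that, of a b]
      by (simp add: w_def)
    show "w (\<lambda>q. f q * g q) = w f * g p + f p * w g" if "smooth_at A p f" "smooth_at A p g" for f g
    proof -
      have "?e' (e p) = p" using inj p by simp
      then show ?thesis
        using tangent_spaceD(3)[OF u sm[OF that(1)] sm[OF that(2)]] that smooth_at_lincomb(2)[OF A that]
        by (simp add: w_def)
    qed
  qed
  show "tangent_map B e p w = u"
  proof
    fix h
    show "tangent_map B e p w h = u h"
    proof (cases "smooth_at B (e p) h")
      case True
      then have s: "smooth_at A p (\<lambda>q. h (e q))" using smooth_at_iff[OF p] by simp
      then obtain W where W: "p \<in> W" "smooth_fun A W (\<lambda>q. h (e q))" by (auto simp: smooth_at_def)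
      have "u (\<lambda>b. h (e (?e' b))) = u h"
        by (rule tangent_germ[OF B u image_mopen[OF smooth_fun_mopen[OF W(2)]]])
          (use W(1) e'[OF _ smooth_fun_mopen[OF W(2)]] in auto)
      then show ?thesis using s unfolding tangent_map_apply[OF p w] by (simp add: w_def)
    next
      case False
      then show ?thesis using tangent_spaceD(1)[OF u] by (simp add: tangent_map_def)
    qed
  qed
qed

lemma diffeo_on_compose:
  assumes M: "inj_atlas M" and F: "diffeo_on M U A V F"
  shows "diffeo_on M U B (e ` V) (\<lambda>p. e (F p))"
proof -
  note F' = diffeo_onD[OF F]
  have V: "V \<subseteq> carrier A" by (rule mopen_subset[OF F'(2)])
  have FU: "F p \<in> carrier A" if "p \<in> U" for p using F'(5) V that by blast
  have inj': "inj_on (\<lambda>p. e (F p)) U"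
  proof (rule inj_onI)
    fix p q assume "p \<in> U" "q \<in> U" "e (F p) = e (F q)"
    then show "p = q" using inj_onD[OF inj, of "F p" "F q"] inj_onD[OF F'(4), of p q] FU by blast
  qed
  have img: "(\<lambda>p. e (F p)) ` U = e ` V" using F'(5) by (simp add: image_image[symmetric])
  have s1: "smooth_map M U B (\<lambda>p. e (F p))"
  proof (rule smooth_mapI[OF F'(1)])
    have eq: "U \<inter> (\<lambda>p. e (F p)) -` X = U \<inter> F -` (carrier A \<inter> e -` X)" for X using FU by auto
    show "e (F p) \<in> carrier B" if "p \<in> U" for p by (rule e_carrier[OF FU[OF that]])
    show "mopen M (U \<inter> (\<lambda>p. e (F p)) -` X)" if "mopen B X" for X
      unfolding eq by (rule smooth_map_vimage[OF F'(6) vimage_mopen[OF that]])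
    show "smooth_fun M (U \<inter> (\<lambda>p. e (F p)) -` X) (\<lambda>p. \<psi> (e (F p)) j)" if c: "(X, \<psi>) \<in> atlas B" "j \<in> index B" for X \<psi> j
    proof -
      obtain \<phi> where d: "(carrier A \<inter> e -` X, \<phi>) \<in> atlas A" "\<And>p. p \<in> carrier A \<Longrightarrow> e p \<in> X \<Longrightarrow> \<psi> (e p) = \<phi> p"
        by (rule chart_vimage[OF c(1)]) (rule that)
      have j: "j \<in> index A" using c(2) idx by simp
      show ?thesis unfolding eq
        by (rule smooth_fun_cong[OF M smooth_map_coordinate[OF F'(6) d(1) j]]) (use d(2) in auto)
    qed
  qed
  let ?G = "inv_into U F" and ?H = "inv_into U (\<lambda>p. e (F p))"
  have He: "?H (e b) = ?G b" if b: "b \<in> V" for b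
  proof -
    obtain p where p: "p \<in> U" "b = F p" using b F'(5) by blast
    have "?H (e (F p)) = p" by (rule inv_into_f_f[OF inj' p(1)])
    then show ?thesis using p F'(4) by simp
  qed
  have GV: "?G b \<in> U" if "b \<in> V" for b using that F'(5) by (auto intro: inv_into_into)
  have s2: "smooth_map B (e ` V) M ?H"
  proof (rule smooth_mapI[OF image_mopen[OF F'(2)]])
    have eq: "e ` V \<inter> ?H -` X = e ` (V \<inter> ?G -` X)" for X using He by auto
    show "?H y \<in> carrier M" if "y \<in> e ` V" for y using that He GV mopen_subset[OF F'(1)] by auto
    show "mopen B (e ` V \<inter> ?H -` X)" if "mopen M X" for X
      unfolding eq by (rule image_mopen[OF smooth_map_vimage[OF F'(7) that]])
    show "smooth_fun B (e ` V \<inter> ?H -` X) (\<lambda>y. \<psi> (?H y) j)" if c: "(X, \<psi>) \<in> atlas M" "j \<in> index M" for X \<psi> j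
      unfolding eq by (rule smooth_fun_push[OF smooth_map_coordinate[OF F'(7) c]]) (use He in auto)
  qed
  show ?thesis
    using F'(1) image_mopen[OF F'(2)] inj' img s1 s2 by (simp add: diffeo_on_def bij_betw_def)
qed

end

lemma diffeo_on_cong:
  assumes M: "inj_atlas M" and N: "inj_atlas N" and F: "diffeo_on M U N V F" and eq: "\<And>p. p \<in> U \<Longrightarrow> F p = H p"
  shows "diffeo_on M U N V H"
proof -
  note F' = diffeo_onD[OF F]
  have b: "bij_betw H U V" using F'(3) eq by (simp add: bij_betw_cong[of U F H])
  have "inv_into U F y = inv_into U H y" if y: "y \<in> V" for y
  proof -
    obtain p where p: "p \<in> U" "y = F p" using y F'(5) by blast
    have "inv_into U H (H p) = p" using b p(1) by (simp add: bij_betw_def)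
    moreover have "inv_into U F (F p) = p" by (rule inv_into_f_f[OF F'(4) p(1)])
    ultimately show ?thesis using eq[OF p(1)] by (simp add: p(2))
  qed
  then have "smooth_map N V M (inv_into U H)" by (rule smooth_map_cong[OF N F'(7)])
  then show ?thesis using F'(1,2) b smooth_map_cong[OF M F'(6) eq] by (simp add: diffeo_on_def)
qed

subsection \<open>Jets under an embedding of bundles\<close>

text \<open>
  An isomorphism of \<open>\<pi>'\<close> with the restriction of \<open>\<pi>\<close> to an open
  subset. It acts on sections by \<open>\<sigma> \<mapsto> f \<circ> \<sigma> \<circ>
  g\<^sup>-\<^sup>1\<close> and hence on jets. Equality of the index sets, and not only of their
  sizes, lets charts correspond with the same coordinates.
\<close>

locale bundle_embedding =
  fixes E' :: "('d, nat) mfd" and Q' :: "('p, nat) mfd" and \<pi>' :: "'d \<Rightarrow> 'p" and f :: "'d \<Rightarrow> 'e" and g :: "'p \<Rightarrow> 'q"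
    and E :: "('e, nat) mfd" and Q :: "('q, nat) mfd" and \<pi> :: "'e \<Rightarrow> 'q"
  assumes E': "smooth_manifold E'" and Q': "smooth_manifold Q'" and E: "smooth_manifold E" and Q: "smooth_manifold Q"
    and idxE: "index E' = index E" and idxQ: "index Q' = index Q" and QE: "index Q \<subseteq> index E"
    and f: "diffeo_on E' (carrier E') E (f ` carrier E') f"
    and g: "diffeo_on Q' (carrier Q') Q (g ` carrier Q') g"
    and cover: "\<And>e. e \<in> carrier E' \<Longrightarrow> \<pi> (f e) = g (\<pi>' e)"
    and \<pi>'_carrier: "\<And>e. e \<in> carrier E' \<Longrightarrow> \<pi>' e \<in> carrier Q'"
begin

abbreviation f_inv :: "'e \<Rightarrow> 'd" where "f_inv \<equiv> inv_into (carrier E') f"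
abbreviation g_inv :: "'q \<Rightarrow> 'p" where "g_inv \<equiv> inv_into (carrier Q') g"
abbreviation emb :: "nat \<Rightarrow> ('d, 'p) jet \<Rightarrow> ('e, 'q) jet" where "emb r \<equiv> prolong E Q \<pi> r f (carrier Q') g"
abbreviation J' :: "nat \<Rightarrow> (('d, 'p) jet, nat \<times> nat multiset) mfd" where "J' r \<equiv> jet_bundle E' Q' \<pi>' r"
abbreviation J :: "nat \<Rightarrow> (('e, 'q) jet, nat \<times> nat multiset) mfd" where "J r \<equiv> jet_bundle E Q \<pi> r"

lemmas f_diffeo = diffeo_onD[OF f] and g_diffeo = diffeo_onD[OF g]
lemmas inj_E' = smooth_manifold_inj_atlas[OF E'] and inj_Q' = smooth_manifold_inj_atlas[OF Q']
  and inj_E = smooth_manifold_inj_atlas[OF E] and inj_Q = smooth_manifold_inj_atlas[OF Q]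

lemma f_inv_f: "e \<in> carrier E' \<Longrightarrow> f_inv (f e) = e" and g_inv_g: "y \<in> carrier Q' \<Longrightarrow> g_inv (g y) = y"
  using f_diffeo(4) g_diffeo(4) by auto

lemma section_push:
  assumes \<sigma>: "local_section E' Q' \<pi>' x \<sigma>"
  shows "local_section E Q \<pi> (g x) (f \<circ> \<sigma> \<circ> g_inv)"
proof -
  obtain N where N: "x \<in> N" "mopen Q' N" "smooth_map Q' N E' \<sigma>" "\<And>y. y \<in> N \<Longrightarrow> \<pi>' (\<sigma> y) = y"
    using \<sigma> by (elim local_sectionE) (rule that)
  have Nc: "N \<subseteq> carrier Q'" by (rule mopen_subset[OF N(2)])
  have gN: "mopen Q (g ` N)" by (rule diffeo_on_image_mopen[OF g N(2) Nc])
  have ginv: "smooth_map Q (g ` N) Q' g_inv"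
    by (rule smooth_map_subset[OF inj_Q g_diffeo(7) gN]) (use Nc in blast)
  have e1: "g ` N \<inter> g_inv -` N = g ` N" using Nc g_inv_g by auto
  have "smooth_map Q (g ` N) E' (\<lambda>y. \<sigma> (g_inv y))"
    using smooth_map_compose[OF inj_Q Q' ginv N(3)] unfolding e1 .
  note s = smooth_map_compose[OF inj_Q E' this f_diffeo(6)]
  have e2: "g ` N \<inter> (\<lambda>y. \<sigma> (g_inv y)) -` carrier E' = g ` N"
    using smooth_map_image[OF \<open>smooth_map Q (g ` N) E' (\<lambda>y. \<sigma> (g_inv y))\<close>] by blast
  have "smooth_map Q (g ` N) E (f \<circ> \<sigma> \<circ> g_inv)" using s unfolding e2 comp_def .
  moreover have "\<pi> ((f \<circ> \<sigma> \<circ> g_inv) z) = z" if z: "z \<in> g ` N" for z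
  proof -
    obtain y where y: "y \<in> N" "z = g y" using z by blast
    have "\<pi> (f (\<sigma> y)) = g (\<pi>' (\<sigma> y))" by (rule cover[OF smooth_map_image[OF N(3) y(1)]])
    then show ?thesis using N(4)[OF y(1)] g_inv_g y Nc by auto
  qed
  ultimately show ?thesis using N(1) unfolding local_section_def by blast
qed

text \<open>
  The image of \<open>f\<close> is open, so the values of \<open>\<tau>\<close> remain in it near
  \<open>g x\<close> and can be pulled back along \<open>f\<close>.
\<close>

lemma section_pull:
  assumes x: "x \<in> carrier Q'" and \<tau>: "local_section E Q \<pi> (g x) \<tau>" "\<tau> (g x) \<in> f ` carrier E'"
  shows "local_section E' Q' \<pi>' x (f_inv \<circ> \<tau> \<circ> g)"
    and "\<exists>W. mopen Q W \<and> g x \<in> W \<and> W \<subseteq> g ` carrier Q' \<and> (\<forall>y\<in>W. (f \<circ> (f_inv \<circ> \<tau> \<circ> g) \<circ> g_inv) y = \<tau> y)"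
proof -
  obtain N where N: "g x \<in> N" "mopen Q N" "smooth_map Q N E \<tau>" "\<And>y. y \<in> N \<Longrightarrow> \<pi> (\<tau> y) = y"
    using \<tau>(1) by (elim local_sectionE) (rule that)
  define N1 where "N1 = N \<inter> \<tau> -` (f ` carrier E')"
  have N1: "mopen Q N1" unfolding N1_def by (rule smooth_map_vimage[OF N(3) f_diffeo(2)])
  have ff: "f (f_inv (\<tau> y)) = \<tau> y" "f_inv (\<tau> y) \<in> carrier E'" if "y \<in> N1" for y
    using that by (auto simp: N1_def intro: f_inv_into_f inv_into_into)
  have "smooth_map Q N1 E' (\<lambda>y. f_inv (\<tau> y))"
    unfolding N1_def by (rule smooth_map_compose[OF inj_Q E N(3) f_diffeo(7)])
  from smooth_map_compose[OF inj_Q' Q g_diffeo(6) this]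
  have s: "smooth_map Q' (carrier Q' \<inter> g -` N1) E' (f_inv \<circ> \<tau> \<circ> g)" by (simp add: comp_def)
  have "\<pi>' ((f_inv \<circ> \<tau> \<circ> g) y) = y" if y: "y \<in> carrier Q' \<inter> g -` N1" for y
  proof -
    have gy: "g y \<in> N1" using y by simp
    have "g (\<pi>' (f_inv (\<tau> (g y)))) = \<pi> (\<tau> (g y))" using cover[OF ff(2)[OF gy]] ff(1)[OF gy] by simp
    also have "\<dots> = g y" using N(4) gy by (simp add: N1_def)
    finally show ?thesis using inj_onD[OF g_diffeo(4)] \<pi>'_carrier[OF ff(2)[OF gy]] y by simp
  qed
  moreover have "x \<in> carrier Q' \<inter> g -` N1" using x N(1) \<tau>(2) by (simp add: N1_def)
  ultimately show "local_section E' Q' \<pi>' x (f_inv \<circ> \<tau> \<circ> g)" using s unfolding local_section_def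
    by (intro exI[of _ "carrier Q' \<inter> g -` N1"] conjI ballI)
  show "\<exists>W. mopen Q W \<and> g x \<in> W \<and> W \<subseteq> g ` carrier Q' \<and> (\<forall>y\<in>W. (f \<circ> (f_inv \<circ> \<tau> \<circ> g) \<circ> g_inv) y = \<tau> y)"
  proof (intro exI[of _ "N1 \<inter> g ` carrier Q'"] conjI ballI)
    show "mopen Q (N1 \<inter> g ` carrier Q')" by (rule mopen_Int[OF inj_Q N1 g_diffeo(2)])
    show "g x \<in> N1 \<inter> g ` carrier Q'" using x N(1) \<tau>(2) by (simp add: N1_def)
    fix y assume y: "y \<in> N1 \<inter> g ` carrier Q'"
    then have "g (g_inv y) = y" by (auto intro: f_inv_into_f)
    then show "(f \<circ> (f_inv \<circ> \<tau> \<circ> g) \<circ> g_inv) y = \<tau> y" using ff(1) y by simp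
  qed simp
qed

text \<open>
  In corresponding charts \<open>h\<close> and \<open>k\<close> are the same function of the
  coordinates near \<open>\<phi>' x\<close>.
\<close>

lemma multi_pderiv_transfer:
  assumes V': "(V', \<phi>') \<in> charts Q'" and V: "(V, \<phi>) \<in> charts Q"
    and \<phi>: "\<And>y. y \<in> V' \<Longrightarrow> g y \<in> V" "\<And>y. y \<in> V' \<Longrightarrow> \<phi> (g y) = \<phi>' y"
    and W: "mopen Q' W" "W \<subseteq> V'" "x \<in> W" and h: "\<And>y. y \<in> W \<Longrightarrow> h (g y) = k y" and K: "set_mset K \<subseteq> index Q"
  shows "multi_pderiv K (\<lambda>z. h (inv_into V \<phi> z)) (\<phi> (g x)) = multi_pderiv K (\<lambda>z. k (inv_into V' \<phi>' z)) (\<phi>' x)"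
proof -
  have S: "coord_open (index Q) (\<phi>' ` W)"
    using charts_open_image[OF Q' V' W(1)] W(2) idxQ by (simp add: Int_absorb1)
  have "multi_pderiv K (\<lambda>z. h (inv_into V \<phi> z)) (\<phi>' x) = multi_pderiv K (\<lambda>z. k (inv_into V' \<phi>' z)) (\<phi>' x)"
  proof (rule multi_pderiv_cong[OF smooth_manifold_finite[OF Q] S _ K])
    show "\<phi>' x \<in> \<phi>' ` W" using W(3) by blast
    fix z assume "z \<in> \<phi>' ` W"
    then obtain y where y: "y \<in> W" "z = \<phi>' y" by blast
    have yV: "y \<in> V'" using y(1) W(2) by blast
    have "inv_into V' \<phi>' z = y" unfolding y(2) by (rule inv_into_f_f[OF chartsD(2)[OF V'] yV])
    moreover have "inv_into V \<phi> z = g y"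
      unfolding y(2) \<phi>(2)[OF yV, symmetric] by (rule inv_into_f_f[OF chartsD(2)[OF V] \<phi>(1)[OF yV]])
    ultimately show "h (inv_into V \<phi> z) = k (inv_into V' \<phi>' z)" using h[OF y(1)] by simp
  qed
  then show ?thesis using \<phi>(2) W(2,3) by auto
qed

lemma charts_pull_Q: "(V, \<phi>) \<in> charts Q \<Longrightarrow> (carrier Q' \<inter> g -` V, \<lambda>y. \<phi> (g y)) \<in> charts Q'"
  and charts_pull_E: "(U, \<psi>) \<in> charts E \<Longrightarrow> (carrier E' \<inter> f -` U, \<lambda>y. \<psi> (f y)) \<in> charts E'"
proof -
  assume V: "(V, \<phi>) \<in> charts Q"
  have "(carrier Q' \<inter> g -` (V \<inter> g ` carrier Q'), \<lambda>y. \<phi> (g y)) \<in> charts Q'"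
    by (rule charts_transport[OF Q' Q idxQ g charts_restrict[OF Q V g_diffeo(2)]]) simp
  moreover have "carrier Q' \<inter> g -` (V \<inter> g ` carrier Q') = carrier Q' \<inter> g -` V" by auto
  ultimately show "(carrier Q' \<inter> g -` V, \<lambda>y. \<phi> (g y)) \<in> charts Q'" by simp
next
  assume U: "(U, \<psi>) \<in> charts E"
  have "(carrier E' \<inter> f -` (U \<inter> f ` carrier E'), \<lambda>y. \<psi> (f y)) \<in> charts E'"
    by (rule charts_transport[OF E' E idxE f charts_restrict[OF E U f_diffeo(2)]]) simp
  moreover have "carrier E' \<inter> f -` (U \<inter> f ` carrier E') = carrier E' \<inter> f -` U" by auto
  ultimately show "(carrier E' \<inter> f -` U, \<lambda>y. \<psi> (f y)) \<in> charts E'" by simp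
qed

lemma charts_push_Q: "(V', \<phi>') \<in> charts Q' \<Longrightarrow> (g ` V', \<lambda>y. \<phi>' (g_inv y)) \<in> charts Q"
  and charts_push_E: "(U', \<psi>') \<in> charts E' \<Longrightarrow> (f ` U', \<lambda>y. \<psi>' (f_inv y)) \<in> charts E"
proof -
  assume V: "(V', \<phi>') \<in> charts Q'"
  note Vc = chartsD(1)[OF V]
  have "(g ` carrier Q' \<inter> g_inv -` V', \<lambda>y. \<phi>' (g_inv y)) \<in> charts Q"
    by (rule charts_transport[OF Q Q' idxQ[symmetric] diffeo_on_inverse[OF inj_Q' g] V Vc])
  moreover have "g ` carrier Q' \<inter> g_inv -` V' = g ` V'" using g_inv_g Vc by force
  ultimately show "(g ` V', \<lambda>y. \<phi>' (g_inv y)) \<in> charts Q" by simp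
next
  assume U: "(U', \<psi>') \<in> charts E'"
  note Uc = chartsD(1)[OF U]
  have "(f ` carrier E' \<inter> f_inv -` U', \<lambda>y. \<psi>' (f_inv y)) \<in> charts E"
    by (rule charts_transport[OF E E' idxE[symmetric] diffeo_on_inverse[OF inj_E' f] U Uc])
  moreover have "f ` carrier E' \<inter> f_inv -` U' = f ` U'" using f_inv_f Uc by force
  ultimately show "(f ` U', \<lambda>y. \<psi>' (f_inv y)) \<in> charts E" by simp
qed

text \<open>
  Charts of \<open>E\<close> and \<open>Q\<close> pull back to charts in which the original
  sections have the coordinate expressions of their images.
\<close>

lemma same_jet_push:
  assumes x: "x \<in> carrier Q'" "\<sigma> x \<in> carrier E'" and st: "same_jet E' Q' r x \<sigma> \<tau>"
  shows "same_jet E Q r (g x) (f \<circ> \<sigma> \<circ> g_inv) (f \<circ> \<tau> \<circ> g_inv)"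
proof (rule same_jetI)
  show "(f \<circ> \<sigma> \<circ> g_inv) (g x) = (f \<circ> \<tau> \<circ> g_inv) (g x)" using same_jetD(1)[OF st] g_inv_g[OF x(1)] by simp
  fix V \<phi> U \<psi> i K
  assume V: "(V, \<phi>) \<in> charts Q" and U: "(U, \<psi>) \<in> charts E" and gx: "g x \<in> V" "(f \<circ> \<sigma> \<circ> g_inv) (g x) \<in> U"
    and i: "i \<in> index E" and K: "set_mset K \<subseteq> index Q" "size K \<le> r"
  note V' = charts_pull_Q[OF V] and U' = charts_pull_E[OF U]
  have tr: "multi_pderiv K (\<lambda>z. \<psi> ((f \<circ> \<rho> \<circ> g_inv) (inv_into V \<phi> z)) i) (\<phi> (g x)) =
      multi_pderiv K (\<lambda>z. \<psi> (f (\<rho> (inv_into (carrier Q' \<inter> g -` V) (\<lambda>y. \<phi> (g y)) z))) i) (\<phi> (g x))" for \<rho>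
    by (rule multi_pderiv_transfer[OF V' V _ _ charts_mopen[OF V'] order_refl _ _ K(1),
          where h = "\<lambda>y. \<psi> ((f \<circ> \<rho> \<circ> g_inv) y) i" and k = "\<lambda>y. \<psi> (f (\<rho> y)) i"])
      (use gx(1) x(1) g_inv_g in auto)
  have "x \<in> carrier Q' \<inter> g -` V" "\<sigma> x \<in> carrier E' \<inter> f -` U" using x gx g_inv_g by auto
  then show "multi_pderiv K (\<lambda>z. \<psi> ((f \<circ> \<sigma> \<circ> g_inv) (inv_into V \<phi> z)) i) (\<phi> (g x)) =
      multi_pderiv K (\<lambda>z. \<psi> ((f \<circ> \<tau> \<circ> g_inv) (inv_into V \<phi> z)) i) (\<phi> (g x))"
    unfolding tr using same_jetD(2)[OF st V' U', of i K] i K idxE idxQ by simp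
qed

lemma same_jet_pull:
  assumes \<sigma>: "local_section E' Q' \<pi>' x \<sigma>" and \<tau>: "local_section E' Q' \<pi>' x \<tau>"
    and st: "same_jet E Q r (g x) (f \<circ> \<sigma> \<circ> g_inv) (f \<circ> \<tau> \<circ> g_inv)"
  shows "same_jet E' Q' r x \<sigma> \<tau>"
proof (rule same_jetI)
  note bx = local_section_base[OF \<sigma>] local_section_base[OF \<tau>]
  have "f (\<sigma> x) = f (\<tau> x)" using same_jetD(1)[OF st] g_inv_g bx by simp
  then show "\<sigma> x = \<tau> x" using inj_onD[OF f_diffeo(4)] bx by blast
  fix V' \<phi>' U' \<psi>' i K
  assume V': "(V', \<phi>') \<in> charts Q'" and U': "(U', \<psi>') \<in> charts E'" and x: "x \<in> V'" "\<sigma> x \<in> U'"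
    and i: "i \<in> index E'" and K: "set_mset K \<subseteq> index Q'" "size K \<le> r"
  note V = charts_push_Q[OF V'] and U = charts_push_E[OF U']
  note Vc = chartsD(1)[OF V']
  have tr: "multi_pderiv K (\<lambda>z. \<psi>' (f_inv ((f \<circ> \<rho> \<circ> g_inv) (inv_into (g ` V') (\<lambda>y. \<phi>' (g_inv y)) z))) i) (\<phi>' (g_inv (g x))) =
      multi_pderiv K (\<lambda>z. \<psi>' (\<rho> (inv_into V' \<phi>' z)) i) (\<phi>' x)" if \<rho>: "local_section E' Q' \<pi>' x \<rho>" for \<rho>
  proof -
    obtain N where N: "x \<in> N" "mopen Q' N" "\<And>y. y \<in> N \<Longrightarrow> \<rho> y \<in> carrier E'"
      using \<rho> by (elim local_sectionE) (rule that)
    have W: "mopen Q' (N \<inter> V')" by (rule mopen_Int[OF inj_Q' N(2) charts_mopen[OF V']])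
    show ?thesis
      by (rule multi_pderiv_transfer[OF V' V _ _ W _ _ _ K(1)[unfolded idxQ],
            where h = "\<lambda>y. \<psi>' (f_inv ((f \<circ> \<rho> \<circ> g_inv) y)) i" and k = "\<lambda>y. \<psi>' (\<rho> y) i"])
        (use N(1,3) x(1) Vc g_inv_g f_inv_f in auto)
  qed
  have "g x \<in> g ` V'" "(f \<circ> \<sigma> \<circ> g_inv) (g x) \<in> f ` U'" using x bx g_inv_g by auto
  then show "multi_pderiv K (\<lambda>z. \<psi>' (\<sigma> (inv_into V' \<phi>' z)) i) (\<phi>' x) =
      multi_pderiv K (\<lambda>z. \<psi>' (\<tau> (inv_into V' \<phi>' z)) i) (\<phi>' x)"
    unfolding tr[OF \<sigma>, symmetric] tr[OF \<tau>, symmetric]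
    using same_jetD(2)[OF st V U, of i K] i K idxE idxQ by simp
qed

lemma emb_jet:
  assumes \<sigma>: "local_section E' Q' \<pi>' x \<sigma>"
  shows "emb r (jet E' Q' \<pi>' s x \<sigma>) = jet E Q \<pi> r (g x) (f \<circ> jet_rep (jet E' Q' \<pi>' s x \<sigma>) \<circ> g_inv)"
    and "r \<le> s \<Longrightarrow> emb r (jet E' Q' \<pi>' s x \<sigma>) = jet E Q \<pi> r (g x) (f \<circ> \<sigma> \<circ> g_inv)"
proof -
  show 1: "emb r (jet E' Q' \<pi>' s x \<sigma>) = jet E Q \<pi> r (g x) (f \<circ> jet_rep (jet E' Q' \<pi>' s x \<sigma>) \<circ> g_inv)"
    by (simp add: prolong_def jet_source_jet)
  assume "r \<le> s"
  then have "same_jet E' Q' r x (jet_rep (jet E' Q' \<pi>' s x \<sigma>)) \<sigma>"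
    using same_jet_lower[OF same_jet_sym[OF jet_rep_jet(2)[OF \<sigma>]]] by blast
  then show "emb r (jet E' Q' \<pi>' s x \<sigma>) = jet E Q \<pi> r (g x) (f \<circ> \<sigma> \<circ> g_inv)"
    unfolding 1 using local_section_base[OF jet_rep_jet(1)[OF \<sigma>]] by (intro jet_eqI same_jet_push) auto
qed

lemma jets_obtain:
  assumes "j \<in> jets E' Q' \<pi>' r"
  obtains x \<sigma> where "local_section E' Q' \<pi>' x \<sigma>" "j = jet E' Q' \<pi>' r x \<sigma>"
  using assms by (auto simp: jets_def)

lemma emb_jets:
  assumes "j \<in> jets E' Q' \<pi>' r"
  shows "emb r j \<in> jets E Q \<pi> r" "jet_source (emb r j) = g (jet_source j)" "jet_target (emb r j) = f (jet_target j)"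
    "jet_target j \<in> carrier E'" "jet_source j \<in> carrier Q'"
proof -
  obtain x \<sigma> where \<sigma>: "local_section E' Q' \<pi>' x \<sigma>" "j = jet E' Q' \<pi>' r x \<sigma>" using assms by (rule jets_obtain) (rule that)
  note b = local_section_base[OF \<sigma>(1)]
  have e: "emb r j = jet E Q \<pi> r (g x) (f \<circ> \<sigma> \<circ> g_inv)" unfolding \<sigma>(2) by (rule emb_jet(2)[OF \<sigma>(1) order_refl])
  show "emb r j \<in> jets E Q \<pi> r" unfolding e by (rule jetsI[OF section_push[OF \<sigma>(1)]])
  show "jet_source (emb r j) = g (jet_source j)" unfolding e unfolding \<sigma>(2) by (simp add: jet_source_jet)
  show "jet_target (emb r j) = f (jet_target j)"
    unfolding e jet_target_jet[OF section_push[OF \<sigma>(1)]] unfolding \<sigma>(2) jet_target_jet[OF \<sigma>(1)]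
    using g_inv_g b by simp
  show "jet_target j \<in> carrier E'" "jet_source j \<in> carrier Q'"
    unfolding \<sigma>(2) jet_target_jet[OF \<sigma>(1)] jet_source_jet using b by auto
qed

lemma emb_inj: "inj_on (emb r) (jets E' Q' \<pi>' r)"
proof (rule inj_onI)
  fix j k assume j: "j \<in> jets E' Q' \<pi>' r" and k: "k \<in> jets E' Q' \<pi>' r" and eq: "emb r j = emb r k"
  obtain x \<sigma> where \<sigma>: "local_section E' Q' \<pi>' x \<sigma>" "j = jet E' Q' \<pi>' r x \<sigma>" using j by (rule jets_obtain) (rule that)
  obtain y \<tau> where \<tau>: "local_section E' Q' \<pi>' y \<tau>" "k = jet E' Q' \<pi>' r y \<tau>" using k by (rule jets_obtain) (rule that)
  have "jet E Q \<pi> r (g x) (f \<circ> \<sigma> \<circ> g_inv) = jet E Q \<pi> r (g y) (f \<circ> \<tau> \<circ> g_inv)"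
    using eq unfolding \<sigma>(2) \<tau>(2) emb_jet(2)[OF \<sigma>(1) order_refl] emb_jet(2)[OF \<tau>(1) order_refl] .
  from jet_eqD[OF this section_push[OF \<tau>(1)]]
  have gg: "g x = g y" and sj: "same_jet E Q r (g x) (f \<circ> \<sigma> \<circ> g_inv) (f \<circ> \<tau> \<circ> g_inv)" by auto
  have xy: "x = y" using inj_onD[OF g_diffeo(4) gg] local_section_base[OF \<sigma>(1)] local_section_base[OF \<tau>(1)] by simp
  have "same_jet E' Q' r x \<sigma> \<tau>" by (rule same_jet_pull[OF \<sigma>(1) _ sj]) (use \<tau>(1) xy in simp)
  then show "j = k" unfolding \<sigma>(2) \<tau>(2) xy[symmetric] by (rule jet_eqI)
qed

lemma emb_onto:
  assumes j: "j \<in> jets E Q \<pi> r" and t: "jet_target j \<in> f ` carrier E'"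
  obtains j' where "j' \<in> jets E' Q' \<pi>' r" "emb r j' = j"
proof -
  define \<tau> where "\<tau> = jet_rep j"
  have \<tau>: "local_section E Q \<pi> (fst j) \<tau>" "jet E Q \<pi> r (fst j) \<tau> = j"
    unfolding \<tau>_def using j by (auto elim: jetsE)
  have t\<tau>: "jet_target j = \<tau> (fst j)" using jet_target_jet[OF \<tau>(1), of r] \<tau>(2) by simp
  obtain e where e: "e \<in> carrier E'" "\<tau> (fst j) = f e" using t t\<tau> by auto
  define x where "x = \<pi>' e"
  have x: "x \<in> carrier Q'" "fst j = g x"
    using \<pi>'_carrier[OF e(1)] cover[OF e(1)] local_section_base[OF \<tau>(1)] e(2) by (auto simp: x_def)
  have \<tau>x: "local_section E Q \<pi> (g x) \<tau>" "\<tau> (g x) \<in> f ` carrier E'" using \<tau>(1) x(2) e by auto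
  note \<sigma> = section_pull(1)[OF x(1) \<tau>x]
  obtain W where W: "mopen Q W" "g x \<in> W" "\<And>y. y \<in> W \<Longrightarrow> (f \<circ> (f_inv \<circ> \<tau> \<circ> g) \<circ> g_inv) y = \<tau> y"
    using section_pull(2)[OF x(1) \<tau>x] by blast
  have "emb r (jet E' Q' \<pi>' r x (f_inv \<circ> \<tau> \<circ> g)) = jet E Q \<pi> r (g x) (f \<circ> (f_inv \<circ> \<tau> \<circ> g) \<circ> g_inv)"
    by (rule emb_jet(2)[OF \<sigma> order_refl])
  also have "\<dots> = jet E Q \<pi> r (g x) \<tau>" by (rule jet_eqI[OF same_jet_germ[OF Q W]])
  also have "\<dots> = j" using \<tau>(2) x(2) by simp
  finally show ?thesis by (rule that[OF jetsI[OF \<sigma>]])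
qed

text \<open>
  In corresponding charts a section and its image have the same coordinate expression, so the map
  of jets is the identity in coordinates.
\<close>

lemma emb_coord:
  assumes c: "((U, \<psi>), (V, \<phi>)) \<in> adapted_charts E Q \<pi>" and c': "((U', \<psi>'), (V', \<phi>')) \<in> adapted_charts E' Q' \<pi>'"
    and f_chart: "\<And>e. e \<in> U' \<Longrightarrow> f e \<in> U" "\<And>e. e \<in> U' \<Longrightarrow> \<psi> (f e) = \<psi>' e"
    and g_chart: "\<And>y. y \<in> V' \<Longrightarrow> g y \<in> V" "\<And>y. y \<in> V' \<Longrightarrow> \<phi> (g y) = \<phi>' y"
    and j: "j \<in> jets E' Q' \<pi>' r" "jet_target j \<in> U'"
  shows "jet_coord E Q r \<psi> V \<phi> (emb r j) = jet_coord E' Q' r \<psi>' V' \<phi>' j"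
proof
  fix \<alpha>K :: "nat \<times> nat multiset"
  obtain \<alpha> K where \<alpha>K: "\<alpha>K = (\<alpha>, K)" by force
  obtain x \<sigma> where \<sigma>: "local_section E' Q' \<pi>' x \<sigma>" "j = jet E' Q' \<pi>' r x \<sigma>" using j(1) by (rule jets_obtain) (rule that)
  note D = adapted_chartsD[OF c] and D' = adapted_chartsD[OF c'] and b = local_section_base[OF \<sigma>(1)]
  have QE': "index Q' \<subseteq> index E'" using QE idxE idxQ by simp
  have \<sigma>x: "\<sigma> x \<in> U'" using j(2) unfolding \<sigma>(2) jet_target_jet[OF \<sigma>(1)] .
  have x: "x \<in> V'" using D'(3)[OF \<sigma>x] b by simp
  have f\<sigma>x: "(f \<circ> \<sigma> \<circ> g_inv) (g x) \<in> U" using f_chart(1)[OF \<sigma>x] g_inv_g b by simp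
  show "jet_coord E Q r \<psi> V \<phi> (emb r j) \<alpha>K = jet_coord E' Q' r \<psi>' V' \<phi>' j \<alpha>K"
  proof (cases "(\<alpha>, K) \<in> jet_index (index Q) (index E) r")
    case True
    then have True': "(\<alpha>, K) \<in> jet_index (index Q') (index E') r" using idxE idxQ by simp
    have K: "set_mset K \<subseteq> index Q" using True by (auto simp: jet_index_def)
    obtain N where N: "x \<in> N" "mopen Q' N" "smooth_map Q' N E' \<sigma>" using \<sigma>(1) by (elim local_sectionE) (rule that)
    have W: "mopen Q' ((N \<inter> \<sigma> -` U') \<inter> V')"
      by (rule mopen_Int[OF inj_Q' smooth_map_vimage[OF N(3) charts_mopen[OF D'(1)]] charts_mopen[OF D'(2)]])
    have "jet_coord E Q r \<psi> V \<phi> (emb r j) \<alpha>K = multi_pderiv K (\<lambda>z. \<psi> ((f \<circ> \<sigma> \<circ> g_inv) (inv_into V \<phi> z)) \<alpha>) (\<phi> (g x))"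
      unfolding \<alpha>K \<sigma>(2) emb_jet(2)[OF \<sigma>(1) order_refl]
      by (rule jet_coord_same_jet[OF QE c section_push[OF \<sigma>(1)] f\<sigma>x True])
    also have "\<dots> = multi_pderiv K (\<lambda>z. \<psi>' (\<sigma> (inv_into V' \<phi>' z)) \<alpha>) (\<phi>' x)"
      by (rule multi_pderiv_transfer[OF D'(2) D(2) g_chart W _ _ _ K,
            where h = "\<lambda>y. \<psi> ((f \<circ> \<sigma> \<circ> g_inv) y) \<alpha>" and k = "\<lambda>y. \<psi>' (\<sigma> y) \<alpha>"])
        (use N(1) \<sigma>x x g_inv_g chartsD(1)[OF D'(2)] f_chart(2) in auto)
    also have "\<dots> = jet_coord E' Q' r \<psi>' V' \<phi>' j \<alpha>K"
      unfolding \<alpha>K \<sigma>(2) by (rule jet_coord_same_jet[OF QE' c' \<sigma>(1) \<sigma>x True', symmetric])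
    finally show ?thesis .
  next
    case False
    then show ?thesis unfolding \<alpha>K jet_coord_def using idxE idxQ by simp
  qed
qed

lemma adapted_pull:
  assumes c: "((U, \<psi>), (V, \<phi>)) \<in> adapted_charts E Q \<pi>"
  shows "((carrier E' \<inter> f -` U, \<lambda>e. \<psi> (f e)), (carrier Q' \<inter> g -` V, \<lambda>y. \<phi> (g y))) \<in> adapted_charts E' Q' \<pi>'"
proof -
  note D = adapted_chartsD[OF c]
  have "\<pi>' e \<in> carrier Q' \<inter> g -` V" if e: "e \<in> carrier E' \<inter> f -` U" for e
    using \<pi>'_carrier cover[of e] D(3)[of "f e"] e by auto
  moreover have "\<psi> (f e) i = \<phi> (g (\<pi>' e)) i" if "e \<in> carrier E' \<inter> f -` U" "i \<in> index Q'" for e i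
    using D(4)[of "f e" i] cover[of e] that idxQ by auto
  ultimately show ?thesis
    using charts_pull_E[OF D(1)] charts_pull_Q[OF D(2)] unfolding adapted_charts_def by auto
qed

lemma adapted_push:
  assumes c: "((U', \<psi>'), (V', \<phi>')) \<in> adapted_charts E' Q' \<pi>'"
  shows "((f ` U', \<lambda>e. \<psi>' (f_inv e)), (g ` V', \<lambda>y. \<phi>' (g_inv y))) \<in> adapted_charts E Q \<pi>"
proof -
  note D = adapted_chartsD[OF c]
  note Uc = chartsD(1)[OF D(1)]
  have "\<pi> e \<in> g ` V'" if "e \<in> f ` U'" for e using that cover D(3) Uc by auto
  moreover have "\<psi>' (f_inv e) i = \<phi>' (g_inv (\<pi> e)) i" if e: "e \<in> f ` U'" and i: "i \<in> index Q" for e i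
  proof -
    obtain e' where e': "e' \<in> U'" "e = f e'" using e by blast
    have ec: "e' \<in> carrier E'" using e'(1) Uc by blast
    show ?thesis using e'(2) f_inv_f[OF ec] cover[OF ec] g_inv_g[OF \<pi>'_carrier[OF ec]] D(4)[OF e'(1)] i idxQ by simp
  qed
  ultimately show ?thesis
    using charts_push_E[OF D(1)] charts_push_Q[OF D(2)] unfolding adapted_charts_def by auto
qed

lemma J'_inj: "inj_atlas (J' r)" and J_inj: "inj_atlas (J r)"
  using jet_bundle_inj_atlas[OF E' Q'] jet_bundle_inj_atlas[OF E Q QE] QE idxE idxQ by auto

text \<open>
  Adapted charts of \<open>\<pi>\<close> pull back to adapted charts of \<open>\<pi>'\<close>, and
  those of \<open>\<pi>'\<close> push forward to adapted charts of \<open>\<pi>\<close>;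
  \<open>emb_coord\<close> compares the coordinates that they induce on jets.
\<close>

sublocale jets: atlas_embedding "J' r" "J r" "emb r" for r
proof (rule atlas_embedding.intro[OF J'_inj J_inj])
  note car = jet_bundle_carrier_subset[of E' Q' \<pi>' r]
  show "index (J' r) = index (J r)" by (simp add: jet_bundle_index idxE idxQ)
  show "inj_on (emb r) (carrier (J' r))" by (rule inj_on_subset[OF emb_inj car])
  show "\<exists>\<zeta>. (emb r ` X, \<zeta>) \<in> atlas (J r) \<and> (\<forall>p\<in>X. \<zeta> (emb r p) = \<xi> p)" if X_atlas: "(X, \<xi>) \<in> atlas (J' r)" for X \<xi>
  proof -
    obtain U' \<psi>' V' \<phi>' where c: "((U', \<psi>'), (V', \<phi>')) \<in> adapted_charts E' Q' \<pi>'"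
      and X: "X = {j \<in> jets E' Q' \<pi>' r. jet_target j \<in> U'}" "\<xi> = jet_coord E' Q' r \<psi>' V' \<phi>'"
      by (rule jet_bundle_atlasE[OF X_atlas])
    note D = adapted_chartsD[OF c]
    note Uc = chartsD(1)[OF D(1)] and Vc = chartsD(1)[OF D(2)]
    note P = adapted_push[OF c]
    have "{j \<in> jets E Q \<pi> r. jet_target j \<in> f ` U'} = emb r ` X"
    proof (intro equalityI subsetI)
      fix j assume j: "j \<in> {j \<in> jets E Q \<pi> r. jet_target j \<in> f ` U'}"
      obtain j' where j': "j' \<in> jets E' Q' \<pi>' r" "emb r j' = j"
        using j Uc by (elim CollectE conjE) (rule emb_onto, assumption, blast, rule that)
      have "f (jet_target j') \<in> f ` U'" using j emb_jets(3)[OF j'(1)] j'(2) by simp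
      then have "jet_target j' \<in> U'" using inj_on_image_mem_iff[OF f_diffeo(4) emb_jets(4)[OF j'(1)] Uc] by simp
      then show "j \<in> emb r ` X" using j' X(1) by blast
    next
      fix j assume "j \<in> emb r ` X"
      then obtain j' where j': "j' \<in> jets E' Q' \<pi>' r" "jet_target j' \<in> U'" "j = emb r j'" using X(1) by blast
      then show "j \<in> {j \<in> jets E Q \<pi> r. jet_target j \<in> f ` U'}" using emb_jets(1,3)[OF j'(1)] by simp
    qed
    moreover have "jet_coord E Q r (\<lambda>e. \<psi>' (f_inv e)) (g ` V') (\<lambda>y. \<phi>' (g_inv y)) (emb r j) = \<xi> j" if j: "j \<in> X" for j
      unfolding X(2)
      by (rule emb_coord[OF P c]) (use j X(1) Uc Vc f_inv_f g_inv_g in auto)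
    ultimately show ?thesis using jet_bundle_atlasI[OF P, of r] by auto
  qed
  show "\<exists>\<zeta>. (carrier (J' r) \<inter> emb r -` X, \<zeta>) \<in> atlas (J' r) \<and>
      (\<forall>p\<in>carrier (J' r) \<inter> emb r -` X. \<xi> (emb r p) = \<zeta> p)" if X_atlas: "(X, \<xi>) \<in> atlas (J r)" for X \<xi>
  proof -
    obtain U \<psi> V \<phi> where c: "((U, \<psi>), (V, \<phi>)) \<in> adapted_charts E Q \<pi>"
      and X: "X = {j \<in> jets E Q \<pi> r. jet_target j \<in> U}" "\<xi> = jet_coord E Q r \<psi> V \<phi>"
      by (rule jet_bundle_atlasE[OF X_atlas])
    note P = adapted_pull[OF c]
    let ?Y = "{j \<in> jets E' Q' \<pi>' r. jet_target j \<in> carrier E' \<inter> f -` U}"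
    note at = jet_bundle_atlasI[OF P, of r]
    have "?Y = carrier (J' r) \<inter> emb r -` X"
      using atlas_carrier[OF at] car emb_jets unfolding X(1) by auto
    moreover have "\<xi> (emb r j) = jet_coord E' Q' r (\<lambda>e. \<psi> (f e)) (carrier Q' \<inter> g -` V) (\<lambda>y. \<phi> (g y)) j" if j: "j \<in> ?Y" for j
      unfolding X(2) by (rule emb_coord[OF c P]) (use j in auto)
    ultimately show ?thesis using at by auto
  qed
qed

end

subsection \<open>The Cartan distribution and vertical vectors under an embedding\<close>

lemma jet_proj_target:
  assumes "j \<in> jets E Q \<pi> r" shows "jet_target (jet_proj E Q \<pi> s j) = jet_target j" "jet_proj E Q \<pi> s j \<in> jets E Q \<pi> s"
proof -
  have s: "local_section E Q \<pi> (fst j) (jet_rep j)" using assms by (rule jetsE)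
  show "jet_target (jet_proj E Q \<pi> s j) = jet_target j"
    unfolding jet_proj_def jet_target_jet[OF s] by (simp add: jet_target_def)
  show "jet_proj E Q \<pi> s j \<in> jets E Q \<pi> s" unfolding jet_proj_def by (rule jetsI[OF s])
qed

lemma jet_proj_carrier:
  assumes "j \<in> carrier (jet_bundle E Q \<pi> r)" shows "jet_proj E Q \<pi> s j \<in> carrier (jet_bundle E Q \<pi> s)"
proof -
  obtain X \<xi> where X: "(X, \<xi>) \<in> atlas (jet_bundle E Q \<pi> r)" "j \<in> X" using assms by (rule carrierE)
  obtain U \<psi> V \<phi> where c: "((U, \<psi>), (V, \<phi>)) \<in> adapted_charts E Q \<pi>" and X': "X = {j \<in> jets E Q \<pi> r. jet_target j \<in> U}"
    using X(1) by (rule jet_bundle_atlasE)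
  have j: "j \<in> jets E Q \<pi> r" "jet_target j \<in> U" using X(2) X' by auto
  have "jet_proj E Q \<pi> s j \<in> {j \<in> jets E Q \<pi> s. jet_target j \<in> U}" using jet_proj_target[OF j(1)] j(2) by simp
  then show ?thesis using atlas_carrier[OF jet_bundle_atlasI[OF c, of s]] by blast
qed

context bundle_embedding
begin

lemma tangent_map_g:
  assumes x: "x \<in> carrier Q'" and v: "v \<in> tangent_space Q' x"
  shows "tangent_map Q g x v k = v (\<lambda>y. k (g y))"
proof (cases "smooth_at Q (g x) k")
  case True then show ?thesis by (simp add: tangent_map_def comp_def)
next
  case False
  have "\<not> smooth_at Q' x (\<lambda>y. k (g y))"
  proof
    assume "smooth_at Q' x (\<lambda>y. k (g y))"
    then have "smooth_at Q (g x) (\<lambda>z. k (g (g_inv z)))"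
      using smooth_at_pullback[OF inj_Q Q' g_diffeo(7), of "g x" "\<lambda>y. k (g y)"] g_inv_g[OF x] x by simp
    then have "smooth_at Q (g x) k"
      by (rule smooth_at_cong[OF inj_Q g_diffeo(2), rotated 2]) (use x in \<open>auto simp: g_inv_g\<close>)
    with False show False ..
  qed
  with False show ?thesis using tangent_spaceD(1)[OF v] by (simp add: tangent_map_def)
qed

text \<open>
  Near \<open>x\<close>, the prolongation of \<open>\<sigma>\<close> followed by \<open>emb
  r\<close> is \<open>g\<close> followed by the prolongation of the image of
  \<open>\<sigma>\<close>; the tangent maps of these composites agree.
\<close>

lemma tangent_map_emb_prolongation:
  assumes \<sigma>: "local_section E' Q' \<pi>' x \<sigma>" and j: "jet E' Q' \<pi>' r x \<sigma> \<in> carrier (J' r)" and v: "v \<in> tangent_space Q' x"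
  shows "tangent_map (J r) (emb r) (jet E' Q' \<pi>' r x \<sigma>) (tangent_map (J' r) (\<lambda>y. jet E' Q' \<pi>' r y \<sigma>) x v) =
    tangent_map (J r) (\<lambda>y. jet E Q \<pi> r y (f \<circ> \<sigma> \<circ> g_inv)) (g x) (tangent_map Q g x v)"
proof
  fix h
  let ?l = "\<lambda>y. jet E' Q' \<pi>' r y \<sigma>" and ?\<tau> = "f \<circ> \<sigma> \<circ> g_inv"
  have x: "x \<in> carrier Q'" using local_section_base[OF \<sigma>] by simp
  have e: "emb r (?l x) = jet E Q \<pi> r (g x) ?\<tau>" by (rule emb_jet(2)[OF \<sigma> order_refl])
  obtain N where N: "x \<in> N" "mopen Q' N" "\<And>y. y \<in> N \<Longrightarrow> local_section E' Q' \<pi>' y \<sigma>"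
    using \<sigma> by (elim local_sectionE) (rule that)
  have "v (\<lambda>y. h (emb r (?l y))) = v (\<lambda>y. h (jet E Q \<pi> r (g y) ?\<tau>))"
    by (rule tangent_germ[OF inj_Q' v N(2,1)]) (simp only: emb_jet(2)[OF N(3) order_refl])
  also have "\<dots> = tangent_map Q g x v (\<lambda>y. h (jet E Q \<pi> r y ?\<tau>))"
    by (rule tangent_map_g[OF x v, symmetric])
  finally have val: "v (\<lambda>y. h (emb r (?l y))) = tangent_map Q g x v (\<lambda>y. h (jet E Q \<pi> r y ?\<tau>))" .
  show "tangent_map (J r) (emb r) (?l x) (tangent_map (J' r) ?l x v) h =
      tangent_map (J r) (\<lambda>y. jet E Q \<pi> r y ?\<tau>) (g x) (tangent_map Q g x v) h"
  proof (cases "smooth_at (J r) (emb r (?l x)) h")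
    case True
    then have "smooth_at (J' r) (?l x) (\<lambda>q. h (emb r q))" using jets.smooth_at_iff[OF j] by simp
    then have "tangent_map (J' r) ?l x v (\<lambda>q. h (emb r q)) = v (\<lambda>y. h (emb r (?l y)))"
      by (simp add: tangent_map_def[of "J' r"] comp_def)
    moreover have "tangent_map (J r) (emb r) (?l x) w h = w (\<lambda>q. h (emb r q))" for w
      using True by (simp add: tangent_map_def[of "J r"] comp_def)
    moreover have "tangent_map (J r) (\<lambda>y. jet E Q \<pi> r y ?\<tau>) (g x) u h = u (\<lambda>y. h (jet E Q \<pi> r y ?\<tau>))" for u
      using True unfolding e by (simp add: tangent_map_def[of "J r"] comp_def[of h])
    ultimately show ?thesis using val by simp
  next
    case False
    moreover from False have "\<not> smooth_at (J r) (jet E Q \<pi> r (g x) ?\<tau>) h" unfolding e .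
    ultimately show ?thesis by (simp add: tangent_map_def[of "J r"])
  qed
qed

text \<open>
  By \<open>section_pull\<close> the sections that represent \<open>emb r j\<close> have the germs
  of images of sections that represent \<open>j\<close>, so both sides are spanned by the tangent
  spaces of corresponding prolongations.
\<close>

lemma cartan_push:
  assumes j: "j \<in> carrier (J' r)"
  shows "cartan E Q \<pi> r (emb r j) = tangent_map (J r) (emb r) j ` cartan E' Q' \<pi>' r j"
proof -
  define x where "x = fst j"
  define \<sigma>0 where "\<sigma>0 = jet_rep j"
  let ?T = "tangent_map (J r) (emb r) j"
  let ?X = "\<lambda>\<tau>. tangent_map (J r) (\<lambda>y. jet E Q \<pi> r y \<tau>) (g x) ` tangent_space Q (g x)"
  let ?Y = "\<lambda>\<sigma>. tangent_map (J' r) (\<lambda>y. jet E' Q' \<pi>' r y \<sigma>) x ` tangent_space Q' x"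
  have jj: "j \<in> jets E' Q' \<pi>' r" using j jet_bundle_carrier_subset by blast
  have \<sigma>0: "local_section E' Q' \<pi>' x \<sigma>0" "jet E' Q' \<pi>' r x \<sigma>0 = j"
    unfolding x_def \<sigma>0_def using jj by (auto elim: jetsE)
  have x: "x \<in> carrier Q'" and \<sigma>0x: "\<sigma>0 x \<in> carrier E'" using local_section_base[OF \<sigma>0(1)] by auto
  have e: "emb r j = jet E Q \<pi> r (g x) (f \<circ> \<sigma> \<circ> g_inv)" if "local_section E' Q' \<pi>' x \<sigma>" "jet E' Q' \<pi>' r x \<sigma> = j" for \<sigma>
    using emb_jet(2)[OF that(1) order_refl, of r] that(2) by simp
  have snd_j: "\<sigma> \<in> snd j \<longleftrightarrow> local_section E' Q' \<pi>' x \<sigma> \<and> same_jet E' Q' r x \<sigma>0 \<sigma>" for \<sigma>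
    unfolding \<sigma>0(2)[symmetric] by (simp add: jet_def)
  have snd_e: "\<tau> \<in> snd (emb r j) \<longleftrightarrow> local_section E Q \<pi> (g x) \<tau> \<and> same_jet E Q r (g x) (f \<circ> \<sigma>0 \<circ> g_inv) \<tau>" for \<tau>
    unfolding e[OF \<sigma>0] by (simp add: jet_def)
  have fst_e: "fst (emb r j) = g x" unfolding e[OF \<sigma>0] by (rule jet_source_jet)
  have claim: "?T (tangent_map (J' r) (\<lambda>y. jet E' Q' \<pi>' r y \<sigma>) x v) =
      tangent_map (J r) (\<lambda>y. jet E Q \<pi> r y (f \<circ> \<sigma> \<circ> g_inv)) (g x) (tangent_map Q g x v)"
    if \<sigma>: "\<sigma> \<in> snd j" and v: "v \<in> tangent_space Q' x" for \<sigma> v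
  proof -
    have s: "local_section E' Q' \<pi>' x \<sigma>" "jet E' Q' \<pi>' r x \<sigma> = j"
      using \<sigma> jet_eqI[of E' Q' r x \<sigma>0 \<sigma> \<pi>'] \<sigma>0(2) unfolding snd_j by auto
    show ?thesis using tangent_map_emb_prolongation[OF s(1) _ v, of r] j unfolding s(2) by simp
  qed
  have bij: "bij_betw (tangent_map Q g x) (tangent_space Q' x) (tangent_space Q (g x))"
    by (rule diffeo_on_tangent_bij[OF Q' Q g x])
  have "(\<Union>\<tau>\<in>snd (emb r j). ?X \<tau>) = ?T ` (\<Union>\<sigma>\<in>snd j. ?Y \<sigma>)"
  proof (intro equalityI subsetI)
    fix w assume "w \<in> (\<Union>\<tau>\<in>snd (emb r j). ?X \<tau>)"
    then obtain \<tau> u where \<tau>: "\<tau> \<in> snd (emb r j)" and u: "u \<in> tangent_space Q (g x)"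
      and w: "w = tangent_map (J r) (\<lambda>y. jet E Q \<pi> r y \<tau>) (g x) u" by blast
    have \<tau>s: "local_section E Q \<pi> (g x) \<tau>" and \<tau>j: "same_jet E Q r (g x) (f \<circ> \<sigma>0 \<circ> g_inv) \<tau>" using \<tau> snd_e by auto
    have "\<tau> (g x) = f (\<sigma>0 x)" using same_jetD(1)[OF \<tau>j] g_inv_g[OF x] by simp
    then have \<tau>x: "\<tau> (g x) \<in> f ` carrier E'" using \<sigma>0x by blast
    define \<sigma> where "\<sigma> = f_inv \<circ> \<tau> \<circ> g"
    have \<sigma>s: "local_section E' Q' \<pi>' x \<sigma>" unfolding \<sigma>_def by (rule section_pull(1)[OF x \<tau>s \<tau>x])
    obtain W where W: "mopen Q W" "g x \<in> W" "\<And>y. y \<in> W \<Longrightarrow> (f \<circ> \<sigma> \<circ> g_inv) y = \<tau> y"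
      using section_pull(2)[OF x \<tau>s \<tau>x] unfolding \<sigma>_def by blast
    have "same_jet E Q r (g x) (f \<circ> \<sigma>0 \<circ> g_inv) (f \<circ> \<sigma> \<circ> g_inv)"
      by (rule same_jet_trans[OF \<tau>j same_jet_sym[OF same_jet_germ[OF Q W]]])
    then have \<sigma>j: "\<sigma> \<in> snd j" unfolding snd_j using \<sigma>s same_jet_pull[OF \<sigma>0(1) \<sigma>s] by blast
    obtain v where v: "v \<in> tangent_space Q' x" "u = tangent_map Q g x v" using u bij_betw_imp_surj_on[OF bij] by blast
    have "w = tangent_map (J r) (\<lambda>y. jet E Q \<pi> r y (f \<circ> \<sigma> \<circ> g_inv)) (g x) u"
      unfolding w
    proof (rule tangent_map_cong[OF inj_Q u W(1,2)])
      fix y assume y: "y \<in> W"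
      show "jet E Q \<pi> r y \<tau> = jet E Q \<pi> r y (f \<circ> \<sigma> \<circ> g_inv)"
        by (rule jet_eqI[OF same_jet_germ[OF Q W(1) y]]) (simp only: W(3))
    qed
    also have "\<dots> = ?T (tangent_map (J' r) (\<lambda>y. jet E' Q' \<pi>' r y \<sigma>) x v)" unfolding v(2) by (rule claim[OF \<sigma>j v(1), symmetric])
    finally show "w \<in> ?T ` (\<Union>\<sigma>\<in>snd j. ?Y \<sigma>)" using \<sigma>j v(1) by blast
  next
    fix w assume "w \<in> ?T ` (\<Union>\<sigma>\<in>snd j. ?Y \<sigma>)"
    then obtain \<sigma> v where \<sigma>: "\<sigma> \<in> snd j" and v: "v \<in> tangent_space Q' x"
      and w: "w = ?T (tangent_map (J' r) (\<lambda>y. jet E' Q' \<pi>' r y \<sigma>) x v)" by blast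
    have s: "local_section E' Q' \<pi>' x \<sigma>" "same_jet E' Q' r x \<sigma>0 \<sigma>" using \<sigma> snd_j by auto
    have "f \<circ> \<sigma> \<circ> g_inv \<in> snd (emb r j)"
      unfolding snd_e using section_push[OF s(1)] same_jet_push[of x \<sigma>0 r \<sigma>, OF x \<sigma>0x s(2)] by blast
    moreover have "tangent_map Q g x v \<in> tangent_space Q (g x)" using v bij_betw_imp_surj_on[OF bij] by blast
    ultimately show "w \<in> (\<Union>\<tau>\<in>snd (emb r j). ?X \<tau>)" unfolding w claim[OF \<sigma> v] by blast
  qed
  then show ?thesis
    unfolding cartan_def fst_e x_def[symmetric] by (simp only: linear_span_image[OF tangent_map_linear])
qed

lemma jet_proj_emb:
  assumes j: "j \<in> jets E' Q' \<pi>' r" and s: "s \<le> r"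
  shows "jet_proj E Q \<pi> s (emb r j) = emb s (jet_proj E' Q' \<pi>' s j)"
proof -
  define x \<sigma> where "x = fst j" and "\<sigma> = jet_rep j"
  have \<sigma>: "local_section E' Q' \<pi>' x \<sigma>" "jet E' Q' \<pi>' r x \<sigma> = j" unfolding x_def \<sigma>_def using j by (auto elim: jetsE)
  have e: "emb r j = jet E Q \<pi> r (g x) (f \<circ> \<sigma> \<circ> g_inv)" using emb_jet(2)[OF \<sigma>(1) order_refl, of r] \<sigma>(2) by simp
  have "jet_proj E Q \<pi> s (emb r j) = jet E Q \<pi> s (g x) (jet_rep (jet E Q \<pi> r (g x) (f \<circ> \<sigma> \<circ> g_inv)))"
    unfolding e jet_proj_def jet_source_jet ..
  also have "\<dots> = jet E Q \<pi> s (g x) (f \<circ> \<sigma> \<circ> g_inv)"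
    by (rule jet_eqI[OF same_jet_lower[OF same_jet_sym[OF jet_rep_jet(2)[OF section_push[OF \<sigma>(1)]]] s]])
  also have "\<dots> = emb s (jet E' Q' \<pi>' s x \<sigma>)" by (rule emb_jet(2)[OF \<sigma>(1) order_refl, symmetric])
  finally show ?thesis by (simp add: jet_proj_def x_def \<sigma>_def)
qed

text \<open>
  The maps of jets of orders \<open>r\<close> and \<open>r - 1\<close> commute with the
  projections, and that of order \<open>r - 1\<close> is injective on tangent vectors.
\<close>

lemma vertical_push:
  assumes W: "mopen (J' r) W" "j \<in> W"
  shows "jet_vertical E Q \<pi> r (emb r j) = tangent_map (J r) (emb r) j ` jet_vertical E' Q' \<pi>' r j"
proof -
  have j: "j \<in> carrier (J' r)" using W mopen_subset by blast
  note jj = subsetD[OF jet_bundle_carrier_subset j]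
  define s where "s = r - 1"
  then have sr: "s \<le> r" by simp
  let ?T = "tangent_map (J r) (emb r) j"
  let ?p' = "jet_proj E' Q' \<pi>' s" and ?p = "jet_proj E Q \<pi> s"
  have pj: "?p' j \<in> carrier (J' s)" by (rule jet_proj_carrier[OF j])
  have com: "?p (emb r q) = emb s (?p' q)" if "q \<in> W" for q
    by (rule jet_proj_emb[OF _ sr]) (use that W(1) mopen_subset jet_bundle_carrier_subset in blast)
  have iff: "tangent_map (J s) ?p (emb r j) (?T w) = 0 \<longleftrightarrow> tangent_map (J' s) ?p' j w = 0"
    if w: "w \<in> tangent_space (J' r) j" for w
  proof -
    have val: "?T w (\<lambda>q. h (?p q)) = w (\<lambda>q. h (emb s (?p' q)))" for h
    proof -
      have "?T w (\<lambda>q. h (?p q)) = w (\<lambda>q. h (?p (emb r q)))" by (rule jets.tangent_map_apply[OF j w])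
      also have "\<dots> = w (\<lambda>q. h (emb s (?p' q)))" by (rule tangent_germ[OF J'_inj w W]) (simp only: com)
      finally show ?thesis .
    qed
    show ?thesis
    proof
      assume z: "tangent_map (J s) ?p (emb r j) (?T w) = 0"
      show "tangent_map (J' s) ?p' j w = 0"
      proof
        fix k
        show "tangent_map (J' s) ?p' j w k = 0 k"
        proof (cases "smooth_at (J' s) (?p' j) k")
          case True
          \<comment> \<open>\<open>k\<close> as a function on the image\<close>
          define h where "h b = k (inv_into (carrier (J' s)) (emb s) b)" for b
          have hk: "h (emb s q) = k q" if "q \<in> carrier (J' s)" for q using that jets.inj by (simp add: h_def)
          obtain X where X: "?p' j \<in> X" "smooth_fun (J' s) X k" using True by (auto simp: smooth_at_def)
          have sm: "smooth_at (J s) (emb s (?p' j)) h"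
            by (rule smooth_fun_smooth_at[OF jets.smooth_fun_push[OF X(2)]])
              (use X hk mopen_subset[OF smooth_fun_mopen[OF X(2)]] in auto)
          have "w (\<lambda>q. k (?p' q)) = w (\<lambda>q. h (emb s (?p' q)))"
          proof (rule tangent_germ[OF J'_inj w W])
            fix q assume "q \<in> W"
            then have "?p' q \<in> carrier (J' s)" using W(1) mopen_subset by (blast intro: jet_proj_carrier)
            then show "k (?p' q) = h (emb s (?p' q))" by (simp only: hk)
          qed
          also have "\<dots> = tangent_map (J s) ?p (emb r j) (?T w) h"
            unfolding val[symmetric] using sm com[OF W(2)] by (simp add: tangent_map_def[of "J s" ?p] comp_def)
          also have "\<dots> = 0" unfolding z by (simp add: zero_fun_def)
          finally show ?thesis by (simp add: tangent_map_def[of "J' s"] comp_def zero_fun_def)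
        qed (simp add: tangent_map_def[of "J' s"] zero_fun_def)
      qed
    next
      assume z: "tangent_map (J' s) ?p' j w = 0"
      show "tangent_map (J s) ?p (emb r j) (?T w) = 0"
      proof
        fix h
        show "tangent_map (J s) ?p (emb r j) (?T w) h = 0 h"
        proof (cases "smooth_at (J s) (?p (emb r j)) h")
          case True
          then have "smooth_at (J' s) (?p' j) (\<lambda>q. h (emb s q))"
            unfolding com[OF W(2)] using jets.smooth_at_iff[OF pj] by simp
          then have "w (\<lambda>q. h (emb s (?p' q))) = tangent_map (J' s) ?p' j w (\<lambda>q. h (emb s q))"
            by (simp add: tangent_map_def[of "J' s"] comp_def)
          also have "\<dots> = 0" unfolding z by (simp add: zero_fun_def)
          finally show ?thesis using val[of h] True by (simp add: tangent_map_def[of "J s" ?p] comp_def zero_fun_def)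
        qed (simp add: tangent_map_def[of "J s" ?p] zero_fun_def)
      qed
    qed
  qed
  show ?thesis
    unfolding jet_vertical_def ker_tangent_map_def s_def[symmetric]
  proof (intro equalityI subsetI)
    fix u assume u: "u \<in> {v \<in> tangent_space (J r) (emb r j). tangent_map (J s) ?p (emb r j) v = 0}"
    then have u': "u \<in> tangent_space (J r) (emb r j)" by simp
    obtain w where w: "w \<in> tangent_space (J' r) j" "?T w = u" by (rule jets.tangent_map_onto[OF j u'])
    then show "u \<in> ?T ` {v \<in> tangent_space (J' r) j. tangent_map (J' s) ?p' j v = 0}"
      using u iff[OF w(1)] by blast
  next
    fix u assume "u \<in> ?T ` {v \<in> tangent_space (J' r) j. tangent_map (J' s) ?p' j v = 0}"
    then obtain w where w: "w \<in> tangent_space (J' r) j" "tangent_map (J' s) ?p' j w = 0" "u = ?T w" by blast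
    then show "u \<in> {v \<in> tangent_space (J r) (emb r j). tangent_map (J s) ?p (emb r j) v = 0}"
      using iff[OF w(1)] jets.tangent_map_in[OF j w(1)] by simp
  qed
qed

end

section \<open>The target of a diffeomorphism\<close>

lemma topspace_mopen: "inj_atlas A \<Longrightarrow> mopen A (carrier A) \<Longrightarrow> topspace (topology (mopen A)) = carrier A"
  unfolding topspace_def openin_mopen using mopen_subset by blast

text \<open>
  The coordinate functions of a chart of \<open>J\<close> are smooth on \<open>M\<close>, and
  pulled back along the inverse of \<open>\<Phi>\<close> they are smooth in every other chart of
  \<open>J\<close>. The separation and countability properties are those of \<open>M\<close>, to
  which \<open>J\<close> is homeomorphic.
\<close>

lemma diffeo_smooth_manifold:
  assumes M: "smooth_manifold M" and J: "inj_atlas J" and \<Phi>: "diffeo M J \<Phi>"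
  shows "smooth_manifold J"
proof -
  note A = smooth_manifold_inj_atlas[OF M]
  have d: "diffeo_on M (carrier M) J (carrier J) \<Phi>" using \<Phi> by (simp add: diffeo_def)
  note D = diffeo_onD[OF d]
  define G where "G = inv_into (carrier M) \<Phi>"
  have G: "smooth_map J (carrier J) M G" using D(7) by (simp add: G_def)
  have \<Phi>G: "\<Phi> (G y) = y" "G y \<in> carrier M" if "y \<in> carrier J" for y
    using that D(5) by (auto simp: G_def intro: f_inv_into_f inv_into_into)
  have op: "coord_open (index J) (\<phi> ` U)" if c: "(U, \<phi>) \<in> atlas J" for U \<phi>
    using mopenD[OF D(2) c] atlas_carrier[OF c] by (simp add: Int_absorb2)
  have sp: "\<phi> ` U \<subseteq> coord_space (index J)" if c: "(U, \<phi>) \<in> atlas J" for U \<phi>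
    by (rule coord_open_subset[OF op[OF c]])
  have sm: "smooth_fun J V (\<lambda>y. \<psi> y i)" if c: "(V, \<psi>) \<in> atlas J" and i: "i \<in> index J" for V \<psi> i
  proof -
    have "smooth_fun J (carrier J \<inter> G -` (carrier M \<inter> \<Phi> -` V)) (\<lambda>y. \<psi> (\<Phi> (G y)) i)"
      by (rule smooth_fun_pullback[OF J M G smooth_map_coordinate[OF D(6) c i]])
    moreover have "carrier J \<inter> G -` (carrier M \<inter> \<Phi> -` V) = V" using atlas_carrier[OF c] \<Phi>G by auto
    ultimately have "smooth_fun J V (\<lambda>y. \<psi> (\<Phi> (G y)) i)" by simp
    then show ?thesis by (rule smooth_fun_cong[OF J]) (use atlas_carrier[OF c] \<Phi>G in auto)
  qed
  have ov: "coord_open (index J) (\<phi> ` (U \<inter> V))" if c: "(U, \<phi>) \<in> atlas J" and e: "(V, \<psi>) \<in> atlas J" for U \<phi> V \<psi>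
  \<comment> \<open>In dimension zero there is no coordinate function to take the domain from, but every subset of the coordinate space is open.\<close>
  proof (cases "index J = {}")
    case True
    have fin: "finite (index J)" by (rule inj_atlas_finite[OF J])
    have "\<phi> ` (U \<inter> V) \<subseteq> coord_space (index J)" using sp[OF c] by blast
    moreover have "y = x" if "x \<in> \<phi> ` (U \<inter> V)" "y \<in> cube (index J) x 1" for x y
      using that calculation True by (intro coord_space_eqI[of y "index J" x]) (auto simp: cube_def)
    then have "\<forall>x\<in>\<phi> ` (U \<inter> V). \<exists>e>0. cube (index J) x e \<subseteq> \<phi> ` (U \<inter> V)" by (intro ballI exI[of _ 1]) auto
    ultimately show ?thesis using coord_open_iff[OF fin] by blast
  next
    case False
    then obtain i where "i \<in> index J" by blast
    from mopenD[OF smooth_fun_mopen[OF sm[OF e this]] c] show ?thesis .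
  qed
  have comp: "compatible (index J) (U, \<phi>) (V, \<psi>)" if c: "(U, \<phi>) \<in> atlas J" and e: "(V, \<psi>) \<in> atlas J" for U \<phi> V \<psi>
    using smooth_funD[OF sm[OF e] c] smooth_funD[OF sm[OF c] e] ov[OF c e] ov[OF e c]
    unfolding compatible_def by (simp add: Int_commute)
  have homeo: "topology (mopen M) homeomorphic_space topology (mopen J)"
    unfolding homeomorphic_space_def homeomorphic_maps_def continuous_map_def
      topspace_mopen[OF A D(1)] topspace_mopen[OF J D(2)] openin_mopen[OF A] openin_mopen[OF J]
  proof (intro exI[of _ \<Phi>] exI[of _ G] conjI allI impI ballI)
    have eq: "{x \<in> S. F x \<in> X} = S \<inter> F -` X" for S X and F :: "'x \<Rightarrow> 'y" by auto
    show "mopen M {x \<in> carrier M. \<Phi> x \<in> X}" if "mopen J X" for X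
      using smooth_map_vimage[OF D(6) that] by (simp add: Int_def)
    show "mopen J {x \<in> carrier J. G x \<in> X}" if "mopen M X" for X
      using smooth_map_vimage[OF G that] by (simp add: Int_def)
    show "G (\<Phi> x) = x" if "x \<in> carrier M" for x using D(4) that by (simp add: G_def)
  qed (use \<Phi>G D(5) in auto)
  have "coord_patch (index J) c" if "c \<in> atlas J" for c
    using inj_atlas_inj[OF J, of "fst c" "snd c"] op[of "fst c" "snd c"] that by (simp add: coord_patch_def case_prod_unfold)
  moreover have "compatible (index J) c e" if "c \<in> atlas J" "e \<in> atlas J" for c e
    using comp[of "fst c" "snd c" "fst e" "snd e"] that by simp
  ultimately show ?thesis
    unfolding smooth_manifold_def
    using M homeomorphic_Hausdorff_space[OF homeo] homeomorphic_space_second_countability[OF homeo] inj_atlas_finite[OF J]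
    by (simp add: smooth_manifold_def)
qed

lemma diffeo_polarised_k_contactomorphism:
  assumes pol: "polarised_k_contact k M D P" and J: "inj_atlas J" and \<Phi>: "diffeo M J \<Phi>"
    and D: "\<And>p. p \<in> carrier M \<Longrightarrow> D p \<subseteq> tangent_space M p" "\<And>p. p \<in> carrier M \<Longrightarrow> tangent_map J \<Phi> p ` D p = D' (\<Phi> p)"
    and P: "\<And>p. p \<in> carrier M \<Longrightarrow> P p \<subseteq> tangent_space M p" "\<And>p. p \<in> carrier M \<Longrightarrow> tangent_map J \<Phi> p ` P p = P' (\<Phi> p)"
  shows "polarised_k_contactomorphism k M D P J D' P' \<Phi>"
proof -
  have M: "smooth_manifold M" using pol by (simp add: polarised_k_contact_def k_contact_manifold_def)
  have Jm: "smooth_manifold J" by (rule diffeo_smooth_manifold[OF M J \<Phi>])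
  have d: "diffeo_on M (carrier M) J (carrier J) \<Phi>" using \<Phi> by (simp add: diffeo_def)
  note dD = diffeo_onD[OF d]
  define G where "G = inv_into (carrier M) \<Phi>"
  interpret diffeomorphism M J \<Phi> G
  proof (rule diffeomorphism.intro[OF M Jm dD(6)])
    show "smooth_map J (carrier J) M G" using dD(7) by (simp add: G_def)
    show "G (\<Phi> p) = p" if "p \<in> carrier M" for p using that dD(4) by (simp add: G_def)
    show "\<Phi> (G q) = q" if "q \<in> carrier J" for q using that dD(5) by (auto simp: G_def intro: f_inv_into_f)
  qed
  interpret inv: diffeomorphism J M G \<Phi> by (rule inverse)
  have "carrier M \<noteq> {}" using pol polarisation_carrier_nonempty by (auto simp: polarised_k_contact_def)
  then obtain p0 where p0: "p0 \<in> carrier M" by blast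
  have card: "card (index M) = card (index J)" by (rule diffeo_on_card_index[OF M Jm d p0])
  have rD: "related D D'" and rP: "related P P'" unfolding related_def using D P by auto
  have "polarised_k_contact k J D' P'" by (rule polarised_k_contact_push[OF card rD rP pol])
  moreover have "tangent_map M G y ` D' y \<subseteq> D (G y)" "tangent_map M G y ` P' y \<subseteq> P (G y)" if "y \<in> carrier J" for y
    using inv.relatedD(2)[OF related_inverse[OF rD] that] inv.relatedD(2)[OF related_inverse[OF rP] that] by auto
  ultimately show ?thesis
    unfolding polarised_k_contactomorphism_def Let_def G_def[symmetric] using pol \<Phi> D(2) P(2) by auto
qed

section \<open>Gluing local identifications\<close>

lemma local_identificationD:
  assumes "local_identification r M D P V E Q \<pi> c"
  shows "fibred_manifold (tot c) (base c) (proj c)"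
    and "diffeo_on M (dom c) (jet_bundle (tot c) (base c) (proj c) r) (ran c) (ident c)"
    and "p \<in> dom c \<Longrightarrow> tangent_map (jet_bundle (tot c) (base c) (proj c) r) (ident c) p ` D p =
      cartan (tot c) (base c) (proj c) r (ident c p)"
    and "p \<in> dom c \<Longrightarrow> tangent_map (jet_bundle (tot c) (base c) (proj c) r) (ident c) p ` P p =
      jet_vertical (tot c) (base c) (proj c) r (ident c p)"
    and "diffeo_on (tot c) (carrier (tot c)) E (tot_emb c ` carrier (tot c)) (tot_emb c)"
    and "diffeo_on (base c) (carrier (base c)) Q (base_emb c ` carrier (base c)) (base_emb c)"
    and "e \<in> carrier (tot c) \<Longrightarrow> \<pi> (tot_emb c e) = base_emb c (proj c e)"
    and "p \<in> dom c \<Longrightarrow> tot_emb c (jet_target (ident c p)) = leaf M (\<lambda>p. derived M D (r - 1) p \<inter> V p) p"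
    and "p \<in> dom c \<Longrightarrow> base_emb c (jet_source (ident c p)) = leaf M V p"
  using assms by (simp_all add: local_identification_def Let_def)

text \<open>
  The point \<open>p\<close> provides points of the total space and of the base, at which the
  tangent spaces can be compared with those of \<open>E\<close> and \<open>Q\<close>. As the index
  sets are initial segments of the natural numbers, equality of the dimensions makes them equal.
\<close>

lemma identification_bundle_embedding:
  assumes E: "smooth_manifold E" "index E = {..<nE}" and Q: "smooth_manifold Q" "index Q = {..<nQ}"
    and c: "local_identification r M D P V E Q \<pi> c" and p: "p \<in> dom c"
  shows "bundle_embedding (tot c) (base c) (proj c) (tot_emb c) (base_emb c) E Q \<pi>"
proof -
  note c = local_identificationD[OF c]
  have fm: "smooth_manifold (tot c)" "smooth_manifold (base c)" using c(1) by (auto simp: fibred_manifold_def)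
  obtain q m where ix: "index (base c) = {..<q}" "index (tot c) = {..<q + m}" using c(1) by (auto simp: fibred_manifold_def)
  have sub: "smooth_map (tot c) (carrier (tot c)) (base c) (proj c)" using c(1) by (simp add: fibred_manifold_def submersion_def)
  have "ident c p \<in> carrier (jet_bundle (tot c) (base c) (proj c) r)" by (rule smooth_map_image[OF diffeo_onD(6)[OF c(2)] p])
  then have j: "ident c p \<in> jets (tot c) (base c) (proj c) r" using jet_bundle_carrier_subset by blast
  then obtain x \<sigma> where \<sigma>: "local_section (tot c) (base c) (proj c) x \<sigma>" by (auto simp: jets_def)
  have pts: "x \<in> carrier (base c)" "\<sigma> x \<in> carrier (tot c)" using local_section_base[OF \<sigma>] by auto
  have "card (index (base c)) = card (index Q)" by (rule diffeo_on_card_index[OF fm(2) Q(1) c(6) pts(1)])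
  then have i1: "index (base c) = index Q" using ix(1) Q(2) by simp
  have "card (index (tot c)) = card (index E)" by (rule diffeo_on_card_index[OF fm(1) E(1) c(5) pts(2)])
  then have i2: "index (tot c) = index E" using ix(2) E(2) by simp
  show ?thesis
  proof (rule bundle_embedding.intro[OF fm E(1) Q(1) i2 i1 _ c(5,6)])
    show "index Q \<subseteq> index E" unfolding i1[symmetric] i2[symmetric] ix by auto
    show "\<pi> (tot_emb c e) = base_emb c (proj c e)" if "e \<in> carrier (tot c)" for e by (rule c(7)[OF that])
    show "proj c e \<in> carrier (base c)" if "e \<in> carrier (tot c)" for e by (rule smooth_map_image[OF sub that])
  qed
qed

context
  fixes r :: nat and M :: "('m, 'i) mfd" and D P V :: "'m dist" and E Q :: "('m set, nat) mfd" and \<pi> :: "'m set \<Rightarrow> 'm set"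
    and nE nQ :: nat
  assumes M: "smooth_manifold M" and E: "smooth_manifold E" "index E = {..<nE}" and Q: "smooth_manifold Q" "index Q = {..<nQ}"
    and sub_E: "submersion M E (leaf M (\<lambda>p. derived M D (r - 1) p \<inter> V p))" and sub_Q: "submersion M Q (leaf M V)"
    and \<pi>: "\<And>p. p \<in> carrier M \<Longrightarrow> \<pi> (leaf M (\<lambda>p. derived M D (r - 1) p \<inter> V p) p) = leaf M V p"
begin

abbreviation (input) class_E :: "'m \<Rightarrow> 'm set" where "class_E \<equiv> leaf M (\<lambda>p. derived M D (r - 1) p \<inter> V p)"
abbreviation (input) class_Q :: "'m \<Rightarrow> 'm set" where "class_Q \<equiv> leaf M V"

lemma identification_jet:
  assumes c: "local_identification r M D P V E Q \<pi> c" and p: "p \<in> dom c"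
  shows "jet_emb r E Q \<pi> c (ident c p) \<in> jets E Q \<pi> r"
    and "jet_source (jet_emb r E Q \<pi> c (ident c p)) = class_Q p"
    and "jet_target (jet_emb r E Q \<pi> c (ident c p)) = class_E p"
proof -
  note c' = local_identificationD[OF c]
  interpret be: bundle_embedding "tot c" "base c" "proj c" "tot_emb c" "base_emb c" E Q \<pi>
    by (rule identification_bundle_embedding[OF E Q c p])
  have "ident c p \<in> jets (tot c) (base c) (proj c) r"
    using smooth_map_image[OF diffeo_onD(6)[OF c'(2)] p] jet_bundle_carrier_subset by blast
  from be.emb_jets[OF this] show "jet_emb r E Q \<pi> c (ident c p) \<in> jets E Q \<pi> r"
    "jet_source (jet_emb r E Q \<pi> c (ident c p)) = class_Q p" "jet_target (jet_emb r E Q \<pi> c (ident c p)) = class_E p"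
    unfolding jet_emb_def using c'(8,9)[OF p] by auto
qed

text \<open>
  The two identifications send a point \<open>q\<close> near \<open>p\<close> to jets over the
  same classes of \<open>q\<close> in \<open>E\<close> and \<open>Q\<close>. Hence the bundle
  automorphism whose prolongation relates these jets fixes the classes of all such
  \<open>q\<close>. As the quotient maps are open, these classes fill neighbourhoods of the
  classes of \<open>p\<close>, where the automorphism is therefore the identity, and so its
  prolongation fixes the jet of \<open>p\<close>.
\<close>

lemma identifications_agree:
  assumes c: "local_identification r M D P V E Q \<pi> c" and d: "local_identification r M D P V E Q \<pi> d"
    and trans: "transition_by_prolongation r E Q \<pi> c d" and p: "p \<in> dom c" "p \<in> dom d"
  shows "jet_emb r E Q \<pi> c (ident c p) = jet_emb r E Q \<pi> d (ident d p)"
proof -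
  note c' = local_identificationD[OF c]
  note dc = diffeo_onD[OF c'(2)]
  note B = smooth_manifold_inj_atlas[OF Q(1)]
  have m: "ident c p \<in> ident c ` (dom c \<inter> dom d)" using p by blast
  from bspec[OF trans[unfolded transition_by_prolongation_def] m]
  obtain N E' f Q' g where big: "ident c p \<in> N \<and> N \<subseteq> ident c ` (dom c \<inter> dom d) \<and>
      mopen (jet_bundle (tot c) (base c) (proj c) r) N \<and>
      local_bundle_automorphism E Q \<pi> E' f Q' g \<and>
      (\<forall>j\<in>N. jet_target (jet_emb r E Q \<pi> c j) \<in> E' \<and>
        jet_emb r E Q \<pi> d (ident d (inv_into (dom c) (ident c) j)) = prolong E Q \<pi> r f Q' g (jet_emb r E Q \<pi> c j))"
    by (elim exE) (rule that)
  have N: "ident c p \<in> N" "N \<subseteq> ident c ` (dom c \<inter> dom d)"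
      "mopen (jet_bundle (tot c) (base c) (proj c) r) N"
    and aut: "local_bundle_automorphism E Q \<pi> E' f Q' g" using big by simp_all
  have tr: "jet_target (jet_emb r E Q \<pi> c j) \<in> E'"
      "jet_emb r E Q \<pi> d (ident d (inv_into (dom c) (ident c) j)) = prolong E Q \<pi> r f Q' g (jet_emb r E Q \<pi> c j)"
    if "j \<in> N" for j using big that by simp_all
  have g_inj: "inj_on g Q'" and \<pi>E': "\<pi> ` E' = Q'"
    using aut by (auto simp: local_bundle_automorphism_def diffeo_on_def bij_betw_def)
  define W where "W = dom c \<inter> ident c -` N"
  have W: "mopen M W" unfolding W_def by (rule smooth_map_vimage[OF dc(6) N(3)])
  have pW: "p \<in> W" using p N(1) by (simp add: W_def)
  have near: "q \<in> dom c \<and> q \<in> dom d \<and> class_E q \<in> E' \<and> class_Q q \<in> Q' \<and>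
      jet_emb r E Q \<pi> d (ident d q) = prolong E Q \<pi> r f Q' g (jet_emb r E Q \<pi> c (ident c q))" if q: "q \<in> W" for q
  proof -
    have qc: "q \<in> dom c" "ident c q \<in> N" using q by (auto simp: W_def)
    obtain q' where q': "q' \<in> dom c" "q' \<in> dom d" "ident c q = ident c q'" using N(2) qc(2) by blast
    have "q = q'" using inj_onD[OF dc(4) q'(3)] qc(1) q'(1) by blast
    then have qd: "q \<in> dom d" using q'(2) by simp
    have "inv_into (dom c) (ident c) (ident c q) = q" by (rule inv_into_f_f[OF dc(4) qc(1)])
    moreover have "class_E q \<in> E'" using tr(1)[OF qc(2)] identification_jet(3)[OF c qc(1)] by simp
    moreover have "class_Q q \<in> Q'"
      unfolding \<pi>[OF subsetD[OF mopen_subset[OF W] q], symmetric] \<pi>E'[symmetric]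
      by (rule imageI) (rule calculation(2))
    ultimately show ?thesis using qc qd tr(2)[OF qc(2)] by simp
  qed
  have fix_Q: "g (class_Q q) = class_Q q" and fix_E: "f (class_E q) = class_E q" if q: "q \<in> W" for q
  proof -
    note nq = near[OF q]
    have qc: "q \<in> dom c" and qd: "q \<in> dom d" using nq by blast+
    define k where "k = jet_emb r E Q \<pi> c (ident c q)"
    define l where "l = jet_emb r E Q \<pi> d (ident d q)"
    have k: "k \<in> jets E Q \<pi> r" "jet_source k = class_Q q" "jet_target k = class_E q"
      unfolding k_def by (rule identification_jet[OF c qc])+
    have l: "l \<in> jets E Q \<pi> r" "jet_source l = class_Q q" "jet_target l = class_E q"
      unfolding l_def by (rule identification_jet[OF d qd])+
    have ls: "local_section E Q \<pi> (fst l) (jet_rep l)" "jet E Q \<pi> r (fst l) (jet_rep l) = l"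
      using l(1) by (auto elim: jetsE)
    have "jet E Q \<pi> r (g (fst k)) (f \<circ> jet_rep k \<circ> inv_into Q' g) = jet E Q \<pi> r (fst l) (jet_rep l)"
      unfolding ls(2) using nq by (simp add: prolong_def k_def l_def)
    from jet_eqD[OF this ls(1)] have eq: "g (fst k) = fst l"
      "same_jet E Q r (g (fst k)) (f \<circ> jet_rep k \<circ> inv_into Q' g) (jet_rep l)" by auto
    then show "g (class_Q q) = class_Q q" using k(2) l(2) by (simp add: jet_source_def)
    have "inv_into Q' g (g (fst k)) = fst k" by (rule inv_into_f_f[OF g_inj]) (use nq k(2) in \<open>simp add: jet_source_def\<close>)
    then have "f (jet_rep k (fst k)) = jet_rep l (fst l)" using same_jetD(1)[OF eq(2)] eq(1) by simp
    then show "f (class_E q) = class_E q" using k(3) l(3) by (simp add: jet_target_def)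
  qed
  define OE where "OE = class_E ` W"
  define OQ where "OQ = class_Q ` W"
  have OE: "mopen E OE" unfolding OE_def by (rule submersion_image_mopen[OF M E(1) sub_E W])
  have OQ: "mopen Q OQ" unfolding OQ_def by (rule submersion_image_mopen[OF M Q(1) sub_Q W])
  define k where "k = jet_emb r E Q \<pi> c (ident c p)"
  have k: "k \<in> jets E Q \<pi> r" "jet_source k = class_Q p" "jet_target k = class_E p"
    unfolding k_def by (rule identification_jet[OF c p(1)])+
  define y \<sigma> where "y = fst k" and "\<sigma> = jet_rep k"
  have \<sigma>: "local_section E Q \<pi> y \<sigma>" "jet E Q \<pi> r y \<sigma> = k" unfolding y_def \<sigma>_def using k(1) by (auto elim: jetsE)
  have y: "y = class_Q p" "\<sigma> y = class_E p" using k(2,3) by (simp_all add: y_def \<sigma>_def jet_source_def jet_target_def)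
  obtain N' where N': "y \<in> N'" "mopen Q N'" "smooth_map Q N' E \<sigma>" using \<sigma>(1) by (elim local_sectionE) (rule that)
  \<comment> \<open>where \<open>g\<close> is the identity, and \<open>f\<close> is the identity on the values of \<open>\<sigma>\<close>\<close>
  define X where "X = (N' \<inter> \<sigma> -` OE) \<inter> OQ"
  have X: "mopen Q X" unfolding X_def by (rule mopen_Int[OF B smooth_map_vimage[OF N'(3) OE] OQ])
  have yX: "y \<in> X" using N'(1) y pW by (auto simp: X_def OE_def OQ_def)
  have germ: "(f \<circ> \<sigma> \<circ> inv_into Q' g) z = \<sigma> z" if z: "z \<in> X" for z
  proof -
    obtain q where q: "q \<in> W" "z = class_Q q" using z by (auto simp: X_def OQ_def)
    have "inv_into Q' g z = z"
      using inv_into_f_f[OF g_inj, of z] fix_Q[OF q(1)] near[OF q(1)] q(2) by simp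
    moreover obtain q' where "q' \<in> W" "\<sigma> z = class_E q'" using z by (auto simp: X_def OE_def)
    ultimately show ?thesis using fix_E by simp
  qed
  have gy: "g y = y" using fix_Q[OF pW] y(1) by simp
  have "jet_emb r E Q \<pi> d (ident d p) = jet E Q \<pi> r (g y) (f \<circ> \<sigma> \<circ> inv_into Q' g)"
    using near[OF pW] by (simp add: prolong_def k_def y_def \<sigma>_def)
  also have "\<dots> = jet E Q \<pi> r y \<sigma>" unfolding gy by (rule jet_eqI[OF same_jet_germ[OF Q(1) X yX germ]])
  also have "\<dots> = k" by (rule \<sigma>(2))
  finally show ?thesis by (simp add: k_def)
qed

text \<open>
  On \<open>dom c\<close> the map \<open>\<Phi>\<close> is the identification followed by the map
  of jets induced by an embedding of bundles, and both of these respect the distributions.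
\<close>

lemma glued_map_local:
  assumes c: "local_identification r M D P V E Q \<pi> c" and \<Phi>: "\<And>q. q \<in> dom c \<Longrightarrow> \<Phi> q = jet_emb r E Q \<pi> c (ident c q)"
    and p: "p \<in> dom c"
  shows "diffeo_on M (dom c) (jet_bundle E Q \<pi> r) (\<Phi> ` dom c) \<Phi>"
    and "D p \<subseteq> tangent_space M p \<Longrightarrow> tangent_map (jet_bundle E Q \<pi> r) \<Phi> p ` D p = cartan E Q \<pi> r (\<Phi> p)"
    and "P p \<subseteq> tangent_space M p \<Longrightarrow> tangent_map (jet_bundle E Q \<pi> r) \<Phi> p ` P p = jet_vertical E Q \<pi> r (\<Phi> p)"
    and "inj_atlas (jet_bundle E Q \<pi> r)"
proof -
  note c' = local_identificationD[OF c]
  note A = smooth_manifold_inj_atlas[OF M]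
  interpret be: bundle_embedding "tot c" "base c" "proj c" "tot_emb c" "base_emb c" E Q \<pi>
    by (rule identification_bundle_embedding[OF E Q c p])
  have \<Phi>': "\<Phi> q = be.emb r (ident c q)" if "q \<in> dom c" for q using \<Phi>[OF that] by (simp add: jet_emb_def)
  note dc = diffeo_onD[OF c'(2)]
  have "diffeo_on M (dom c) (be.J r) (be.emb r ` ran c) \<Phi>"
    by (rule diffeo_on_cong[OF A be.J_inj be.jets.diffeo_on_compose[OF A c'(2)]]) (simp only: \<Phi>')
  then show "diffeo_on M (dom c) (be.J r) (\<Phi> ` dom c) \<Phi>" using diffeo_onD(5) by metis
  have jp: "ident c p \<in> carrier (be.J' r)" by (rule smooth_map_image[OF dc(6) p])
  have tm: "tangent_map (be.J r) \<Phi> p ` S = tangent_map (be.J r) (be.emb r) (ident c p) ` tangent_map (be.J' r) (ident c) p ` S"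
    if S: "S \<subseteq> tangent_space M p" for S
  proof -
    have "tangent_map (be.J r) \<Phi> p v = tangent_map (be.J r) (be.emb r) (ident c p) (tangent_map (be.J' r) (ident c) p v)"
      if "v \<in> S" for v
    proof -
      have "tangent_map (be.J r) \<Phi> p v = tangent_map (be.J r) (\<lambda>q. be.emb r (ident c q)) p v"
        by (rule tangent_map_cong[OF A _ dc(1) p]) (use S that \<Phi>' in auto)
      also have "\<dots> = tangent_map (be.J r) (be.emb r) (ident c p) (tangent_map (be.J' r) (ident c) p v)"
        by (rule be.jets.tangent_map_comp[where F = "ident c", OF jp])
      finally show ?thesis .
    qed
    then show ?thesis by (simp add: image_image)
  qed
  show "tangent_map (be.J r) \<Phi> p ` D p = cartan E Q \<pi> r (\<Phi> p)" if "D p \<subseteq> tangent_space M p"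
    unfolding tm[OF that] c'(3)[OF p] \<Phi>'[OF p] by (rule be.cartan_push[OF jp, symmetric])
  show "tangent_map (be.J r) \<Phi> p ` P p = jet_vertical E Q \<pi> r (\<Phi> p)" if "P p \<subseteq> tangent_space M p"
    unfolding tm[OF that] c'(4)[OF p] \<Phi>'[OF p] by (rule be.vertical_push[OF dc(2), symmetric]) (use dc(5) p in blast)
  show "inj_atlas (be.J r)" by (rule be.J_inj)
qed

end

subsection \<open>The fibration of the leaf spaces\<close>

lemma leaf_mono: "(\<And>p. V' p \<subseteq> V p) \<Longrightarrow> leaf M V' p \<subseteq> leaf M V p"
proof -
  assume "\<And>p. V' p \<subseteq> V p"
  then have "tangent_step M V' \<subseteq> tangent_step M V" unfolding tangent_step_def by blast
  from rtrancl_mono[OF this] show ?thesis by (auto simp: leaf_def)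
qed

text \<open>
  Curves tangent to \<open>V'\<close> are tangent to \<open>V\<close>, so \<open>p\<close> and
  \<open>q\<close> can be reached from each other along \<open>V\<close>.
\<close>

lemma leaf_eq:
  assumes sub: "\<And>p. V' p \<subseteq> V p" and eq: "leaf M V' p = leaf M V' q"
  shows "leaf M V p = leaf M V q"
proof -
  have mono: "leaf M V' x \<subseteq> leaf M V x" for x by (rule leaf_mono) (rule sub)
  have "p \<in> leaf M V' p" "q \<in> leaf M V' q" by (simp_all add: leaf_def)
  then have "p \<in> leaf M V q" "q \<in> leaf M V p" using eq mono[of p] mono[of q] by auto
  then show ?thesis unfolding leaf_def by (auto intro: rtrancl_trans)
qed

theorem theorem7p9:
  fixes M :: "('m, 'i) mfd" and D P Vr :: "'m dist"
    and E Q :: "('m set, nat) mfd" and k r :: nat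
  assumes order: "1 \<le> r"
    and contact: "polarised_k_contact k M D P"
    and jet_type: "jet_type r M D P"
    and global_Vr: "\<forall>p\<in>carrier M. \<exists>U H. p \<in> U \<and> jet_splitting r M D P U H Vr"
    and leaf_space_Q: "simple_with M Vr Q"
    and leaf_space_E: "simple_with M (\<lambda>p. derived M D (r - 1) p \<inter> Vr p) E"
  shows "\<exists>\<pi>. submersion E Q \<pi> \<and>
    (\<forall>p\<in>carrier M. \<pi> (leaf M (\<lambda>p. derived M D (r - 1) p \<inter> Vr p) p) = leaf M Vr p) \<and>
    (\<forall>(A :: 'a set) (c :: 'a \<Rightarrow> ('m, 'd, 'p, 'm set, 'm set) local_ident).
      (\<forall>a\<in>A. local_identification r M D P Vr E Q \<pi> (c a)) \<and>
      (\<Union>a\<in>A. dom (c a)) = carrier M \<and>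
      (\<forall>a\<in>A. \<forall>b\<in>A. transition_by_prolongation r E Q \<pi> (c a) (c b)) \<longrightarrow>
      (\<exists>\<Phi> :: 'm \<Rightarrow> ('m set, 'm set) jet.
        (\<forall>a\<in>A. \<forall>p\<in>dom (c a). \<Phi> p = jet_emb r E Q \<pi> (c a) (ident (c a) p)) \<and>
        (\<forall>p\<in>carrier M. jet_source (\<Phi> p) = leaf M Vr p \<and>
          jet_target (\<Phi> p) = leaf M (\<lambda>p. derived M D (r - 1) p \<inter> Vr p) p) \<and>
        local_diffeo M (jet_bundle E Q \<pi> r) \<Phi> \<and>
        (diffeo M (jet_bundle E Q \<pi> r) \<Phi> \<longrightarrow>
          polarised_k_contactomorphism k M D P
            (jet_bundle E Q \<pi> r) (cartan E Q \<pi> r) (jet_vertical E Q \<pi> r) \<Phi>)))"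
proof -
  let ?V' = "\<lambda>p. derived M D (r - 1) p \<inter> Vr p"
  have M: "smooth_manifold M" using contact by (simp add: polarised_k_contact_def k_contact_manifold_def)
  note A = smooth_manifold_inj_atlas[OF M]
  have Q: "smooth_manifold Q" "submersion M Q (leaf M Vr)"
    using leaf_space_Q by (auto simp: simple_with_def)
  obtain nQ where nQ: "index Q = {..<nQ}" using leaf_space_Q by (auto simp: simple_with_def)
  have E: "smooth_manifold E" "submersion M E (leaf M ?V')" "leaf M ?V' ` carrier M = carrier E"
    using leaf_space_E by (auto simp: simple_with_def)
  obtain nE where nE: "index E = {..<nE}" using leaf_space_E by (auto simp: simple_with_def)
  have D_tangent: "D p \<subseteq> tangent_space M p" if p: "p \<in> carrier M" for p
  proof -
    obtain U \<eta> where "p \<in> U" "\<forall>q\<in>U. D q = ker_form M k \<eta> q"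
      using contact p unfolding polarised_k_contact_def k_contact_manifold_def by blast
    then show ?thesis by (auto simp: ker_form_def)
  qed
  have P_tangent: "P p \<subseteq> tangent_space M p" if p: "p \<in> carrier M" for p
  proof -
    have "legendrian M D p (P p)"
      using contact p by (auto simp: polarised_k_contact_def polarisation_def integrable_legendrian_def)
    then have "P p \<subseteq> D p" by (simp add: legendrian_def isotropic_def)
    then show ?thesis using D_tangent[OF p] by blast
  qed
  define \<pi> where "\<pi> e = leaf M Vr (SOME p. p \<in> carrier M \<and> leaf M ?V' p = e)" for e
  have \<pi>: "\<pi> (leaf M ?V' p) = leaf M Vr p" if p: "p \<in> carrier M" for p
  proof -
    have "leaf M ?V' (SOME q. q \<in> carrier M \<and> leaf M ?V' q = leaf M ?V' p) = leaf M ?V' p"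
      using someI[of "\<lambda>q. q \<in> carrier M \<and> leaf M ?V' q = leaf M ?V' p" p] p by blast
    then show ?thesis unfolding \<pi>_def by (rule leaf_eq[rotated]) simp
  qed
  have sub: "submersion E Q \<pi>" by (rule submersion_descends[OF M E(1) Q(1) E(2,3) Q(2) \<pi>])
  have glue: "\<exists>\<Phi> :: 'm \<Rightarrow> ('m set, 'm set) jet.
        (\<forall>a\<in>I. \<forall>p\<in>dom (c a). \<Phi> p = jet_emb r E Q \<pi> (c a) (ident (c a) p)) \<and>
        (\<forall>p\<in>carrier M. jet_source (\<Phi> p) = leaf M Vr p \<and> jet_target (\<Phi> p) = leaf M ?V' p) \<and>
        local_diffeo M (jet_bundle E Q \<pi> r) \<Phi> \<and>
        (diffeo M (jet_bundle E Q \<pi> r) \<Phi> \<longrightarrow>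
          polarised_k_contactomorphism k M D P
            (jet_bundle E Q \<pi> r) (cartan E Q \<pi> r) (jet_vertical E Q \<pi> r) \<Phi>)"
    if ident: "\<forall>a\<in>I. local_identification r M D P Vr E Q \<pi> (c a)" and cover: "(\<Union>a\<in>I. dom (c a)) = carrier M"
      and trans: "\<forall>a\<in>I. \<forall>b\<in>I. transition_by_prolongation r E Q \<pi> (c a) (c b)"
    for I :: "'a set" and c :: "'a \<Rightarrow> ('m, 'd, 'p, 'm set, 'm set) local_ident"
  proof -
    note ctx = M E(1) nE Q(1) nQ E(2) Q(2) \<pi>
    define idx where "idx p = (SOME a. a \<in> I \<and> p \<in> dom (c a))" for p
    define \<Phi> where "\<Phi> p = jet_emb r E Q \<pi> (c (idx p)) (ident (c (idx p)) p)" for p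
    have idx: "idx p \<in> I" "p \<in> dom (c (idx p))" if "p \<in> carrier M" for p
      using someI_ex[of "\<lambda>a. a \<in> I \<and> p \<in> dom (c a)"] cover that unfolding idx_def by blast+
    have identp: "local_identification r M D P Vr E Q \<pi> (c (idx p))" if "p \<in> carrier M" for p
      using ident idx(1)[OF that] by blast
    have \<Phi>: "\<Phi> p = jet_emb r E Q \<pi> (c a) (ident (c a) p)" if a: "a \<in> I" and p: "p \<in> dom (c a)" for a p
    proof -
      have pc: "p \<in> carrier M" using cover a p by blast
      show ?thesis unfolding \<Phi>_def
        by (rule identifications_agree[OF ctx]) (use ident trans idx[OF pc] a p in auto)
    qed
    have st: "jet_source (\<Phi> p) = leaf M Vr p \<and> jet_target (\<Phi> p) = leaf M ?V' p" if p: "p \<in> carrier M" for p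
      unfolding \<Phi>_def
      using identification_jet(2)[OF ctx identp[OF p] idx(2)[OF p]] identification_jet(3)[OF ctx identp[OF p] idx(2)[OF p]]
      by (rule conjI)
    have local: "diffeo_on M (dom (c a)) (jet_bundle E Q \<pi> r) (\<Phi> ` dom (c a)) \<Phi>" if "a \<in> I" "p \<in> dom (c a)" for a p
      by (rule glued_map_local(1)[OF ctx]) (use that ident \<Phi> in auto)
    have \<Phi>_cartan: "tangent_map (jet_bundle E Q \<pi> r) \<Phi> p ` D p = cartan E Q \<pi> r (\<Phi> p)" if p: "p \<in> carrier M" for p
      by (rule glued_map_local(2)[OF ctx identp[OF p], where \<Phi> = \<Phi> and p = p])
        (rule \<Phi>[OF idx(1)[OF p]] idx(2)[OF p] D_tangent[OF p] | assumption)+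
    have \<Phi>_vert: "tangent_map (jet_bundle E Q \<pi> r) \<Phi> p ` P p = jet_vertical E Q \<pi> r (\<Phi> p)" if p: "p \<in> carrier M" for p
      by (rule glued_map_local(3)[OF ctx identp[OF p], where \<Phi> = \<Phi> and p = p])
        (rule \<Phi>[OF idx(1)[OF p]] idx(2)[OF p] P_tangent[OF p] | assumption)+
    have ld: "local_diffeo M (jet_bundle E Q \<pi> r) \<Phi>"
      unfolding local_diffeo_def
    proof
      show "smooth_map M (carrier M) (jet_bundle E Q \<pi> r) \<Phi>"
      proof (rule smooth_map_local[OF A])
        fix p assume p: "p \<in> carrier M"
        show "\<exists>U. p \<in> U \<and> U \<subseteq> carrier M \<and> smooth_map M U (jet_bundle E Q \<pi> r) \<Phi>"
          using diffeo_onD(6)[OF local[OF idx[OF p]]] idx[OF p] cover by blast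
      qed
      show "\<forall>p\<in>carrier M. \<exists>U. p \<in> U \<and> diffeo_on M U (jet_bundle E Q \<pi> r) (\<Phi> ` U) \<Phi>"
        using local idx by blast
    qed
    have "polarised_k_contactomorphism k M D P (jet_bundle E Q \<pi> r) (cartan E Q \<pi> r) (jet_vertical E Q \<pi> r) \<Phi>"
      if d: "diffeo M (jet_bundle E Q \<pi> r) \<Phi>"
    proof (rule diffeo_polarised_k_contactomorphism[OF contact _ d D_tangent \<Phi>_cartan P_tangent \<Phi>_vert])
      have "carrier M \<noteq> {}" using contact polarisation_carrier_nonempty by (auto simp: polarised_k_contact_def)
      then obtain p where p: "p \<in> carrier M" by blast
      show "inj_atlas (jet_bundle E Q \<pi> r)"
        by (rule glued_map_local(4)[OF ctx identp[OF p], where \<Phi> = \<Phi> and p = p])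
          (rule \<Phi>[OF idx(1)[OF p]] idx(2)[OF p] | assumption)+
    qed
    then show ?thesis using \<Phi> st ld by (intro exI[of _ \<Phi>] conjI ballI impI) auto
  qed
  show ?thesis
    by (rule exI[of _ \<pi>], intro conjI ballI allI impI, rule sub, rule \<pi>, assumption, elim conjE, rule glue)
qed

end
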